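(* Let $(\mathscr{G},a_0)$ be a pointed Serre groupoid. Then there is a natural long exact sequence $$\cdots\to\pi_n(s^{-1}(a_0),1_{a_0})\xrightarrow{\pi_n(t)}\pi_n(\mathscr{G}_0,a_0)\to\pi_n(\mathscr{G},a_0)\to\pi_{n-1}(s^{-1}(a_0),1_{a_0})\to\cdots$$ ending with $\pi_0(s^{-1}(a_0),1_{a_0})\to\pi_0(\mathscr{G}_0,a_0)\to\pi_0(\mathscr{G},a_0)$.
   Context: A topological groupoid $\mathscr{G}$ has spaces $\mathscr{G}_0$ of objects and $\mathscr{G}_1$ of arrows, with all structure maps (source $s$, target $t$, multiplication, inverse, unit $x\mapsto1_x$) continuous; $gg'$ is defined when $s(g)=t(g')$. It is a Serre groupoid if $s:\mathscr{G}_1\to\mathscr{G}_0$ is a Serre fibration in the classical sense; it is pointed by a choice of $a_0\in\mathscr{G}_0$. Here $s^{-1}(a_0)\subset\mathscr{G}_1$ is the source fiber, and $t$ denotes the restriction of the target map to it. A right $\mathscr{G}$-action on a space $X$ along $\epsilon:X\to\mathscr{G}_0$ is a continuous map $X\times_{\mathscr{G}_0}\mathscr{G}_1=\{(x,g):\epsilon(x)=t(g)\}\to X$, $(x,g)\mapsto xg$, with $\epsilon(xg)=s(g)$, $x1_{\epsilon(x)}=x$, $(xg)g'=x(gg')$. A principal $\mathscr{G}$-bundle over a space $B$ is a space $P$ with a continuous map $\pi:P\to B$ having local sections (continuous sections over an open neighbourhood of each point) and a right $\mathscr{G}$-action along a map $\epsilon:P\to\mathscr{G}_0$, with $\pi(pg)=\pi(p)$,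 such that $(p,g)\mapsto(p,pg)$ is a homeomorphism $P\times_{\mathscr{G}_0}\mathscr{G}_1\to P\times_BP$. A principal $(\mathscr{G},a_0)$-bundle over a pair of spaces $(B,A)$ is a pair $(P,\sigma)$ with $P$ a principal $\mathscr{G}$-bundle over $B$ and $\sigma:A\to P$ a continuous section over $A$ with $\epsilon\circ\sigma\equiv a_0$, such that every $b\in B$ has an open neighbourhood $V$ with a continuous section $V\to P$ agreeing with $\sigma$ on $V\cap A$. Isomorphisms are $\mathscr{G}$-equivariant homeomorphisms commuting with $\pi,\epsilon$ and preserving the sections. With $I=[0,1]$, two such bundles over $(B,A)$ are homotopic if there is one over $(B\times I,A\times I)$ whose restrictions to the two ends are isomorphic to them. $\pi_n(\mathscr{G},a_0)$ is the set of homotopy classes of principal $(\mathscr{G},a_0)$-bundles over $(I^n,\partial I^n)$ ($n\ge0$); for $n\ge1$ it is a group by concatenation (gluing along the unique section-preserving isomorphism between the restriction of the first bundle to $\{1\}\times I^{n-1}$ and of the second to $\{0\}\times I^{n-1}$, then reparametrizing). Homotopy groups of spaces are the usual ones. For $n=0$ the terms are pointed sets and exactness is meant in that sense. *)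

theory Defs
  imports "HOL-Analysis.Analysis" "HOL-Algebra.Coset"
begin

section \<open>Cubes and homotopy groups of spaces\<close>

text \<open>The cube \<open>I^n\<close> sits in \<^const>\<open>Euclidean_space\<close>, whose points are sequences vanishing from
  index \<open>n\<close> on. Hence \<open>I^n\<close> is literally the face \<open>x n = 0\<close> of \<open>I^(n+1)\<close>.\<close>

abbreviation unit_interval :: "real topology" where
  "unit_interval \<equiv> top_of_set {0..1}"

definition cube :: "nat \<Rightarrow> (nat \<Rightarrow> real) topology" where
  "cube n = subtopology (Euclidean_space n) {x. \<forall>i<n. 0 \<le> x i \<and> x i \<le> 1}"

definition cube_boundary :: "nat \<Rightarrow> (nat \<Rightarrow> real) set" where
  "cube_boundary n = {x \<in> topspace (cube n). \<exists>i<n. x i = 0 \<or> x i = 1}"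

text \<open>The closure of \<open>\<partial>I^(n+1) - I^n\<close>: all faces but \<open>x n = 0\<close>.\<close>

definition open_box :: "nat \<Rightarrow> (nat \<Rightarrow> real) set" where
  "open_box n = {x \<in> topspace (cube (Suc n)). x n = 1 \<or> (\<exists>i<n. x i = 0 \<or> x i = 1)}"

definition spheroids :: "nat \<Rightarrow> 'a topology \<Rightarrow> 'a \<Rightarrow> ((nat \<Rightarrow> real) \<Rightarrow> 'a) set" where
  "spheroids n X x0 = {f. continuous_map (cube n) X f \<and> (\<forall>x\<in>cube_boundary n. f x = x0)}"

definition homotopic_spheroids ::
    "nat \<Rightarrow> 'a topology \<Rightarrow> 'a \<Rightarrow> ((nat \<Rightarrow> real) \<Rightarrow> 'a) \<Rightarrow> ((nat \<Rightarrow> real) \<Rightarrow> 'a) \<Rightarrow> bool" where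
  "homotopic_spheroids n X x0 =
     homotopic_with (\<lambda>h. \<forall>x\<in>cube_boundary n. h x = x0) (cube n) X"

definition concat_spheroid ::
    "((nat \<Rightarrow> real) \<Rightarrow> 'a) \<Rightarrow> ((nat \<Rightarrow> real) \<Rightarrow> 'a) \<Rightarrow> (nat \<Rightarrow> real) \<Rightarrow> 'a" where
  "concat_spheroid f g x = (if x 0 \<le> 1/2 then f (x(0 := 2 * x 0)) else g (x(0 := 2 * x 0 - 1)))"

text \<open>The neutral element doubles as the base point, so that \<^const>\<open>kernel\<close> is also the
  kernel of a map of pointed sets when \<open>n = 0\<close>; the multiplication is meaningful only for \<open>n \<ge> 1\<close>.\<close>

definition homotopy_group :: "nat \<Rightarrow> 'a topology \<Rightarrow> 'a \<Rightarrow> ((nat \<Rightarrow> real) \<Rightarrow> 'a) set monoid" where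
  "homotopy_group n X x0 =
     \<lparr>carrier = spheroids n X x0 // {(f, g). homotopic_spheroids n X x0 f g},
      mult = (\<lambda>A B. {h. \<exists>f\<in>A. \<exists>g\<in>B. homotopic_spheroids n X x0 (concat_spheroid f g) h}),
      one = {h. homotopic_spheroids n X x0 (\<lambda>_. x0) h}\<rparr>"

definition homotopy_group_map ::
    "nat \<Rightarrow> 'b topology \<Rightarrow> 'b \<Rightarrow> ('a \<Rightarrow> 'b) \<Rightarrow> ((nat \<Rightarrow> real) \<Rightarrow> 'a) set \<Rightarrow> ((nat \<Rightarrow> real) \<Rightarrow> 'b) set" where
  "homotopy_group_map n Y y0 \<phi> A = {h. \<exists>f\<in>A. homotopic_spheroids n Y y0 (\<phi> \<circ> f) h}"

definition serre_fibration :: "'a topology \<Rightarrow> 'b topology \<Rightarrow> ('a \<Rightarrow> 'b) \<Rightarrow> bool" where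
  "serre_fibration X Y p \<longleftrightarrow> continuous_map X Y p \<and>
     (\<forall>n f h. continuous_map (cube n) X f \<and>
        continuous_map (prod_topology (cube n) unit_interval) Y h \<and>
        (\<forall>x\<in>topspace (cube n). h (x, 0) = p (f x)) \<longrightarrow>
        (\<exists>k. continuous_map (prod_topology (cube n) unit_interval) X k \<and>
           (\<forall>x\<in>topspace (cube n). k (x, 0) = f x) \<and>
           (\<forall>z\<in>topspace (prod_topology (cube n) unit_interval). p (k z) = h z)))"


section \<open>Quotient topologies\<close>

definition quotient_topology :: "'a topology \<Rightarrow> ('a \<Rightarrow> 'b) \<Rightarrow> 'b topology" where
  "quotient_topology X f =
     topology (\<lambda>U. U \<subseteq> f ` topspace X \<and> openin X {x \<in> topspace X. f x \<in> U})"

lemma openin_quotient_topology: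
  "openin (quotient_topology X f) U \<longleftrightarrow> U \<subseteq> f ` topspace X \<and> openin X {x \<in> topspace X. f x \<in> U}"
proof -
  have "istopology (\<lambda>U. U \<subseteq> f ` topspace X \<and> openin X {x \<in> topspace X. f x \<in> U})"
    unfolding istopology_def
  proof (intro conjI allI impI; (elim conjE)?)
    fix S T assume "openin X {x \<in> topspace X. f x \<in> S}" "openin X {x \<in> topspace X. f x \<in> T}"
    then have "openin X ({x \<in> topspace X. f x \<in> S} \<inter> {x \<in> topspace X. f x \<in> T})" by blast
    moreover have "{x \<in> topspace X. f x \<in> S} \<inter> {x \<in> topspace X. f x \<in> T} = {x \<in> topspace X. f x \<in> S \<inter> T}"
      by auto
    ultimately show "openin X {x \<in> topspace X. f x \<in> S \<inter> T}" by simp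
  next
    fix K assume K: "\<forall>U\<in>K. U \<subseteq> f ` topspace X \<and> openin X {x \<in> topspace X. f x \<in> U}"
    have "{x \<in> topspace X. f x \<in> \<Union>K} = (\<Union>U\<in>K. {x \<in> topspace X. f x \<in> U})" by auto
    then show "openin X {x \<in> topspace X. f x \<in> \<Union>K}" using K by auto
  qed auto
  then show ?thesis by (simp add: quotient_topology_def topology_inverse')
qed

lemma topspace_quotient_topology: "topspace (quotient_topology X f) = f ` topspace X"
proof
  have "{x \<in> topspace X. f x \<in> f ` topspace X} = topspace X" by auto
  then have "openin (quotient_topology X f) (f ` topspace X)"
    by (simp add: openin_quotient_topology)
  then show "f ` topspace X \<subseteq> topspace (quotient_topology X f)" by (rule openin_subset)
  show "topspace (quotient_topology X f) \<subseteq> f ` topspace X"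
    using openin_quotient_topology[of X f "topspace (quotient_topology X f)"] by simp
qed

lemma quotient_map_quotient_topology: "quotient_map X (quotient_topology X f) f"
  by (auto simp: quotient_map_def topspace_quotient_topology openin_quotient_topology)


section \<open>Topological groupoids\<close>

record ('o, 'a) groupoid =
  objs :: "'o topology"
  arrs :: "'a topology"
  src :: "'a \<Rightarrow> 'o"
  tgt :: "'a \<Rightarrow> 'o"
  gmul :: "'a \<Rightarrow> 'a \<Rightarrow> 'a"
  ginv :: "'a \<Rightarrow> 'a"
  gunit :: "'o \<Rightarrow> 'a"

abbreviation "ob G \<equiv> topspace (objs G)"
abbreviation "ar G \<equiv> topspace (arrs G)"

text \<open>\<open>gmul G g g'\<close> is meaningful when \<open>src G g = tgt G g'\<close>.\<close>

locale topological_groupoid =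
  fixes G :: "('o, 'a) groupoid"
  assumes src_continuous: "continuous_map (arrs G) (objs G) (src G)"
    and tgt_continuous: "continuous_map (arrs G) (objs G) (tgt G)"
    and gmul_continuous:
      "continuous_map (subtopology (prod_topology (arrs G) (arrs G)) {(g, h). src G g = tgt G h})
         (arrs G) (\<lambda>(g, h). gmul G g h)"
    and ginv_continuous: "continuous_map (arrs G) (arrs G) (ginv G)"
    and gunit_continuous: "continuous_map (objs G) (arrs G) (gunit G)"
    and src_gunit: "x \<in> ob G \<Longrightarrow> src G (gunit G x) = x"
    and tgt_gunit: "x \<in> ob G \<Longrightarrow> tgt G (gunit G x) = x"
    and src_gmul: "\<lbrakk>g \<in> ar G; h \<in> ar G; src G g = tgt G h\<rbrakk> \<Longrightarrow> src G (gmul G g h) = src G h"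
    and tgt_gmul: "\<lbrakk>g \<in> ar G; h \<in> ar G; src G g = tgt G h\<rbrakk> \<Longrightarrow> tgt G (gmul G g h) = tgt G g"
    and gmul_assoc: "\<lbrakk>g \<in> ar G; h \<in> ar G; k \<in> ar G; src G g = tgt G h; src G h = tgt G k\<rbrakk>
      \<Longrightarrow> gmul G (gmul G g h) k = gmul G g (gmul G h k)"
    and gmul_gunit_right: "g \<in> ar G \<Longrightarrow> gmul G g (gunit G (src G g)) = g"
    and gmul_gunit_left: "g \<in> ar G \<Longrightarrow> gmul G (gunit G (tgt G g)) g = g"
    and src_ginv: "g \<in> ar G \<Longrightarrow> src G (ginv G g) = tgt G g"
    and tgt_ginv: "g \<in> ar G \<Longrightarrow> tgt G (ginv G g) = src G g"
    and gmul_ginv_right: "g \<in> ar G \<Longrightarrow> gmul G g (ginv G g) = gunit G (tgt G g)"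
    and gmul_ginv_left: "g \<in> ar G \<Longrightarrow> gmul G (ginv G g) g = gunit G (src G g)"

locale serre_groupoid = topological_groupoid G for G :: "('o, 'a) groupoid" +
  assumes serre: "serre_fibration (arrs G) (objs G) (src G)"

locale pointed_serre_groupoid = serre_groupoid G for G :: "('o, 'a) groupoid" +
  fixes a0 :: 'o
  assumes base_in: "a0 \<in> ob G"

definition source_fiber :: "('o, 'a) groupoid \<Rightarrow> 'o \<Rightarrow> 'a topology" where
  "source_fiber G a0 = subtopology (arrs G) {g. src G g = a0}"

text \<open>Continuous functors preserving the base objects.\<close>

definition pointed_groupoid_morphism ::
    "('o, 'a) groupoid \<Rightarrow> 'o \<Rightarrow> ('o2, 'a2) groupoid \<Rightarrow> 'o2 \<Rightarrow> ('o \<Rightarrow> 'o2) \<Rightarrow> ('a \<Rightarrow> 'a2) \<Rightarrow> bool" where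
  "pointed_groupoid_morphism G a0 H b0 \<phi>0 \<phi>1 \<longleftrightarrow>
     continuous_map (objs G) (objs H) \<phi>0 \<and> continuous_map (arrs G) (arrs H) \<phi>1 \<and> \<phi>0 a0 = b0 \<and>
     (\<forall>g\<in>ar G. src H (\<phi>1 g) = \<phi>0 (src G g) \<and> tgt H (\<phi>1 g) = \<phi>0 (tgt G g)) \<and>
     (\<forall>x\<in>ob G. \<phi>1 (gunit G x) = gunit H (\<phi>0 x)) \<and>
     (\<forall>g\<in>ar G. \<forall>h\<in>ar G. src G g = tgt G h \<longrightarrow> \<phi>1 (gmul G g h) = gmul H (\<phi>1 g) (\<phi>1 h))"


section \<open>Principal bundles over pairs of spaces\<close>

text \<open>The field \<open>anchor\<close> is the map \<open>\<epsilon>\<close> along which the groupoid acts. The last field is the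
  section \<open>\<sigma>\<close> over the subspace \<open>A\<close> of a pair \<open>(B, A)\<close>; \<open>principal_bundle\<close> ignores it.\<close>

record ('b, 'o, 'a, 'p) gbundle =
  total :: "'p topology"
  proj :: "'p \<Rightarrow> 'b"
  anchor :: "'p \<Rightarrow> 'o"
  act :: "'p \<Rightarrow> 'a \<Rightarrow> 'p"
  sect :: "'b \<Rightarrow> 'p"

abbreviation "pts P \<equiv> topspace (total P)"

definition act_domain :: "('o, 'a) groupoid \<Rightarrow> ('b, 'o, 'a, 'p) gbundle \<Rightarrow> ('p \<times> 'a) topology" where
  "act_domain G P = subtopology (prod_topology (total P) (arrs G)) {(p, g). anchor P p = tgt G g}"

definition fiber_square :: "('b, 'o, 'a, 'p) gbundle \<Rightarrow> ('p \<times> 'p) topology" where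
  "fiber_square P = subtopology (prod_topology (total P) (total P)) {(p, q). proj P p = proj P q}"

locale principal_bundle = topological_groupoid G for G :: "('o, 'a) groupoid" +
  fixes B :: "'b topology" and P :: "('b, 'o, 'a, 'p) gbundle"
  assumes proj_continuous: "continuous_map (total P) B (proj P)"
    and anchor_continuous: "continuous_map (total P) (objs G) (anchor P)"
    and act_continuous: "continuous_map (act_domain G P) (total P) (\<lambda>(p, g). act P p g)"
    and anchor_act: "\<lbrakk>p \<in> pts P; g \<in> ar G; anchor P p = tgt G g\<rbrakk> \<Longrightarrow> anchor P (act P p g) = src G g"
    and act_gunit: "p \<in> pts P \<Longrightarrow> act P p (gunit G (anchor P p)) = p"
    and act_act: "\<lbrakk>p \<in> pts P; g \<in> ar G; h \<in> ar G; anchor P p = tgt G g; src G g = tgt G h\<rbrakk>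
      \<Longrightarrow> act P (act P p g) h = act P p (gmul G g h)"
    and proj_act: "\<lbrakk>p \<in> pts P; g \<in> ar G; anchor P p = tgt G g\<rbrakk> \<Longrightarrow> proj P (act P p g) = proj P p"
    and local_sections: "b \<in> topspace B \<Longrightarrow> \<exists>V s. openin B V \<and> b \<in> V \<and>
      continuous_map (subtopology B V) (total P) s \<and> (\<forall>x\<in>V. proj P (s x) = x)"
    and principal: "homeomorphic_map (act_domain G P) (fiber_square P) (\<lambda>(p, g). (p, act P p g))"

locale principal_pair_bundle = principal_bundle G B P
  for G :: "('o, 'a) groupoid" and a0 :: 'o and B :: "'b topology" and A :: "'b set"
    and P :: "('b, 'o, 'a, 'p) gbundle" +
  assumes base_object: "a0 \<in> ob G"
    and subspace: "A \<subseteq> topspace B"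
    and sect_continuous: "continuous_map (subtopology B A) (total P) (sect P)"
    and proj_sect: "x \<in> A \<Longrightarrow> proj P (sect P x) = x"
    and anchor_sect: "x \<in> A \<Longrightarrow> anchor P (sect P x) = a0"
    and local_extensions: "b \<in> topspace B \<Longrightarrow> \<exists>V s. openin B V \<and> b \<in> V \<and>
      continuous_map (subtopology B V) (total P) s \<and> (\<forall>x\<in>V. proj P (s x) = x) \<and>
      (\<forall>x\<in>V \<inter> A. s x = sect P x)"

definition bundle_iso_map ::
    "('o, 'a) groupoid \<Rightarrow> 'b set \<Rightarrow> ('b, 'o, 'a, 'p) gbundle \<Rightarrow> ('b, 'o, 'a, 'q) gbundle \<Rightarrow> ('p \<Rightarrow> 'q) \<Rightarrow> bool" where
  "bundle_iso_map G A P Q \<phi> \<longleftrightarrow> homeomorphic_map (total P) (total Q) \<phi> \<and>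
     (\<forall>p\<in>pts P. proj Q (\<phi> p) = proj P p \<and> anchor Q (\<phi> p) = anchor P p) \<and>
     (\<forall>p\<in>pts P. \<forall>g\<in>ar G. anchor P p = tgt G g \<longrightarrow> \<phi> (act P p g) = act Q (\<phi> p) g) \<and>
     (\<forall>x\<in>A. \<phi> (sect P x) = sect Q x)"

definition bundle_iso ::
    "('o, 'a) groupoid \<Rightarrow> 'b set \<Rightarrow> ('b, 'o, 'a, 'p) gbundle \<Rightarrow> ('b, 'o, 'a, 'q) gbundle \<Rightarrow> bool" where
  "bundle_iso G A P Q \<longleftrightarrow> (\<exists>\<phi>. bundle_iso_map G A P Q \<phi>)"

text \<open>The restriction to \<open>B \<times> {u}\<close> of a bundle over \<open>(B \<times> I, A \<times> I)\<close>, viewed over \<open>(B, A)\<close>.\<close>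

definition bundle_slice :: "real \<Rightarrow> ('b \<times> real, 'o, 'a, 'p) gbundle \<Rightarrow> ('b, 'o, 'a, 'p) gbundle" where
  "bundle_slice u R =
     \<lparr>total = subtopology (total R) {p. snd (proj R p) = u},
      proj = (\<lambda>p. fst (proj R p)),
      anchor = anchor R,
      act = act R,
      sect = (\<lambda>b. sect R (b, u))\<rparr>"

lemma (in principal_pair_bundle) transport:
  fixes k :: "'p \<Rightarrow> 'q"
  assumes inj: "inj_on k (pts P)"
  shows "\<exists>Q :: ('b, 'o, 'a, 'q) gbundle. principal_pair_bundle G a0 B A Q \<and> bundle_iso G A P Q"
proof -
  define T where "T = quotient_topology (total P) k"
  define j where "j = inv_into (pts P) k"
  define Q :: "('b, 'o, 'a, 'q) gbundle" where "Q =
    \<lparr>total = T, proj = proj P \<circ> j, anchor = anchor P \<circ> j, act = (\<lambda>q g. k (act P (j q) g)),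
     sect = k \<circ> sect P\<rparr>"
  have kT: "homeomorphic_map (total P) T k"
    unfolding homeomorphic_map_def T_def using inj quotient_map_quotient_topology by blast
  have jk: "j (k p) = p" if "p \<in> pts P" for p
    using that inj by (simp add: j_def)
  have kj: "k (j q) = q" if "q \<in> topspace T" for q
    using that by (simp add: T_def topspace_quotient_topology j_def f_inv_into_f)
  have ck: "continuous_map (total P) T k"
    using kT homeomorphic_imp_continuous_map by blast
  have kpts: "k p \<in> topspace T" if "p \<in> pts P" for p
    using that by (simp add: T_def topspace_quotient_topology)
  have jpts: "j q \<in> pts P" if "q \<in> topspace T" for q
    using that by (auto simp: T_def topspace_quotient_topology jk)
  obtain j' where j': "homeomorphic_maps (total P) T k j'"
    using kT by (auto simp: homeomorphic_map_maps)
  have jj: "j' q = j q" if q: "q \<in> topspace T" for q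
  proof -
    have "k (j' q) = q" "j' q \<in> pts P"
      using j' q by (auto simp: homeomorphic_maps_def continuous_map_def)
    then show ?thesis using jk by metis
  qed
  have cj: "continuous_map T (total P) j"
  proof (rule continuous_map_eq)
    show "continuous_map T (total P) j'" using j' by (simp add: homeomorphic_maps_def)
  qed (rule jj)
  have actpts: "act P p g \<in> pts P" if "p \<in> pts P" "g \<in> ar G" "anchor P p = tgt G g" for p g
  proof -
    have "(p, g) \<in> topspace (act_domain G P)" using that by (simp add: act_domain_def)
    then have "(\<lambda>(p, g). act P p g) (p, g) \<in> pts P"
      using continuous_map_image_subset_topspace[OF act_continuous] by blast
    then show ?thesis by simp
  qed
  have Qsimps: "total Q = T" "proj Q = proj P \<circ> j" "anchor Q = anchor P \<circ> j"
    "act Q = (\<lambda>q g. k (act P (j q) g))" "sect Q = k \<circ> sect P"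
    by (simp_all add: Q_def)
  have sectpts: "sect P x \<in> pts P" if "x \<in> A" for x
    using sect_continuous that subspace unfolding continuous_map_def by auto
  obtain m where m: "homeomorphic_maps (act_domain G P) (fiber_square P) (\<lambda>(p, g). (p, act P p g)) m"
    using principal homeomorphic_map_maps by blast
  have jprod: "continuous_map (prod_topology T (arrs G)) (prod_topology (total P) (arrs G)) (\<lambda>(q, g). (j q, g))"
    and kprod: "continuous_map (prod_topology (total P) (arrs G)) (prod_topology T (arrs G)) (\<lambda>(p, g). (k p, g))"
    using cj ck continuous_map_id[of "arrs G", unfolded id_def]
    by (simp_all add: continuous_map_prod_top[where g = "\<lambda>g. g"])
  have jsq: "continuous_map (prod_topology T T) (prod_topology (total P) (total P)) (\<lambda>(q, r). (j q, j r))"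
    and ksq: "continuous_map (prod_topology (total P) (total P)) (prod_topology T T) (\<lambda>(q, r). (k q, k r))"
    using cj ck by (simp_all add: continuous_map_prod_top)
  have c1: "continuous_map (act_domain G Q) (act_domain G P) (\<lambda>(q, g). (j q, g))"
    unfolding act_domain_def Qsimps continuous_map_in_subtopology
    using continuous_map_from_subtopology[OF jprod] by auto
  have c2: "continuous_map (act_domain G P) (act_domain G Q) (\<lambda>(p, g). (k p, g))"
    unfolding act_domain_def Qsimps continuous_map_in_subtopology
    using continuous_map_from_subtopology[OF kprod] by (auto simp: jk)
  have c3: "continuous_map (fiber_square Q) (fiber_square P) (\<lambda>(p, q). (j p, j q))"
    unfolding fiber_square_def Qsimps continuous_map_in_subtopology
    using continuous_map_from_subtopology[OF jsq] by auto
  have c4: "continuous_map (fiber_square P) (fiber_square Q) (\<lambda>(p, q). (k p, k q))"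
    unfolding fiber_square_def Qsimps continuous_map_in_subtopology
    using continuous_map_from_subtopology[OF ksq] by (auto simp: jk)
  have h1: "homeomorphic_maps (act_domain G Q) (act_domain G P) (\<lambda>(q, g). (j q, g)) (\<lambda>(p, g). (k p, g))"
    unfolding homeomorphic_maps_def using c1 c2
    by (auto simp: act_domain_def Qsimps jk kj)
  have h2: "homeomorphic_maps (fiber_square P) (fiber_square Q) (\<lambda>(p, q). (k p, k q)) (\<lambda>(p, q). (j p, j q))"
    unfolding homeomorphic_maps_def using c3 c4
    by (auto simp: fiber_square_def Qsimps jk kj)
  have princ: "homeomorphic_map (act_domain G Q) (fiber_square Q) (\<lambda>(q, g). (q, act Q q g))"
  proof (rule homeomorphic_map_eq)
    show "homeomorphic_map (act_domain G Q) (fiber_square Q)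
       ((\<lambda>(p, q). (k p, k q)) \<circ> ((\<lambda>(p, g). (p, act P p g)) \<circ> (\<lambda>(q, g). (j q, g))))"
      using h1 h2 by (intro homeomorphic_map_compose[OF homeomorphic_map_compose[OF _ principal]])
        (auto simp: homeomorphic_map_maps)
  qed (auto simp: act_domain_def Qsimps kj)
  have actc: "continuous_map (act_domain G Q) (total Q) (\<lambda>(q, g). act Q q g)"
    using continuous_map_compose[OF continuous_map_compose[OF c1 act_continuous] ck]
    by (simp add: Qsimps comp_def case_prod_unfold)
  have "principal_pair_bundle G a0 B A Q"
  proof
    show "continuous_map (total Q) B (proj Q)"
      unfolding Qsimps by (rule continuous_map_compose[OF cj proj_continuous])
    show "continuous_map (total Q) (objs G) (anchor Q)"
      unfolding Qsimps by (rule continuous_map_compose[OF cj anchor_continuous])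
    show "continuous_map (act_domain G Q) (total Q) (\<lambda>(q, g). act Q q g)" by (rule actc)
    show "homeomorphic_map (act_domain G Q) (fiber_square Q) (\<lambda>(q, g). (q, act Q q g))" by (rule princ)
    show "a0 \<in> ob G" "A \<subseteq> topspace B" by (rule base_object subspace)+
    show "continuous_map (subtopology B A) (total Q) (sect Q)"
      unfolding Qsimps by (rule continuous_map_compose[OF sect_continuous ck])
    fix b assume b: "b \<in> topspace B"
    from local_extensions[OF b] obtain V s where V: "openin B V" "b \<in> V"
      and s: "continuous_map (subtopology B V) (total P) s" "\<forall>x\<in>V. proj P (s x) = x"
        "\<forall>x\<in>V \<inter> A. s x = sect P x" by blast
    have sV: "s x \<in> pts P" if "x \<in> V" for x
      using s(1) that openin_subset[OF V(1)] unfolding continuous_map_def by auto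
    show "\<exists>V s. openin B V \<and> b \<in> V \<and> continuous_map (subtopology B V) (total Q) s \<and>
      (\<forall>x\<in>V. proj Q (s x) = x) \<and> (\<forall>x\<in>V \<inter> A. s x = sect Q x)"
      using V s sV by (intro exI[of _ V] exI[of _ "k \<circ> s"])
        (auto simp: Qsimps jk intro: continuous_map_compose[OF _ ck])
    then show "\<exists>V s. openin B V \<and> b \<in> V \<and> continuous_map (subtopology B V) (total Q) s \<and>
      (\<forall>x\<in>V. proj Q (s x) = x)" by blast
  next
    fix q g assume "q \<in> pts Q" "g \<in> ar G" "anchor Q q = tgt G g"
    then have q: "j q \<in> pts P" "g \<in> ar G" "anchor P (j q) = tgt G g"
      using jpts by (simp_all add: Qsimps)
    show "anchor Q (act Q q g) = src G g" "proj Q (act Q q g) = proj Q q"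
      using q actpts[OF q] anchor_act[OF q] proj_act[OF q] by (simp_all add: Qsimps jk)
    fix h assume h: "h \<in> ar G" "src G g = tgt G h"
    show "act Q (act Q q g) h = act Q q (gmul G g h)"
      using act_act[OF q(1,2) h(1) q(3) h(2)] actpts[OF q] by (simp add: Qsimps jk)
  next
    fix q assume "q \<in> pts Q"
    then show "act Q q (gunit G (anchor Q q)) = q"
      using jpts kj act_gunit by (simp add: Qsimps)
  next
    fix x assume "x \<in> A"
    then show "proj Q (sect Q x) = x" "anchor Q (sect Q x) = a0"
      using sectpts proj_sect anchor_sect by (simp_all add: Qsimps jk)
  qed
  moreover have "bundle_iso_map G A P Q k"
    using kT by (auto simp: bundle_iso_map_def Qsimps jk)
  ultimately show ?thesis unfolding bundle_iso_def by blast
qed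

lemma canonical_total_space:
  fixes P :: "('b, 'o, 'a, 'p) gbundle"
  assumes "principal_pair_bundle G a0 B A P"
  shows "\<exists>Q :: ('b, 'o, 'a, 'b \<times> 'a) gbundle. principal_pair_bundle G a0 B A Q \<and> bundle_iso G A P Q"
proof -
  interpret principal_pair_bundle G a0 B A P by (rule assms)
  define c where "c b = (SOME p. p \<in> pts P \<and> proj P p = b)" for b
  have c: "c (proj P p) \<in> pts P" "proj P (c (proj P p)) = proj P p" if "p \<in> pts P" for p
    using someI[of "\<lambda>q. q \<in> pts P \<and> proj P q = proj P p" p] that by (auto simp: c_def)
  have tr: "\<exists>g. g \<in> ar G \<and> anchor P (c (proj P p)) = tgt G g \<and> act P (c (proj P p)) g = p"
    if "p \<in> pts P" for p
  proof -
    have "(c (proj P p), p) \<in> topspace (fiber_square P)"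
      using c that by (simp add: fiber_square_def)
    then have "(c (proj P p), p) \<in> (\<lambda>(p, g). (p, act P p g)) ` topspace (act_domain G P)"
      using homeomorphic_imp_surjective_map[OF principal] by simp
    then show ?thesis by (auto simp: act_domain_def)
  qed
  define d where "d p = (SOME g. g \<in> ar G \<and> anchor P (c (proj P p)) = tgt G g \<and> act P (c (proj P p)) g = p)" for p
  have d: "act P (c (proj P p)) (d p) = p" if "p \<in> pts P" for p
    using someI_ex[OF tr[OF that]] by (simp add: d_def)
  have "inj_on (\<lambda>p. (proj P p, d p)) (pts P)"
    by (rule inj_onI) (metis d prod.inject)
  then show ?thesis by (rule transport)
qed

text \<open>Bundles are compared up to isomorphism, so by \<open>canonical_total_space\<close> no generality is lost
  in taking total spaces whose points are pairs (point of \<open>B\<close>, arrow).\<close>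

definition homotopic_bundles ::
    "('o, 'a) groupoid \<Rightarrow> 'o \<Rightarrow> 'b topology \<Rightarrow> 'b set \<Rightarrow>
     ('b, 'o, 'a, 'p) gbundle \<Rightarrow> ('b, 'o, 'a, 'q) gbundle \<Rightarrow> bool" where
  "homotopic_bundles G a0 B A P Q \<longleftrightarrow>
     principal_pair_bundle G a0 B A P \<and> principal_pair_bundle G a0 B A Q \<and>
     (\<exists>R :: ('b \<times> real, 'o, 'a, ('b \<times> real) \<times> 'a) gbundle.
        principal_pair_bundle G a0 (prod_topology B unit_interval) (A \<times> {0..1}) R \<and>
        bundle_iso G A (bundle_slice 0 R) P \<and> bundle_iso G A (bundle_slice 1 R) Q)"

text \<open>The pullback along \<open>f : B \<rightarrow> G0\<close> of the unit bundle \<open>tgt : G1 \<rightarrow> G0\<close>, on which arrows act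
  by right multiplication.\<close>

definition pullback_unit_bundle ::
    "('o, 'a) groupoid \<Rightarrow> 'b topology \<Rightarrow> ('b \<Rightarrow> 'o) \<Rightarrow> ('b, 'o, 'a, 'b \<times> 'a) gbundle" where
  "pullback_unit_bundle G B f =
     \<lparr>total = subtopology (prod_topology B (arrs G)) {(b, g). f b = tgt G g},
      proj = fst,
      anchor = (\<lambda>(b, g). src G g),
      act = (\<lambda>(b, g) h. (b, gmul G g h)),
      sect = (\<lambda>b. (b, gunit G (f b)))\<rparr>"

text \<open>For \<open>p\<close>, \<open>q\<close> in the same fiber, the unique arrow \<open>g\<close> with \<open>q = p g\<close>.\<close>

definition transporter :: "('o, 'a) groupoid \<Rightarrow> ('b, 'o, 'a, 'p) gbundle \<Rightarrow> 'p \<Rightarrow> 'p \<Rightarrow> 'a" where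
  "transporter G P p q = (THE g. g \<in> ar G \<and> anchor P p = tgt G g \<and> act P p g = q)"

section \<open>The homotopy groups of a pointed groupoid\<close>

text \<open>Concatenation of bundles over \<open>(I^n, \<partial>I^n)\<close>, \<open>n \<ge> 1\<close>. The disjoint union of \<open>P\<close> and \<open>Q\<close>
  consists of the points \<open>(False, p)\<close> and \<open>(True, q)\<close>. A point \<open>q\<close> of \<open>Q\<close> over the face \<open>x 0 = 0\<close>
  is identified with its image \<open>face_iso G P Q q\<close> in \<open>P\<close> over the face \<open>x 0 = 1\<close>, and
  the latter is taken as representative. The base is rescaled to the cube at the same time.\<close>

definition face_iso ::
    "('o, 'a) groupoid \<Rightarrow> (nat \<Rightarrow> real, 'o, 'a, 'p) gbundle \<Rightarrow> (nat \<Rightarrow> real, 'o, 'a, 'p) gbundle \<Rightarrow> 'p \<Rightarrow> 'p" where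
  "face_iso G P Q q =
     act P (sect P ((proj Q q)(0 := 1))) (transporter G Q (sect Q (proj Q q)) q)"

definition glue_map ::
    "('o, 'a) groupoid \<Rightarrow> (nat \<Rightarrow> real, 'o, 'a, 'p) gbundle \<Rightarrow> (nat \<Rightarrow> real, 'o, 'a, 'p) gbundle \<Rightarrow>
     bool \<times> 'p \<Rightarrow> bool \<times> 'p" where
  "glue_map G P Q = (\<lambda>(i, p). if i \<and> proj Q p 0 = 0 then (False, face_iso G P Q p) else (i, p))"

definition concat_bundle ::
    "('o, 'a) groupoid \<Rightarrow> (nat \<Rightarrow> real, 'o, 'a, 'p) gbundle \<Rightarrow> (nat \<Rightarrow> real, 'o, 'a, 'p) gbundle \<Rightarrow>
     (nat \<Rightarrow> real, 'o, 'a, bool \<times> 'p) gbundle" where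
  "concat_bundle G P Q =
     \<lparr>total = quotient_topology (sum_topology (\<lambda>i. total (if i then Q else P)) UNIV) (glue_map G P Q),
      proj = (\<lambda>(i, p). if i then (proj Q p)(0 := (proj Q p 0 + 1) / 2)
                       else (proj P p)(0 := proj P p 0 / 2)),
      anchor = (\<lambda>(i, p). anchor (if i then Q else P) p),
      act = (\<lambda>(i, p) g. (i, act (if i then Q else P) p g)),
      sect = (\<lambda>x. if x 0 \<le> 1/2 then (False, sect P (x(0 := 2 * x 0)))
                  else (True, sect Q (x(0 := 2 * x 0 - 1))))\<rparr>"

type_synonym ('o, 'a) cube_bundle = "(nat \<Rightarrow> real, 'o, 'a, (nat \<Rightarrow> real) \<times> 'a) gbundle"

abbreviation homotopic_cube_bundles ::
    "nat \<Rightarrow> ('o, 'a) groupoid \<Rightarrow> 'o \<Rightarrow>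
     (nat \<Rightarrow> real, 'o, 'a, 'p) gbundle \<Rightarrow> (nat \<Rightarrow> real, 'o, 'a, 'q) gbundle \<Rightarrow> bool" where
  "homotopic_cube_bundles n G a0 \<equiv> homotopic_bundles G a0 (cube n) (cube_boundary n)"

text \<open>As for spaces, the neutral element is the base point, here the class of the trivial bundle,
  and the multiplication is meaningful only for \<open>n \<ge> 1\<close>.\<close>

definition groupoid_homotopy_group ::
    "nat \<Rightarrow> ('o, 'a) groupoid \<Rightarrow> 'o \<Rightarrow> ('o, 'a) cube_bundle set monoid" where
  "groupoid_homotopy_group n G a0 =
     \<lparr>carrier = {P. principal_pair_bundle G a0 (cube n) (cube_boundary n) P} //
                {(P, Q). homotopic_cube_bundles n G a0 P Q},
      mult = (\<lambda>X Y. {R. \<exists>P\<in>X. \<exists>Q\<in>Y. homotopic_cube_bundles n G a0 (concat_bundle G P Q) R}),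
      one = {R. homotopic_cube_bundles n G a0 (pullback_unit_bundle G (cube n) (\<lambda>_. a0)) R}\<rparr>"


section \<open>The maps of the exact sequence\<close>

abbreviation "fiber_homotopy_group n G a0 \<equiv> homotopy_group n (source_fiber G a0) (gunit G a0)"
abbreviation "object_homotopy_group n G a0 \<equiv> homotopy_group n (objs G) a0"

abbreviation "fiber_homotopy_group_map n H b0 \<equiv> homotopy_group_map n (source_fiber H b0) (gunit H b0)"
abbreviation "object_homotopy_group_map n H b0 \<equiv> homotopy_group_map n (objs H) b0"

abbreviation "target_map n G a0 \<equiv> homotopy_group_map n (objs G) a0 (tgt G)"

definition pullback_unit_map ::
    "nat \<Rightarrow> ('o, 'a) groupoid \<Rightarrow> 'o \<Rightarrow> ((nat \<Rightarrow> real) \<Rightarrow> 'o) set \<Rightarrow> ('o, 'a) cube_bundle set" where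
  "pullback_unit_map n G a0 X =
     {R. \<exists>f\<in>X. homotopic_cube_bundles n G a0 (pullback_unit_bundle G (cube n) f) R}"

text \<open>The connecting map \<open>\<pi>_(n+1)(G, a0) \<rightarrow> \<pi>_n(s^{-1}(a0), 1)\<close>: extend the restriction of \<open>\<sigma>\<close> to
  the open box to a global section \<open>\<tau>\<close>; over the remaining face \<open>I^n\<close> one has \<open>\<sigma> = \<tau> g\<close> for a
  unique \<open>g : I^n \<rightarrow> s^{-1}(a0)\<close>.\<close>

definition connecting_map ::
    "nat \<Rightarrow> ('o, 'a) groupoid \<Rightarrow> 'o \<Rightarrow> ('o, 'a) cube_bundle set \<Rightarrow> ((nat \<Rightarrow> real) \<Rightarrow> 'a) set" where
  "connecting_map n G a0 X =
     {h. \<exists>P\<in>X. \<exists>\<tau>. continuous_map (cube (Suc n)) (total P) \<tau> \<and>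
           (\<forall>x\<in>topspace (cube (Suc n)). proj P (\<tau> x) = x) \<and>
           (\<forall>x\<in>open_box n. \<tau> x = sect P x) \<and>
           homotopic_spheroids n (source_fiber G a0) (gunit G a0)
             (\<lambda>y. transporter G P (\<tau> y) (sect P y)) h}"

text \<open>Extension of the structure groupoid along a morphism \<open>(\<phi>0, \<phi>1)\<close> from \<open>G\<close> to \<open>H\<close>: the
  quotient of \<open>{(p, h). \<phi>0 (\<epsilon> p) = tgt h}\<close> by \<open>(p, h) \<sim> (p g, \<phi>1 g\<inverse> h)\<close>.\<close>

definition extension_orbit ::
    "('o, 'a) groupoid \<Rightarrow> ('o2, 'a2) groupoid \<Rightarrow> ('a \<Rightarrow> 'a2) \<Rightarrow> ('b, 'o, 'a, 'p) gbundle \<Rightarrow>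
     'p \<times> 'a2 \<Rightarrow> ('p \<times> 'a2) set" where
  "extension_orbit G H \<phi>1 P = (\<lambda>(p, h).
     (\<lambda>g. (act P p g, gmul H (ginv H (\<phi>1 g)) h)) ` {g \<in> ar G. anchor P p = tgt G g})"

definition extension_bundle ::
    "('o, 'a) groupoid \<Rightarrow> ('o2, 'a2) groupoid \<Rightarrow> ('o \<Rightarrow> 'o2) \<Rightarrow> ('a \<Rightarrow> 'a2) \<Rightarrow>
     ('b, 'o, 'a, 'p) gbundle \<Rightarrow> ('b, 'o2, 'a2, ('p \<times> 'a2) set) gbundle" where
  "extension_bundle G H \<phi>0 \<phi>1 P =
     \<lparr>total = quotient_topology
        (subtopology (prod_topology (total P) (arrs H)) {(p, h). \<phi>0 (anchor P p) = tgt H h})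
        (extension_orbit G H \<phi>1 P),
      proj = (\<lambda>c. the_elem ((\<lambda>(p, h). proj P p) ` c)),
      anchor = (\<lambda>c. the_elem ((\<lambda>(p, h). src H h) ` c)),
      act = (\<lambda>c k. (\<lambda>(p, h). (p, gmul H h k)) ` c),
      sect = (\<lambda>b. extension_orbit G H \<phi>1 P (sect P b, gunit H (\<phi>0 (anchor P (sect P b)))))\<rparr>"

definition groupoid_homotopy_group_map ::
    "nat \<Rightarrow> ('o, 'a) groupoid \<Rightarrow> ('o2, 'a2) groupoid \<Rightarrow> 'o2 \<Rightarrow> ('o \<Rightarrow> 'o2) \<Rightarrow> ('a \<Rightarrow> 'a2) \<Rightarrow>
     ('o, 'a) cube_bundle set \<Rightarrow> ('o2, 'a2) cube_bundle set" where
  "groupoid_homotopy_group_map n G H b0 \<phi>0 \<phi>1 X =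
     {R. \<exists>P\<in>X. homotopic_cube_bundles n H b0 (extension_bundle G H \<phi>0 \<phi>1 P) R}"

text \<open>A homomorphism of groups for \<open>n \<ge> 1\<close>, a map of pointed sets for \<open>n = 0\<close>.\<close>

definition homotopy_hom :: "nat \<Rightarrow> 'x monoid \<Rightarrow> 'y monoid \<Rightarrow> ('x \<Rightarrow> 'y) \<Rightarrow> bool" where
  "homotopy_hom n M N f \<longleftrightarrow>
     f \<in> carrier M \<rightarrow> carrier N \<and> f \<one>\<^bsub>M\<^esub> = \<one>\<^bsub>N\<^esub> \<and> \<one>\<^bsub>M\<^esub> \<in> carrier M \<and> (n \<ge> 1 \<longrightarrow> group_hom M N f)"

end

theory Submission
  imports Defs
begin

text \<open>A principal bundle over a cube, for a Serre groupoid, has a global section. Up to isomorphism, a bundle over the pair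
  \<open>(I^n, \<partial>I^n)\<close> is therefore given by a pair \<open>(f, \<gamma>)\<close>: the map \<open>f : I^n \<rightarrow> G0\<close> along which the unit bundle is pulled
  back, and the arrow-valued function \<open>\<gamma>\<close> on the boundary, with \<open>t \<gamma> = f\<close> and \<open>s \<gamma> = a0\<close>, that describes the section
  \<open>\<sigma>\<close>. The global section can be chosen to extend \<open>\<sigma>\<close> over all faces but one. Then \<open>\<gamma>\<close> is the unit on these faces, and
  what remains is a spheroid \<open>g\<close> of the source fiber, the restriction of \<open>\<gamma>\<close> to the last face, together with a null homotopy
  \<open>f\<close> of \<open>t g\<close>. In other words, \<open>\<pi>\<^sub>n(G, a0)\<close> for \<open>n \<ge> 1\<close> is the relative homotopy group of the map \<open>t\<close> from the source fiber
  to the space of objects, and the sequence is the exact sequence of that map. In these terms the connecting map takes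
  \<open>(f, g)\<close> to \<open>g\<close>, and exactness (\<open>exact_at_objects\<close>, \<open>exact_at_bundles\<close>, \<open>exact_at_fiber\<close>) is a matter of
  reading off definitions and extending homotopies.

  The work lies in passing from bundles to data. The inclusions along which sections are extended are retracts of
  \<open>I^m \<times> 0 \<rightarrow> I^m \<times> I\<close>, here called anodyne. A union of faces of a cube is anodyne as soon as it contains exactly one
  face of some pair of opposite faces (\<open>anodyne_faces\<close>). Serre fibrations lift against anodyne inclusions by definition, and
  the projection of a principal bundle is a Serre fibration, because this property is local over the base
  (\<open>serre_fibration_locally\<close>) and a principal bundle is locally a pullback of the target map (\<open>principal_bundle_serre\<close>).
  It follows that a homotopy of bundles can be replaced by a homotopy of data, with prescribed values on part of the boundary,
  followed by an isomorphism of trivialised bundles, that is, a gauge transformation \<open>u : I^n \<rightarrow> G1\<close>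
  (\<open>trivialise_homotopy\<close>). A gauge transformation that is the unit on all faces but one can moreover be deformed to the unit,
  so the class of \<open>g\<close> depends on that of the bundle only (\<open>box_datum_homotopic\<close>).

  Concatenating bundles and extending the structure groupoid have simple effects on data: they concatenate them, provided
  that they agree on the common face (\<open>concat_bundle_iso\<close>), and compose them with the given morphism
  (\<open>extension_bundle_iso\<close>). The group axioms thus follow from reparametrisations of the cube, as they do for the homotopy
  groups of spaces; both cases are instances of the locale \<open>cubical_group\<close>. Naturality is immediate.\<close>

section \<open>Cubes and their faces\<close>

lemma in_cube: "x \<in> topspace (cube n) \<longleftrightarrow> (\<forall>i<n. 0 \<le> x i \<and> x i \<le> 1) \<and> (\<forall>i\<ge>n. x i = 0)"
  by (auto simp: cube_def topspace_Euclidean_space)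

text \<open>This makes the calculus of \<^const>\<open>continuous_on\<close> available for maps between cubes.\<close>

lemma cube_euclidean: "cube n = top_of_set (topspace (cube n))"
proof -
  have "cube n = top_of_set ({x. \<forall>i\<ge>n. x i = 0} \<inter> {x. \<forall>i<n. 0 \<le> x i \<and> x i \<le> 1})"
    by (simp add: cube_def Euclidean_space_def subtopology_subtopology euclidean_product_topology)
  then show ?thesis by simp
qed

abbreviation cylinder :: "'b topology \<Rightarrow> ('b \<times> real) topology" where
  "cylinder X \<equiv> prod_topology X unit_interval"

lemma cylinder_euclidean:
  "cylinder (cube n) = top_of_set (topspace (cube n) \<times> {0..1})"
  by (metis cube_euclidean prod_topology_subtopology_eu)

lemma continuous_on_coordinate [continuous_intros]:
  fixes S :: "(nat \<Rightarrow> real) set" and T :: "((nat \<Rightarrow> real) \<times> 'c::topological_space) set"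
  shows "continuous_on S (\<lambda>x. x i)" "continuous_on T (\<lambda>z. fst z i)"
  by (rule continuous_on_product_then_coordinatewise[OF continuous_on_id])
    (rule continuous_on_product_then_coordinatewise[OF continuous_on_fst[OF continuous_on_id]])

text \<open>Otherwise updated points would be taken apart into coordinates before \<open>continuous_on_fun_upd\<close> applies.\<close>

declare continuous_on_coordinatewise_then_product [continuous_intros del]

lemma continuous_on_fun_upd [continuous_intros]:
  fixes f :: "'b::topological_space \<Rightarrow> nat \<Rightarrow> real"
  assumes "continuous_on S f" "continuous_on S g"
  shows "continuous_on S (\<lambda>x. (f x)(i := g x))"
proof (rule continuous_on_coordinatewise_then_product)
  show "continuous_on S (\<lambda>x. ((f x)(i := g x)) j)" for j
    using assms by (cases "j = i") (auto intro: continuous_on_product_then_coordinatewise)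
qed

lemma continuous_map_into_cube:
  "continuous_map (top_of_set S) (cube n) f \<longleftrightarrow> continuous_on S f \<and> f \<in> S \<rightarrow> topspace (cube n)"
  by (subst cube_euclidean) simp

lemma continuous_map_cubeI:
  assumes "continuous_on (topspace (cube m)) f" "\<And>x. x \<in> topspace (cube m) \<Longrightarrow> f x \<in> topspace (cube n)"
  shows "continuous_map (cube m) (cube n) f"
  using assms by (subst cube_euclidean) (auto simp: continuous_map_into_cube)

lemma continuous_map_cylinderI:
  assumes "continuous_on (topspace (cube m) \<times> {0..1}) f"
    "\<And>x t. x \<in> topspace (cube m) \<Longrightarrow> 0 \<le> t \<Longrightarrow> t \<le> 1 \<Longrightarrow> f (x, t) \<in> topspace (cube n)"
  shows "continuous_map (cylinder (cube m)) (cube n) f"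
  using assms by (subst cylinder_euclidean) (auto simp: continuous_map_into_cube)

definition faces :: "nat \<Rightarrow> (nat \<times> real) set \<Rightarrow> (nat \<Rightarrow> real) set" where
  "faces n F = {x \<in> topspace (cube n). \<exists>(i, e) \<in> F. x i = e}"

lemma cube_boundary_faces: "cube_boundary n = faces n ({..<n} \<times> {0, 1})"
  by (auto simp: cube_boundary_def faces_def)

lemma open_box_faces: "open_box n = faces (Suc n) ({..<n} \<times> {0, 1} \<union> {(n, 1)})"
  by (auto simp: open_box_def faces_def)

lemma faces_subset: "faces n F \<subseteq> topspace (cube n)"
  by (auto simp: faces_def)

lemma faces_mono: "F \<subseteq> F' \<Longrightarrow> faces n F \<subseteq> faces n F'"
  by (auto simp: faces_def)

lemma closedin_faces:
  assumes "finite F" shows "closedin (cube n) (faces n F)"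
proof -
  have "closedin (cube n) {x \<in> topspace (cube n). x i \<in> {e}}" for i e
    by (rule closedin_continuous_map_preimage[of _ euclideanreal])
      (subst cube_euclidean, auto intro!: continuous_intros)
  then have "closedin (cube n) (\<Union>z\<in>F. {x \<in> topspace (cube n). x (fst z) = snd z})"
    using assms by (intro closedin_Union) auto
  also have "(\<Union>z\<in>F. {x \<in> topspace (cube n). x (fst z) = snd z}) = faces n F"
    by (auto simp: faces_def)
  finally show ?thesis .
qed

lemma cube_boundary_subset: "cube_boundary n \<subseteq> topspace (cube n)"
  by (auto simp: cube_boundary_def)

lemma closedin_cube_boundary: "closedin (cube n) (cube_boundary n)"
  by (simp add: cube_boundary_faces closedin_faces)


section \<open>Anodyne pairs\<close>

text \<open>The pair is a retract of \<open>(I^n \<times> I, I^n \<times> 0)\<close>. Since solutions of lifting problems pass to retracts, Serre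
  fibrations have the right lifting property for these inclusions.\<close>

definition anodyne :: "'b topology \<Rightarrow> 'b set \<Rightarrow> bool" where
  "anodyne X A \<longleftrightarrow> A \<subseteq> topspace X \<and>
     (\<exists>n i r. continuous_map X (cylinder (cube n)) i \<and>
        continuous_map (cylinder (cube n)) X r \<and>
        (\<forall>x\<in>topspace X. r (i x) = x) \<and> (\<forall>x\<in>A. snd (i x) = 0) \<and>
        (\<forall>x\<in>topspace (cube n). r (x, 0) \<in> A))"

lemma anodyne_subset: "anodyne X A \<Longrightarrow> A \<subseteq> topspace X"
  by (simp add: anodyne_def)

lemma anodyne_retract:
  assumes X: "anodyne X A" and j: "continuous_map Y X j" and q: "continuous_map X Y q"
    and qj: "\<And>y. y \<in> topspace Y \<Longrightarrow> q (j y) = y"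
    and B: "B \<subseteq> topspace Y" "\<And>y. y \<in> B \<Longrightarrow> j y \<in> A" "\<And>x. x \<in> A \<Longrightarrow> q x \<in> B"
  shows "anodyne Y B"
proof -
  obtain n i r where i: "continuous_map X (cylinder (cube n)) i"
    and r: "continuous_map (cylinder (cube n)) X r"
    and ri: "\<forall>x\<in>topspace X. r (i x) = x" and A: "\<forall>x\<in>A. snd (i x) = 0"
      "\<forall>x\<in>topspace (cube n). r (x, 0) \<in> A"
    using X by (auto simp: anodyne_def)
  have "j y \<in> topspace X" if "y \<in> topspace Y" for y
    using continuous_map_image_subset_topspace[OF j] that by blast
  then show ?thesis
    unfolding anodyne_def using B A ri qj
    by (intro conjI exI[of _ n] exI[of _ "i \<circ> j"] exI[of _ "q \<circ> r"])
      (auto intro: continuous_map_compose[OF j i] continuous_map_compose[OF r q])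
qed

text \<open>Composed with the retraction, the problem becomes one on \<open>I^n \<times> I\<close>; its solution is then
  restricted to \<open>X\<close>.\<close>

lemma serre_fibration_lift:
  assumes "serre_fibration E B p" "anodyne X A"
    and f: "continuous_map (subtopology X A) E f" and h: "continuous_map X B h"
    and pf: "\<And>x. x \<in> A \<Longrightarrow> p (f x) = h x"
  obtains k where "continuous_map X E k" "\<And>x. x \<in> topspace X \<Longrightarrow> p (k x) = h x"
    "\<And>x. x \<in> A \<Longrightarrow> k x = f x"
proof -
  obtain n i r where AX: "A \<subseteq> topspace X" and i: "continuous_map X (cylinder (cube n)) i"
    and r: "continuous_map (cylinder (cube n)) X r"
    and ri: "\<forall>x\<in>topspace X. r (i x) = x" and iA: "\<forall>x\<in>A. snd (i x) = 0"
    and rA: "\<forall>x\<in>topspace (cube n). r (x, 0) \<in> A"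
    using assms(2) by (auto simp: anodyne_def)
  have r0: "continuous_map (cube n) (subtopology X A) (\<lambda>x. r (x, 0))"
    unfolding continuous_map_in_subtopology using rA
    by (auto intro!: continuous_map_compose[OF _ r, unfolded comp_def] continuous_map_pairedI)
  have "continuous_map (cube n) E (\<lambda>x. f (r (x, 0)))"
    using continuous_map_compose[OF r0 f] by (simp add: comp_def)
  moreover have "continuous_map (cylinder (cube n)) B (h \<circ> r)"
    by (rule continuous_map_compose[OF r h])
  moreover have "\<forall>x\<in>topspace (cube n). (h \<circ> r) (x, 0) = p (f (r (x, 0)))"
    using rA pf by auto
  ultimately obtain k where k: "continuous_map (cylinder (cube n)) E k"
    and k0: "\<forall>x\<in>topspace (cube n). k (x, 0) = f (r (x, 0))"
    and pk: "\<forall>z\<in>topspace (cylinder (cube n)). p (k z) = (h \<circ> r) z"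
    using assms(1) unfolding serre_fibration_def by blast
  have iX: "i x \<in> topspace (cylinder (cube n))" if "x \<in> topspace X" for x
    using continuous_map_image_subset_topspace[OF i] that by blast
  show ?thesis
  proof
    show "continuous_map X E (k \<circ> i)" by (rule continuous_map_compose[OF i k])
    show "p ((k \<circ> i) x) = h x" if "x \<in> topspace X" for x
      using bspec[OF pk iX[OF that]] ri that by simp
    show "(k \<circ> i) x = f x" if "x \<in> A" for x
    proof -
      have x: "x \<in> topspace X" using that AX by blast
      have "i x = (fst (i x), 0)" using iA that by (metis prod.collapse)
      then show ?thesis using k0 iX[OF x] ri x by (metis comp_apply mem_Sigma_iff topspace_prod_topology)
    qed
  qed
qed

text \<open>Projecting to the bottom of \<open>I^n \<times> I\<close> induces a retraction of \<open>X\<close> onto \<open>A\<close>.\<close>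

lemma anodyne_extension:
  assumes "anodyne X A" and f: "continuous_map (subtopology X A) Y f"
  obtains k where "continuous_map X Y k" "\<And>x. x \<in> A \<Longrightarrow> k x = f x"
proof -
  obtain n i r where AX: "A \<subseteq> topspace X" and i: "continuous_map X (cylinder (cube n)) i"
    and r: "continuous_map (cylinder (cube n)) X r"
    and ri: "\<forall>x\<in>topspace X. r (i x) = x" and iA: "\<forall>x\<in>A. snd (i x) = 0"
    and rA: "\<forall>x\<in>topspace (cube n). r (x, 0) \<in> A"
    using assms(1) by (auto simp: anodyne_def)
  have r0: "continuous_map (cube n) (subtopology X A) (\<lambda>x. r (x, 0))"
    unfolding continuous_map_in_subtopology using rA
    by (auto intro!: continuous_map_compose[OF _ r, unfolded comp_def] continuous_map_pairedI)
  have "continuous_map X (cube n) (\<lambda>x. fst (i x))"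
    using continuous_map_compose[OF i continuous_map_fst] by (simp add: comp_def)
  from continuous_map_compose[OF this continuous_map_compose[OF r0 f]]
  have "continuous_map X Y (\<lambda>x. f (r (fst (i x), 0)))" by (simp add: comp_def)
  moreover have "f (r (fst (i x), 0)) = f x" if "x \<in> A" for x
    using that iA ri AX by (metis prod.collapse subsetD)
  ultimately show ?thesis by (rule that)
qed

lemma continuous_on_Min:
  fixes f :: "'i \<Rightarrow> 'b::topological_space \<Rightarrow> real"
  assumes "finite I" "I \<noteq> {}" "\<And>i. i \<in> I \<Longrightarrow> continuous_on S (f i)"
  shows "continuous_on S (\<lambda>x. Min ((\<lambda>i. f i x) ` I))"
  using assms
proof (induction rule: finite_ne_induct)
  case (insert i I)
  then have "continuous_on S (\<lambda>x. min (f i x) (Min ((\<lambda>i. f i x) ` I)))"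
    by (intro continuous_intros) auto
  moreover have "Min ((\<lambda>i. f i x) ` insert i I) = min (f i x) (Min ((\<lambda>i. f i x) ` I))" for x
    using insert.hyps by simp
  ultimately show ?case by presburger
qed simp

text \<open>The cube is pushed onto the given faces, away from a centre \<open>c\<close> that lies beyond the face opposite
  to \<open>(k, e)\<close>. The function \<open>\<phi>\<close> vanishes exactly on the given faces, so that \<open>x \<mapsto> (x, \<phi> x)\<close> embeds the cube
  in its cylinder and takes them to the bottom. The retraction moves \<open>x\<close> away from \<open>c\<close> in proportion to
  \<open>\<phi> x - s\<close>, stopping at the boundary of the cube: for \<open>s = \<phi> x\<close> it does not move \<open>x\<close>, and for \<open>s = 0\<close> it
  moves it as far as the nearest of the given faces.\<close>

theorem anodyne_faces:
  assumes F: "F \<subseteq> {..<m} \<times> {0, 1}" and kF: "(k, e) \<in> F" "(k, 1 - e) \<notin> F"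
  shows "anodyne (cube m) (faces m F)"
proof -
  have fin: "finite F" using F by (rule finite_subset) simp
  have ke: "k < m" "e = 0 \<or> e = 1" using F kF by auto
  \<comment> \<open>The weight \<open>1/4\<close> gives \<open>\<phi> \<le> 1/4\<close>: in every direction other than \<open>k\<close>, a point whose nearest face
    is \<open>(i, a)\<close> then lies between the centre \<open>1/2\<close> and that face, and so is moved towards the face.\<close>
  define d where "d z x = (if fst z = k then 1/4 else 1) * \<bar>x (fst z) - snd z\<bar>"
    for z :: "nat \<times> real" and x :: "nat \<Rightarrow> real"
  define \<phi> where "\<phi> x = Min ((\<lambda>z. d z x) ` F)" for x
  define c :: "nat \<Rightarrow> real" where "c i = (if i \<noteq> k then 1/2 else if e = 0 then 2 else -1)" for i
  define r :: "(nat \<Rightarrow> real) \<times> real \<Rightarrow> nat \<Rightarrow> real" where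
    "r = (\<lambda>(x, s) i. if i < m then max 0 (min 1 (x i + 4 * (\<phi> x - s) * (x i - c i))) else 0)"
  have \<phi>_att: "\<exists>z\<in>F. \<phi> x = d z x" for x
    using Min_in[of "(\<lambda>z. d z x) ` F"] fin kF unfolding \<phi>_def by (metis empty_iff finite_imageI imageE image_is_empty)
  have \<phi>_le: "\<phi> x \<le> d z x" if "z \<in> F" for z x
    using that fin by (simp add: \<phi>_def)
  have \<phi>_nonneg: "0 \<le> \<phi> x" for x using \<phi>_att[of x] by (auto simp: d_def)
  have \<phi>_quarter: "\<phi> x \<le> 1/4" if "x \<in> topspace (cube m)" for x
    using \<phi>_le[OF kF(1), of x] that ke by (auto simp: d_def in_cube) 
  have \<phi>_cont: "continuous_on S \<phi>" for S
    unfolding \<phi>_def using fin kF by (intro continuous_on_Min) (auto simp: d_def intro!: continuous_intros)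
  have r_cont: "continuous_on S r" for S
    unfolding r_def case_prod_unfold
    apply (rule continuous_on_coordinatewise_then_product)
    subgoal for i by (cases "i < m") (auto intro!: continuous_intros continuous_on_compose2[OF \<phi>_cont])
    done
  show ?thesis
    unfolding anodyne_def
  proof (intro conjI exI[of _ m] exI[of _ "\<lambda>x. (x, \<phi> x)"] exI[of _ r] ballI)
    show "continuous_map (cube m) (cylinder (cube m)) (\<lambda>x. (x, \<phi> x))"
    proof (intro continuous_map_pairedI)
      show "continuous_map (cube m) unit_interval \<phi>"
        using \<phi>_nonneg \<phi>_quarter \<phi>_cont by (subst cube_euclidean) fastforce
    qed simp
    show "continuous_map (cylinder (cube m)) (cube m) r"
      by (rule continuous_map_cylinderI[OF r_cont]) (auto simp: in_cube r_def)
    show "faces m F \<subseteq> topspace (cube m)" by (rule faces_subset)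
    fix x assume x: "x \<in> topspace (cube m)"
    show "r (x, \<phi> x) = x" using x by (auto simp: r_def in_cube fun_eq_iff)
    obtain i a where z: "(i, a) \<in> F" "\<phi> x = d (i, a) x" using \<phi>_att[of x] by auto
    have i: "i < m" "a = 0 \<or> a = 1" using z F by auto
    have xi: "0 \<le> x i" "x i \<le> 1" using x i by (auto simp: in_cube)
    have "r (x, 0) i = a"
    proof (cases "i = k")
      case True
      have a: "a = e" using True z kF i ke by auto
      have \<phi>: "4 * \<phi> x = \<bar>x i - e\<bar>" using z True a by (simp add: d_def)
      show ?thesis
      proof (cases "e = 0")
        case True
        have "x i * (x i - 1) \<le> 0" using xi by (simp add: mult_nonneg_nonpos)
        then have "x i + x i * (x i - 2) \<le> 0" by (simp add: algebra_simps)
        then show ?thesis using \<open>i = k\<close> i \<phi> True a xi by (simp add: r_def c_def)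
      next
        case False
        then have e1: "e = 1" using ke by simp
        have "x i * x i \<le> x i" using xi by (simp add: mult_left_le)
        then have "x i + (1 - x i) * (x i + 1) \<ge> 1" using xi by (simp add: algebra_simps)
        then show ?thesis using \<open>i = k\<close> i \<phi> e1 a xi by (simp add: r_def c_def)
      qed
    next
      case False
      have \<phi>: "\<phi> x = \<bar>x i - a\<bar>" using z False by (simp add: d_def)
      then have q: "\<bar>x i - a\<bar> \<le> 1/4" using \<phi>_quarter[OF x] by simp
      show ?thesis
      proof (cases "a = 0")
        case True
        have "x i * (4 * x i - 1) \<le> 0" using q True xi by (intro mult_nonneg_nonpos) auto
        then have "x i + 4 * x i * (x i - 1/2) \<le> 0" by (simp add: algebra_simps)
        then show ?thesis using False i \<phi> True xi by (simp add: r_def c_def)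
      next
        case a0: False
        then have a: "a = 1" using i by simp
        have "(1 - x i) * (4 * x i - 3) \<ge> 0" using q a xi by (intro mult_nonneg_nonneg) auto
        then have "x i + 4 * (1 - x i) * (x i - 1/2) \<ge> 1" by (simp add: algebra_simps)
        then show ?thesis using False i \<phi> a xi by (simp add: r_def c_def)
      qed
    qed
    then show "r (x, 0) \<in> faces m F"
      using z unfolding faces_def by (auto simp: in_cube r_def)
  next
    fix x assume x: "x \<in> faces m F"
    then obtain i a where z: "(i, a) \<in> F" "x i = a" by (auto simp: faces_def)
    have "\<phi> x \<le> 0" using \<phi>_le[OF z(1), of x] z by (simp add: d_def)
    then show "snd (x, \<phi> x) = 0" using \<phi>_nonneg[of x] by simp
  qed
qed

lemma cylinder_cube_homeomorphism:
  "homeomorphic_maps (cylinder (cube n)) (cube (Suc n))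
     (\<lambda>(x, t). x(n := t)) (\<lambda>x. (x(n := 0), x n))"
  unfolding homeomorphic_maps_def
proof (intro conjI ballI)
  show "continuous_map (cylinder (cube n)) (cube (Suc n)) (\<lambda>(x, t). x(n := t))"
    by (rule continuous_map_cylinderI)
      (auto simp: case_prod_unfold in_cube intro!: continuous_intros)
  show "continuous_map (cube (Suc n)) (cylinder (cube n)) (\<lambda>x. (x(n := 0), x n))"
  proof (rule continuous_map_pairedI)
    show "continuous_map (cube (Suc n)) (cube n) (\<lambda>x. x(n := 0))"
      by (rule continuous_map_cubeI) (auto simp: in_cube intro!: continuous_intros)
    show "continuous_map (cube (Suc n)) unit_interval (\<lambda>x. x n)"
      by (subst cube_euclidean) (auto simp: in_cube intro!: continuous_intros)
  qed
qed (auto simp: in_cube fun_eq_iff)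

lemma cylinder_faces_iff:
  assumes "F \<subseteq> {..<n} \<times> UNIV" "x \<in> topspace (cube n)" "0 \<le> t" "t \<le> 1"
  shows "x(n := t) \<in> faces (Suc n) (F \<union> {n} \<times> E) \<longleftrightarrow> x \<in> faces n F \<or> t \<in> E"
proof -
  have "x(n := t) \<in> topspace (cube (Suc n))" using assms by (auto simp: in_cube)
  moreover have "(\<exists>(i, e)\<in>F. (x(n := t)) i = e) \<longleftrightarrow> (\<exists>(i, e)\<in>F. x i = e)"
    using assms(1) by (intro bex_cong) auto
  moreover have "(\<exists>(i, e)\<in>{n} \<times> E. (x(n := t)) i = e) \<longleftrightarrow> t \<in> E" by auto
  ultimately show ?thesis unfolding faces_def bex_Un using assms(2) by blast
qed

text \<open>The cylinder on \<open>I^n\<close> is \<open>I^(n+1)\<close>, and \<open>E\<close> selects those of its two ends that belong to the subspace.\<close>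

lemma anodyne_cylinder:
  assumes F: "F \<subseteq> {..<n} \<times> {0, 1}" and E: "E \<subseteq> {0, 1}"
    and k: "(k, e) \<in> F \<union> {n} \<times> E" "(k, 1 - e) \<notin> F \<union> {n} \<times> E"
  shows "anodyne (cylinder (cube n)) (topspace (cube n) \<times> E \<union> faces n F \<times> {0..1})"
proof (rule anodyne_retract)
  have F': "F \<subseteq> {..<n} \<times> UNIV" using F by auto
  show "anodyne (cube (Suc n)) (faces (Suc n) (F \<union> {n} \<times> E))"
    using F E by (intro anodyne_faces[OF _ k]) auto
  show "continuous_map (cylinder (cube n)) (cube (Suc n)) (\<lambda>(x, t). x(n := t))"
    "continuous_map (cube (Suc n)) (cylinder (cube n)) (\<lambda>x. (x(n := 0), x n))"
    using cylinder_cube_homeomorphism[of n] by (auto simp: homeomorphic_maps_def)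
  show sub: "topspace (cube n) \<times> E \<union> faces n F \<times> {0..1} \<subseteq> topspace (cylinder (cube n))"
    using E by (auto simp: faces_def)
  fix y assume y: "y \<in> topspace (cylinder (cube n))"
  then show "((case y of (x, t) \<Rightarrow> x(n := t))(n := 0), (case y of (x, t) \<Rightarrow> x(n := t)) n) = y"
    using cylinder_cube_homeomorphism[of n] unfolding homeomorphic_maps_def by blast
next
  fix y assume y: "y \<in> topspace (cube n) \<times> E \<union> faces n F \<times> {0..1}"
  obtain x t where [simp]: "y = (x, t)" by force
  have "x \<in> topspace (cube n)" "0 \<le> t" "t \<le> 1" "x \<in> faces n F \<or> t \<in> E"
    using y E faces_subset[of n F] by auto
  then show "(case y of (x, t) \<Rightarrow> x(n := t)) \<in> faces (Suc n) (F \<union> {n} \<times> E)"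
    using cylinder_faces_iff[of F n x t E] F by auto
next
  fix x assume x: "x \<in> faces (Suc n) (F \<union> {n} \<times> E)"
  have x': "x(n := 0) \<in> topspace (cube n)" "0 \<le> x n" "x n \<le> 1" using x by (auto simp: faces_def in_cube)
  moreover have "(x(n := 0))(n := x n) = x" by simp
  ultimately have "x(n := 0) \<in> faces n F \<or> x n \<in> E"
    using cylinder_faces_iff[of F n "x(n := 0)" "x n" E] F x by auto
  then show "(x(n := 0), x n) \<in> topspace (cube n) \<times> E \<union> faces n F \<times> {0..1}"
    using x' unfolding Un_iff mem_Times_iff fst_conv snd_conv atLeastAtMost_iff by blast
qed

lemma anodyne_open_box: "anodyne (cube (Suc n)) (open_box n)"
  unfolding open_box_faces by (rule anodyne_faces[of _ _ n 1]) auto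

section \<open>Serre fibrations are local over the base\<close>

lemma continuous_map_union_closed:
  assumes S: "closedin X S" and T: "closedin X T"
    and f: "continuous_map (subtopology X S) Y f" and g: "continuous_map (subtopology X T) Y g"
    and eq: "\<And>x. x \<in> S \<Longrightarrow> x \<in> T \<Longrightarrow> f x = g x"
  shows "continuous_map (subtopology X (S \<union> T)) Y (\<lambda>x. if x \<in> S then f x else g x)"
proof (rule pasting_lemma_closed[of "UNIV :: bool set" _ "\<lambda>u. if u then S else T" _ "\<lambda>u. if u then f else g"])
  fix i :: bool
  show "closedin (subtopology X (S \<union> T)) (if i then S else T)"
    using S T by (auto intro: closedin_subset_topspace)
  have "(S \<union> T) \<inter> (if i then S else T) = (if i then S else T)" by auto
  then show "continuous_map (subtopology (subtopology X (S \<union> T)) (if i then S else T)) Y (if i then f else g)"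
    using f g by (simp add: subtopology_subtopology)
next
  fix i j x
  assume "x \<in> topspace (subtopology X (S \<union> T)) \<inter> (if i then S else T) \<inter> (if j then S else T)"
  then show "(if i then f else g) x = (if j then f else g) x"
    using eq by (auto split: if_splits)
next
  fix x assume "x \<in> topspace (subtopology X (S \<union> T))"
  then show "\<exists>j. j \<in> UNIV \<and> x \<in> (if j then S else T) \<and> (if x \<in> S then f x else g x) = (if j then f else g) x"
    by (intro exI[of _ "x \<in> S"]) auto
qed simp

definition cell :: "nat \<Rightarrow> (nat \<Rightarrow> real) \<Rightarrow> (nat \<Rightarrow> real) \<Rightarrow> (nat \<Rightarrow> real) set" where
  "cell m a b = {x \<in> topspace (cube m). \<forall>i<m. a i \<le> x i \<and> x i \<le> b i}"

definition cell_faces ::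
    "nat \<Rightarrow> (nat \<Rightarrow> real) \<Rightarrow> (nat \<Rightarrow> real) \<Rightarrow> (nat \<times> bool) set \<Rightarrow> (nat \<Rightarrow> real) set" where
  "cell_faces m a b F = {x \<in> cell m a b. \<exists>(i, u)\<in>F. x i = (if u then b i else a i)}"

definition proper_cell :: "nat \<Rightarrow> (nat \<Rightarrow> real) \<Rightarrow> (nat \<Rightarrow> real) \<Rightarrow> bool" where
  "proper_cell m a b \<longleftrightarrow> (\<forall>i<m. 0 \<le> a i \<and> a i < b i \<and> b i \<le> 1)"

lemma closedin_coordinate_le:
  "closedin (cube m) {x \<in> topspace (cube m). c \<le> x i \<and> x i \<le> d}"
proof -
  have "closedin (cube m) {x \<in> topspace (cube m). x i \<in> {c..d}}"
    by (rule closedin_continuous_map_preimage[of _ euclideanreal])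
      (subst cube_euclidean, auto intro!: continuous_intros)
  then show ?thesis by simp
qed

lemma closedin_cell: "closedin (cube m) (cell m a b)"
proof -
  have "closedin (cube m) (topspace (cube m) \<inter> (\<Inter>i<m. {x \<in> topspace (cube m). a i \<le> x i \<and> x i \<le> b i}))"
    by (cases "m = 0") (auto intro!: closedin_Int closedin_coordinate_le closedin_Inter)
  also have "topspace (cube m) \<inter> (\<Inter>i<m. {x \<in> topspace (cube m). a i \<le> x i \<and> x i \<le> b i}) = cell m a b"
    by (auto simp: cell_def)
  finally show ?thesis .
qed

lemma closedin_cell_faces:
  assumes "finite F" shows "closedin (cube m) (cell_faces m a b F)"
proof -
  have "{x \<in> topspace (cube m). x i = c} = {x \<in> topspace (cube m). c \<le> x i \<and> x i \<le> c}" for i c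
    by auto
  then have "closedin (cube m) {x \<in> topspace (cube m). x i = c}" for i c
    using closedin_coordinate_le by simp
  then have "closedin (cube m) (\<Union>z\<in>F. cell m a b \<inter>
      {x \<in> topspace (cube m). x (fst z) = (if snd z then b (fst z) else a (fst z))})"
    using assms by (intro closedin_Union) (auto intro!: closedin_Int closedin_cell)
  also have "\<dots> = cell_faces m a b F"
    unfolding cell_faces_def cell_def case_prod_unfold by blast
  finally show ?thesis .
qed

lemma anodyne_cell_faces:
  assumes ab: "proper_cell m a b" and F: "F \<subseteq> {..<m} \<times> UNIV" "(k, u) \<in> F" "(k, \<not> u) \<notin> F"
  shows "anodyne (subtopology (cube m) (cell m a b)) (cell_faces m a b F)"
proof (rule anodyne_retract)
  define v :: "bool \<Rightarrow> real" where "v u = (if u then 1 else 0)" for u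
  define F' where "F' = (\<lambda>(i, u). (i, v u)) ` F"
  define j where "j x = (\<lambda>i. if i < m then (x i - a i) / (b i - a i) else 0)" for x :: "nat \<Rightarrow> real"
  define q where "q x = (\<lambda>i. if i < m then a i + (b i - a i) * x i else 0)" for x :: "nat \<Rightarrow> real"
  have pos: "0 < b i - a i" if "i < m" for i using ab that by (simp add: proper_cell_def)
  have bnd: "0 \<le> a i" "b i \<le> 1" if "i < m" for i using ab that by (simp_all add: proper_cell_def)
  have v_inj: "v u = v w \<longleftrightarrow> u = w" for u w by (simp add: v_def)
  have v: "1 - v u = v (\<not> u)" "(k, v u) \<in> F' \<longleftrightarrow> (k, u) \<in> F" for u k
    by (simp add: v_def) (auto simp: F'_def v_inj image_iff split: if_splits; force simp: v_inj)
  show "anodyne (cube m) (faces m F')"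
  proof (rule anodyne_faces[of _ _ k "v u"])
    show "F' \<subseteq> {..<m} \<times> {0, 1}" using F by (auto simp: F'_def v_def split: if_splits)
  qed (simp_all add: v F)
  have jc: "j x \<in> topspace (cube m)" if "x \<in> cell m a b" for x
    using that pos by (auto simp: in_cube j_def cell_def)
  have qc: "q x \<in> cell m a b" if x: "x \<in> topspace (cube m)" for x
  proof -
    have "a i \<le> a i + (b i - a i) * x i \<and> a i + (b i - a i) * x i \<le> b i" if "i < m" for i
    proof -
      have "(b i - a i) * x i \<le> (b i - a i) * 1" using pos[OF that] x that
        by (intro mult_left_mono) (auto simp: in_cube)
      moreover have "0 \<le> (b i - a i) * x i" using pos[OF that] x that by (auto simp: in_cube)
      ultimately show ?thesis unfolding mult_1_right by simp
    qed
    then show ?thesis using bnd by (force simp: q_def cell_def in_cube)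
  qed
  show "continuous_map (subtopology (cube m) (cell m a b)) (cube m) j"
  proof -
    have "continuous_on (cell m a b) j"
      unfolding j_def
      apply (rule continuous_on_coordinatewise_then_product)
      subgoal for i using pos[of i] by (cases "i < m") (auto intro!: continuous_intros)
      done
    moreover have "subtopology (cube m) (cell m a b) = top_of_set (cell m a b)"
      by (subst cube_euclidean) (auto simp: subtopology_subtopology cell_def Int_def intro: arg_cong[where f = top_of_set])
    ultimately show ?thesis using jc by (auto simp: continuous_map_into_cube)
  qed
  have "continuous_map (cube m) (cube m) q"
  proof (rule continuous_map_cubeI)
    show "continuous_on (topspace (cube m)) q"
      unfolding q_def
      apply (rule continuous_on_coordinatewise_then_product)
      subgoal for i by (cases "i < m") (auto intro!: continuous_intros)
      done
  qed (use qc in \<open>auto simp: cell_def\<close>)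
  then show "continuous_map (cube m) (subtopology (cube m) (cell m a b)) q"
    using qc by (auto simp: continuous_map_in_subtopology)
  show "cell_faces m a b F \<subseteq> topspace (subtopology (cube m) (cell m a b))"
    by (auto simp: cell_faces_def cell_def)
  show "q (j x) = x" if "x \<in> topspace (subtopology (cube m) (cell m a b))" for x
    using that pos by (fastforce simp: q_def j_def in_cube fun_eq_iff)
  show "j x \<in> faces m F'" if x: "x \<in> cell_faces m a b F" for x
  proof -
    obtain i u where iu: "(i, u) \<in> F" "x i = (if u then b i else a i)" using x by (auto simp: cell_faces_def)
    then have "i < m" using F by auto
    then have "j x i = v u" using iu pos[of i] by (auto simp: j_def v_def)
    moreover have "(i, v u) \<in> F'" using iu by (simp add: v)
    ultimately show ?thesis using jc x by (auto simp: faces_def cell_faces_def)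
  qed
  show "q x \<in> cell_faces m a b F" if x: "x \<in> faces m F'" for x
  proof -
    obtain i u where iu: "(i, u) \<in> F" "x i = v u" using x by (auto simp: faces_def F'_def)
    then have "i < m" using F by auto
    then have "q x i = (if u then b i else a i)" using iu by (simp add: q_def v_def)
    then have "\<exists>(i, u)\<in>F. q x i = (if u then b i else a i)" using iu by blast
    then show ?thesis using qc x by (auto simp: faces_def cell_faces_def)
  qed
qed

text \<open>The face \<open>x k = a k\<close> plays the role of the bottom of a cylinder. Lifts prescribed on further faces have to be
  admitted, because a lift over one half of a cell prescribes the lift over the other half on the face that they share.\<close>

definition cell_liftable ::
    "'e topology \<Rightarrow> ('e \<Rightarrow> 'b) \<Rightarrow> nat \<Rightarrow> nat \<Rightarrow> ((nat \<Rightarrow> real) \<Rightarrow> 'b) \<Rightarrow> (nat \<Rightarrow> real) \<Rightarrow> (nat \<Rightarrow> real) \<Rightarrow> bool" where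
  "cell_liftable E p m k h a b \<longleftrightarrow>
     (\<forall>F f. F \<subseteq> {..<m} \<times> UNIV \<and> (k, False) \<in> F \<and> (k, True) \<notin> F \<and>
        continuous_map (subtopology (cube m) (cell_faces m a b F)) E f \<and>
        (\<forall>x\<in>cell_faces m a b F. p (f x) = h x) \<longrightarrow>
        (\<exists>g. continuous_map (subtopology (cube m) (cell m a b)) E g \<and>
           (\<forall>x\<in>cell m a b. p (g x) = h x) \<and> (\<forall>x\<in>cell_faces m a b F. g x = f x)))"

lemma cell_liftableE:
  assumes "cell_liftable E p m k h a b" "F \<subseteq> {..<m} \<times> UNIV" "(k, False) \<in> F" "(k, True) \<notin> F"
    "continuous_map (subtopology (cube m) (cell_faces m a b F)) E f"
    "\<forall>x\<in>cell_faces m a b F. p (f x) = h x"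
  obtains g where "continuous_map (subtopology (cube m) (cell m a b)) E g"
    "\<forall>x\<in>cell m a b. p (g x) = h x" "\<forall>x\<in>cell_faces m a b F. g x = f x"
  using assms(1)[unfolded cell_liftable_def, rule_format, OF conjI, OF _ conjI, OF _ _ conjI, OF _ _ _ conjI] assms(2-)
  by (metis (no_types, lifting))

text \<open>The lower half is treated first, with its new face \<open>x j = c\<close> left free; this face is then
  prescribed for the upper half.\<close>

lemma cell_liftable_split:
  assumes j: "j < m" "a j < c" "c < b j"
    and L1: "cell_liftable E p m k h a (b(j := c))" and L2: "cell_liftable E p m k h (a(j := c)) b"
  shows "cell_liftable E p m k h a b"
  unfolding cell_liftable_def
proof (intro allI impI, elim conjE)
  fix F f
  assume F: "F \<subseteq> {..<m} \<times> UNIV" "(k, False) \<in> F" "(k, True) \<notin> F"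
    and f: "continuous_map (subtopology (cube m) (cell_faces m a b F)) E f"
    and pf: "\<forall>x\<in>cell_faces m a b F. p (f x) = h x"
  define A where "A = cell_faces m a b F"
  define Q1 where "Q1 = cell m a (b(j := c))"
  define Q2 where "Q2 = cell m (a(j := c)) b"
  define A1 where "A1 = cell_faces m a (b(j := c)) (F - {(j, True)})"
  define A2 where "A2 = cell_faces m (a(j := c)) b (F \<union> {(j, False)})"
  have Q1_iff: "x \<in> Q1 \<longleftrightarrow> x \<in> cell m a b \<and> x j \<le> c" and Q2_iff: "x \<in> Q2 \<longleftrightarrow> x \<in> cell m a b \<and> c \<le> x j" for x
    unfolding cell_def Q1_def Q2_def using j by (smt (verit) fun_upd_apply mem_Collect_eq)+
  then have cellQ: "cell m a b = Q1 \<union> Q2" by force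
  have finF: "finite F" using F(1) by (rule finite_subset[OF _ finite_SigmaI]) (auto)
  have A1A: "A1 = A \<inter> Q1"
  proof -
    have "x \<in> A1 \<longleftrightarrow> x \<in> A \<and> x \<in> Q1" for x
    proof (cases "x \<in> Q1")
      case True
      then have x: "x \<in> cell m a b" "x j \<le> c" by (auto simp: Q1_iff)
      have "(\<exists>(i, u)\<in>F - {(j, True)}. x i = (if u then (b(j := c)) i else a i)) \<longleftrightarrow>
          (\<exists>(i, u)\<in>F. x i = (if u then b i else a i))"
      proof
        assume "\<exists>(i, u)\<in>F. x i = (if u then b i else a i)"
        then obtain i u where iu: "(i, u) \<in> F" "x i = (if u then b i else a i)" by auto
        then have "(i, u) \<noteq> (j, True)" using x j by auto
        then show "\<exists>(i, u)\<in>F - {(j, True)}. x i = (if u then (b(j := c)) i else a i)"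
          using iu by (intro bexI[of _ "(i, u)"]) auto
      next
        assume "\<exists>(i, u)\<in>F - {(j, True)}. x i = (if u then (b(j := c)) i else a i)"
        then obtain i u where iu: "(i, u) \<in> F" "(i, u) \<noteq> (j, True)" "x i = (if u then (b(j := c)) i else a i)" by blast
        then show "\<exists>(i, u)\<in>F. x i = (if u then b i else a i)"
          by (intro bexI[of _ "(i, u)"]) (auto split: if_splits)
      qed
      then show ?thesis using True x unfolding A1_def A_def cell_faces_def Q1_def by blast
    qed (auto simp: A1_def Q1_def cell_faces_def)
    then show ?thesis by blast
  qed
  have A2A: "A2 = (A - Q1) \<union> {x \<in> A. x j = c} \<union> {x \<in> Q1. x j = c}"
  proof -
    have "x \<in> A2 \<longleftrightarrow> x \<in> A \<or> x j = c" if "x \<in> Q2" for x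
    proof -
      have x: "x \<in> cell m a b" "c \<le> x j" using that by (auto simp: Q2_iff)
      have "(\<exists>(i, u)\<in>F \<union> {(j, False)}. x i = (if u then b i else (a(j := c)) i)) \<longleftrightarrow>
          x j = c \<or> (\<exists>(i, u)\<in>F. x i = (if u then b i else a i))"
      proof
        assume "\<exists>(i, u)\<in>F \<union> {(j, False)}. x i = (if u then b i else (a(j := c)) i)"
        then obtain i u where iu: "(i, u) \<in> F \<union> {(j, False)}" "x i = (if u then b i else (a(j := c)) i)" by blast
        show "x j = c \<or> (\<exists>(i, u)\<in>F. x i = (if u then b i else a i))"
        proof (cases "i = j \<and> \<not> u")
          case False
          then show ?thesis using iu by (intro disjI2 bexI[of _ "(i, u)"]) (auto split: if_splits)
        qed (use iu in auto)
      next
        assume "x j = c \<or> (\<exists>(i, u)\<in>F. x i = (if u then b i else a i))"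
        then show "\<exists>(i, u)\<in>F \<union> {(j, False)}. x i = (if u then b i else (a(j := c)) i)"
        proof (elim disjE bexE)
          fix z assume z: "z \<in> F" "case z of (i, u) \<Rightarrow> x i = (if u then b i else a i)"
          then have "z \<noteq> (j, False)" using x j by auto
          then show ?thesis using z by (intro bexI[of _ z]) (auto split: if_splits)
        qed auto
      qed
      then show ?thesis using that x unfolding A2_def A_def cell_faces_def Q2_def by blast
    qed
    moreover have "A2 \<subseteq> Q2" "A \<subseteq> cell m a b" by (auto simp: A2_def Q2_def A_def cell_faces_def)
    moreover have "{x \<in> Q1. x j = c} \<subseteq> Q2" by (auto simp: Q1_iff Q2_iff)
    ultimately show ?thesis unfolding set_eq_iff Un_iff Diff_iff mem_Collect_eq
      by (metis Q1_iff Q2_iff cellQ Un_iff subsetD linorder_le_cases order_antisym)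
  qed
  have cf1: "continuous_map (subtopology (cube m) A1) E f"
    using f by (rule continuous_map_from_subtopology_mono) (auto simp: A1A A_def)
  have pf1: "\<forall>x\<in>A1. p (f x) = h x" using pf by (auto simp: A1A A_def)
  have F1: "F - {(j, True)} \<subseteq> {..<m} \<times> UNIV" "(k, False) \<in> F - {(j, True)}" "(k, True) \<notin> F - {(j, True)}"
    using F by auto
  obtain g1 where g1: "continuous_map (subtopology (cube m) Q1) E g1" "\<forall>x\<in>Q1. p (g1 x) = h x" "\<forall>x\<in>A1. g1 x = f x"
    unfolding A1_def Q1_def by (rule cell_liftableE[OF L1 F1 cf1[unfolded A1_def] pf1[unfolded A1_def]])
  define f2 where "f2 x = (if x \<in> Q1 then g1 x else f x)" for x
  have "continuous_map (subtopology (cube m) (Q1 \<union> A)) E f2"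
    unfolding f2_def using g1 f A1A finF
    by (intro continuous_map_union_closed) (auto simp: Q1_def A_def closedin_cell closedin_cell_faces)
  then have cf2: "continuous_map (subtopology (cube m) A2) E f2"
    by (rule continuous_map_from_subtopology_mono) (auto simp: A2A)
  have pf2: "\<forall>x\<in>A2. p (f2 x) = h x" using g1 pf by (auto simp: A2A f2_def A_def)
  have F2: "F \<union> {(j, False)} \<subseteq> {..<m} \<times> UNIV" "(k, False) \<in> F \<union> {(j, False)}" "(k, True) \<notin> F \<union> {(j, False)}"
    using F j by auto
  obtain g2 where g2: "continuous_map (subtopology (cube m) Q2) E g2" "\<forall>x\<in>Q2. p (g2 x) = h x" "\<forall>x\<in>A2. g2 x = f2 x"
    unfolding A2_def Q2_def by (rule cell_liftableE[OF L2 F2 cf2[unfolded A2_def] pf2[unfolded A2_def]])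
  have "continuous_map (subtopology (cube m) (Q1 \<union> Q2)) E (\<lambda>x. if x \<in> Q1 then g1 x else g2 x)"
  proof (rule continuous_map_union_closed)
    fix x assume x: "x \<in> Q1" "x \<in> Q2"
    then have "x j = c" by (auto simp: Q1_iff Q2_iff)
    then have "x \<in> A2" using x by (auto simp: A2A)
    then show "g1 x = g2 x" using g2 x by (simp add: f2_def)
  qed (use g1 g2 in \<open>auto simp: Q1_def Q2_def closedin_cell\<close>)
  moreover have "(if x \<in> Q1 then g1 x else g2 x) = f x" if "x \<in> A" for x
    using that g1 g2 by (auto simp: A1A A2A f2_def)
  ultimately show "\<exists>g. continuous_map (subtopology (cube m) (cell m a b)) E g \<and>
      (\<forall>x\<in>cell m a b. p (g x) = h x) \<and> (\<forall>x\<in>cell_faces m a b F. g x = f x)"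
    using g1 g2 unfolding cellQ A_def by (intro exI[of _ "\<lambda>x. if x \<in> Q1 then g1 x else g2 x"]) auto
qed

lemma cell_liftable_local:
  assumes ab: "proper_cell m a b" and k: "k < m"
    and h: "continuous_map (cube m) B h" and V: "h ` cell m a b \<subseteq> V"
    and serre: "serre_fibration (subtopology E {e. p e \<in> V}) (subtopology B V) p"
  shows "cell_liftable E p m k h a b"
  unfolding cell_liftable_def
proof (intro allI impI, elim conjE)
  fix F f
  assume F: "F \<subseteq> {..<m} \<times> UNIV" "(k, False) \<in> F" "(k, True) \<notin> F"
    and f: "continuous_map (subtopology (cube m) (cell_faces m a b F)) E f"
    and pf: "\<forall>x\<in>cell_faces m a b F. p (f x) = h x"
  have sub: "cell_faces m a b F \<subseteq> cell m a b" by (auto simp: cell_faces_def)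
  have an: "anodyne (subtopology (cube m) (cell m a b)) (cell_faces m a b F)"
    using ab F by (intro anodyne_cell_faces[of _ _ _ _ k False]) auto
  have cf: "continuous_map (subtopology (subtopology (cube m) (cell m a b)) (cell_faces m a b F))
      (subtopology E {e. p e \<in> V}) f"
    using f sub V pf by (auto simp: subtopology_subtopology Int_absorb1 continuous_map_in_subtopology cell_def subset_iff)
  have ch: "continuous_map (subtopology (cube m) (cell m a b)) (subtopology B V) h"
    using h V by (auto simp: continuous_map_in_subtopology intro: continuous_map_from_subtopology)
  obtain g where "continuous_map (subtopology (cube m) (cell m a b)) (subtopology E {e. p e \<in> V}) g"
    "\<And>x. x \<in> topspace (subtopology (cube m) (cell m a b)) \<Longrightarrow> p (g x) = h x"
    "\<And>x. x \<in> cell_faces m a b F \<Longrightarrow> g x = f x"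
    by (rule serre_fibration_lift[OF serre an cf ch bspec[OF pf]]) (assumption | rule that)+
  then show "\<exists>g. continuous_map (subtopology (cube m) (cell m a b)) E g \<and>
      (\<forall>x\<in>cell m a b. p (g x) = h x) \<and> (\<forall>x\<in>cell_faces m a b F. g x = f x)"
    by (intro exI[of _ g]) (auto simp: continuous_map_in_subtopology cell_def)
qed

lemma cube_neighbourhood_cell:
  assumes U: "openin (cube m) U" and y: "y \<in> U"
  obtains \<delta> where "\<delta> > 0" "\<And>x. x \<in> topspace (cube m) \<Longrightarrow> (\<And>i. i < m \<Longrightarrow> \<bar>x i - y i\<bar> < \<delta>) \<Longrightarrow> x \<in> U"
proof -
  obtain W where W: "openin (powertop_real UNIV) W" "U = W \<inter> topspace (cube m)"
    using U by (subst (asm) cube_euclidean) (auto simp: openin_subtopology euclidean_product_topology)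
  then obtain X where X: "\<forall>i. open (X i)" "y \<in> Pi\<^sub>E UNIV X" "Pi\<^sub>E UNIV X \<subseteq> W"
    using y unfolding openin_product_topology_alt by fastforce
  have "\<exists>d>0. \<forall>r. \<bar>r - y i\<bar> < d \<longrightarrow> r \<in> X i" for i
    using X(1,2) unfolding open_dist by (auto simp: dist_real_def PiE_iff)
  then obtain d where d: "\<And>i. d i > 0" "\<And>i r. \<bar>r - y i\<bar> < d i \<Longrightarrow> r \<in> X i" by metis
  define \<delta> where "\<delta> = Min (insert 1 (d ` {..<m}))"
  have \<delta>: "\<delta> > 0" "\<And>i. i < m \<Longrightarrow> \<delta> \<le> d i" using d by (auto simp: \<delta>_def)
  show ?thesis
  proof (rule that[OF \<delta>(1)])
    fix x assume x: "x \<in> topspace (cube m)" and xy: "\<And>i. i < m \<Longrightarrow> \<bar>x i - y i\<bar> < \<delta>"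
    have "x i \<in> X i" for i
    proof (cases "i < m")
      case True then show ?thesis using d(2)[of "x i" i] xy \<delta> by force
    next
      case False
      then have "x i = y i" using x y W by (auto simp: in_cube)
      then show ?thesis using d(1)[of i] d(2)[of "x i" i] by simp
    qed
    then show "x \<in> U" using X(3) W(2) x by (auto simp: PiE_iff)
  qed
qed

text \<open>Compactness is used one coordinate at a time. If the cells that are small in the coordinates from \<open>l\<close> on and
  full in the others are liftable, then subdividing the interval of coordinate \<open>l\<close> shows the same for
  \<open>Suc l\<close>; for \<open>l = 0\<close> the cells lie over sets on which \<open>p\<close> is a Serre fibration.\<close>

lemma cell_liftable_cube:
  assumes k: "k < m" and h: "continuous_map (cube m) B h"
    and loc: "\<And>b. b \<in> topspace B \<Longrightarrow> \<exists>V. openin B V \<and> b \<in> V \<and>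
      serre_fibration (subtopology E {e. p e \<in> V}) (subtopology B V) p"
  shows "cell_liftable E p m k h (\<lambda>_. 0) (\<lambda>_. 1)"
proof -
  have main: "\<exists>\<delta>>0. \<forall>a b. proper_cell m a b \<and> (\<forall>i<l. a i = 0 \<and> b i = 1) \<and>
      (\<forall>i<m. l \<le> i \<longrightarrow> y i - \<delta> < a i \<and> b i < y i + \<delta>) \<longrightarrow> cell_liftable E p m k h a b"
    if "l \<le> m" "y \<in> topspace (cube m)" for l y
    using that
  proof (induction l arbitrary: y)
    case 0
    have "h y \<in> topspace B" using continuous_map_image_subset_topspace[OF h] 0 by blast
    then obtain V where V: "openin B V" "h y \<in> V"
      "serre_fibration (subtopology E {e. p e \<in> V}) (subtopology B V) p" using loc by blast
    have "openin (cube m) {x \<in> topspace (cube m). h x \<in> V}"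
      by (rule openin_continuous_map_preimage[OF h V(1)])
    then obtain \<delta> where \<delta>: "\<delta> > 0"
      "\<And>x. x \<in> topspace (cube m) \<Longrightarrow> (\<And>i. i < m \<Longrightarrow> \<bar>x i - y i\<bar> < \<delta>) \<Longrightarrow> h x \<in> V"
      using 0 V(2) by (elim cube_neighbourhood_cell[of _ _ y]) auto
    show ?case
    proof (intro exI[of _ \<delta>] conjI allI impI; (elim conjE)?)
      fix a b assume ab: "proper_cell m a b" "\<forall>i<m. 0 \<le> i \<longrightarrow> y i - \<delta> < a i \<and> b i < y i + \<delta>"
      have "h x \<in> V" if "x \<in> cell m a b" for x
        using that ab(2) by (intro \<delta>(2)) (force simp: cell_def abs_less_iff)+
      then show "cell_liftable E p m k h a b"
        by (intro cell_liftable_local[OF ab(1) k h _ V(3)]) auto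
    qed (rule \<delta>(1))
  next
    case (Suc l)
    define P where "P c d \<longleftrightarrow> (0 \<le> c \<longrightarrow> c < d \<longrightarrow> d \<le> 1 \<longrightarrow> (\<exists>\<delta>>0. \<forall>a b. proper_cell m a b \<and> a l = c \<and> b l = d \<and>
      (\<forall>i<l. a i = 0 \<and> b i = 1) \<and> (\<forall>i<m. Suc l \<le> i \<longrightarrow> y i - \<delta> < a i \<and> b i < y i + \<delta>) \<longrightarrow>
      cell_liftable E p m k h a b))" for c d
    have "(0::real) \<le> 1" by simp
    then have "P 0 1"
    proof (induction rule: Bolzano)
      case (trans c e d)
      show ?case
      proof (cases "c < e \<and> e < d")
        case False then show ?thesis using trans by (cases "c = e") (auto simp: P_def)
      next
        case True
        show ?thesis unfolding P_def
        proof (intro impI)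
          assume cd: "0 \<le> c" "d \<le> 1"
          obtain \<delta>1 where \<delta>1: "\<delta>1 > 0" "\<And>a b. \<lbrakk>proper_cell m a b; a l = c; b l = e; \<forall>i<l. a i = 0 \<and> b i = 1;
              \<forall>i<m. Suc l \<le> i \<longrightarrow> y i - \<delta>1 < a i \<and> b i < y i + \<delta>1\<rbrakk> \<Longrightarrow> cell_liftable E p m k h a b"
            using trans(1) True cd unfolding P_def by auto
          obtain \<delta>2 where \<delta>2: "\<delta>2 > 0" "\<And>a b. \<lbrakk>proper_cell m a b; a l = e; b l = d; \<forall>i<l. a i = 0 \<and> b i = 1;
              \<forall>i<m. Suc l \<le> i \<longrightarrow> y i - \<delta>2 < a i \<and> b i < y i + \<delta>2\<rbrakk> \<Longrightarrow> cell_liftable E p m k h a b"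
            using trans(2) True cd unfolding P_def by auto
          show "\<exists>\<delta>>0. \<forall>a b. proper_cell m a b \<and> a l = c \<and> b l = d \<and>
            (\<forall>i<l. a i = 0 \<and> b i = 1) \<and> (\<forall>i<m. Suc l \<le> i \<longrightarrow> y i - \<delta> < a i \<and> b i < y i + \<delta>) \<longrightarrow>
            cell_liftable E p m k h a b"
          proof (intro exI[of _ "min \<delta>1 \<delta>2"] conjI allI impI; (elim conjE)?)
            fix a b
            assume ab: "proper_cell m a b" "a l = c" "b l = d" "\<forall>i<l. a i = 0 \<and> b i = 1"
              and near: "\<forall>i<m. Suc l \<le> i \<longrightarrow> y i - min \<delta>1 \<delta>2 < a i \<and> b i < y i + min \<delta>1 \<delta>2"
            show "cell_liftable E p m k h a b"
            proof (rule cell_liftable_split[of l _ _ e])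
              show "cell_liftable E p m k h a (b(l := e))"
                using ab near True by (intro \<delta>1(2)) (force simp: proper_cell_def)+
              show "cell_liftable E p m k h (a(l := e)) b"
                using ab near True by (intro \<delta>2(2)) (force simp: proper_cell_def)+
            qed (use ab True Suc.prems in auto)
          qed (use \<delta>1 \<delta>2 in auto)
        qed
      qed
    next
      case (local x)
      have "y(l := x) \<in> topspace (cube m)" using Suc.prems local by (auto simp: in_cube)
      then obtain \<delta> where \<delta>: "\<delta> > 0" "\<And>a b. \<lbrakk>proper_cell m a b; \<forall>i<l. a i = 0 \<and> b i = 1;
          \<forall>i<m. l \<le> i \<longrightarrow> (y(l := x)) i - \<delta> < a i \<and> b i < (y(l := x)) i + \<delta>\<rbrakk> \<Longrightarrow> cell_liftable E p m k h a b"
        using Suc.IH[of "y(l := x)"] Suc.prems by (metis Suc_leD)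
      have "P c d" if cd: "c \<le> x" "x \<le> d" "d - c < \<delta>" for c d
        unfolding P_def
      proof (intro impI exI[of _ \<delta>] conjI allI; (elim conjE)?)
        fix a b
        assume ab: "proper_cell m a b" "a l = c" "b l = d" "\<forall>i<l. a i = 0 \<and> b i = 1"
          "\<forall>i<m. Suc l \<le> i \<longrightarrow> y i - \<delta> < a i \<and> b i < y i + \<delta>"
        have "(y(l := x)) i - \<delta> < a i \<and> b i < (y(l := x)) i + \<delta>" if "i < m" "l \<le> i" for i
        proof (cases "i = l")
          case False then show ?thesis using ab(5) that by simp
        qed (use ab cd in auto)
        then show "cell_liftable E p m k h a b" using ab by (intro \<delta>(2)) auto
      qed (rule \<delta>(1))
      then show ?case using \<delta>(1) by blast
    qed
    then show ?case unfolding P_def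
      by (elim impE exE) (auto simp: less_Suc_eq all_conj_distrib imp_conjR intro!: exI)
  qed
  have "(\<lambda>_. 0) \<in> topspace (cube m)" by (simp add: in_cube)
  from main[OF order_refl this] show ?thesis by (auto simp: proper_cell_def)
qed

text \<open>A cylinder on \<open>I^n\<close> is the cell \<open>I^(n+1)\<close>, on which the lift is prescribed on the bottom face.\<close>

theorem serre_fibration_locally:
  assumes p: "continuous_map E B p"
    and loc: "\<And>b. b \<in> topspace B \<Longrightarrow> \<exists>V. openin B V \<and> b \<in> V \<and>
      serre_fibration (subtopology E {e. p e \<in> V}) (subtopology B V) p"
  shows "serre_fibration E B p"
  unfolding serre_fibration_def
proof (intro conjI p allI impI, elim conjE)
  fix n f h
  assume f: "continuous_map (cube n) E f"
    and h: "continuous_map (cylinder (cube n)) B h"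
    and hf: "\<forall>x\<in>topspace (cube n). h (x, 0) = p (f x)"
  let ?to = "\<lambda>(x, t). x(n := t) :: nat \<Rightarrow> real" and ?from = "\<lambda>x. (x(n := 0) :: nat \<Rightarrow> real, x n)"
  have hm: "continuous_map (cylinder (cube n)) (cube (Suc n)) ?to"
    "continuous_map (cube (Suc n)) (cylinder (cube n)) ?from"
    using cylinder_cube_homeomorphism[of n] by (auto simp: homeomorphic_maps_def)
  have cell: "cell (Suc n) (\<lambda>_. 0) (\<lambda>_. 1) = topspace (cube (Suc n))" by (auto simp: cell_def in_cube)
  have bot: "cell_faces (Suc n) (\<lambda>_. 0) (\<lambda>_. 1) {(n, False)} = {x \<in> topspace (cube (Suc n)). x n = 0}"
    by (auto simp: cell_faces_def cell)
  have botn: "x(n := 0) = x" "x \<in> topspace (cube n)" if "x \<in> topspace (cube (Suc n))" "x n = 0" for x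
  proof -
    have "x i = 0" if "n \<le> i" for i
      using that \<open>x n = 0\<close> \<open>x \<in> topspace (cube (Suc n))\<close> by (cases "i = n") (auto simp: in_cube)
    then show "x(n := 0) = x" "x \<in> topspace (cube n)" using that by (auto simp: in_cube)
  qed
  have L: "cell_liftable E p (Suc n) n (h \<circ> ?from) (\<lambda>_. 0) (\<lambda>_. 1)"
    by (rule cell_liftable_cube[OF _ continuous_map_compose[OF hm(2) h] loc]) auto
  have cf: "continuous_map (subtopology (cube (Suc n)) {x \<in> topspace (cube (Suc n)). x n = 0}) E f"
  proof (rule continuous_map_eq)
    have "continuous_map (cube (Suc n)) (cube n) (\<lambda>x. x(n := 0))"
      using continuous_map_compose[OF hm(2) continuous_map_fst] by (simp add: comp_def)
    from continuous_map_compose[OF this f]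
    show "continuous_map (subtopology (cube (Suc n)) {x \<in> topspace (cube (Suc n)). x n = 0}) E (f \<circ> (\<lambda>x. x(n := 0)))"
      by (rule continuous_map_from_subtopology)
  qed (use botn in auto)
  have pf: "\<forall>x\<in>{x \<in> topspace (cube (Suc n)). x n = 0}. p (f x) = (h \<circ> ?from) x"
    using botn hf by simp
  have F: "{(n, False)} \<subseteq> {..<Suc n} \<times> UNIV" "(n, False) \<in> {(n, False)}" "(n, True) \<notin> {(n, False)}" by auto
  obtain g where g: "continuous_map (cube (Suc n)) E g"
    "\<forall>x\<in>topspace (cube (Suc n)). p (g x) = (h \<circ> ?from) x" "\<forall>x\<in>{x \<in> topspace (cube (Suc n)). x n = 0}. g x = f x"
    by (rule cell_liftableE[OF L F, unfolded bot cell subtopology_topspace, OF cf pf])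
  show "\<exists>k. continuous_map (cylinder (cube n)) E k \<and>
      (\<forall>x\<in>topspace (cube n). k (x, 0) = f x) \<and>
      (\<forall>z\<in>topspace (cylinder (cube n)). p (k z) = h z)"
  proof (intro exI conjI ballI)
    show "continuous_map (cylinder (cube n)) E (g \<circ> ?to)"
      by (rule continuous_map_compose[OF hm(1) g(1)])
    show "(g \<circ> ?to) (x, 0) = f x" if "x \<in> topspace (cube n)" for x
    proof -
      have "x(n := 0) = x" "x \<in> topspace (cube (Suc n))" "x n = 0" using that by (auto simp: in_cube less_Suc_eq)
      then show ?thesis using g(3) by simp
    qed
    fix z assume z: "z \<in> topspace (cylinder (cube n))"
    obtain x t where xt: "z = (x, t)" by force
    have "x(n := t) \<in> topspace (cube (Suc n))" using z xt by (auto simp: in_cube less_Suc_eq)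
    moreover have "x(n := 0) = x" using z xt by (auto simp: in_cube)
    ultimately show "p ((g \<circ> ?to) z) = h z" using bspec[OF g(2), of "x(n := t)"] xt by simp
  qed
qed

section \<open>Groupoid arithmetic\<close>

lemma continuous_map_apply: "continuous_map X Y f \<Longrightarrow> x \<in> topspace X \<Longrightarrow> f x \<in> topspace Y"
  by (auto simp: continuous_map_def)

context topological_groupoid
begin

lemma gmul_closed: "\<lbrakk>g \<in> ar G; h \<in> ar G; src G g = tgt G h\<rbrakk> \<Longrightarrow> gmul G g h \<in> ar G"
  using continuous_map_apply[OF gmul_continuous, of "(g, h)"] by simp

lemma ginv_closed: "g \<in> ar G \<Longrightarrow> ginv G g \<in> ar G"
  using continuous_map_image_subset_topspace[OF ginv_continuous] by auto

lemma gunit_closed: "x \<in> ob G \<Longrightarrow> gunit G x \<in> ar G"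
  using continuous_map_image_subset_topspace[OF gunit_continuous] by auto

lemma tgt_closed: "g \<in> ar G \<Longrightarrow> tgt G g \<in> ob G"
  using continuous_map_image_subset_topspace[OF tgt_continuous] by auto

lemma gmul_cancel_left:
  assumes "g \<in> ar G" "h \<in> ar G" "src G g = tgt G h" shows "gmul G (ginv G g) (gmul G g h) = h"
  using assms gmul_assoc[of "ginv G g" g h] by (simp add: ginv_closed src_ginv gmul_ginv_left gmul_gunit_left)

lemma gmul_cancel_left':
  assumes "g \<in> ar G" "h \<in> ar G" "tgt G g = tgt G h" shows "gmul G g (gmul G (ginv G g) h) = h"
  using assms gmul_assoc[of g "ginv G g" h]
  by (simp add: ginv_closed src_ginv tgt_ginv gmul_ginv_right gmul_gunit_left)

lemma ginv_ginv: assumes "g \<in> ar G" shows "ginv G (ginv G g) = g"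
proof -
  have "ginv G (ginv G g) = gmul G (ginv G (ginv G g)) (gmul G (ginv G g) g)"
    using assms gmul_gunit_right[of "ginv G (ginv G g)"]
    by (simp add: gmul_ginv_left ginv_closed src_ginv tgt_ginv)
  also have "\<dots> = g" using assms by (intro gmul_cancel_left) (simp_all add: ginv_closed src_ginv)
  finally show ?thesis .
qed

lemma ginv_gunit: "x \<in> ob G \<Longrightarrow> ginv G (gunit G x) = gunit G x"
  using gmul_gunit_left[of "ginv G (gunit G x)"] gmul_ginv_right[of "gunit G x"]
  by (simp add: gunit_closed tgt_ginv src_gunit tgt_gunit ginv_closed)

lemma continuous_map_gmul:
  assumes "continuous_map X (arrs G) f" "continuous_map X (arrs G) g"
    "\<And>x. x \<in> topspace X \<Longrightarrow> src G (f x) = tgt G (g x)"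
  shows "continuous_map X (arrs G) (\<lambda>x. gmul G (f x) (g x))"
proof -
  have "continuous_map X (subtopology (prod_topology (arrs G) (arrs G)) {(g, h). src G g = tgt G h}) (\<lambda>x. (f x, g x))"
    using assms by (auto simp: continuous_map_in_subtopology continuous_map_pairedI)
  from continuous_map_compose[OF this gmul_continuous] show ?thesis by (simp add: comp_def)
qed

lemma continuous_map_ginv: "continuous_map X (arrs G) f \<Longrightarrow> continuous_map X (arrs G) (\<lambda>x. ginv G (f x))"
  using continuous_map_compose[OF _ ginv_continuous] by (simp add: comp_def)

lemma continuous_map_gunit: "continuous_map X (objs G) f \<Longrightarrow> continuous_map X (arrs G) (\<lambda>x. gunit G (f x))"
  using continuous_map_compose[OF _ gunit_continuous] by (simp add: comp_def)

lemma continuous_map_src: "continuous_map X (arrs G) f \<Longrightarrow> continuous_map X (objs G) (\<lambda>x. src G (f x))"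
  using continuous_map_compose[OF _ src_continuous] by (simp add: comp_def)

lemma continuous_map_tgt: "continuous_map X (arrs G) f \<Longrightarrow> continuous_map X (objs G) (\<lambda>x. tgt G (f x))"
  using continuous_map_compose[OF _ tgt_continuous] by (simp add: comp_def)

end

text \<open>Inversion exchanges source and target.\<close>

lemma (in serre_groupoid) tgt_serre: "serre_fibration (arrs G) (objs G) (tgt G)"
  unfolding serre_fibration_def
proof (intro conjI tgt_continuous allI impI, elim conjE)
  fix n f h
  assume f: "continuous_map (cube n) (arrs G) f"
    and h: "continuous_map (cylinder (cube n)) (objs G) h"
    and hf: "\<forall>x\<in>topspace (cube n). h (x, 0) = tgt G (f x)"
  have "\<forall>x\<in>topspace (cube n). h (x, 0) = src G (ginv G (f x))"
    using hf continuous_map_apply[OF f] by (simp add: src_ginv)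
  with continuous_map_ginv[OF f] h obtain k
    where k: "continuous_map (cylinder (cube n)) (arrs G) k"
      "\<forall>x\<in>topspace (cube n). k (x, 0) = ginv G (f x)"
      "\<forall>z\<in>topspace (cylinder (cube n)). src G (k z) = h z"
    using serre unfolding serre_fibration_def by blast
  show "\<exists>k. continuous_map (cylinder (cube n)) (arrs G) k \<and>
      (\<forall>x\<in>topspace (cube n). k (x, 0) = f x) \<and>
      (\<forall>z\<in>topspace (cylinder (cube n)). tgt G (k z) = h z)"
  proof (intro exI conjI ballI)
    show "continuous_map (cylinder (cube n)) (arrs G) (\<lambda>z. ginv G (k z))"
      by (rule continuous_map_ginv[OF k(1)])
    show "ginv G (k (x, 0)) = f x" if "x \<in> topspace (cube n)" for x
      using k(2) that continuous_map_apply[OF f] by (simp add: ginv_ginv)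
    show "tgt G (ginv G (k z)) = h z" if "z \<in> topspace (cylinder (cube n))" for z
      using k(3) that continuous_map_apply[OF k(1) that] by (simp only: tgt_ginv)
  qed
qed


section \<open>Principal bundles\<close>

text \<open>The map \<open>\<tau>\<close>, which finds the arrow from \<open>p\<close> to \<open>q\<close>, provides the continuous inverse.\<close>

lemma principal_mapI:
  assumes act: "continuous_map (act_domain G P) (total P) (\<lambda>(p, g). act P p g)"
    and \<tau>: "continuous_map (fiber_square P) (arrs G) (\<lambda>(p, q). \<tau> p q)"
    and act_\<tau>: "\<And>p q. \<lbrakk>p \<in> pts P; q \<in> pts P; proj P p = proj P q\<rbrakk> \<Longrightarrow> anchor P p = tgt G (\<tau> p q) \<and> act P p (\<tau> p q) = q"
    and \<tau>_act: "\<And>p g. \<lbrakk>p \<in> pts P; g \<in> ar G; anchor P p = tgt G g\<rbrakk> \<Longrightarrow> \<tau> p (act P p g) = g \<and> proj P (act P p g) = proj P p"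
  shows "homeomorphic_map (act_domain G P) (fiber_square P) (\<lambda>(p, g). (p, act P p g))"
proof -
  have fst1: "continuous_map (act_domain G P) (total P) fst" and fst2: "continuous_map (fiber_square P) (total P) fst"
    by (simp_all add: act_domain_def fiber_square_def continuous_map_from_subtopology continuous_map_fst)
  have "continuous_map (act_domain G P) (prod_topology (total P) (total P)) (\<lambda>z. (fst z, act P (fst z) (snd z)))"
    using act fst1 by (intro continuous_map_pairedI) (simp_all add: case_prod_unfold)
  moreover have "continuous_map (fiber_square P) (prod_topology (total P) (arrs G)) (\<lambda>z. (fst z, \<tau> (fst z) (snd z)))"
    using \<tau> fst2 by (intro continuous_map_pairedI) (simp_all add: case_prod_unfold)
  ultimately have "homeomorphic_maps (act_domain G P) (fiber_square P) (\<lambda>(p, g). (p, act P p g)) (\<lambda>(p, q). (p, \<tau> p q))"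
    using act_\<tau>[THEN conjunct1, symmetric] act_\<tau>[THEN conjunct2] \<tau>_act unfolding homeomorphic_maps_def
    by (auto simp: case_prod_unfold fiber_square_def act_domain_def continuous_map_in_subtopology)
  then show ?thesis by (auto simp: homeomorphic_map_maps)
qed

context principal_bundle
begin

lemma proj_closed: "p \<in> pts P \<Longrightarrow> proj P p \<in> topspace B"
  using proj_continuous by (rule continuous_map_apply)

lemma anchor_closed: "p \<in> pts P \<Longrightarrow> anchor P p \<in> ob G"
  using anchor_continuous by (rule continuous_map_apply)

lemma act_closed: "\<lbrakk>p \<in> pts P; g \<in> ar G; anchor P p = tgt G g\<rbrakk> \<Longrightarrow> act P p g \<in> pts P"
  using continuous_map_apply[OF act_continuous, of "(p, g)"] by (simp add: act_domain_def)

lemma act_inj: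
  assumes "p \<in> pts P" "g \<in> ar G" "h \<in> ar G" "anchor P p = tgt G g" "anchor P p = tgt G h" "act P p g = act P p h"
  shows "g = h"
  using inj_onD[OF homeomorphic_imp_injective_map[OF principal], of "(p, g)" "(p, h)"] assms
  by (simp add: act_domain_def)

lemma transporter_unique:
  assumes "p \<in> pts P" "g \<in> ar G" "anchor P p = tgt G g" "act P p g = q" shows "transporter G P p q = g"
  unfolding transporter_def using assms by (intro the_equality) (auto intro: act_inj)

lemma transporter:
  assumes "p \<in> pts P" "q \<in> pts P" "proj P p = proj P q"
  shows "transporter G P p q \<in> ar G" "anchor P p = tgt G (transporter G P p q)"
    "act P p (transporter G P p q) = q" "src G (transporter G P p q) = anchor P q"
proof -
  have "(p, q) \<in> topspace (fiber_square P)" using assms by (simp add: fiber_square_def)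
  then have "(p, q) \<in> (\<lambda>(p, g). (p, act P p g)) ` topspace (act_domain G P)"
    using homeomorphic_imp_surjective_map[OF principal] by simp
  then obtain g where g: "g \<in> ar G" "anchor P p = tgt G g" "act P p g = q"
    by (auto simp: act_domain_def)
  then have "transporter G P p q = g" using assms by (intro transporter_unique) auto
  with g show "transporter G P p q \<in> ar G" "anchor P p = tgt G (transporter G P p q)"
    "act P p (transporter G P p q) = q" "src G (transporter G P p q) = anchor P q"
    using anchor_act assms by auto
qed

lemma continuous_map_act:
  assumes "continuous_map X (total P) f" "continuous_map X (arrs G) g"
    "\<And>x. x \<in> topspace X \<Longrightarrow> anchor P (f x) = tgt G (g x)"
  shows "continuous_map X (total P) (\<lambda>x. act P (f x) (g x))"
proof -
  have "continuous_map X (act_domain G P) (\<lambda>x. (f x, g x))"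
    unfolding act_domain_def using assms by (auto simp: continuous_map_in_subtopology continuous_map_pairedI)
  from continuous_map_compose[OF this act_continuous] show ?thesis by (simp add: comp_def)
qed

lemma continuous_map_transporter:
  assumes "continuous_map X (total P) f" "continuous_map X (total P) g"
    "\<And>x. x \<in> topspace X \<Longrightarrow> proj P (f x) = proj P (g x)"
  shows "continuous_map X (arrs G) (\<lambda>x. transporter G P (f x) (g x))"
proof -
  obtain m where m: "homeomorphic_maps (act_domain G P) (fiber_square P) (\<lambda>(p, g). (p, act P p g)) m"
    using principal homeomorphic_map_maps by blast
  have "continuous_map X (fiber_square P) (\<lambda>x. (f x, g x))"
    unfolding fiber_square_def using assms by (auto simp: continuous_map_in_subtopology continuous_map_pairedI)
  moreover have "continuous_map (fiber_square P) (prod_topology (total P) (arrs G)) m"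
    using m by (simp add: homeomorphic_maps_def act_domain_def continuous_map_in_subtopology)
  ultimately have c: "continuous_map X (arrs G) (\<lambda>x. snd (m (f x, g x)))"
    using continuous_map_compose[OF continuous_map_compose continuous_map_snd] by (fastforce simp: comp_def)
  have "snd (m (f x, g x)) = transporter G P (f x) (g x)" if x: "x \<in> topspace X" for x
  proof -
    have "(f x, g x) \<in> topspace (fiber_square P)"
      using assms x continuous_map_apply[OF assms(1) x] continuous_map_apply[OF assms(2) x]
      by (simp add: fiber_square_def)
    then have "m (f x, g x) \<in> topspace (act_domain G P)"
      "(\<lambda>(p, g). (p, act P p g)) (m (f x, g x)) = (f x, g x)"
      using m by (auto simp: homeomorphic_maps_def dest: continuous_map_apply)
    then show ?thesis
      by (cases "m (f x, g x)") (auto simp: act_domain_def intro!: transporter_unique[symmetric])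
  qed
  then show ?thesis using c by (rule continuous_map_eq[rotated])
qed

end

text \<open>Over the domain of a local section \<open>s\<close> the points of the bundle are the \<open>s b g\<close> with \<open>t g = \<epsilon> (s b)\<close>,
  so that a lift to the bundle is the same as a lift along the target map.\<close>

theorem principal_bundle_serre:
  assumes "serre_groupoid G" "principal_bundle G B P"
  shows "serre_fibration (total P) B (proj P)"
proof (rule serre_fibration_locally)
  interpret serre_groupoid G by fact
  interpret principal_bundle G B P by fact
  show "continuous_map (total P) B (proj P)" by (rule proj_continuous)
  fix b assume b: "b \<in> topspace B"
  obtain V s where V: "openin B V" "b \<in> V" and s: "continuous_map (subtopology B V) (total P) s" "\<forall>x\<in>V. proj P (s x) = x"
    using local_sections[OF b] by blast
  have "serre_fibration (subtopology (total P) {e. proj P e \<in> V}) (subtopology B V) (proj P)"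
    unfolding serre_fibration_def
  proof (intro conjI allI impI, goal_cases)
    case 1
    show ?case using proj_continuous
      by (auto simp: continuous_map_in_subtopology intro: continuous_map_from_subtopology)
  next
    case (2 n f h)
    then have f: "continuous_map (cube n) (total P) f"
      and h: "continuous_map (cylinder (cube n)) (subtopology B V) h"
      and hf: "\<forall>x\<in>topspace (cube n). h (x, 0) = proj P (f x)"
      by (auto simp: continuous_map_in_subtopology)
    have hV: "h z \<in> V" if "z \<in> topspace (cylinder (cube n))" for z
      using continuous_map_apply[OF h that] by simp
    have sh: "continuous_map (cylinder (cube n)) (total P) (s \<circ> h)"
      by (rule continuous_map_compose[OF h s(1)])
    have sh0: "continuous_map (cube n) (total P) (\<lambda>x. s (h (x, 0)))"
      using continuous_map_compose[OF _ sh, of "cube n" "\<lambda>x. (x, 0)"] by (simp add: continuous_map_pairedI comp_def)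
    have pf: "proj P (s (h (x, 0))) = proj P (f x)" if "x \<in> topspace (cube n)" for x
      using hV[of "(x, 0)"] s(2) hf that by simp
    have c1: "continuous_map (cube n) (arrs G) (\<lambda>x. transporter G P (s (h (x, 0))) (f x))"
      by (rule continuous_map_transporter[OF sh0 f pf])
    have c2: "continuous_map (cylinder (cube n)) (objs G) (\<lambda>z. anchor P (s (h z)))"
      using continuous_map_compose[OF sh anchor_continuous] by (simp add: comp_def)
    have c3: "\<forall>x\<in>topspace (cube n). anchor P (s (h (x, 0))) = tgt G (transporter G P (s (h (x, 0))) (f x))"
      using pf continuous_map_apply[OF sh0] continuous_map_apply[OF f] transporter(2) by blast
    obtain u where u: "continuous_map (cylinder (cube n)) (arrs G) u"
      "\<forall>x\<in>topspace (cube n). u (x, 0) = transporter G P (s (h (x, 0))) (f x)"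
      "\<forall>z\<in>topspace (cylinder (cube n)). tgt G (u z) = anchor P (s (h z))"
      using tgt_serre c1 c2 c3 unfolding serre_fibration_def by blast
    define k where "k z = act P (s (h z)) (u z)" for z
    have k: "continuous_map (cylinder (cube n)) (total P) k"
      unfolding k_def using sh u by (intro continuous_map_act) (auto simp: comp_def)
    have pk: "proj P (k z) = h z" if z: "z \<in> topspace (cylinder (cube n))" for z
      unfolding k_def
      using proj_act[of "s (h z)" "u z"] continuous_map_apply[OF sh z] continuous_map_apply[OF u(1) z] u(3) s(2) hV[OF z] z
      by (metis comp_apply)
    have k0: "k (x, 0) = f x" if "x \<in> topspace (cube n)" for x
      unfolding k_def using u(2) that transporter(3)[OF _ _ pf[OF that]]
        continuous_map_apply[OF sh0 that] continuous_map_apply[OF f that] by simp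
    show ?case
      using k pk k0 hV by (intro exI[of _ k]) (auto simp: continuous_map_in_subtopology)
  qed
  then show "\<exists>V. openin B V \<and> b \<in> V \<and>
      serre_fibration (subtopology (total P) {e. proj P e \<in> V}) (subtopology B V) (proj P)"
    using V by blast
qed

lemma (in principal_pair_bundle) sect_closed: "x \<in> A \<Longrightarrow> sect P x \<in> pts P"
  using continuous_map_apply[OF sect_continuous] subspace by auto


section \<open>Isomorphisms of bundles\<close>

lemma bundle_iso_mapD:
  assumes "bundle_iso_map G A P Q \<phi>" "p \<in> pts P"
  shows "\<phi> p \<in> pts Q" "proj Q (\<phi> p) = proj P p" "anchor Q (\<phi> p) = anchor P p"
    "\<lbrakk>g \<in> ar G; anchor P p = tgt G g\<rbrakk> \<Longrightarrow> act Q (\<phi> p) g = \<phi> (act P p g)"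
  using assms by (auto simp: bundle_iso_map_def dest: homeomorphic_imp_surjective_map)

lemma bundle_iso_map_sect: "bundle_iso_map G A P Q \<phi> \<Longrightarrow> x \<in> A \<Longrightarrow> \<phi> (sect P x) = sect Q x"
  by (simp add: bundle_iso_map_def)

lemma bundle_iso_map_compose:
  assumes "bundle_iso_map G A P Q \<phi>" "bundle_iso_map G A Q R \<psi>"
  shows "bundle_iso_map G A P R (\<psi> \<circ> \<phi>)"
proof -
  have "\<phi> p \<in> pts Q" if "p \<in> pts P" for p
    using assms(1) that by (auto simp: bundle_iso_map_def dest: homeomorphic_imp_surjective_map)
  then show ?thesis
    using assms by (auto simp: bundle_iso_map_def intro: homeomorphic_map_compose)
qed

lemma bundle_iso_trans: "bundle_iso G A P Q \<Longrightarrow> bundle_iso G A Q R \<Longrightarrow> bundle_iso G A P R"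
  unfolding bundle_iso_def using bundle_iso_map_compose by blast

lemma bundle_iso_refl: "bundle_iso G A P P"
  unfolding bundle_iso_def bundle_iso_map_def
  by (rule exI[of _ id]) (simp add: homeomorphic_map_id[unfolded id_def] id_def)

text \<open>The closure conditions hold for pair bundles and also for slices of a pair bundle over a cylinder.\<close>

lemma bundle_iso_sym:
  assumes iso: "bundle_iso G A P Q"
    and act_closed: "\<And>p g. \<lbrakk>p \<in> pts P; g \<in> ar G; anchor P p = tgt G g\<rbrakk> \<Longrightarrow> act P p g \<in> pts P"
    and sect_closed: "\<And>x. x \<in> A \<Longrightarrow> sect P x \<in> pts P"
  shows "bundle_iso G A Q P"
proof -
  obtain \<phi> where \<phi>: "bundle_iso_map G A P Q \<phi>" using iso by (auto simp: bundle_iso_def)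
  then obtain \<psi> where \<psi>: "homeomorphic_maps (total P) (total Q) \<phi> \<psi>"
    by (auto simp: bundle_iso_map_def homeomorphic_map_maps)
  then have h: "homeomorphic_map (total Q) (total P) \<psi>"
    by (meson homeomorphic_map_maps homeomorphic_maps_sym)
  have \<phi>\<psi>: "\<phi> (\<psi> q) = q" "\<psi> q \<in> pts P" if "q \<in> pts Q" for q
    using \<psi> that by (auto simp: homeomorphic_maps_def dest: continuous_map_apply)
  have \<psi>\<phi>: "\<psi> (\<phi> p) = p" if "p \<in> pts P" for p using \<psi> that by (auto simp: homeomorphic_maps_def)
  have "bundle_iso_map G A Q P \<psi>"
    unfolding bundle_iso_map_def
  proof (intro conjI ballI impI h)
    fix q assume q: "q \<in> pts Q"
    show "proj P (\<psi> q) = proj Q q" "anchor P (\<psi> q) = anchor Q q"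
      using bundle_iso_mapD(2,3)[OF \<phi> \<phi>\<psi>(2)[OF q]] \<phi>\<psi>(1)[OF q] by simp_all
    fix g assume g: "g \<in> ar G" "anchor Q q = tgt G g"
    have a: "anchor P (\<psi> q) = tgt G g" using g \<open>anchor P (\<psi> q) = anchor Q q\<close> by simp
    have "\<phi> (act P (\<psi> q) g) = act Q q g" using bundle_iso_mapD(4)[OF \<phi> \<phi>\<psi>(2)[OF q] g(1) a] \<phi>\<psi>(1)[OF q] by simp
    then show "\<psi> (act Q q g) = act P (\<psi> q) g" using \<psi>\<phi> act_closed[OF \<phi>\<psi>(2)[OF q] g(1) a] by metis
  next
    fix x assume "x \<in> A"
    then show "\<psi> (sect Q x) = sect P x" using bundle_iso_map_sect[OF \<phi>] \<psi>\<phi> sect_closed by metis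
  qed
  then show ?thesis by (auto simp: bundle_iso_def)
qed

text \<open>On the points of \<open>Q\<close> all structure maps of \<open>Q\<close> are determined by those of \<open>P\<close> and the isomorphism; outside
  they are arbitrary, hence the guarded rewriting below.\<close>

lemma principal_pair_bundle_iso:
  assumes "principal_pair_bundle G a0 B A P" "bundle_iso G A P Q"
  shows "principal_pair_bundle G a0 B A Q"
proof -
  interpret principal_pair_bundle G a0 B A P by fact
  obtain \<phi> where \<phi>: "bundle_iso_map G A P Q \<phi>" using assms(2) by (auto simp: bundle_iso_def)
  then obtain \<psi> where \<psi>: "homeomorphic_maps (total P) (total Q) \<phi> \<psi>"
    by (auto simp: bundle_iso_map_def homeomorphic_map_maps)
  then have c\<phi>: "continuous_map (total P) (total Q) \<phi>" and c\<psi>: "continuous_map (total Q) (total P) \<psi>"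
    by (simp_all add: homeomorphic_maps_def)
  have \<phi>\<psi>: "\<phi> (\<psi> q) = q" "\<psi> q \<in> pts P" if "q \<in> pts Q" for q
    using \<psi> that by (auto simp: homeomorphic_maps_def dest: continuous_map_apply)
  have \<psi>\<phi>: "\<psi> (\<phi> p) = p" "\<phi> p \<in> pts Q" if "p \<in> pts P" for p
    using \<psi> that by (auto simp: homeomorphic_maps_def dest: continuous_map_apply)
  have projQ: "proj Q q = proj P (\<psi> q)" and anchorQ: "anchor Q q = anchor P (\<psi> q)" if "q \<in> pts Q" for q
    using bundle_iso_mapD(2,3)[OF \<phi> \<phi>\<psi>(2)[OF that]] \<phi>\<psi>(1)[OF that] by simp_all
  have actQ: "act Q q g = \<phi> (act P (\<psi> q) g)" if "q \<in> pts Q" "g \<in> ar G" "anchor Q q = tgt G g" for q g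
    using bundle_iso_mapD(4)[OF \<phi> \<phi>\<psi>(2)[OF that(1)] that(2)] \<phi>\<psi>(1)[OF that(1)] anchorQ that by simp
  have sectQ: "sect Q x = \<phi> (sect P x)" if "x \<in> A" for x using \<phi> that by (simp add: bundle_iso_map_def)
  have actpts: "act P (\<psi> q) g \<in> pts P" if "q \<in> pts Q" "g \<in> ar G" "anchor Q q = tgt G g" for q g
    using act_closed[OF \<phi>\<psi>(2)] anchorQ that by metis
  have fst: "continuous_map (act_domain G Q) (total Q) fst" and snd: "continuous_map (act_domain G Q) (arrs G) snd"
    and fst2: "continuous_map (fiber_square Q) (total Q) fst" and snd2: "continuous_map (fiber_square Q) (total Q) snd"
    by (simp_all add: act_domain_def fiber_square_def continuous_map_from_subtopology continuous_map_fst continuous_map_snd)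
  have "continuous_map (act_domain G Q) (total P) (\<lambda>z. act P (\<psi> (fst z)) (snd z))"
    using continuous_map_compose[OF fst c\<psi>] snd anchorQ
    by (intro continuous_map_act) (auto simp: comp_def act_domain_def)
  from continuous_map_compose[OF this c\<phi>]
  have c_act: "continuous_map (act_domain G Q) (total Q) (\<lambda>(q, g). act Q q g)"
    by (rule continuous_map_eq) (auto simp: act_domain_def actQ)
  have c_tr: "continuous_map (fiber_square Q) (arrs G) (\<lambda>(p, q). transporter G P (\<psi> p) (\<psi> q))"
    using continuous_map_compose[OF fst2 c\<psi>] continuous_map_compose[OF snd2 c\<psi>] projQ
    unfolding case_prod_unfold by (intro continuous_map_transporter) (auto simp: comp_def fiber_square_def)
  show ?thesis
  proof
    show "continuous_map (total Q) B (proj Q)"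
      using continuous_map_compose[OF c\<psi> proj_continuous] by (rule continuous_map_eq) (simp add: projQ)
    show "continuous_map (total Q) (objs G) (anchor Q)"
      using continuous_map_compose[OF c\<psi> anchor_continuous] by (rule continuous_map_eq) (simp add: anchorQ)
    show "continuous_map (act_domain G Q) (total Q) (\<lambda>(q, g). act Q q g)" by (rule c_act)
    show "homeomorphic_map (act_domain G Q) (fiber_square Q) (\<lambda>(q, g). (q, act Q q g))"
    proof (rule principal_mapI[OF c_act c_tr])
      fix p q assume pq: "p \<in> pts Q" "q \<in> pts Q" "proj Q p = proj Q q"
      then have t: "\<psi> p \<in> pts P" "\<psi> q \<in> pts P" "proj P (\<psi> p) = proj P (\<psi> q)" using \<phi>\<psi> projQ by auto
      show "anchor Q p = tgt G (transporter G P (\<psi> p) (\<psi> q)) \<and> act Q p (transporter G P (\<psi> p) (\<psi> q)) = q"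
        using transporter[OF t] pq anchorQ actQ \<phi>\<psi> by metis
    next
      fix p g assume p: "p \<in> pts Q" "g \<in> ar G" "anchor Q p = tgt G g"
      then have "\<psi> (act Q p g) = act P (\<psi> p) g" using actQ \<psi>\<phi> actpts by metis
      then show "transporter G P (\<psi> p) (\<psi> (act Q p g)) = g \<and> proj Q (act Q p g) = proj Q p"
        using p actQ \<psi>\<phi> actpts \<phi>\<psi> anchorQ projQ proj_act transporter_unique by metis
    qed
    show "a0 \<in> ob G" "A \<subseteq> topspace B" by (rule base_object subspace)+
    show "continuous_map (subtopology B A) (total Q) (sect Q)"
      using continuous_map_compose[OF sect_continuous c\<phi>] by (rule continuous_map_eq) (simp add: sectQ)
    fix b assume b: "b \<in> topspace B"
    from local_extensions[OF b] obtain V s where V: "openin B V" "b \<in> V"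
      and s: "continuous_map (subtopology B V) (total P) s" "\<forall>x\<in>V. proj P (s x) = x"
        "\<forall>x\<in>V \<inter> A. s x = sect P x" by blast
    have sV: "s x \<in> pts P" if "x \<in> V" for x
      using continuous_map_apply[OF s(1)] that openin_subset[OF V(1)] by auto
    show "\<exists>V s. openin B V \<and> b \<in> V \<and> continuous_map (subtopology B V) (total Q) s \<and>
      (\<forall>x\<in>V. proj Q (s x) = x) \<and> (\<forall>x\<in>V \<inter> A. s x = sect Q x)"
      using V s sV by (intro exI[of _ V] exI[of _ "\<phi> \<circ> s"])
        (auto simp: projQ \<psi>\<phi> sectQ intro: continuous_map_compose[OF _ c\<phi>])
    then show "\<exists>V s. openin B V \<and> b \<in> V \<and> continuous_map (subtopology B V) (total Q) s \<and>
      (\<forall>x\<in>V. proj Q (s x) = x)" by blast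
  next
    fix q g assume q: "q \<in> pts Q" "g \<in> ar G" "anchor Q q = tgt G g"
    then have p: "\<psi> q \<in> pts P" "g \<in> ar G" "anchor P (\<psi> q) = tgt G g" using \<phi>\<psi> anchorQ by auto
    have \<psi>act: "\<psi> (act Q q g) = act P (\<psi> q) g" and pt: "act Q q g \<in> pts Q"
      using actQ[OF q] \<psi>\<phi> act_closed[OF p] by auto
    show "anchor Q (act Q q g) = src G g" "proj Q (act Q q g) = proj Q q"
      using \<psi>act anchorQ[OF pt] projQ[OF pt] projQ[OF q(1)] anchor_act[OF p] proj_act[OF p] by auto
    fix h assume h: "h \<in> ar G" "src G g = tgt G h"
    have "act Q (act Q q g) h = \<phi> (act P (act P (\<psi> q) g) h)"
      using actQ[OF pt h(1)] h \<open>anchor Q (act Q q g) = src G g\<close> \<psi>act by simp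
    also have "\<dots> = \<phi> (act P (\<psi> q) (gmul G g h))" using act_act[OF p(1,2) h(1) p(3) h(2)] by simp
    also have "\<dots> = act Q q (gmul G g h)"
      using q h gmul_closed[OF q(2) h] tgt_gmul[OF q(2) h] by (subst actQ) auto
    finally show "act Q (act Q q g) h = act Q q (gmul G g h)" .
  next
    fix q assume q: "q \<in> pts Q"
    then have "act P (\<psi> q) (gunit G (anchor P (\<psi> q))) = \<psi> q" using \<phi>\<psi> act_gunit by blast
    moreover have "gunit G (anchor Q q) \<in> ar G" "anchor Q q = tgt G (gunit G (anchor Q q))"
      using q anchorQ anchor_closed \<phi>\<psi> by (auto simp: gunit_closed tgt_gunit)
    ultimately show "act Q q (gunit G (anchor Q q)) = q" using actQ[OF q] anchorQ[OF q] \<phi>\<psi>[OF q] by simp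
  next
    fix x assume x: "x \<in> A"
    then show "proj Q (sect Q x) = x" "anchor Q (sect Q x) = a0"
      using sect_closed[OF x] proj_sect[OF x] anchor_sect[OF x] by (simp_all add: sectQ projQ anchorQ \<psi>\<phi>)
  qed
qed

section \<open>Trivialised bundles\<close>

text \<open>A bundle with a global section \<open>\<tau>\<close> is described by \<open>f = \<epsilon> \<tau>\<close>, and its section \<open>\<sigma>\<close> over \<open>A\<close> by the
  function \<open>\<gamma>\<close> with \<open>\<sigma> = \<tau> \<gamma>\<close>.\<close>

definition section_datum ::
    "('o, 'a) groupoid \<Rightarrow> 'o \<Rightarrow> 'b topology \<Rightarrow> 'b set \<Rightarrow> ('b \<Rightarrow> 'o) \<Rightarrow> ('b \<Rightarrow> 'a) \<Rightarrow> bool" where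
  "section_datum G a0 B A f \<gamma> \<longleftrightarrow> A \<subseteq> topspace B \<and> continuous_map B (objs G) f \<and>
     continuous_map (subtopology B A) (arrs G) \<gamma> \<and> (\<forall>x\<in>A. tgt G (\<gamma> x) = f x \<and> src G (\<gamma> x) = a0)"

definition datum_bundle ::
    "('o, 'a) groupoid \<Rightarrow> 'b topology \<Rightarrow> ('b \<Rightarrow> 'o) \<Rightarrow> ('b \<Rightarrow> 'a) \<Rightarrow> ('b, 'o, 'a, 'b \<times> 'a) gbundle" where
  "datum_bundle G B f \<gamma> = (pullback_unit_bundle G B f)\<lparr>sect := \<lambda>b. (b, \<gamma> b)\<rparr>"

lemma datum_bundle_simps:
  "total (datum_bundle G B f \<gamma>) = subtopology (prod_topology B (arrs G)) {(b, g). f b = tgt G g}"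
  "proj (datum_bundle G B f \<gamma>) = fst"
  "anchor (datum_bundle G B f \<gamma>) = (\<lambda>(b, g). src G g)"
  "act (datum_bundle G B f \<gamma>) = (\<lambda>(b, g) h. (b, gmul G g h))"
  "sect (datum_bundle G B f \<gamma>) = (\<lambda>b. (b, \<gamma> b))"
  by (simp_all add: datum_bundle_def pullback_unit_bundle_def)

lemma datum_bundle_pts:
  "p \<in> pts (datum_bundle G B f \<gamma>) \<longleftrightarrow> fst p \<in> topspace B \<and> snd p \<in> ar G \<and> f (fst p) = tgt G (snd p)"
  by (cases p) (simp add: datum_bundle_simps)

lemma pullback_unit_bundle_datum:
  "pullback_unit_bundle G B f = datum_bundle G B f (\<lambda>b. gunit G (f b))"
  by (simp add: datum_bundle_def pullback_unit_bundle_def)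

lemma section_datumD:
  assumes "section_datum G a0 B A f \<gamma>"
  shows "A \<subseteq> topspace B" "continuous_map B (objs G) f" "continuous_map (subtopology B A) (arrs G) \<gamma>"
    "x \<in> A \<Longrightarrow> tgt G (\<gamma> x) = f x" "x \<in> A \<Longrightarrow> src G (\<gamma> x) = a0" "x \<in> A \<Longrightarrow> \<gamma> x \<in> ar G"
  using assms continuous_map_apply[of "subtopology B A" "arrs G" \<gamma> x] by (auto simp: section_datum_def)

text \<open>For a Serre groupoid this makes every section over \<open>A\<close> of a trivialised bundle extend locally. The boundary of a
  cube has the property, because near each point it is contained in a union of all faces but one. The case
  \<open>A' = {}\<close> is for \<open>I^0\<close>, whose boundary is empty.\<close>

definition locally_anodyne :: "'b topology \<Rightarrow> 'b set \<Rightarrow> bool" where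
  "locally_anodyne B A \<longleftrightarrow> A \<subseteq> topspace B \<and> (\<forall>b\<in>topspace B. \<exists>V A'. openin B V \<and> b \<in> V \<and>
     V \<inter> A \<subseteq> A' \<and> A' \<subseteq> A \<and> (A' = {} \<or> anodyne B A'))"

lemma cube_boundary_0: "cube_boundary 0 = {}"
  by (simp add: cube_boundary_def)

lemma cube_minus_face:
  assumes "0 < n" "b \<in> topspace (cube n)"
  obtains e where "e \<in> {0, 1}" "b \<notin> faces n {(0, e)}"
    "(topspace (cube n) - faces n {(0, e)}) \<inter> cube_boundary n \<subseteq> faces n ({..<n} \<times> {0, 1} - {(0, e)})"
proof (rule that[of "if b 0 = 0 then 1 else 0"])
  show "(topspace (cube n) - faces n {(0, if b 0 = 0 then 1 else 0)}) \<inter> cube_boundary n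
      \<subseteq> faces n ({..<n} \<times> {0, 1} - {(0, if b 0 = 0 then 1 else 0)})"
    unfolding cube_boundary_faces faces_def by blast
qed (auto simp: faces_def)

lemma locally_anodyne_cube: "locally_anodyne (cube n) (cube_boundary n)"
  unfolding locally_anodyne_def
proof (intro conjI ballI cube_boundary_subset)
  fix b assume b: "b \<in> topspace (cube n)"
  show "\<exists>V A'. openin (cube n) V \<and> b \<in> V \<and> V \<inter> cube_boundary n \<subseteq> A' \<and> A' \<subseteq> cube_boundary n \<and>
      (A' = {} \<or> anodyne (cube n) A')"
  proof (cases "n = 0")
    case True
    then show ?thesis using b by (intro exI[of _ "topspace (cube n)"] exI[of _ "{}"]) (simp add: cube_boundary_0)
  next
    case False
    then obtain e where e: "e \<in> {0, 1}" "b \<notin> faces n {(0, e)}"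
      "(topspace (cube n) - faces n {(0, e)}) \<inter> cube_boundary n \<subseteq> faces n ({..<n} \<times> {0, 1} - {(0, e)})"
      using cube_minus_face[OF _ b] by blast
    have "anodyne (cube n) (faces n ({..<n} \<times> {0, 1} - {(0, e)}))"
      using e False by (intro anodyne_faces[of _ _ 0 "1 - e"]) auto
    moreover have "openin (cube n) (topspace (cube n) - faces n {(0, e)})"
      by (intro openin_diff closedin_faces) auto
    moreover have "faces n ({..<n} \<times> {0, 1} - {(0, e)}) \<subseteq> cube_boundary n"
      unfolding cube_boundary_faces by (rule faces_mono) blast
    ultimately show ?thesis using b e(2,3) by blast
  qed
qed

lemma locally_anodyne_cylinder:
  "locally_anodyne (cylinder (cube n)) (cube_boundary n \<times> {0..1})"
  unfolding locally_anodyne_def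
proof (intro conjI ballI)
  show "cube_boundary n \<times> {0..1} \<subseteq> topspace (cylinder (cube n))"
    using cube_boundary_subset[of n] by auto
  fix z assume z: "z \<in> topspace (cylinder (cube n))"
  then obtain b t where b: "z = (b, t)" "b \<in> topspace (cube n)" "t \<in> {0..1}" by auto
  show "\<exists>V A'. openin (cylinder (cube n)) V \<and> z \<in> V \<and> V \<inter> cube_boundary n \<times> {0..1} \<subseteq> A' \<and>
      A' \<subseteq> cube_boundary n \<times> {0..1} \<and> (A' = {} \<or> anodyne (cylinder (cube n)) A')"
  proof (cases "n = 0")
    case True
    then show ?thesis using z
      by (intro exI[of _ "topspace (cylinder (cube n))"] exI[of _ "{}"])
        (auto simp: cube_boundary_0 simp del: topspace_prod_topology)
  next
    case False
    then obtain e where e: "e \<in> {0, 1}" "b \<notin> faces n {(0, e)}"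
      "(topspace (cube n) - faces n {(0, e)}) \<inter> cube_boundary n \<subseteq> faces n ({..<n} \<times> {0, 1} - {(0, e)})"
      using cube_minus_face[OF _ b(2)] by blast
    have "anodyne (cylinder (cube n))
        (topspace (cube n) \<times> {} \<union> faces n ({..<n} \<times> {0, 1} - {(0, e)}) \<times> {0..1})"
      using e False by (intro anodyne_cylinder[of _ _ _ 0 "1 - e"]) auto
    moreover have "openin (cylinder (cube n)) ((topspace (cube n) - faces n {(0, e)}) \<times> {0..1})"
    proof -
      have "openin unit_interval {0..1}" using openin_topspace[of unit_interval] by simp
      then show ?thesis unfolding openin_prod_Times_iff by (auto intro!: openin_diff closedin_faces)
    qed
    moreover have "faces n ({..<n} \<times> {0, 1} - {(0, e)}) \<times> {0..1} \<subseteq> cube_boundary n \<times> {0..1}"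
      unfolding cube_boundary_faces by (intro Sigma_mono faces_mono) auto
    moreover have "(topspace (cube n) - faces n {(0, e)}) \<times> {0..1} \<inter> cube_boundary n \<times> {0..1}
        \<subseteq> faces n ({..<n} \<times> {0, 1} - {(0, e)}) \<times> {0..1}"
      using e(3) unfolding Times_Int_Times by (intro Sigma_mono) auto
    moreover have "z \<in> (topspace (cube n) - faces n {(0, e)}) \<times> {0..1}" using b e(2) by simp
    ultimately show ?thesis unfolding Sigma_empty2 Un_empty_left by blast
  qed
qed

context pointed_serre_groupoid
begin

text \<open>The local extensions of the section are lifts of \<open>f\<close> along the target map that extend \<open>\<gamma>\<close>.\<close>

lemma datum_bundle_principal:
  assumes loc: "locally_anodyne B A" and datum: "section_datum G a0 B A f \<gamma>"
  shows "principal_pair_bundle G a0 B A (datum_bundle G B f \<gamma>)"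
proof -
  note D = section_datumD[OF datum]
  let ?P = "datum_bundle G B f \<gamma>"
  have cfst: "continuous_map (total ?P) B fst" and csnd: "continuous_map (total ?P) (arrs G) snd"
    by (simp_all add: datum_bundle_simps continuous_map_from_subtopology continuous_map_fst continuous_map_snd)
  have into: "continuous_map X (total ?P) (\<lambda>x. (b x, g x))"
    if "continuous_map X B b" "continuous_map X (arrs G) g" "\<And>x. x \<in> topspace X \<Longrightarrow> f (b x) = tgt G (g x)"
    for X :: "'z topology" and b g
    using that by (auto simp: datum_bundle_simps continuous_map_in_subtopology continuous_map_pairedI)
  have cda: "continuous_map (act_domain G ?P) (total ?P) fst" "continuous_map (act_domain G ?P) (arrs G) snd"
    "continuous_map (fiber_square ?P) (total ?P) fst" "continuous_map (fiber_square ?P) (total ?P) snd"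
    by (simp_all add: act_domain_def fiber_square_def continuous_map_from_subtopology continuous_map_fst continuous_map_snd)
  have c1: "continuous_map (act_domain G ?P) B (\<lambda>z. fst (fst z))"
    "continuous_map (act_domain G ?P) (arrs G) (\<lambda>z. snd (fst z))"
    "continuous_map (fiber_square ?P) (arrs G) (\<lambda>z. snd (fst z))"
    "continuous_map (fiber_square ?P) (arrs G) (\<lambda>z. snd (snd z))"
    using continuous_map_compose[OF cda(1) cfst] continuous_map_compose[OF cda(1) csnd]
      continuous_map_compose[OF cda(3) csnd] continuous_map_compose[OF cda(4) csnd] by (simp_all add: comp_def)
  have "continuous_map (act_domain G ?P) (total ?P) (\<lambda>z. (fst (fst z), gmul G (snd (fst z)) (snd z)))"
    using c1 cda by (intro into continuous_map_gmul)
      (auto simp: act_domain_def datum_bundle_pts datum_bundle_simps tgt_gmul)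
  then have c_act: "continuous_map (act_domain G ?P) (total ?P) (\<lambda>(p, g). act ?P p g)"
    by (simp add: datum_bundle_simps(4) case_prod_unfold)
  have "continuous_map (fiber_square ?P) (arrs G) (\<lambda>z. gmul G (ginv G (snd (fst z))) (snd (snd z)))"
    using c1 cda by (intro continuous_map_gmul continuous_map_ginv)
      (auto simp: fiber_square_def datum_bundle_simps src_ginv)
  then have c_tr: "continuous_map (fiber_square ?P) (arrs G) (\<lambda>(p, q). gmul G (ginv G (snd p)) (snd q))"
    by (simp add: case_prod_unfold)
  show ?thesis
  proof
    show "continuous_map (total ?P) B (proj ?P)" using cfst by (simp add: datum_bundle_simps)
    show "continuous_map (total ?P) (objs G) (anchor ?P)"
      using continuous_map_src[OF csnd] by (simp add: datum_bundle_simps case_prod_unfold)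
    show "continuous_map (act_domain G ?P) (total ?P) (\<lambda>(p, g). act ?P p g)" by (rule c_act)
    show "homeomorphic_map (act_domain G ?P) (fiber_square ?P) (\<lambda>(p, g). (p, act ?P p g))"
    proof (rule principal_mapI[OF c_act c_tr])
      fix p q assume "p \<in> pts ?P" "q \<in> pts ?P" "proj ?P p = proj ?P q"
      then show "anchor ?P p = tgt G (gmul G (ginv G (snd p)) (snd q)) \<and> act ?P p (gmul G (ginv G (snd p)) (snd q)) = q"
        by (cases p; cases q) (auto simp: datum_bundle_simps tgt_gmul src_ginv tgt_ginv ginv_closed gmul_cancel_left')
    next
      fix p g assume "p \<in> pts ?P" "g \<in> ar G" "anchor ?P p = tgt G g"
      then show "gmul G (ginv G (snd p)) (snd (act ?P p g)) = g \<and> proj ?P (act ?P p g) = proj ?P p"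
        by (cases p) (auto simp: datum_bundle_simps gmul_cancel_left)
    qed
    show "a0 \<in> ob G" "A \<subseteq> topspace B" by (rule base_in D(1))+
    show "continuous_map (subtopology B A) (total ?P) (sect ?P)"
      unfolding datum_bundle_simps(5) using D by (intro into) (auto simp: continuous_map_from_subtopology)
    fix b assume b: "b \<in> topspace B"
    obtain V A' where V: "openin B V" "b \<in> V" and A': "V \<inter> A \<subseteq> A'" "A' \<subseteq> A" "A' = {} \<or> anodyne B A'"
      using loc b unfolding locally_anodyne_def by blast
    have "\<exists>k. continuous_map B (arrs G) k \<and> (\<forall>x\<in>topspace B. tgt G (k x) = f x) \<and> (\<forall>x\<in>A'. k x = \<gamma> x)"
    proof (cases "A' = {}")
      case True
      then show ?thesis using continuous_map_gunit[OF D(2)] continuous_map_apply[OF D(2)]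
        by (intro exI[of _ "\<lambda>x. gunit G (f x)"]) (simp add: tgt_gunit)
    next
      case False
      have "continuous_map (subtopology B A') (arrs G) \<gamma>"
        using D(3) A'(2) by (rule continuous_map_from_subtopology_mono)
      then show ?thesis
        using False A' D(2,4) serre_fibration_lift[OF tgt_serre, of B A' \<gamma> f] by (metis subsetD)
    qed
    then obtain k where k: "continuous_map B (arrs G) k" "\<forall>x\<in>topspace B. tgt G (k x) = f x" "\<forall>x\<in>A'. k x = \<gamma> x"
      by blast
    show "\<exists>V s. openin B V \<and> b \<in> V \<and> continuous_map (subtopology B V) (total ?P) s \<and>
        (\<forall>x\<in>V. proj ?P (s x) = x) \<and> (\<forall>x\<in>V \<inter> A. s x = sect ?P x)"
      using V A' k by (intro exI[of _ V] exI[of _ "\<lambda>x. (x, k x)"] conjI into)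
        (auto simp: datum_bundle_simps intro: continuous_map_from_subtopology)
    then show "\<exists>V s. openin B V \<and> b \<in> V \<and> continuous_map (subtopology B V) (total ?P) s \<and>
        (\<forall>x\<in>V. proj ?P (s x) = x)" by blast
  next
    fix p g assume p: "p \<in> pts ?P" "g \<in> ar G" "anchor ?P p = tgt G g"
    then show "anchor ?P (act ?P p g) = src G g" "proj ?P (act ?P p g) = proj ?P p"
      by (auto simp: datum_bundle_simps src_gmul)
    fix h assume "h \<in> ar G" "src G g = tgt G h"
    then show "act ?P (act ?P p g) h = act ?P p (gmul G g h)"
      using p by (auto simp: datum_bundle_simps gmul_assoc)
  next
    fix p assume "p \<in> pts ?P"
    then show "act ?P p (gunit G (anchor ?P p)) = p" by (auto simp: datum_bundle_simps gmul_gunit_right)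
  next
    fix x assume "x \<in> A"
    then show "proj ?P (sect ?P x) = x" "anchor ?P (sect ?P x) = a0" using D by (auto simp: datum_bundle_simps)
  qed
qed

end

lemma (in principal_pair_bundle) section_datum_of_section:
  assumes \<tau>: "continuous_map B (total P) \<tau>" "\<And>b. b \<in> topspace B \<Longrightarrow> proj P (\<tau> b) = b"
    and f: "\<And>b. b \<in> topspace B \<Longrightarrow> f b = anchor P (\<tau> b)"
    and \<gamma>: "\<And>x. x \<in> A \<Longrightarrow> \<gamma> x = transporter G P (\<tau> x) (sect P x)"
  shows "section_datum G a0 B A f \<gamma>"
    "bundle_iso_map G A (datum_bundle G B f \<gamma>) P (\<lambda>(b, h). act P (\<tau> b) h)"
proof -
  have AB: "x \<in> topspace B" if "x \<in> A" for x using that subspace by blast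
  have \<tau>p: "\<tau> b \<in> pts P" if "b \<in> topspace B" for b using continuous_map_apply[OF \<tau>(1) that] .
  have tr: "proj P (\<tau> x) = proj P (sect P x)" if "x \<in> A" for x using \<tau>(2) AB proj_sect that by simp
  note T = transporter[OF \<tau>p[OF AB] sect_closed tr]
  have "continuous_map B (objs G) f"
    using continuous_map_compose[OF \<tau>(1) anchor_continuous] by (rule continuous_map_eq) (simp add: f)
  moreover have "continuous_map (subtopology B A) (arrs G) \<gamma>"
  proof (rule continuous_map_eq)
    show "continuous_map (subtopology B A) (arrs G) (\<lambda>x. transporter G P (\<tau> x) (sect P x))"
      using continuous_map_from_subtopology[OF \<tau>(1)] sect_continuous tr by (intro continuous_map_transporter) auto
  qed (simp add: \<gamma>)
  ultimately show "section_datum G a0 B A f \<gamma>"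
    unfolding section_datum_def using subspace T anchor_sect AB by (auto simp: f \<gamma>)
  let ?D = "datum_bundle G B f \<gamma>"
  have D: "b \<in> topspace B" "h \<in> ar G" "anchor P (\<tau> b) = tgt G h" "\<tau> b \<in> pts P" if "(b, h) \<in> pts ?D" for b h
    using that f \<tau>p by (auto simp: datum_bundle_simps)
  show "bundle_iso_map G A ?D P (\<lambda>(b, h). act P (\<tau> b) h)"
    unfolding bundle_iso_map_def
  proof (intro conjI ballI impI)
    have cfst: "continuous_map (total ?D) B fst" and csnd: "continuous_map (total ?D) (arrs G) snd"
      by (simp_all add: datum_bundle_simps continuous_map_from_subtopology continuous_map_fst continuous_map_snd)
    have "continuous_map (total ?D) (total P) (\<lambda>z. act P (\<tau> (fst z)) (snd z))"
      using continuous_map_compose[OF cfst \<tau>(1)] csnd D by (intro continuous_map_act) (auto simp: comp_def)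
    moreover have "continuous_map (total P) (total ?D) (\<lambda>p. (proj P p, transporter G P (\<tau> (proj P p)) p))"
    proof -
      have "continuous_map (total P) (total P) (\<lambda>p. \<tau> (proj P p))"
        using continuous_map_compose[OF proj_continuous \<tau>(1)] by (simp add: comp_def)
      then have "continuous_map (total P) (arrs G) (\<lambda>p. transporter G P (\<tau> (proj P p)) p)"
        by (intro continuous_map_transporter) (simp_all add: \<tau> proj_closed)
      then show ?thesis
        unfolding datum_bundle_simps continuous_map_in_subtopology
        using proj_continuous transporter(2)[OF \<tau>p] proj_closed
        by (auto simp: continuous_map_pairedI f \<tau>)
    qed
    ultimately have "homeomorphic_maps (total ?D) (total P) (\<lambda>z. act P (\<tau> (fst z)) (snd z))
        (\<lambda>p. (proj P p, transporter G P (\<tau> (proj P p)) p))"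
      unfolding homeomorphic_maps_def
      using D transporter(3)[OF \<tau>p] proj_closed by (auto simp: \<tau> proj_act intro: transporter_unique)
    then show "homeomorphic_map (total ?D) (total P) (\<lambda>(b, h). act P (\<tau> b) h)"
      by (auto simp: homeomorphic_map_maps case_prod_unfold)
    fix p assume p: "p \<in> pts ?D"
    obtain b h where [simp]: "p = (b, h)" by force
    show "proj P (case p of (b, h) \<Rightarrow> act P (\<tau> b) h) = proj ?D p"
      "anchor P (case p of (b, h) \<Rightarrow> act P (\<tau> b) h) = anchor ?D p"
      using D p by (auto simp: datum_bundle_simps(2,3) proj_act anchor_act \<tau>)
    fix g assume "g \<in> ar G" "anchor ?D p = tgt G g"
    then show "(case act ?D p g of (b, h) \<Rightarrow> act P (\<tau> b) h) = act P (case p of (b, h) \<Rightarrow> act P (\<tau> b) h) g"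
      using D p act_act by (auto simp: datum_bundle_simps(3,4))
  next
    fix x assume "x \<in> A"
    then show "(case sect ?D x of (b, h) \<Rightarrow> act P (\<tau> b) h) = sect P x"
      using T by (simp add: datum_bundle_simps \<gamma>)
  qed
qed

context pointed_serre_groupoid
begin

text \<open>An isomorphism of trivialised bundles takes \<open>(b, 1)\<close> to \<open>(b, u b)\<close> for a function \<open>u\<close>, which determines it by
  equivariance. Such a \<open>u\<close> is called a gauge transformation.\<close>

lemma datum_bundle_gauge:
  assumes loc: "locally_anodyne B A" and datum: "section_datum G a0 B A f \<gamma>" "section_datum G a0 B A f' \<gamma>'"
    and u: "continuous_map B (arrs G) u" "\<And>b. b \<in> topspace B \<Longrightarrow> tgt G (u b) = f' b"
      "\<And>b. b \<in> topspace B \<Longrightarrow> src G (u b) = f b" "\<And>x. x \<in> A \<Longrightarrow> gmul G (u x) (\<gamma> x) = \<gamma>' x"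
  shows "bundle_iso G A (datum_bundle G B f \<gamma>) (datum_bundle G B f' \<gamma>')"
proof -
  interpret P: principal_pair_bundle G a0 B A "datum_bundle G B f' \<gamma>'"
    by (rule datum_bundle_principal[OF loc datum(2)])
  note D = section_datumD[OF datum(1)]
  have up: "u x \<in> ar G" if "x \<in> topspace B" for x using continuous_map_apply[OF u(1) that] .
  have "bundle_iso_map G A (datum_bundle G B f \<gamma>) (datum_bundle G B f' \<gamma>')
      (\<lambda>(b, h). act (datum_bundle G B f' \<gamma>') (b, u b) h)"
  proof (rule P.section_datum_of_section(2))
    show "continuous_map B (total (datum_bundle G B f' \<gamma>')) (\<lambda>b. (b, u b))"
      unfolding datum_bundle_simps using u by (auto simp: continuous_map_in_subtopology continuous_map_pairedI)
    fix x assume x: "x \<in> A"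
    then have xB: "x \<in> topspace B" using D by blast
    show "\<gamma> x = transporter G (datum_bundle G B f' \<gamma>') (x, u x) (sect (datum_bundle G B f' \<gamma>') x)"
      using x xB D(4,6)[OF x] up u
      by (intro P.transporter_unique[symmetric]) (auto simp: datum_bundle_simps)
  qed (auto simp: datum_bundle_simps u)
  then show ?thesis by (auto simp: bundle_iso_def)
qed

lemma datum_bundle_cong:
  assumes "locally_anodyne B A" "section_datum G a0 B A f \<gamma>"
    and "\<And>b. b \<in> topspace B \<Longrightarrow> f b = f' b" "\<And>x. x \<in> A \<Longrightarrow> \<gamma> x = \<gamma>' x"
  shows "section_datum G a0 B A f' \<gamma>'" "bundle_iso G A (datum_bundle G B f \<gamma>) (datum_bundle G B f' \<gamma>')"
proof -
  note D = section_datumD[OF assms(2)]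
  have "continuous_map B (objs G) f'" by (rule continuous_map_eq[OF D(2)]) (rule assms(3))
  moreover have "continuous_map (subtopology B A) (arrs G) \<gamma>'"
    by (rule continuous_map_eq[OF D(3)]) (use assms(4) in auto)
  ultimately show datum: "section_datum G a0 B A f' \<gamma>'"
    using D assms(3,4) unfolding section_datum_def by (metis subsetD)
  show "bundle_iso G A (datum_bundle G B f \<gamma>) (datum_bundle G B f' \<gamma>')"
  proof (rule datum_bundle_gauge[OF assms(1,2) datum])
    show "continuous_map B (arrs G) (\<lambda>b. gunit G (f b))" by (rule continuous_map_gunit[OF D(2)])
    show "gmul G (gunit G (f x)) (\<gamma> x) = \<gamma>' x" if "x \<in> A" for x
      using that D(4,6) assms(4) gmul_gunit_left by metis
  qed (use assms(3) continuous_map_apply[OF D(2)] in \<open>auto simp: src_gunit tgt_gunit\<close>)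
qed

lemma datum_bundle_iso_gauge:
  assumes iso: "bundle_iso G A (datum_bundle G B f \<gamma>) (datum_bundle G B f' \<gamma>')"
    and datum: "section_datum G a0 B A f \<gamma>"
  obtains u where "continuous_map B (arrs G) u" "\<And>b. b \<in> topspace B \<Longrightarrow> tgt G (u b) = f' b"
    "\<And>b. b \<in> topspace B \<Longrightarrow> src G (u b) = f b" "\<And>x. x \<in> A \<Longrightarrow> gmul G (u x) (\<gamma> x) = \<gamma>' x"
proof -
  note D = section_datumD[OF datum]
  obtain \<phi> where \<phi>: "bundle_iso_map G A (datum_bundle G B f \<gamma>) (datum_bundle G B f' \<gamma>') \<phi>"
    using iso by (auto simp: bundle_iso_def)
  define u where "u b = snd (\<phi> (b, gunit G (f b)))" for b
  have one: "(b, gunit G (f b)) \<in> pts (datum_bundle G B f \<gamma>)" if "b \<in> topspace B" for b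
    using that continuous_map_apply[OF D(2)] by (simp add: datum_bundle_pts gunit_closed tgt_gunit)
  have \<phi>1: "\<phi> (b, gunit G (f b)) = (b, u b)" if "b \<in> topspace B" for b
    using bundle_iso_mapD(2)[OF \<phi> one[OF that]] by (simp add: datum_bundle_simps(2) u_def prod_eq_iff)
  show ?thesis
  proof
    have "continuous_map B (total (datum_bundle G B f \<gamma>)) (\<lambda>b. (b, gunit G (f b)))"
      unfolding datum_bundle_simps using D(2) continuous_map_apply[OF D(2)]
      by (auto simp: continuous_map_in_subtopology continuous_map_pairedI continuous_map_gunit tgt_gunit)
    moreover have "continuous_map (total (datum_bundle G B f \<gamma>)) (total (datum_bundle G B f' \<gamma>')) \<phi>"
      using \<phi> by (auto simp: bundle_iso_map_def homeomorphic_imp_continuous_map)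
    moreover have "continuous_map (total (datum_bundle G B f' \<gamma>')) (arrs G) snd"
      by (simp add: datum_bundle_simps continuous_map_from_subtopology continuous_map_snd)
    ultimately show "continuous_map B (arrs G) u"
      using continuous_map_compose[OF continuous_map_compose] by (fastforce simp: u_def[abs_def] comp_def)
    fix b assume b: "b \<in> topspace B"
    show "tgt G (u b) = f' b"
      using bundle_iso_mapD(1)[OF \<phi> one[OF b]] by (simp add: \<phi>1[OF b] datum_bundle_pts)
    show "src G (u b) = f b"
      using bundle_iso_mapD(3)[OF \<phi> one[OF b]] continuous_map_apply[OF D(2) b]
      by (simp add: \<phi>1[OF b] datum_bundle_simps(3) src_gunit)
  next
    fix x assume x: "x \<in> A"
    then have xB: "x \<in> topspace B" using D by blast
    have "anchor (datum_bundle G B f \<gamma>) (x, gunit G (f x)) = tgt G (\<gamma> x)"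
      using D(4)[OF x] continuous_map_apply[OF D(2) xB] by (simp add: datum_bundle_simps src_gunit)
    then have "act (datum_bundle G B f' \<gamma>') (x, u x) (\<gamma> x) = \<phi> (act (datum_bundle G B f \<gamma>) (x, gunit G (f x)) (\<gamma> x))"
      using bundle_iso_mapD(4)[OF \<phi> one[OF xB] D(6)[OF x]] by (simp add: \<phi>1[OF xB])
    also have "act (datum_bundle G B f \<gamma>) (x, gunit G (f x)) (\<gamma> x) = sect (datum_bundle G B f \<gamma>) x"
      using D(4,6)[OF x] gmul_gunit_left by (metis (no_types, lifting) case_prod_conv datum_bundle_simps(4,5))
    also have "\<phi> \<dots> = sect (datum_bundle G B f' \<gamma>') x" by (rule bundle_iso_map_sect[OF \<phi> x])
    finally show "gmul G (u x) (\<gamma> x) = \<gamma>' x" by (simp add: datum_bundle_simps)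
  qed
qed

end

section \<open>Cylinders\<close>

lemma subtopology_cylinder: "subtopology (cylinder X) (A \<times> {0..1}) = cylinder (subtopology X A)"
  by (simp add: subtopology_Times subtopology_subtopology)

lemma continuous_map_at_time:
  assumes "continuous_map (cylinder X) Y F" "0 \<le> u" "u \<le> 1"
  shows "continuous_map X Y (\<lambda>x. F (x, u))"
  using continuous_map_compose[OF _ assms(1), of X "\<lambda>x. (x, u)"] assms(2,3)
  by (simp add: comp_def continuous_map_pairedI)

lemma continuous_map_rescale:
  assumes "continuous_map X (cylinder Y) (\<lambda>z. (a z, c z))" "continuous_map (cylinder Y) Z F"
  shows "continuous_map X Z (\<lambda>z. F (a z, c z))"
  using continuous_map_compose[OF assms] by (simp add: comp_def)

lemma continuous_map_time:
  "continuous_map (subtopology (cylinder X) S) euclideanreal snd"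
  by (rule continuous_map_from_subtopology)
    (use continuous_map_snd[of X unit_interval] in \<open>simp add: continuous_map_in_subtopology\<close>)

lemma continuous_map_retime:
  assumes F: "continuous_map (cylinder X) Y F" and T: "continuous_on {0..1} T"
    and S: "\<And>z. z \<in> topspace (cylinder X) \<Longrightarrow> z \<in> S \<Longrightarrow> T (snd z) \<in> {0..1}"
  shows "continuous_map (subtopology (cylinder X) S) Y (\<lambda>z. F (fst z, T (snd z)))"
proof (rule continuous_map_rescale[OF _ F])
  have "continuous_map (cylinder X) euclideanreal (\<lambda>z. T (snd z))"
    using continuous_map_compose[OF continuous_map_snd[of X unit_interval], of euclideanreal T] T
    by (simp add: comp_def)
  then have "continuous_map (subtopology (cylinder X) S) unit_interval (\<lambda>z. T (snd z))"
    unfolding continuous_map_in_subtopology using S by (auto intro: continuous_map_from_subtopology)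
  then show "continuous_map (subtopology (cylinder X) S) (cylinder X) (\<lambda>z. (fst z, T (snd z)))"
    by (intro continuous_map_pairedI) (auto intro: continuous_map_from_subtopology continuous_map_fst)
qed

definition time_concat :: "('b \<times> real \<Rightarrow> 'c) \<Rightarrow> ('b \<times> real \<Rightarrow> 'c) \<Rightarrow> 'b \<times> real \<Rightarrow> 'c" where
  "time_concat F F' z = (if snd z \<le> 1/2 then F (fst z, 2 * snd z) else F' (fst z, 2 * snd z - 1))"

definition time_reverse :: "('b \<times> real \<Rightarrow> 'c) \<Rightarrow> 'b \<times> real \<Rightarrow> 'c" where
  "time_reverse F z = F (fst z, 1 - snd z)"

lemma continuous_map_time_reverse:
  "continuous_map (cylinder X) Y F \<Longrightarrow> continuous_map (cylinder X) Y (time_reverse F)"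
  unfolding time_reverse_def[abs_def]
  using continuous_map_retime[of X Y F "\<lambda>t. 1 - t" UNIV, OF _ continuous_on_diff[OF continuous_on_const continuous_on_id]]
  by auto

lemma continuous_map_time_concat:
  assumes "continuous_map (cylinder X) Y F" "continuous_map (cylinder X) Y F'"
    "\<And>x. x \<in> topspace X \<Longrightarrow> F (x, 1) = F' (x, 0)"
  shows "continuous_map (cylinder X) Y (time_concat F F')"
  unfolding time_concat_def
proof (rule continuous_map_cases_le)
  show "continuous_map (cylinder X) euclideanreal snd" using continuous_map_time[of X UNIV] by simp
  show "continuous_map (cylinder X) euclideanreal (\<lambda>z. 1/2)" by simp
  show "continuous_map (subtopology (cylinder X) {x \<in> topspace (cylinder X). snd x \<le> 1/2}) Y
      (\<lambda>z. F (fst z, 2 * snd z))"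
    by (rule continuous_map_retime[OF assms(1)]) (auto intro!: continuous_intros)
  show "continuous_map (subtopology (cylinder X) {x \<in> topspace (cylinder X). 1/2 \<le> snd x}) Y
      (\<lambda>z. F' (fst z, 2 * snd z - 1))"
    by (rule continuous_map_retime[OF assms(2)]) (auto intro!: continuous_intros)
next
  fix z assume z: "z \<in> topspace (cylinder X)" "snd z = 1/2"
  then have "2 * snd z = 1" by simp
  then show "F (fst z, 2 * snd z) = F' (fst z, 2 * snd z - 1)" using assms(3)[of "fst z"] z(1) by auto
qed

lemma continuous_map_comp_fst: "continuous_map X Y f \<Longrightarrow> continuous_map (prod_topology X Z) Y (\<lambda>z. f (fst z))"
  using continuous_map_compose[OF continuous_map_fst] by (fastforce simp: comp_def)

lemma cylinder_datum_iff:
  "section_datum G a0 (cylinder B) (A \<times> {0..1}) F \<Gamma> \<longleftrightarrow> A \<subseteq> topspace B \<and> continuous_map (cylinder B) (objs G) F \<and>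
     continuous_map (cylinder (subtopology B A)) (arrs G) \<Gamma> \<and>
     (\<forall>z\<in>A \<times> {0..1}. tgt G (\<Gamma> z) = F z \<and> src G (\<Gamma> z) = a0)"
proof -
  have "A \<times> {0..1} \<subseteq> topspace (cylinder B) \<longleftrightarrow> A \<subseteq> topspace B"
    using Times_subset_cancel2[of "0::real" "{0..1}"] by simp
  then show ?thesis unfolding section_datum_def subtopology_cylinder by simp
qed

lemma cylinder_datum_at:
  assumes "section_datum G a0 (cylinder B) (A \<times> {0..1}) F \<Gamma>" "0 \<le> u" "u \<le> 1"
  shows "section_datum G a0 B A (\<lambda>x. F (x, u)) (\<lambda>x. \<Gamma> (x, u))"
  using assms unfolding cylinder_datum_iff unfolding section_datum_def by (auto intro: continuous_map_at_time)

lemma cylinder_datum_reverse: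
  assumes "section_datum G a0 (cylinder B) (A \<times> {0..1}) F \<Gamma>"
  shows "section_datum G a0 (cylinder B) (A \<times> {0..1}) (time_reverse F) (time_reverse \<Gamma>)"
  using assms unfolding cylinder_datum_iff by (auto intro: continuous_map_time_reverse simp: time_reverse_def)

lemma cylinder_datum_concat:
  assumes F: "section_datum G a0 (cylinder B) (A \<times> {0..1}) F \<Gamma>" and F': "section_datum G a0 (cylinder B) (A \<times> {0..1}) F' \<Gamma>'"
    and FF': "\<And>x. x \<in> topspace B \<Longrightarrow> F (x, 1) = F' (x, 0)" "\<And>x. x \<in> A \<Longrightarrow> \<Gamma> (x, 1) = \<Gamma>' (x, 0)"
  shows "section_datum G a0 (cylinder B) (A \<times> {0..1}) (time_concat F F') (time_concat \<Gamma> \<Gamma>')"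
  using assms unfolding cylinder_datum_iff
  by (auto intro!: continuous_map_time_concat simp: time_concat_def)


section \<open>Homotopies of bundles over cubes\<close>

lemma datum_bundle_slice:
  assumes datum: "section_datum G a0 (cylinder B) (A \<times> {0..1}) F \<Gamma>" and u: "0 \<le> u" "u \<le> 1"
  shows "bundle_iso G A (bundle_slice u (datum_bundle G (cylinder B) F \<Gamma>))
    (datum_bundle G B (\<lambda>x. F (x, u)) (\<lambda>x. \<Gamma> (x, u)))"
proof -
  let ?S = "bundle_slice u (datum_bundle G (cylinder B) F \<Gamma>)"
    and ?D = "datum_bundle G B (\<lambda>x. F (x, u)) (\<lambda>x. \<Gamma> (x, u))"
  have tot: "total ?S = subtopology (prod_topology (cylinder B) (arrs G)) {(z, g). F z = tgt G g \<and> snd z = u}"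
    by (simp add: bundle_slice_def datum_bundle_simps subtopology_subtopology Int_def case_prod_unfold)
  have "homeomorphic_maps (total ?S) (total ?D) (\<lambda>(z, g). (fst z, g)) (\<lambda>(b, g). ((b, u), g))"
    unfolding homeomorphic_maps_def
  proof (intro conjI ballI)
    have "continuous_map (prod_topology (cylinder B) (arrs G)) (prod_topology B (arrs G)) (\<lambda>p. (fst (fst p), snd p))"
      using continuous_map_compose[OF continuous_map_fst continuous_map_fst]
      by (intro continuous_map_pairedI) (auto simp: comp_def continuous_map_snd)
    then show "continuous_map (total ?S) (total ?D) (\<lambda>(z, g). (fst z, g))"
      unfolding tot datum_bundle_simps continuous_map_in_subtopology
      by (auto simp: case_prod_unfold intro: continuous_map_from_subtopology)
    have "continuous_map (prod_topology B (arrs G)) (prod_topology (cylinder B) (arrs G)) (\<lambda>p. ((fst p, u), snd p))"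
      using u by (intro continuous_map_pairedI) (auto simp: continuous_map_snd continuous_map_fst)
    then show "continuous_map (total ?D) (total ?S) (\<lambda>(b, g). ((b, u), g))"
      unfolding tot datum_bundle_simps continuous_map_in_subtopology
      by (auto simp: case_prod_unfold intro: continuous_map_from_subtopology)
  qed (auto simp: tot datum_bundle_simps)
  then have "bundle_iso_map G A ?S ?D (\<lambda>(z, g). (fst z, g))"
    unfolding bundle_iso_map_def
    by (auto simp: homeomorphic_map_maps bundle_slice_def datum_bundle_simps)
  then show ?thesis by (auto simp: bundle_iso_def)
qed

lemma homotopic_bundles_iso:
  assumes hom: "homotopic_bundles G a0 B A P Q" and iso: "bundle_iso G A P P'" "bundle_iso G A Q Q'"
  shows "homotopic_bundles G a0 B A P' Q'"
  using assms principal_pair_bundle_iso bundle_iso_trans unfolding homotopic_bundles_def by metis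

text \<open>A slice inherits the closure under the action from the ambient bundle.\<close>

lemma bundle_slice_iso_sym:
  assumes "principal_pair_bundle G a0 (cylinder B) (A \<times> {0..1}) R" "0 \<le> u" "u \<le> 1"
    "bundle_iso G A (bundle_slice u R) P"
  shows "bundle_iso G A P (bundle_slice u R)"
proof -
  interpret R: principal_pair_bundle G a0 "cylinder B" "A \<times> {0..1}" R by fact
  show ?thesis
    using assms(2,3) R.act_closed R.proj_act R.sect_closed R.proj_sect
    by (intro bundle_iso_sym[OF assms(4)]) (auto simp: bundle_slice_def)
qed

abbreviation cube_datum :: "nat \<Rightarrow> ('o, 'a) groupoid \<Rightarrow> 'o \<Rightarrow> ((nat \<Rightarrow> real) \<Rightarrow> 'o) \<Rightarrow> ((nat \<Rightarrow> real) \<Rightarrow> 'a) \<Rightarrow> bool" where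
  "cube_datum n G a0 \<equiv> section_datum G a0 (cube n) (cube_boundary n)"

abbreviation homotopy_datum ::
    "nat \<Rightarrow> ('o, 'a) groupoid \<Rightarrow> 'o \<Rightarrow> ((nat \<Rightarrow> real) \<times> real \<Rightarrow> 'o) \<Rightarrow> ((nat \<Rightarrow> real) \<times> real \<Rightarrow> 'a) \<Rightarrow> bool" where
  "homotopy_datum n G a0 \<equiv> section_datum G a0 (cylinder (cube n)) (cube_boundary n \<times> {0..1})"

abbreviation cube_bundle_of ::
    "nat \<Rightarrow> ('o, 'a) groupoid \<Rightarrow> ((nat \<Rightarrow> real) \<Rightarrow> 'o) \<Rightarrow> ((nat \<Rightarrow> real) \<Rightarrow> 'a) \<Rightarrow> ('o, 'a) cube_bundle" where
  "cube_bundle_of n G \<equiv> datum_bundle G (cube n)"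

abbreviation "cube_pair_bundle n G a0 \<equiv> principal_pair_bundle G a0 (cube n) (cube_boundary n)"
abbreviation "cube_bundle_iso n G \<equiv> bundle_iso G (cube_boundary n)"

lemma anodyne_bottom: "anodyne (cylinder (cube n)) (topspace (cube n) \<times> {0} \<union> {} \<times> {0..1})"
  using anodyne_cylinder[of "{}" n "{0}" n 0] by (simp add: faces_def)

lemma anodyne_bottom_boundary:
  "anodyne (cylinder (cube n)) (topspace (cube n) \<times> {0} \<union> cube_boundary n \<times> {0..1})"
  unfolding cube_boundary_faces by (rule anodyne_cylinder[of _ _ _ n 0]) auto

context pointed_serre_groupoid
begin

lemma cube_bundle_of_principal: "cube_datum n G a0 f \<gamma> \<Longrightarrow> cube_pair_bundle n G a0 (cube_bundle_of n G f \<gamma>)"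
  by (rule datum_bundle_principal[OF locally_anodyne_cube])

lemma homotopic_bundles_of_datum:
  assumes datum: "homotopy_datum n G a0 F \<Gamma>"
  shows "homotopic_cube_bundles n G a0 (cube_bundle_of n G (\<lambda>x. F (x, 0)) (\<lambda>x. \<Gamma> (x, 0)))
    (cube_bundle_of n G (\<lambda>x. F (x, 1)) (\<lambda>x. \<Gamma> (x, 1)))"
  unfolding homotopic_bundles_def
  using cylinder_datum_at[OF datum] datum_bundle_slice[OF datum]
    datum_bundle_principal[OF locally_anodyne_cylinder datum]
  by (auto intro!: cube_bundle_of_principal)

text \<open>Let \<open>R\<close> be the bundle over the cylinder. The trivialisation of its slice at time 0 is a section over the bottom,
  and \<open>\<sigma> \<Gamma>0\<inverse>\<close> is a section over \<open>A \<times> I\<close> that agrees with it at time 0. Since the projection of \<open>R\<close> is a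
  Serre fibration, the two extend to a global section of \<open>R\<close>, whose datum begins with \<open>(f, \<gamma>)\<close> and equals
  \<open>\<Gamma>0\<close> on \<open>A \<times> I\<close>.\<close>

theorem trivialise_homotopy:
  assumes hom: "homotopic_cube_bundles n G a0 P Q"
    and iso: "cube_bundle_iso n G (cube_bundle_of n G f \<gamma>) P" and datum: "cube_datum n G a0 f \<gamma>"
    and A: "A \<subseteq> cube_boundary n" "closedin (cube n) A"
      "anodyne (cylinder (cube n)) (topspace (cube n) \<times> {0} \<union> A \<times> {0..1})"
    and \<Gamma>0: "continuous_map (cylinder (subtopology (cube n) A)) (arrs G) \<Gamma>0"
      "\<And>z. z \<in> A \<times> {0..1} \<Longrightarrow> src G (\<Gamma>0 z) = a0" "\<And>x. x \<in> A \<Longrightarrow> \<Gamma>0 (x, 0) = \<gamma> x"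
  obtains F \<Gamma> where "homotopy_datum n G a0 F \<Gamma>" "\<And>x. x \<in> topspace (cube n) \<Longrightarrow> F (x, 0) = f x"
    "\<And>x. x \<in> cube_boundary n \<Longrightarrow> \<Gamma> (x, 0) = \<gamma> x" "\<And>z. z \<in> A \<times> {0..1} \<Longrightarrow> \<Gamma> z = \<Gamma>0 z"
    "cube_bundle_iso n G (cube_bundle_of n G (\<lambda>x. F (x, 1)) (\<lambda>x. \<Gamma> (x, 1))) Q"
proof -
  note D = section_datumD[OF datum]
  obtain R :: "((nat \<Rightarrow> real) \<times> real, 'o, 'a, ((nat \<Rightarrow> real) \<times> real) \<times> 'a) gbundle"
    where R: "principal_pair_bundle G a0 (cylinder (cube n)) (cube_boundary n \<times> {0..1}) R"
    and R0: "cube_bundle_iso n G (bundle_slice 0 R) P" and R1: "cube_bundle_iso n G (bundle_slice 1 R) Q"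
    and Q: "cube_pair_bundle n G a0 Q"
    using hom by (auto simp: homotopic_bundles_def)
  interpret R: principal_pair_bundle G a0 "cylinder (cube n)" "cube_boundary n \<times> {0..1}" R by (rule R)
  interpret D: principal_pair_bundle G a0 "cube n" "cube_boundary n" "cube_bundle_of n G f \<gamma>"
    by (rule cube_bundle_of_principal[OF datum])
  have "cube_bundle_iso n G (cube_bundle_of n G f \<gamma>) (bundle_slice 0 R)"
    using bundle_iso_trans[OF iso bundle_slice_iso_sym[OF R _ _ R0]] by simp
  then obtain \<phi> where \<phi>: "bundle_iso_map G (cube_boundary n) (cube_bundle_of n G f \<gamma>) (bundle_slice 0 R) \<phi>"
    by (auto simp: bundle_iso_def)
  define e where "e b = (b, gunit G (f b))" for b
  have e: "e b \<in> pts (cube_bundle_of n G f \<gamma>)" if "b \<in> topspace (cube n)" for b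
    using that continuous_map_apply[OF D(2)] by (simp add: e_def datum_bundle_pts gunit_closed tgt_gunit)
  have \<phi>e: "\<phi> (e b) \<in> pts R" "proj R (\<phi> (e b)) = (b, 0)" "anchor R (\<phi> (e b)) = f b" if "b \<in> topspace (cube n)" for b
    using bundle_iso_mapD(1-3)[OF \<phi> e[OF that]] continuous_map_apply[OF D(2) that]
    by (auto simp: bundle_slice_def datum_bundle_simps e_def prod_eq_iff src_gunit)
  have \<phi>\<gamma>: "act R (\<phi> (e x)) (\<gamma> x) = sect R (x, 0)" if x: "x \<in> cube_boundary n" for x
  proof -
    have xB: "x \<in> topspace (cube n)" using D(1) x by blast
    have a: "anchor (cube_bundle_of n G f \<gamma>) (e x) = tgt G (\<gamma> x)"
      using D(4)[OF x] continuous_map_apply[OF D(2) xB] by (simp add: datum_bundle_simps src_gunit e_def)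
    have "act (cube_bundle_of n G f \<gamma>) (e x) (\<gamma> x) = sect (cube_bundle_of n G f \<gamma>) x"
      unfolding e_def datum_bundle_simps(4,5) using D(4,6)[OF x] gmul_gunit_left[of "\<gamma> x"] by simp
    then show ?thesis
      using bundle_iso_mapD(4)[OF \<phi> e[OF xB] D(6)[OF x] a] bundle_iso_map_sect[OF \<phi> x]
      by (simp add: bundle_slice_def)
  qed
  define \<rho> where "\<rho> z = act R (sect R z) (ginv G (\<Gamma>0 z))" for z
  have AB: "A \<subseteq> topspace (cube n)" using A(1) D(1) by blast
  have \<Gamma>0p: "\<Gamma>0 z \<in> ar G" if "z \<in> A \<times> {0..1}" for z
    using continuous_map_apply[OF \<Gamma>0(1), of z] that AB by auto
  have sec: "sect R z \<in> pts R" "anchor R (sect R z) = a0" "proj R (sect R z) = z" if "z \<in> A \<times> {0..1}" for z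
    using that A(1) by (auto intro!: R.sect_closed R.anchor_sect R.proj_sect)
  have \<rho>: "\<rho> z \<in> pts R" "proj R (\<rho> z) = z" "anchor R (\<rho> z) = tgt G (\<Gamma>0 z)" "act R (\<rho> z) (\<Gamma>0 z) = sect R z"
    if z: "z \<in> A \<times> {0..1}" for z
    using sec[OF z] \<Gamma>0(2)[OF z] \<Gamma>0p[OF z] R.act_act[of "sect R z" "ginv G (\<Gamma>0 z)" "\<Gamma>0 z"] R.act_gunit[of "sect R z"]
    by (auto simp: \<rho>_def ginv_closed tgt_ginv src_ginv gmul_ginv_left intro!: R.act_closed simp: R.proj_act R.anchor_act)
  have \<rho>0: "\<rho> (x, 0) = \<phi> (e x)" if x: "x \<in> A" for x
  proof -
    have xb: "x \<in> cube_boundary n" "x \<in> topspace (cube n)" using x A AB by auto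
    have "\<rho> (x, 0) = act R (act R (\<phi> (e x)) (\<gamma> x)) (ginv G (\<gamma> x))"
      using \<phi>\<gamma>[OF xb(1)] \<Gamma>0(3)[OF x] by (simp add: \<rho>_def)
    also have "\<dots> = act R (\<phi> (e x)) (gunit G (f x))"
      using \<phi>e[OF xb(2)] D(4,6)[OF xb(1)]
      by (subst R.act_act) (auto simp: ginv_closed tgt_ginv gmul_ginv_right)
    also have "\<dots> = \<phi> (e x)" using \<phi>e[OF xb(2)] R.act_gunit[of "\<phi> (e x)"] by simp
    finally show ?thesis .
  qed
  define \<sigma> where "\<sigma> z = (if z \<in> topspace (cube n) \<times> {0} then \<phi> (e (fst z)) else \<rho> z)" for z
  have c_\<phi>e: "continuous_map (cube n) (total R) (\<lambda>b. \<phi> (e b))"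
  proof -
    have "continuous_map (cube n) (total (cube_bundle_of n G f \<gamma>)) e"
      unfolding datum_bundle_simps e_def[abs_def] using D(2) continuous_map_apply[OF D(2)]
      by (auto simp: continuous_map_in_subtopology continuous_map_pairedI continuous_map_gunit tgt_gunit)
    moreover have "continuous_map (total (cube_bundle_of n G f \<gamma>)) (total R) \<phi>"
      using \<phi> by (auto simp: bundle_iso_map_def bundle_slice_def continuous_map_in_subtopology dest!: homeomorphic_imp_continuous_map)
    ultimately show ?thesis using continuous_map_compose by (fastforce simp: comp_def)
  qed
  have c_\<rho>: "continuous_map (subtopology (cylinder (cube n)) (A \<times> {0..1})) (total R) \<rho>"
    unfolding \<rho>_def
  proof (rule R.continuous_map_act)
    show "continuous_map (subtopology (cylinder (cube n)) (A \<times> {0..1})) (total R) (sect R)"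
      using R.sect_continuous A(1) by (rule continuous_map_from_subtopology_mono[OF _ Sigma_mono]) auto
    show "continuous_map (subtopology (cylinder (cube n)) (A \<times> {0..1})) (arrs G) (\<lambda>z. ginv G (\<Gamma>0 z))"
      using continuous_map_ginv[OF \<Gamma>0(1)] by (simp only: subtopology_cylinder)
  qed (use sec(2) \<Gamma>0(2) \<Gamma>0p in \<open>auto simp: tgt_ginv\<close>)
  have c_bot: "continuous_map (subtopology (cylinder (cube n)) (topspace (cube n) \<times> {0})) (total R) (\<lambda>z. \<phi> (e (fst z)))"
    using continuous_map_compose[OF continuous_map_from_subtopology[OF continuous_map_fst] c_\<phi>e] by (simp add: comp_def)
  have c_\<sigma>: "continuous_map (subtopology (cylinder (cube n)) (topspace (cube n) \<times> {0} \<union> A \<times> {0..1})) (total R) \<sigma>"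
    unfolding \<sigma>_def
  proof (rule continuous_map_union_closed[OF _ _ c_bot c_\<rho>])
    show "closedin (cylinder (cube n)) (topspace (cube n) \<times> {0})" "closedin (cylinder (cube n)) (A \<times> {0..1})"
      using A(2) closedin_topspace[of unit_interval] by (auto simp: closedin_prod_Times_iff)
  qed (auto simp: \<rho>0)
  have p\<sigma>: "proj R (\<sigma> z) = z" if "z \<in> topspace (cube n) \<times> {0} \<union> A \<times> {0..1}" for z
    using that \<phi>e \<rho> by (auto simp: \<sigma>_def)
  have "serre_fibration (total R) (cylinder (cube n)) (proj R)"
    by (rule principal_bundle_serre) unfold_locales
  from serre_fibration_lift[OF this A(3) c_\<sigma> continuous_map_id[unfolded id_def] p\<sigma>]
  obtain \<tau> where \<tau>: "continuous_map (cylinder (cube n)) (total R) \<tau>"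
    "\<And>z. z \<in> topspace (cylinder (cube n)) \<Longrightarrow> proj R (\<tau> z) = z"
    "\<And>z. z \<in> topspace (cube n) \<times> {0} \<union> A \<times> {0..1} \<Longrightarrow> \<tau> z = \<sigma> z" by metis
  define F where "F z = anchor R (\<tau> z)" for z
  define \<Gamma> where "\<Gamma> z = transporter G R (\<tau> z) (sect R z)" for z
  show ?thesis
  proof
    show "homotopy_datum n G a0 F \<Gamma>"
      by (rule R.section_datum_of_section(1)[OF \<tau>(1,2)]) (auto simp: F_def \<Gamma>_def)
    show "F (x, 0) = f x" if "x \<in> topspace (cube n)" for x
      using that \<tau>(3)[of "(x, 0)"] \<phi>e by (simp add: F_def \<sigma>_def)
    show "\<Gamma> (x, 0) = \<gamma> x" if x: "x \<in> cube_boundary n" for x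
    proof -
      have xB: "x \<in> topspace (cube n)" using D(1) x by blast
      have "\<tau> (x, 0) = \<phi> (e x)" using \<tau>(3)[of "(x, 0)"] xB by (simp add: \<sigma>_def)
      then show ?thesis
        unfolding \<Gamma>_def using \<phi>e[OF xB] \<phi>\<gamma>[OF x] D(4,6)[OF x] by (intro R.transporter_unique) auto
    qed
    show "\<Gamma> z = \<Gamma>0 z" if z: "z \<in> A \<times> {0..1}" for z
    proof -
      have "\<tau> z = \<rho> z" using \<tau>(3)[of z] z \<rho>0 by (auto simp: \<sigma>_def)
      then show ?thesis unfolding \<Gamma>_def using \<rho>[OF z] \<Gamma>0p[OF z] by (intro R.transporter_unique) auto
    qed
    interpret Q: principal_pair_bundle G a0 "cube n" "cube_boundary n" Q by (rule Q)
    interpret S: principal_pair_bundle G a0 "cube n" "cube_boundary n" "bundle_slice 1 R"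
      by (rule principal_pair_bundle_iso[OF Q bundle_slice_iso_sym[OF R _ _ R1]]) auto
    have "cube_bundle_iso n G (cube_bundle_of n G (\<lambda>x. F (x, 1)) (\<lambda>x. \<Gamma> (x, 1))) (bundle_slice 1 R)"
      unfolding bundle_iso_def
    proof (rule exI, rule S.section_datum_of_section(2))
      show "continuous_map (cube n) (total (bundle_slice 1 R)) (\<lambda>x. \<tau> (x, 1))"
        using continuous_map_at_time[OF \<tau>(1), of 1] \<tau>(2)
        by (auto simp: bundle_slice_def continuous_map_in_subtopology)
    qed (use \<tau>(2) in \<open>auto simp: bundle_slice_def F_def \<Gamma>_def transporter_def\<close>)
    then show "cube_bundle_iso n G (cube_bundle_of n G (\<lambda>x. F (x, 1)) (\<lambda>x. \<Gamma> (x, 1))) Q"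
      using R1 by (rule bundle_iso_trans)
  qed
qed

text \<open>A global section is obtained by lifting the contraction of the cube to its vertex 0.\<close>

lemma cube_bundle_trivial:
  assumes P: "cube_pair_bundle n G a0 P"
  obtains f \<gamma> where "cube_datum n G a0 f \<gamma>" "cube_bundle_iso n G (cube_bundle_of n G f \<gamma>) P"
proof -
  interpret P: principal_pair_bundle G a0 "cube n" "cube_boundary n" P by (rule P)
  have 0: "(\<lambda>_. 0) \<in> topspace (cube n)" by (simp add: in_cube)
  obtain V s where s: "(\<lambda>_. 0) \<in> V" "openin (cube n) V" "continuous_map (subtopology (cube n) V) (total P) s" "\<forall>x\<in>V. proj P (s x) = x"
    using P.local_sections[OF 0] by blast
  define p where "p = s (\<lambda>_. 0)"
  have p: "p \<in> pts P" "proj P p = (\<lambda>_. 0)"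
    using s continuous_map_apply[OF s(3), of "\<lambda>_. 0"] 0 by (auto simp: p_def)
  define h :: "(nat \<Rightarrow> real) \<times> real \<Rightarrow> nat \<Rightarrow> real" where "h z = (\<lambda>i. snd z * fst z i)" for z
  have h: "continuous_map (cylinder (cube n)) (cube n) h"
  proof (rule continuous_map_cylinderI)
    show "continuous_on (topspace (cube n) \<times> {0..1}) h"
      unfolding h_def by (rule continuous_on_coordinatewise_then_product) (intro continuous_intros)
  qed (auto simp: in_cube h_def mult_le_one)
  have "serre_fibration (total P) (cube n) (proj P)" by (rule principal_bundle_serre) unfold_locales
  moreover have "continuous_map (cube n) (total P) (\<lambda>_. p)" using p by simp
  moreover have "\<forall>x\<in>topspace (cube n). h (x, 0) = proj P p" by (simp add: h_def p)
  ultimately obtain k where k: "continuous_map (cylinder (cube n)) (total P) k"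
    "\<forall>z\<in>topspace (cylinder (cube n)). proj P (k z) = h z"
    using h unfolding serre_fibration_def by metis
  have \<tau>: "continuous_map (cube n) (total P) (\<lambda>x. k (x, 1))" by (rule continuous_map_at_time[OF k(1)]) auto
  have p\<tau>: "proj P (k (x, 1)) = x" if "x \<in> topspace (cube n)" for x using k(2) that by (auto simp: h_def)
  show ?thesis
    using P.section_datum_of_section[OF \<tau> p\<tau> refl refl] that by (auto simp: bundle_iso_def)
qed

text \<open>The section \<open>\<sigma> \<gamma>0\<inverse>\<close> over \<open>A\<close> extends to the cube.\<close>

lemma cube_bundle_trivial_prescribed:
  assumes P: "cube_pair_bundle n G a0 P" and A: "A \<subseteq> cube_boundary n" "anodyne (cube n) A"
    and \<gamma>0: "continuous_map (subtopology (cube n) A) (arrs G) \<gamma>0" "\<And>x. x \<in> A \<Longrightarrow> src G (\<gamma>0 x) = a0"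
  obtains f \<gamma> where "cube_datum n G a0 f \<gamma>" "cube_bundle_iso n G (cube_bundle_of n G f \<gamma>) P"
    "\<And>x. x \<in> A \<Longrightarrow> \<gamma> x = \<gamma>0 x"
proof -
  interpret P: principal_pair_bundle G a0 "cube n" "cube_boundary n" P by (rule P)
  have AB: "A \<subseteq> topspace (cube n)" using A(2) by (rule anodyne_subset)
  have \<gamma>0p: "\<gamma>0 x \<in> ar G" if "x \<in> A" for x using continuous_map_apply[OF \<gamma>0(1), of x] that AB by auto
  have sec: "sect P x \<in> pts P" "anchor P (sect P x) = a0" "proj P (sect P x) = x" if "x \<in> A" for x
    using that A(1) by (auto intro!: P.sect_closed P.anchor_sect P.proj_sect)
  define \<rho> where "\<rho> x = act P (sect P x) (ginv G (\<gamma>0 x))" for x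
  have \<rho>: "\<rho> x \<in> pts P" "proj P (\<rho> x) = x" "anchor P (\<rho> x) = tgt G (\<gamma>0 x)" "act P (\<rho> x) (\<gamma>0 x) = sect P x"
    if x: "x \<in> A" for x
    using sec[OF x] \<gamma>0(2)[OF x] \<gamma>0p[OF x] P.act_act[of "sect P x" "ginv G (\<gamma>0 x)" "\<gamma>0 x"] P.act_gunit[of "sect P x"]
    by (auto simp: \<rho>_def ginv_closed tgt_ginv src_ginv gmul_ginv_left intro!: P.act_closed simp: P.proj_act P.anchor_act)
  have c_\<rho>: "continuous_map (subtopology (cube n) A) (total P) \<rho>"
    unfolding \<rho>_def
  proof (rule P.continuous_map_act)
    show "continuous_map (subtopology (cube n) A) (total P) (sect P)"
      using P.sect_continuous A(1) by (rule continuous_map_from_subtopology_mono)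
  qed (use continuous_map_ginv[OF \<gamma>0(1)] sec(2) \<gamma>0(2) \<gamma>0p in \<open>auto simp: tgt_ginv\<close>)
  have "serre_fibration (total P) (cube n) (proj P)" by (rule principal_bundle_serre) unfold_locales
  from serre_fibration_lift[OF this A(2) c_\<rho> continuous_map_id[unfolded id_def] \<rho>(2)]
  obtain \<tau> where \<tau>: "continuous_map (cube n) (total P) \<tau>" "\<And>x. x \<in> topspace (cube n) \<Longrightarrow> proj P (\<tau> x) = x"
    "\<And>x. x \<in> A \<Longrightarrow> \<tau> x = \<rho> x" by metis
  have "transporter G P (\<tau> x) (sect P x) = \<gamma>0 x" if "x \<in> A" for x
    using \<tau>(3)[OF that] \<rho>[OF that] \<gamma>0p[OF that] by (intro P.transporter_unique) auto
  then show ?thesis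
    using P.section_datum_of_section[OF \<tau>(1,2) refl refl] that by (auto simp: bundle_iso_def)
qed

lemma trivialise_homotopy_free:
  assumes "homotopic_cube_bundles n G a0 P Q"
    "cube_bundle_iso n G (cube_bundle_of n G f \<gamma>) P" "cube_datum n G a0 f \<gamma>"
  obtains F \<Gamma> where "homotopy_datum n G a0 F \<Gamma>" "\<And>x. x \<in> topspace (cube n) \<Longrightarrow> F (x, 0) = f x"
    "\<And>x. x \<in> cube_boundary n \<Longrightarrow> \<Gamma> (x, 0) = \<gamma> x"
    "cube_bundle_iso n G (cube_bundle_of n G (\<lambda>x. F (x, 1)) (\<lambda>x. \<Gamma> (x, 1))) Q"
  by (rule trivialise_homotopy[OF assms, of "{}" "\<lambda>_. gunit G a0"]) (use anodyne_bottom[of n] that in auto)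

lemma homotopic_cube_bundles_refl:
  assumes P: "cube_pair_bundle n G a0 P" shows "homotopic_cube_bundles n G a0 P P"
proof -
  obtain f \<gamma> where fg: "cube_datum n G a0 f \<gamma>" "cube_bundle_iso n G (cube_bundle_of n G f \<gamma>) P"
    by (rule cube_bundle_trivial[OF P])
  have "homotopy_datum n G a0 (\<lambda>z. f (fst z)) (\<lambda>z. \<gamma> (fst z))"
    using section_datumD[OF fg(1)] unfolding cylinder_datum_iff by (auto intro: continuous_map_comp_fst)
  from homotopic_bundles_of_datum[OF this] show ?thesis
    using fg(2) by (auto intro: homotopic_bundles_iso)
qed

lemma homotopic_cube_bundles_sym:
  assumes hom: "homotopic_cube_bundles n G a0 P Q" shows "homotopic_cube_bundles n G a0 Q P"
proof -
  have P: "cube_pair_bundle n G a0 P" using hom by (simp add: homotopic_bundles_def)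
  obtain f \<gamma> where fg: "cube_datum n G a0 f \<gamma>" "cube_bundle_iso n G (cube_bundle_of n G f \<gamma>) P"
    by (rule cube_bundle_trivial[OF P])
  obtain F \<Gamma> where F: "homotopy_datum n G a0 F \<Gamma>" "\<And>x. x \<in> topspace (cube n) \<Longrightarrow> F (x, 0) = f x"
    "\<And>x. x \<in> cube_boundary n \<Longrightarrow> \<Gamma> (x, 0) = \<gamma> x"
    "cube_bundle_iso n G (cube_bundle_of n G (\<lambda>x. F (x, 1)) (\<lambda>x. \<Gamma> (x, 1))) Q"
    by (rule trivialise_homotopy_free[OF hom fg(2,1)]) (rule that)
  have "cube_bundle_iso n G (cube_bundle_of n G (\<lambda>x. F (x, 0)) (\<lambda>x. \<Gamma> (x, 0))) P"
    using datum_bundle_cong(2)[OF locally_anodyne_cube cylinder_datum_at[OF F(1), of 0] F(2,3)] fg(2)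
    by (auto intro: bundle_iso_trans)
  then show ?thesis
    using homotopic_bundles_of_datum[OF cylinder_datum_reverse[OF F(1)]] F(4)
    by (auto simp: time_reverse_def intro: homotopic_bundles_iso)
qed

text \<open>The second homotopy can be trivialised starting with the very datum with which the first one ends. So the data
  can be concatenated instead of the bundles.\<close>

lemma homotopic_cube_bundles_trans:
  assumes PQ: "homotopic_cube_bundles n G a0 P Q" and QS: "homotopic_cube_bundles n G a0 Q S"
  shows "homotopic_cube_bundles n G a0 P S"
proof -
  have P: "cube_pair_bundle n G a0 P" using PQ by (simp add: homotopic_bundles_def)
  obtain f \<gamma> where fg: "cube_datum n G a0 f \<gamma>" "cube_bundle_iso n G (cube_bundle_of n G f \<gamma>) P"
    by (rule cube_bundle_trivial[OF P])
  obtain F \<Gamma> where F: "homotopy_datum n G a0 F \<Gamma>" "\<And>x. x \<in> topspace (cube n) \<Longrightarrow> F (x, 0) = f x"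
    "\<And>x. x \<in> cube_boundary n \<Longrightarrow> \<Gamma> (x, 0) = \<gamma> x"
    "cube_bundle_iso n G (cube_bundle_of n G (\<lambda>x. F (x, 1)) (\<lambda>x. \<Gamma> (x, 1))) Q"
    by (rule trivialise_homotopy_free[OF PQ fg(2,1)]) (rule that)
  obtain F' \<Gamma>' where F': "homotopy_datum n G a0 F' \<Gamma>'" "\<And>x. x \<in> topspace (cube n) \<Longrightarrow> F' (x, 0) = F (x, 1)"
    "\<And>x. x \<in> cube_boundary n \<Longrightarrow> \<Gamma>' (x, 0) = \<Gamma> (x, 1)"
    "cube_bundle_iso n G (cube_bundle_of n G (\<lambda>x. F' (x, 1)) (\<lambda>x. \<Gamma>' (x, 1))) S"
    by (rule trivialise_homotopy_free[OF QS F(4) cylinder_datum_at[OF F(1)]]) auto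
  have iso: "cube_bundle_iso n G (cube_bundle_of n G (\<lambda>x. F (x, 0)) (\<lambda>x. \<Gamma> (x, 0))) P"
    using datum_bundle_cong(2)[OF locally_anodyne_cube cylinder_datum_at[OF F(1), of 0] F(2,3)] fg(2)
    by (auto intro: bundle_iso_trans)
  have "homotopy_datum n G a0 (time_concat F F') (time_concat \<Gamma> \<Gamma>')"
    using F F' by (intro cylinder_datum_concat) auto
  from homotopic_bundles_of_datum[OF this] show ?thesis
    using iso F'(4) by (auto simp: time_concat_def intro: homotopic_bundles_iso)
qed

end

section \<open>Concatenation of bundles\<close>

text \<open>Data that are to be concatenated must agree on the common face. For \<open>n = 1\<close> this cannot be achieved by making them
  trivial near both ends of the interval, since only one end is at disposal when a trivialisation is chosen.\<close>

definition matched :: "nat \<Rightarrow> ((nat \<Rightarrow> real) \<Rightarrow> 'z) \<Rightarrow> ((nat \<Rightarrow> real) \<Rightarrow> 'z) \<Rightarrow> bool" where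
  "matched n d d' \<longleftrightarrow> (\<forall>x\<in>cube_boundary n. x 0 = 0 \<longrightarrow> d' x = d (x(0 := 1)))"

definition concat_homotopy ::
    "((nat \<Rightarrow> real) \<times> real \<Rightarrow> 'z) \<Rightarrow> ((nat \<Rightarrow> real) \<times> real \<Rightarrow> 'z) \<Rightarrow> (nat \<Rightarrow> real) \<times> real \<Rightarrow> 'z" where
  "concat_homotopy F F' z = concat_spheroid (\<lambda>x. F (x, snd z)) (\<lambda>x. F' (x, snd z)) (fst z)"

lemma cylinder_subcube_euclidean:
  assumes "A \<subseteq> topspace (cube n)" shows "cylinder (subtopology (cube n) A) = top_of_set (A \<times> {0..1})"
proof -
  have "subtopology (cube n) A = top_of_set A"
    by (subst cube_euclidean) (simp add: subtopology_subtopology Int_absorb1 assms)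
  then show ?thesis by simp
qed

lemma continuous_map_concat_homotopy:
  assumes A: "A \<subseteq> topspace (cube n)"
    and lower: "\<And>x. x \<in> A \<Longrightarrow> x 0 \<le> 1/2 \<Longrightarrow> x(0 := 2 * x 0) \<in> A"
    and upper: "\<And>x. x \<in> A \<Longrightarrow> 1/2 \<le> x 0 \<Longrightarrow> x(0 := 2 * x 0 - 1) \<in> A"
    and F: "continuous_map (cylinder (subtopology (cube n) A)) Y F"
      "continuous_map (cylinder (subtopology (cube n) A)) Y F'"
    and FF': "\<And>x t. x \<in> A \<Longrightarrow> x 0 = 0 \<Longrightarrow> t \<in> {0..1} \<Longrightarrow> F' (x, t) = F (x(0 := 1), t)"
  shows "continuous_map (cylinder (subtopology (cube n) A)) Y (concat_homotopy F F')"
proof -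
  have half: "continuous_map (subtopology (cylinder (subtopology (cube n) A)) S) Y (\<lambda>z. H ((fst z)(0 := c (fst z 0)), snd z))"
    if H: "continuous_map (cylinder (subtopology (cube n) A)) Y H" and c: "continuous_on UNIV c"
      and S: "\<And>z. z \<in> S \<Longrightarrow> fst z \<in> A \<Longrightarrow> (fst z)(0 := c (fst z 0)) \<in> A" for H S and c :: "real \<Rightarrow> real"
  proof (rule continuous_map_rescale[OF _ H])
    show "continuous_map (subtopology (cylinder (subtopology (cube n) A)) S) (cylinder (subtopology (cube n) A))
        (\<lambda>z. ((fst z)(0 := c (fst z 0)), snd z))"
      unfolding cylinder_subcube_euclidean[OF A] subtopology_subtopology
      using S by (auto intro!: continuous_intros continuous_on_compose2[OF c])
  qed
  have "continuous_map (cylinder (subtopology (cube n) A)) Y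
      (\<lambda>z. if fst z 0 \<le> 1/2 then F ((fst z)(0 := 2 * fst z 0), snd z) else F' ((fst z)(0 := 2 * fst z 0 - 1), snd z))"
  proof (rule continuous_map_cases_le)
    show "continuous_map (cylinder (subtopology (cube n) A)) euclideanreal (\<lambda>z. fst z 0)"
      unfolding cylinder_subcube_euclidean[OF A] by (auto intro!: continuous_intros)
    show "continuous_map (cylinder (subtopology (cube n) A)) euclideanreal (\<lambda>_. 1/2)" by simp
    show "continuous_map (subtopology (cylinder (subtopology (cube n) A))
        {z \<in> topspace (cylinder (subtopology (cube n) A)). fst z 0 \<le> 1/2}) Y (\<lambda>z. F ((fst z)(0 := 2 * fst z 0), snd z))"
      by (rule half[OF F(1)]) (auto intro!: continuous_intros lower)
    show "continuous_map (subtopology (cylinder (subtopology (cube n) A))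
        {z \<in> topspace (cylinder (subtopology (cube n) A)). 1/2 \<le> fst z 0}) Y (\<lambda>z. F' ((fst z)(0 := 2 * fst z 0 - 1), snd z))"
      by (rule half[OF F(2)]) (auto intro!: continuous_intros upper)
    fix z assume z: "z \<in> topspace (cylinder (subtopology (cube n) A))" "fst z 0 = 1/2"
    then have "fst z \<in> A" by auto
    then have "(fst z)(0 := 0) \<in> A" using upper[of "fst z"] z(2) by simp
    have h: "2 * fst z 0 = 1" using z(2) by simp
    with \<open>(fst z)(0 := 0) \<in> A\<close> show "F ((fst z)(0 := 2 * fst z 0), snd z) = F' ((fst z)(0 := 2 * fst z 0 - 1), snd z)"
      using FF'[of "(fst z)(0 := 0)" "snd z"] z(1) unfolding h by auto
  qed
  then show ?thesis by (simp add: concat_homotopy_def[abs_def] concat_spheroid_def)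
qed

lemma cube_halves:
  assumes "x \<in> topspace (cube n)" "0 < n"
  shows "x 0 \<le> 1/2 \<Longrightarrow> x(0 := 2 * x 0) \<in> topspace (cube n)"
    "1/2 \<le> x 0 \<Longrightarrow> x(0 := 2 * x 0 - 1) \<in> topspace (cube n)"
  using assms by (auto simp: in_cube)

lemma boundary_update:
  assumes "x \<in> cube_boundary n" "0 < n" "0 \<le> c" "c \<le> 1" "x 0 = 0 \<or> x 0 = 1 \<Longrightarrow> c = 0 \<or> c = 1"
  shows "x(0 := c) \<in> cube_boundary n"
proof -
  obtain i where i: "i < n" "x i = 0 \<or> x i = 1" using assms(1) by (auto simp: cube_boundary_def)
  have "x(0 := c) \<in> topspace (cube n)" using assms by (auto simp: in_cube cube_boundary_def)
  moreover have "\<exists>i<n. (x(0 := c)) i = 0 \<or> (x(0 := c)) i = 1"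
    using i assms(2,5) by (cases "i = 0") (auto intro: exI[of _ 0] exI[of _ i])
  ultimately show ?thesis by (simp add: cube_boundary_def)
qed

lemma boundary_face:
  assumes "x \<in> topspace (cube n)" "0 < n" "c = 0 \<or> c = 1" shows "x(0 := c) \<in> cube_boundary n"
  using assms by (auto simp: cube_boundary_def in_cube intro: exI[of _ 0])

lemma boundary_halves:
  assumes "x \<in> cube_boundary n" "0 < n"
  shows "x 0 \<le> 1/2 \<Longrightarrow> x(0 := 2 * x 0) \<in> cube_boundary n"
    "1/2 \<le> x 0 \<Longrightarrow> x(0 := 2 * x 0 - 1) \<in> cube_boundary n"
proof -
  have "0 \<le> x 0" "x 0 \<le> 1" using assms by (auto simp: cube_boundary_def in_cube)
  then show "x 0 \<le> 1/2 \<Longrightarrow> x(0 := 2 * x 0) \<in> cube_boundary n"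
    "1/2 \<le> x 0 \<Longrightarrow> x(0 := 2 * x 0 - 1) \<in> cube_boundary n"
    by (auto intro!: boundary_update assms)
qed

lemma homotopy_datum_concat:
  assumes n: "0 < n" and F: "homotopy_datum n G a0 F \<Gamma>" "homotopy_datum n G a0 F' \<Gamma>'"
    and m: "\<And>t. t \<in> {0..1} \<Longrightarrow> matched n (\<lambda>x. \<Gamma> (x, t)) (\<lambda>x. \<Gamma>' (x, t))"
  shows "homotopy_datum n G a0 (concat_homotopy F F') (concat_homotopy \<Gamma> \<Gamma>')"
proof -
  note D = F(1)[unfolded cylinder_datum_iff] and D' = F(2)[unfolded cylinder_datum_iff]
  have m': "\<Gamma>' (x, t) = \<Gamma> (x(0 := 1), t)" if "x \<in> cube_boundary n" "x 0 = 0" "t \<in> {0..1}" for x t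
    using m[OF that(3)] that by (simp add: matched_def)
  have mF: "F' (x, t) = F (x(0 := 1), t)" if "x \<in> topspace (cube n)" "x 0 = 0" "t \<in> {0..1}" for x t
  proof -
    have "x(0 := 0) = x" using that by auto
    then have "x \<in> cube_boundary n" "x(0 := 1) \<in> cube_boundary n"
      using boundary_face[OF that(1) n, of 0] boundary_face[OF that(1) n, of 1] by auto
    then show ?thesis using m'[of x t] that D D' by (metis (no_types, lifting) mem_Sigma_iff)
  qed
  have C: "continuous_map (cylinder (cube n)) (objs G) (concat_homotopy F F')"
    using continuous_map_concat_homotopy[of "topspace (cube n)" n "objs G" F F'] D D' cube_halves[OF _ n] mF
    by simp
  have "continuous_map (cylinder (subtopology (cube n) (cube_boundary n))) (arrs G) (concat_homotopy \<Gamma> \<Gamma>')"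
    using D D' boundary_halves[OF _ n] m' by (intro continuous_map_concat_homotopy) (auto simp: cube_boundary_subset)
  moreover have "tgt G (concat_homotopy \<Gamma> \<Gamma>' z) = concat_homotopy F F' z \<and> src G (concat_homotopy \<Gamma> \<Gamma>' z) = a0"
    if z: "z \<in> cube_boundary n \<times> {0..1}" for z
  proof (cases "fst z 0 \<le> 1/2")
    case True
    then have "((fst z)(0 := 2 * fst z 0), snd z) \<in> cube_boundary n \<times> {0..1}"
      using boundary_halves(1)[OF _ n, of "fst z"] z by auto
    then show ?thesis using D True by (simp add: concat_homotopy_def concat_spheroid_def)
  next
    case False
    then have "((fst z)(0 := 2 * fst z 0 - 1), snd z) \<in> cube_boundary n \<times> {0..1}"
      using boundary_halves(2)[OF _ n, of "fst z"] z by auto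
    then show ?thesis using D' False by (simp add: concat_homotopy_def concat_spheroid_def)
  qed
  ultimately show ?thesis unfolding cylinder_datum_iff using C cube_boundary_subset by blast
qed

lemma cube_datum_constant_homotopy: "cube_datum n G a0 f \<gamma> \<Longrightarrow> homotopy_datum n G a0 (\<lambda>z. f (fst z)) (\<lambda>z. \<gamma> (fst z))"
  unfolding cylinder_datum_iff unfolding section_datum_def by (auto intro: continuous_map_comp_fst)

lemma cube_datum_concat:
  assumes "0 < n" "cube_datum n G a0 f \<gamma>" "cube_datum n G a0 f' \<gamma>'" "matched n \<gamma> \<gamma>'"
  shows "cube_datum n G a0 (concat_spheroid f f') (concat_spheroid \<gamma> \<gamma>')"
  using cylinder_datum_at[OF homotopy_datum_concat[OF assms(1) cube_datum_constant_homotopy[OF assms(2)]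
      cube_datum_constant_homotopy[OF assms(3)]], of 0] assms(4)
  by (simp add: concat_homotopy_def)

lemma continuous_map_from_sum:
  assumes "\<And>i. i \<in> I \<Longrightarrow> continuous_map (X i) Y (\<lambda>x. f (i, x))"
  shows "continuous_map (sum_topology X I) Y f"
  unfolding continuous_map
proof (intro conjI allI impI)
  show "f ` topspace (sum_topology X I) \<subseteq> topspace Y"
    using assms continuous_map_apply by fastforce
  fix U assume U: "openin Y U"
  have "{x. (i, x) \<in> {z \<in> topspace (sum_topology X I). f z \<in> U}} = {x \<in> topspace (X i). f (i, x) \<in> U}" if "i \<in> I" for i
    using that by auto
  then show "openin (sum_topology X I) {z \<in> topspace (sum_topology X I). f z \<in> U}"
    using openin_continuous_map_preimage[OF assms U] by (auto simp: openin_sum_topology)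
qed

lemma bundle_iso_inverse:
  assumes "bundle_iso_map G A P Q \<phi>"
  obtains \<psi> where "continuous_map (total P) (total Q) \<phi>" "continuous_map (total Q) (total P) \<psi>"
    "\<And>p. p \<in> pts P \<Longrightarrow> \<psi> (\<phi> p) = p" "\<And>q. q \<in> pts Q \<Longrightarrow> \<phi> (\<psi> q) = q" "\<And>q. q \<in> pts Q \<Longrightarrow> \<psi> q \<in> pts P"
proof -
  obtain \<psi> where "homeomorphic_maps (total P) (total Q) \<phi> \<psi>"
    using assms by (auto simp: bundle_iso_map_def homeomorphic_map_maps)
  then show ?thesis using that[of \<psi>] by (auto simp: homeomorphic_maps_def dest: continuous_map_apply)
qed

lemma datum_bundle_iso_mapD:
  assumes \<phi>: "bundle_iso_map G A (datum_bundle G B f \<gamma>) P \<phi>" and bh: "b \<in> topspace B" "h \<in> ar G" "f b = tgt G h"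
  shows "\<phi> (b, h) \<in> pts P" "proj P (\<phi> (b, h)) = b" "anchor P (\<phi> (b, h)) = src G h"
    "\<lbrakk>k \<in> ar G; src G h = tgt G k\<rbrakk> \<Longrightarrow> act P (\<phi> (b, h)) k = \<phi> (b, gmul G h k)"
  using bundle_iso_mapD[OF \<phi>, of "(b, h)"] bh by (auto simp: datum_bundle_pts datum_bundle_simps(2-4))

context pointed_serre_groupoid
begin

text \<open>Let \<open>\<phi>\<close> and \<open>\<phi>'\<close> be the given trivialisations. As the data are matched, the gluing over the common
  face identifies \<open>\<phi>' (y, h)\<close> with \<open>\<phi> (y(0 := 1), h)\<close>. Hence \<open>\<phi>\<close> and \<open>\<phi>'\<close>, rescaled, fit together to a
  continuous map \<open>\<theta>\<close> on the bundle of the concatenated data; its inverse \<open>\<xi>\<close> is continuous because it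
  comes from a continuous map on the disjoint union.\<close>

theorem concat_bundle_iso:
  fixes P Q :: "(nat \<Rightarrow> real, 'o, 'a, 'p) gbundle"
  assumes n: "0 < n" and datum: "cube_datum n G a0 f \<gamma>" "cube_datum n G a0 f' \<gamma>'" and m: "matched n \<gamma> \<gamma>'"
    and P: "cube_bundle_iso n G (cube_bundle_of n G f \<gamma>) P" and Q: "cube_bundle_iso n G (cube_bundle_of n G f' \<gamma>') Q"
  shows "cube_bundle_iso n G (cube_bundle_of n G (concat_spheroid f f') (concat_spheroid \<gamma> \<gamma>')) (concat_bundle G P Q)"
proof -
  note D = section_datumD[OF datum(1)] and D' = section_datumD[OF datum(2)]
  interpret P: principal_pair_bundle G a0 "cube n" "cube_boundary n" P
    by (rule principal_pair_bundle_iso[OF cube_bundle_of_principal[OF datum(1)] P])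
  interpret Q: principal_pair_bundle G a0 "cube n" "cube_boundary n" Q
    by (rule principal_pair_bundle_iso[OF cube_bundle_of_principal[OF datum(2)] Q])
  obtain \<phi> where \<phi>: "bundle_iso_map G (cube_boundary n) (cube_bundle_of n G f \<gamma>) P \<phi>" using P by (auto simp: bundle_iso_def)
  obtain \<phi>' where \<phi>': "bundle_iso_map G (cube_boundary n) (cube_bundle_of n G f' \<gamma>') Q \<phi>'" using Q by (auto simp: bundle_iso_def)
  obtain \<psi> where c\<phi>: "continuous_map (total (cube_bundle_of n G f \<gamma>)) (total P) \<phi>"
    and c\<psi>: "continuous_map (total P) (total (cube_bundle_of n G f \<gamma>)) \<psi>"
    and \<psi>\<phi>: "\<And>p. p \<in> pts (cube_bundle_of n G f \<gamma>) \<Longrightarrow> \<psi> (\<phi> p) = p"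
    and \<phi>\<psi>: "\<And>q. q \<in> pts P \<Longrightarrow> \<phi> (\<psi> q) = q" "\<And>q. q \<in> pts P \<Longrightarrow> \<psi> q \<in> pts (cube_bundle_of n G f \<gamma>)"
    using bundle_iso_inverse[OF \<phi>] by metis
  obtain \<psi>' where c\<phi>': "continuous_map (total (cube_bundle_of n G f' \<gamma>')) (total Q) \<phi>'"
    and c\<psi>': "continuous_map (total Q) (total (cube_bundle_of n G f' \<gamma>')) \<psi>'"
    and \<psi>\<phi>': "\<And>p. p \<in> pts (cube_bundle_of n G f' \<gamma>') \<Longrightarrow> \<psi>' (\<phi>' p) = p"
    and \<phi>\<psi>': "\<And>q. q \<in> pts Q \<Longrightarrow> \<phi>' (\<psi>' q) = q" "\<And>q. q \<in> pts Q \<Longrightarrow> \<psi>' q \<in> pts (cube_bundle_of n G f' \<gamma>')"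
    using bundle_iso_inverse[OF \<phi>'] by metis
  note \<phi>D = datum_bundle_iso_mapD[OF \<phi>] and \<phi>D' = datum_bundle_iso_mapD[OF \<phi>']
  define S where "S = sum_topology (\<lambda>i. total (if i then Q else P)) UNIV"
  define q where "q = glue_map G P Q"
  define T where "T = quotient_topology S q"
  let ?F = "concat_spheroid f f'" and ?\<Gamma> = "concat_spheroid \<gamma> \<gamma>'" and ?C = "concat_bundle G P Q"
  let ?D = "cube_bundle_of n G ?F ?\<Gamma>"
  have totC: "total ?C = T" by (simp add: concat_bundle_def T_def S_def q_def)
  have topS: "(i, p) \<in> topspace S \<longleftrightarrow> p \<in> pts (if i then Q else P)" for i p by (simp add: S_def)
  have cq: "continuous_map S T q" unfolding T_def by (rule quotient_imp_continuous_map[OF quotient_map_quotient_topology])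
  have cinj: "continuous_map (total P) S (\<lambda>p. (False, p))" "continuous_map (total Q) S (\<lambda>p. (True, p))"
    unfolding S_def using continuous_map_component_injection[of False UNIV "\<lambda>i. total (if i then Q else P)"]
      continuous_map_component_injection[of True UNIV "\<lambda>i. total (if i then Q else P)"] by auto
  \<comment> \<open>The gluing identifies the two descriptions of a point over the common face.\<close>
  have glue: "q (True, \<phi>' (y, h)) = (False, \<phi> (y(0 := 1), h))"
    if y: "y \<in> topspace (cube n)" "y 0 = 0" "h \<in> ar G" "f' y = tgt G h" for y h
  proof -
    have y0: "y(0 := 0) = y" using y by auto
    have yb: "y \<in> cube_boundary n" "y(0 := 1) \<in> cube_boundary n"
      using boundary_face[OF y(1) n, of 0] boundary_face[OF y(1) n, of 1] y0 by auto
    have yc: "y(0 := 1) \<in> topspace (cube n)" using yb(2) D(1) by blast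
    have g: "\<gamma>' y = \<gamma> (y(0 := 1))" using m yb y by (simp add: matched_def)
    have gi: "ginv G (\<gamma>' y) \<in> ar G" using D'(6)[OF yb(1)] by (rule ginv_closed)
    have gih: "gmul G (ginv G (\<gamma>' y)) h \<in> ar G" "tgt G (gmul G (ginv G (\<gamma>' y)) h) = a0"
      using D'(4-6)[OF yb(1)] y gi by (simp_all add: gmul_closed src_ginv tgt_gmul tgt_ginv)
    have s: "sect Q y = \<phi>' (y, \<gamma>' y)" "sect P (y(0 := 1)) = \<phi> (y(0 := 1), \<gamma> (y(0 := 1)))"
      using bundle_iso_map_sect[OF \<phi>' yb(1)] bundle_iso_map_sect[OF \<phi> yb(2)] by (simp_all add: datum_bundle_simps)
    have "act Q (sect Q y) (gmul G (ginv G (\<gamma>' y)) h) = \<phi>' (y, h)"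
      unfolding s using \<phi>D'(4)[OF y(1), of "\<gamma>' y" "gmul G (ginv G (\<gamma>' y)) h"] D'(4-6)[OF yb(1)] gih y
      by (simp add: gmul_cancel_left')
    then have "transporter G Q (sect Q y) (\<phi>' (y, h)) = gmul G (ginv G (\<gamma>' y)) h"
      using Q.sect_closed[OF yb(1)] Q.anchor_sect[OF yb(1)] gih by (intro Q.transporter_unique) auto
    moreover have "act P (sect P (y(0 := 1))) (gmul G (ginv G (\<gamma>' y)) h) = \<phi> (y(0 := 1), h)"
      unfolding s(2) using \<phi>D(4)[OF yc, of "\<gamma> (y(0 := 1))" "gmul G (ginv G (\<gamma>' y)) h"] D(4-6)[OF yb(2)] D'(4)[OF yb(1)] gih y
      by (simp add: g gmul_cancel_left')
    ultimately show ?thesis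
      using \<phi>D'(2)[OF y(1,3,4)] y(2) by (simp add: q_def glue_map_def face_iso_def)
  qed
  define \<theta> where "\<theta> z = (if fst z 0 \<le> 1/2 then (False, \<phi> ((fst z)(0 := 2 * fst z 0), snd z))
      else (True, \<phi>' ((fst z)(0 := 2 * fst z 0 - 1), snd z)))" for z
  define \<xi> where "\<xi> z = (if fst z then ((proj Q (snd z))(0 := (proj Q (snd z) 0 + 1) / 2), snd (\<psi>' (snd z)))
      else ((proj P (snd z))(0 := proj P (snd z) 0 / 2), snd (\<psi> (snd z))))" for z
  have ptsD: "z \<in> pts ?D \<longleftrightarrow> fst z \<in> topspace (cube n) \<and> snd z \<in> ar G \<and> ?F (fst z) = tgt G (snd z)" for z
    by (rule datum_bundle_pts)
  have lowD: "(fst z)(0 := 2 * fst z 0) \<in> topspace (cube n)" "f ((fst z)(0 := 2 * fst z 0)) = tgt G (snd z)" "snd z \<in> ar G"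
    if "z \<in> pts ?D" "fst z 0 \<le> 1/2" for z
    using that cube_halves(1)[OF _ n, of "fst z"] unfolding ptsD by (auto simp: concat_spheroid_def)
  have uppD: "(fst z)(0 := 2 * fst z 0 - 1) \<in> topspace (cube n)" "f' ((fst z)(0 := 2 * fst z 0 - 1)) = tgt G (snd z)" "snd z \<in> ar G"
    if z: "z \<in> pts ?D" "1/2 \<le> fst z 0" for z
  proof -
    show c: "(fst z)(0 := 2 * fst z 0 - 1) \<in> topspace (cube n)" "snd z \<in> ar G"
      using z cube_halves(2)[OF _ n, of "fst z"] unfolding ptsD by auto
    show "f' ((fst z)(0 := 2 * fst z 0 - 1)) = tgt G (snd z)"
    proof (cases "fst z 0 = 1/2")
      case True
      have b: "(fst z)(0 := 0) \<in> cube_boundary n" "(fst z)(0 := 1) \<in> cube_boundary n"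
        using boundary_face[OF _ n, of "fst z"] z unfolding ptsD by auto
      have "f' ((fst z)(0 := 0)) = f ((fst z)(0 := 1))"
        using D(4)[OF b(2)] D'(4)[OF b(1)] m b(1) by (auto simp: matched_def)
      moreover have h: "2 * fst z 0 = 1" using True by simp
      ultimately show ?thesis using lowD(2)[OF z(1)] True unfolding h by simp
    next
      case False then show ?thesis using z unfolding ptsD by (auto simp: concat_spheroid_def)
    qed
  qed
  have topD: "total ?D = subtopology (prod_topology (cube n) (arrs G)) {z. ?F (fst z) = tgt G (snd z)}"
    by (simp add: datum_bundle_simps case_prod_unfold)
  have cfst: "continuous_map (total ?D) (cube n) fst" and csnd: "continuous_map (total ?D) (arrs G) snd"
    by (simp_all add: datum_bundle_simps continuous_map_from_subtopology continuous_map_fst continuous_map_snd)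
  have upd: "continuous_map (subtopology (total ?D) U) (cube n) (\<lambda>z. (fst z)(0 := c (fst z 0)))"
    if c: "continuous_on UNIV c" and U: "\<And>z. z \<in> pts ?D \<Longrightarrow> z \<in> U \<Longrightarrow> (fst z)(0 := c (fst z 0)) \<in> topspace (cube n)"
    for U and c :: "real \<Rightarrow> real"
  proof -
    have "continuous_map (cube n) (powertop_real UNIV) (\<lambda>x. x(0 := c (x 0)))"
      unfolding euclidean_product_topology
      by (subst cube_euclidean) (auto intro!: continuous_intros continuous_on_compose2[OF c])
    then have "continuous_map (total ?D) (powertop_real UNIV) (\<lambda>z. (fst z)(0 := c (fst z 0)))"
      using continuous_map_compose[OF cfst] by (fastforce simp: comp_def)
    then show ?thesis using U
      by (subst cube_euclidean)
        (auto simp: continuous_map_in_subtopology euclidean_product_topology intro: continuous_map_from_subtopology)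
  qed
  have c\<theta>: "continuous_map (total ?D) T \<theta>"
  proof (rule continuous_map_eq)
    show "continuous_map (total ?D) T (\<lambda>z. if fst z 0 \<le> 1/2 then q (False, \<phi> ((fst z)(0 := 2 * fst z 0), snd z))
        else q (True, \<phi>' ((fst z)(0 := 2 * fst z 0 - 1), snd z)))"
    proof (rule continuous_map_cases_le)
      have "continuous_map (cube n) euclideanreal (\<lambda>x. x 0)"
        by (subst cube_euclidean) (auto intro!: continuous_intros)
      then show "continuous_map (total ?D) euclideanreal (\<lambda>z. fst z 0)"
        using continuous_map_compose[OF cfst] by (fastforce simp: comp_def)
      show "continuous_map (total ?D) euclideanreal (\<lambda>_. 1/2)" by simp
      let ?L = "{z \<in> pts ?D. fst z 0 \<le> 1/2}" and ?U = "{z \<in> pts ?D. 1/2 \<le> fst z 0}"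
      have "continuous_map (subtopology (total ?D) ?L) (total (cube_bundle_of n G f \<gamma>)) (\<lambda>z. ((fst z)(0 := 2 * fst z 0), snd z))"
        unfolding datum_bundle_simps(1)[of G "cube n" f] continuous_map_in_subtopology
        using upd[of "\<lambda>t. 2 * t" ?L] lowD csnd
        by (auto intro!: continuous_map_pairedI continuous_intros intro: continuous_map_from_subtopology)
      from continuous_map_compose[OF continuous_map_compose[OF continuous_map_compose[OF this c\<phi>] cinj(1)] cq]
      show "continuous_map (subtopology (total ?D) ?L) T (\<lambda>z. q (False, \<phi> ((fst z)(0 := 2 * fst z 0), snd z)))"
        by (simp add: comp_def)
      have "continuous_map (subtopology (total ?D) ?U) (total (cube_bundle_of n G f' \<gamma>')) (\<lambda>z. ((fst z)(0 := 2 * fst z 0 - 1), snd z))"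
        unfolding datum_bundle_simps(1)[of G "cube n" f'] continuous_map_in_subtopology
        using upd[of "\<lambda>t. 2 * t - 1" ?U, OF continuous_on_diff[OF continuous_on_mult_left[OF continuous_on_id] continuous_on_const]]
          uppD csnd
        by (auto intro!: continuous_map_pairedI continuous_intros intro: continuous_map_from_subtopology)
      from continuous_map_compose[OF continuous_map_compose[OF continuous_map_compose[OF this c\<phi>'] cinj(2)] cq]
      show "continuous_map (subtopology (total ?D) ?U) T (\<lambda>z. q (True, \<phi>' ((fst z)(0 := 2 * fst z 0 - 1), snd z)))"
        by (simp add: comp_def)
      fix z assume z: "z \<in> pts ?D" "fst z 0 = 1/2"
      then have h: "2 * fst z 0 = 1" by simp
      show "q (False, \<phi> ((fst z)(0 := 2 * fst z 0), snd z)) = q (True, \<phi>' ((fst z)(0 := 2 * fst z 0 - 1), snd z))"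
        using glue[of "(fst z)(0 := 0)" "snd z"] uppD[of z] z unfolding h by (simp add: q_def glue_map_def)
    qed
    fix z assume z: "z \<in> pts ?D"
    show "(if fst z 0 \<le> 1/2 then q (False, \<phi> ((fst z)(0 := 2 * fst z 0), snd z))
        else q (True, \<phi>' ((fst z)(0 := 2 * fst z 0 - 1), snd z))) = \<theta> z"
    proof (cases "fst z 0 \<le> 1/2")
      case False
      then have "1/2 \<le> fst z 0" by simp
      then show ?thesis using False \<phi>D'(2)[OF uppD(1,3,2)[OF z]] by (simp add: \<theta>_def q_def glue_map_def)
    qed (simp add: \<theta>_def q_def glue_map_def)
  qed
  have \<phi>P: "\<exists>y h. p = \<phi> (y, h) \<and> y \<in> topspace (cube n) \<and> h \<in> ar G \<and> f y = tgt G h" if "p \<in> pts P" for p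
    using \<phi>\<psi>[OF that] by (metis datum_bundle_pts prod.collapse)
  have \<phi>Q: "\<exists>y h. p = \<phi>' (y, h) \<and> y \<in> topspace (cube n) \<and> h \<in> ar G \<and> f' y = tgt G h" if "p \<in> pts Q" for p
    using \<phi>\<psi>'[OF that] by (metis datum_bundle_pts prod.collapse)
  have \<xi>\<phi>: "\<xi> (False, \<phi> (y, h)) = (y(0 := y 0 / 2), h)" if "y \<in> topspace (cube n)" "h \<in> ar G" "f y = tgt G h" for y h
    using \<phi>D(2)[OF that] \<psi>\<phi>[of "(y, h)"] that by (simp add: \<xi>_def datum_bundle_pts)
  have \<xi>\<phi>': "\<xi> (True, \<phi>' (y, h)) = (y(0 := (y 0 + 1) / 2), h)" if "y \<in> topspace (cube n)" "h \<in> ar G" "f' y = tgt G h" for y h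
    using \<phi>D'(2)[OF that] \<psi>\<phi>'[of "(y, h)"] that by (simp add: \<xi>_def datum_bundle_pts)
  have F0: "?F (y(0 := y 0 / 2)) = f y" if "y \<in> topspace (cube n)" for y
    using that n by (auto simp: concat_spheroid_def in_cube)
  have F1: "?F (y(0 := (y 0 + 1) / 2)) = f' y" if y: "y \<in> topspace (cube n)" for y
  proof (cases "y 0 = 0")
    case True
    then have "y(0 := 0) = y" by auto
    then have b: "y \<in> cube_boundary n" "y(0 := 1) \<in> cube_boundary n"
      using boundary_face[OF y n, of 0] boundary_face[OF y n, of 1] by auto
    then have "f' y = f (y(0 := 1))" using D(4)[OF b(2)] D'(4)[OF b(1)] m True by (auto simp: matched_def)
    then show ?thesis using True by (simp add: concat_spheroid_def)
  next
    case False
    moreover have "0 \<le> y 0" using y n by (simp add: in_cube)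
    ultimately have nl: "\<not> (y 0 + 1) / 2 \<le> 1/2" by simp
    have e: "2 * ((y 0 + 1) / 2) - 1 = y 0" by (simp add: field_simps)
    show ?thesis unfolding concat_spheroid_def fun_upd_same fun_upd_upd if_not_P[OF nl] e by simp
  qed
  have scaled: "y(0 := y 0 / 2) \<in> topspace (cube n)" "y(0 := (y 0 + 1) / 2) \<in> topspace (cube n)"
    if y: "y \<in> topspace (cube n)" for y
  proof -
    have "0 \<le> y 0 \<and> y 0 \<le> 1" using y n by (simp add: in_cube)
    then show "y(0 := y 0 / 2) \<in> topspace (cube n)" "y(0 := (y 0 + 1) / 2) \<in> topspace (cube n)"
      using y n by (auto simp: in_cube)
  qed
  have c\<xi>S: "continuous_map S (total ?D) \<xi>"
    unfolding S_def
  proof (rule continuous_map_from_sum)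
    fix i :: bool
    have scale: "continuous_map X (cube n) (\<lambda>p. (b p)(0 := c (b p 0)))"
      if b: "continuous_map X (cube n) b" and c: "continuous_on UNIV c" "\<And>t. 0 \<le> t \<Longrightarrow> t \<le> 1 \<Longrightarrow> 0 \<le> c t \<and> c t \<le> 1"
      for X :: "'p topology" and b and c :: "real \<Rightarrow> real"
    proof -
      have "continuous_map (cube n) (cube n) (\<lambda>x. x(0 := c (x 0)))"
        using n c(2) by (intro continuous_map_cubeI)
          (auto simp: in_cube intro!: continuous_intros continuous_on_compose2[OF c(1)])
      from continuous_map_compose[OF b this] show ?thesis by (simp add: comp_def)
    qed
    have chalf: "continuous_on UNIV (\<lambda>t::real. t / 2)" "continuous_on UNIV (\<lambda>t::real. (t + 1) / 2)"
      by (intro continuous_intros; simp)+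
    have snd: "continuous_map (total P) (arrs G) (\<lambda>p. snd (\<psi> p))" "continuous_map (total Q) (arrs G) (\<lambda>p. snd (\<psi>' p))"
      using continuous_map_compose[OF c\<psi>, of "arrs G" snd] continuous_map_compose[OF c\<psi>', of "arrs G" snd]
      by (simp_all add: datum_bundle_simps continuous_map_from_subtopology continuous_map_snd comp_def)
    have "\<xi> (False, p) \<in> pts ?D" if "p \<in> pts P" for p
    proof -
      obtain y h where "p = \<phi> (y, h)" "y \<in> topspace (cube n)" "h \<in> ar G" "f y = tgt G h" using \<phi>P[OF \<open>p \<in> pts P\<close>] by blast
      then show ?thesis using \<xi>\<phi> F0[of y] scaled[of y] by (simp add: ptsD)
    qed
    moreover have "\<xi> (True, p) \<in> pts ?D" if "p \<in> pts Q" for p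
    proof -
      obtain y h where "p = \<phi>' (y, h)" "y \<in> topspace (cube n)" "h \<in> ar G" "f' y = tgt G h" using \<phi>Q[OF \<open>p \<in> pts Q\<close>] by blast
      then show ?thesis using \<xi>\<phi>' F1[of y] scaled[of y] by (simp add: ptsD)
    qed
    moreover have "continuous_map (total P) (prod_topology (cube n) (arrs G)) (\<lambda>p. \<xi> (False, p))"
      unfolding \<xi>_def using scale[OF P.proj_continuous chalf(1)] snd
      by (simp add: continuous_map_pairedI)
    moreover have "continuous_map (total Q) (prod_topology (cube n) (arrs G)) (\<lambda>p. \<xi> (True, p))"
      unfolding \<xi>_def using scale[OF Q.proj_continuous chalf(2)] snd
      by (simp add: continuous_map_pairedI)
    ultimately show "continuous_map (total (if i then Q else P)) (total ?D) (\<lambda>x. \<xi> (i, x))"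
      unfolding topD continuous_map_in_subtopology by (cases i) (auto simp: ptsD[unfolded topD])
  qed
  have \<xi>q: "\<xi> (q z) = \<xi> z" if z: "z \<in> topspace S" for z
  proof (cases "fst z \<and> proj Q (snd z) 0 = 0")
    case True
    then have "snd z \<in> pts Q" using z topS[of "fst z" "snd z"] by (cases z) auto
    then obtain y h where y: "snd z = \<phi>' (y, h)" "y \<in> topspace (cube n)" "h \<in> ar G" "f' y = tgt G h" using \<phi>Q by blast
    have y0: "y 0 = 0" using True \<phi>D'(2)[OF y(2-4)] y(1) by simp
    then have "y(0 := 0) = y" by auto
    then have b: "y \<in> cube_boundary n" "y(0 := 1) \<in> cube_boundary n"
      using boundary_face[OF y(2) n, of 0] boundary_face[OF y(2) n, of 1] by auto
    have "f (y(0 := 1)) = tgt G h" using D(4)[OF b(2)] D'(4)[OF b(1)] m b y0 y(4) by (auto simp: matched_def)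
    moreover have "y(0 := 1) \<in> topspace (cube n)" using b D(1) by blast
    moreover have "z = (True, \<phi>' (y, h))" using True y(1) by (simp add: prod_eq_iff)
    ultimately show ?thesis using glue[OF y(2) y0 y(3,4)] \<xi>\<phi>[of "y(0 := 1)" h] \<xi>\<phi>'[OF y(2-4)] y(3) y0 by simp
  qed (auto simp: q_def glue_map_def case_prod_unfold)
  have c\<xi>: "continuous_map T (total ?D) \<xi>"
    unfolding T_def
  proof (rule continuous_compose_quotient_map[OF quotient_map_quotient_topology])
    show "continuous_map S (total ?D) (\<xi> \<circ> q)" by (rule continuous_map_eq[OF c\<xi>S]) (simp add: \<xi>q)
  qed
  have \<xi>\<theta>: "\<xi> (\<theta> z) = z" if z: "z \<in> pts ?D" for z
  proof (cases "fst z 0 \<le> 1/2")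
    case True
    then show ?thesis using \<xi>\<phi>[OF lowD(1,3,2)[OF z True]] by (simp add: \<theta>_def prod_eq_iff)
  next
    case False
    then have u: "1/2 \<le> fst z 0" by simp
    show ?thesis using \<xi>\<phi>'[OF uppD(1,3,2)[OF z u]] False by (simp add: \<theta>_def prod_eq_iff)
  qed
  have \<theta>\<xi>: "\<theta> (\<xi> w) = w" if w: "w \<in> topspace T" for w
  proof -
    obtain z where z: "z \<in> topspace S" "w = q z" using w by (auto simp: T_def topspace_quotient_topology)
    have low: "\<theta> (\<xi> (False, p)) = (False, p)" if "p \<in> pts P" for p
    proof -
      obtain y h where y: "p = \<phi> (y, h)" "y \<in> topspace (cube n)" "h \<in> ar G" "f y = tgt G h" using \<phi>P[OF \<open>p \<in> pts P\<close>] by blast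
      then have "y 0 \<le> 1" using n by (simp add: in_cube)
      then show ?thesis using \<xi>\<phi>[OF y(2-4)] y(1) by (simp add: \<theta>_def)
    qed
    show ?thesis
    proof (cases "fst z \<and> proj Q (snd z) 0 \<noteq> 0")
      case True
      then have "snd z \<in> pts Q" using z topS[of "fst z" "snd z"] by (cases z) auto
      then obtain y h where y: "snd z = \<phi>' (y, h)" "y \<in> topspace (cube n)" "h \<in> ar G" "f' y = tgt G h" using \<phi>Q by blast
      have "y 0 \<noteq> 0" "0 \<le> y 0" using True \<phi>D'(2)[OF y(2-4)] y(1,2) n by (auto simp: in_cube)
      then have "\<theta> (\<xi> (True, \<phi>' (y, h))) = (True, \<phi>' (y, h))" using \<xi>\<phi>'[OF y(2-4)] by (simp add: \<theta>_def add_divide_distrib)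
      moreover have "w = (True, \<phi>' (y, h))" using True z y(1) by (cases z) (auto simp: q_def glue_map_def)
      ultimately show ?thesis by simp
    next
      case False
      have "\<exists>p. w = (False, p) \<and> p \<in> pts P"
      proof (cases "fst z")
        case True
        then have "snd z \<in> pts Q" using z topS[of "fst z" "snd z"] by (cases z) auto
        then obtain y h where y: "snd z = \<phi>' (y, h)" "y \<in> topspace (cube n)" "h \<in> ar G" "f' y = tgt G h" using \<phi>Q by blast
        have y0: "y 0 = 0" using True False \<phi>D'(2)[OF y(2-4)] y(1) by simp
        then have "y(0 := 0) = y" by auto
        then have b: "y \<in> cube_boundary n" "y(0 := 1) \<in> cube_boundary n"
          using boundary_face[OF y(2) n, of 0] boundary_face[OF y(2) n, of 1] by auto
        have "f (y(0 := 1)) = tgt G h" using D(4)[OF b(2)] D'(4)[OF b(1)] m b y0 y(4) by (auto simp: matched_def)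
        moreover have "y(0 := 1) \<in> topspace (cube n)" using b D(1) by blast
        moreover have "z = (True, \<phi>' (y, h))" using True y(1) by (simp add: prod_eq_iff)
        ultimately show ?thesis using glue[OF y(2) y0 y(3,4)] z \<phi>D(1) y(3) by auto
      next
        case False
        then show ?thesis using z topS[of "fst z" "snd z"] by (cases z) (auto simp: q_def glue_map_def)
      qed
      then show ?thesis using low by auto
    qed
  qed
  have "homeomorphic_maps (total ?D) (total ?C) \<theta> \<xi>"
    unfolding homeomorphic_maps_def totC using c\<theta> c\<xi> \<xi>\<theta> \<theta>\<xi> by blast
  then have "bundle_iso_map G (cube_boundary n) ?D ?C \<theta>"
    unfolding bundle_iso_map_def
  proof (intro conjI ballI impI)
    fix z assume z: "z \<in> pts ?D"
    have u: "1/2 \<le> fst z 0" if "\<not> fst z 0 \<le> 1/2" using that by simp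
    show "proj ?C (\<theta> z) = proj ?D z" "anchor ?C (\<theta> z) = anchor ?D z"
      using \<phi>D(2,3)[OF lowD(1,3,2)[OF z]] \<phi>D'(2,3)[OF uppD(1,3,2)[OF z u]]
      by (cases "fst z 0 \<le> 1/2"; simp add: \<theta>_def concat_bundle_def datum_bundle_simps case_prod_unfold)+
    fix k assume k: "k \<in> ar G" "anchor ?D z = tgt G k"
    show "\<theta> (act ?D z k) = act ?C (\<theta> z) k"
      using \<phi>D(4)[OF lowD(1,3,2)[OF z] k(1)] \<phi>D'(4)[OF uppD(1,3,2)[OF z u] k(1)] k(2)
      by (cases "fst z 0 \<le> 1/2"; simp add: \<theta>_def concat_bundle_def datum_bundle_simps case_prod_unfold)
  next
    fix x assume x: "x \<in> cube_boundary n"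
    show "\<theta> (sect ?D x) = sect ?C x"
      using bundle_iso_map_sect[OF \<phi> boundary_halves(1)[OF x n]] bundle_iso_map_sect[OF \<phi>' boundary_halves(2)[OF x n]]
      by (cases "x 0 \<le> 1/2") (simp_all add: \<theta>_def concat_bundle_def datum_bundle_simps concat_spheroid_def)
  qed (auto simp: homeomorphic_map_maps)
  then show ?thesis by (auto simp: bundle_iso_def)
qed

end

section \<open>Extension of the structure groupoid\<close>

lemma (in topological_groupoid) ginv_gmul:
  assumes "g \<in> ar G" "h \<in> ar G" "src G g = tgt G h"
  shows "ginv G (gmul G g h) = gmul G (ginv G h) (ginv G g)"
proof -
  let ?k = "gmul G (ginv G h) (ginv G g)"
  have gh: "gmul G g h \<in> ar G" "src G (gmul G g h) = src G h" "tgt G (gmul G g h) = tgt G g"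
    using assms by (simp_all add: gmul_closed src_gmul tgt_gmul)
  have k: "?k \<in> ar G" "tgt G ?k = src G h"
    using assms by (simp_all add: gmul_closed ginv_closed src_ginv tgt_ginv tgt_gmul)
  have "gmul G (gmul G g h) ?k = gmul G g (gmul G h ?k)"
    using assms gh k by (intro gmul_assoc) auto
  also have "gmul G h ?k = ginv G g" using assms by (intro gmul_cancel_left') (simp_all add: ginv_closed tgt_ginv)
  finally have "gmul G (gmul G g h) ?k = gunit G (tgt G g)" using assms by (simp add: gmul_ginv_right)
  then have "gmul G (ginv G (gmul G g h)) (gmul G (gmul G g h) ?k) = ginv G (gmul G g h)"
    using gh gmul_gunit_right[of "ginv G (gmul G g h)"] by (simp add: ginv_closed src_ginv)
  then show ?thesis using gmul_cancel_left[OF gh(1) k(1)] gh k by simp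
qed

locale pointed_serre_morphism =
  G: pointed_serre_groupoid G a0 + H: pointed_serre_groupoid H b0
  for G :: "('o, 'a) groupoid" and a0 :: 'o and H :: "('o2, 'a2) groupoid" and b0 :: 'o2 +
  fixes \<phi>0 :: "'o \<Rightarrow> 'o2" and \<phi>1 :: "'a \<Rightarrow> 'a2"
  assumes morphism: "pointed_groupoid_morphism G a0 H b0 \<phi>0 \<phi>1"
begin

lemma \<phi>0_continuous: "continuous_map (objs G) (objs H) \<phi>0" and \<phi>1_continuous: "continuous_map (arrs G) (arrs H) \<phi>1"
  and \<phi>0_base: "\<phi>0 a0 = b0"
  and \<phi>1_src: "g \<in> ar G \<Longrightarrow> src H (\<phi>1 g) = \<phi>0 (src G g)" and \<phi>1_tgt: "g \<in> ar G \<Longrightarrow> tgt H (\<phi>1 g) = \<phi>0 (tgt G g)"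
  and \<phi>1_gunit: "x \<in> ob G \<Longrightarrow> \<phi>1 (gunit G x) = gunit H (\<phi>0 x)"
  and \<phi>1_gmul: "\<lbrakk>g \<in> ar G; h \<in> ar G; src G g = tgt G h\<rbrakk> \<Longrightarrow> \<phi>1 (gmul G g h) = gmul H (\<phi>1 g) (\<phi>1 h)"
  using morphism by (auto simp: pointed_groupoid_morphism_def)

lemma \<phi>1_closed: "g \<in> ar G \<Longrightarrow> \<phi>1 g \<in> ar H" and \<phi>0_closed: "x \<in> ob G \<Longrightarrow> \<phi>0 x \<in> ob H"
  using continuous_map_apply[OF \<phi>1_continuous] continuous_map_apply[OF \<phi>0_continuous] by auto

lemma section_datum_map:
  assumes "section_datum G a0 B A f \<gamma>" shows "section_datum H b0 B A (\<phi>0 \<circ> f) (\<phi>1 \<circ> \<gamma>)"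
  using section_datumD[OF assms] continuous_map_compose[OF _ \<phi>0_continuous] continuous_map_compose[OF _ \<phi>1_continuous]
  unfolding section_datum_def by (auto simp: \<phi>1_src \<phi>1_tgt \<phi>0_base)

text \<open>Let \<open>\<tau>\<close> be the global section of \<open>P\<close> that belongs to the trivialisation. The orbit of \<open>(\<tau> b k, h)\<close> contains
  \<open>(\<tau> b, \<phi>1 k h)\<close>, and this is its only element of the form \<open>(\<tau> b, h')\<close>. So the quotient is the
  set of pairs \<open>(b, h')\<close>, topologised as a product because \<open>\<xi>'\<close>, which computes \<open>h'\<close>, is continuous before
  passing to orbits.\<close>

theorem extension_bundle_iso:
  assumes P: "principal_pair_bundle G a0 B A P" and datum: "section_datum G a0 B A f \<gamma>"
    and iso: "bundle_iso G A (datum_bundle G B f \<gamma>) P"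
  shows "bundle_iso H A (datum_bundle H B (\<phi>0 \<circ> f) (\<phi>1 \<circ> \<gamma>)) (extension_bundle G H \<phi>0 \<phi>1 P)"
proof -
  interpret P: principal_pair_bundle G a0 B A P by (rule P)
  note D = section_datumD[OF datum]
  obtain \<kappa> where \<kappa>: "bundle_iso_map G A (datum_bundle G B f \<gamma>) P \<kappa>" using iso by (auto simp: bundle_iso_def)
  note \<kappa>D = datum_bundle_iso_mapD[OF \<kappa>]
  obtain \<omega> where c\<kappa>: "continuous_map (total (datum_bundle G B f \<gamma>)) (total P) \<kappa>"
    and c\<omega>: "continuous_map (total P) (total (datum_bundle G B f \<gamma>)) \<omega>"
    and \<omega>\<kappa>: "\<And>p. p \<in> pts (datum_bundle G B f \<gamma>) \<Longrightarrow> \<omega> (\<kappa> p) = p"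
    and \<kappa>\<omega>: "\<And>q. q \<in> pts P \<Longrightarrow> \<kappa> (\<omega> q) = q" "\<And>q. q \<in> pts P \<Longrightarrow> \<omega> q \<in> pts (datum_bundle G B f \<gamma>)"
    using bundle_iso_inverse[OF \<kappa>] by metis
  define E where "E = subtopology (prod_topology (total P) (arrs H)) {(p, h). \<phi>0 (anchor P p) = tgt H h}"
  define q where "q = extension_orbit G H \<phi>1 P"
  define T where "T = quotient_topology E q"
  let ?X = "extension_bundle G H \<phi>0 \<phi>1 P" and ?D = "datum_bundle H B (\<phi>0 \<circ> f) (\<phi>1 \<circ> \<gamma>)"
  have totX: "total ?X = T" by (simp add: extension_bundle_def T_def E_def q_def)
  have E: "(p, h) \<in> topspace E \<longleftrightarrow> p \<in> pts P \<and> h \<in> ar H \<and> \<phi>0 (anchor P p) = tgt H h" for p h by (simp add: E_def)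
  have q: "z \<in> q (p, h) \<longleftrightarrow> (\<exists>g\<in>ar G. anchor P p = tgt G g \<and> z = (act P p g, gmul H (ginv H (\<phi>1 g)) h))" for z p h
    by (auto simp: q_def extension_orbit_def)
  have cq: "continuous_map E T q" unfolding T_def by (rule quotient_imp_continuous_map[OF quotient_map_quotient_topology])
  have step: "(act P p g, gmul H (ginv H (\<phi>1 g)) h) \<in> topspace E"
    "q (act P p g, gmul H (ginv H (\<phi>1 g)) h) = q (p, h)"
    if ph: "(p, h) \<in> topspace E" and g: "g \<in> ar G" "anchor P p = tgt G g" for p h g
  proof -
    have p: "p \<in> pts P" and h: "h \<in> ar H" "\<phi>0 (anchor P p) = tgt H h" using ph by (auto simp: E)
    have gh: "src H (ginv H (\<phi>1 g)) = tgt H h" "ginv H (\<phi>1 g) \<in> ar H" using g h by (simp_all add: H.src_ginv \<phi>1_closed \<phi>1_tgt H.ginv_closed)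
    show "(act P p g, gmul H (ginv H (\<phi>1 g)) h) \<in> topspace E"
      using p h g gh by (simp add: E P.act_closed P.anchor_act H.gmul_closed H.tgt_gmul H.tgt_ginv \<phi>1_closed \<phi>1_src)
    have twice: "(act P (act P p g) k, gmul H (ginv H (\<phi>1 k)) (gmul H (ginv H (\<phi>1 g)) h)) =
        (act P p (gmul G g k), gmul H (ginv H (\<phi>1 (gmul G g k))) h)"
      if k: "k \<in> ar G" "src G g = tgt G k" for k
    proof -
      have "gmul H (ginv H (\<phi>1 k)) (gmul H (ginv H (\<phi>1 g)) h) = gmul H (gmul H (ginv H (\<phi>1 k)) (ginv H (\<phi>1 g))) h"
        using g k h gh by (intro H.gmul_assoc[symmetric]) (simp_all add: \<phi>1_closed H.ginv_closed H.src_ginv H.tgt_ginv \<phi>1_tgt \<phi>1_src)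
      also have "gmul H (ginv H (\<phi>1 k)) (ginv H (\<phi>1 g)) = ginv H (\<phi>1 (gmul G g k))"
        using g k by (simp add: \<phi>1_gmul H.ginv_gmul \<phi>1_closed \<phi>1_src \<phi>1_tgt)
      finally show ?thesis using P.act_act[OF p g(1) k(1) g(2) k(2)] by simp
    qed
    show "q (act P p g, gmul H (ginv H (\<phi>1 g)) h) = q (p, h)"
    proof (intro subset_antisym subsetI)
      fix z assume "z \<in> q (act P p g, gmul H (ginv H (\<phi>1 g)) h)"
      then obtain k where k: "k \<in> ar G" "src G g = tgt G k" "z = (act P p (gmul G g k), gmul H (ginv H (\<phi>1 (gmul G g k))) h)"
        unfolding q using twice P.anchor_act[OF p g] by metis
      then show "z \<in> q (p, h)" unfolding q using g G.gmul_closed[OF g(1) k(1,2)] G.tgt_gmul[OF g(1) k(1,2)] by metis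
    next
      fix z assume "z \<in> q (p, h)"
      then obtain k where k: "k \<in> ar G" "anchor P p = tgt G k" "z = (act P p k, gmul H (ginv H (\<phi>1 k)) h)" unfolding q by blast
      let ?l = "gmul G (ginv G g) k"
      have l: "?l \<in> ar G" "src G g = tgt G ?l" "gmul G g ?l = k"
        using g k by (simp_all add: G.gmul_closed G.ginv_closed G.src_ginv G.tgt_gmul G.tgt_ginv G.gmul_cancel_left')
      show "z \<in> q (act P p g, gmul H (ginv H (\<phi>1 g)) h)"
        unfolding q using l twice[OF l(1,2)] k(3) P.anchor_act[OF p g] by metis
    qed
  qed
  have q_self: "z \<in> q z" if "z \<in> topspace E" for z
  proof -
    obtain p h where z: "z = (p, h)" by force
    have ph: "p \<in> pts P" "h \<in> ar H" "\<phi>0 (anchor P p) = tgt H h" using that by (simp_all add: z E)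
    then have "gmul H (ginv H (\<phi>1 (gunit G (anchor P p)))) h = h"
      using H.gmul_gunit_left[of h] by (simp add: \<phi>1_gunit P.anchor_closed H.ginv_gunit H.tgt_closed)
    then show ?thesis unfolding z q using ph P.act_gunit[of p]
      by (intro bexI[of _ "gunit G (anchor P p)"]) (simp_all add: P.anchor_closed G.gunit_closed G.tgt_gunit)
  qed
  define \<theta> where "\<theta> z = q (\<kappa> (fst z, gunit G (f (fst z))), snd z)" for z
  define \<xi>' where "\<xi>' z = (proj P (fst z), gmul H (\<phi>1 (snd (\<omega> (fst z)))) (snd z))" for z
  define \<xi> where "\<xi> c = the_elem (\<xi>' ` c)" for c
  have ptsD: "z \<in> pts ?D \<longleftrightarrow> fst z \<in> topspace B \<and> snd z \<in> ar H \<and> \<phi>0 (f (fst z)) = tgt H (snd z)" for z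
    by (simp add: datum_bundle_pts)
  have fB: "f b \<in> ob G" if "b \<in> topspace B" for b using continuous_map_apply[OF D(2) that] .
  have one: "\<kappa> (b, gunit G (f b)) \<in> pts P" "proj P (\<kappa> (b, gunit G (f b))) = b" "anchor P (\<kappa> (b, gunit G (f b))) = f b"
    "\<lbrakk>k \<in> ar G; f b = tgt G k\<rbrakk> \<Longrightarrow> act P (\<kappa> (b, gunit G (f b))) k = \<kappa> (b, k)" if b: "b \<in> topspace B" for b k
    using \<kappa>D[OF b, of "gunit G (f b)"] fB[OF b] G.gmul_gunit_left[of k] by (auto simp: G.gunit_closed G.tgt_gunit G.src_gunit)
  have \<kappa>P: "\<exists>b k. p = \<kappa> (b, k) \<and> b \<in> topspace B \<and> k \<in> ar G \<and> f b = tgt G k" if "p \<in> pts P" for p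
    using \<kappa>\<omega>[OF that] by (metis datum_bundle_pts prod.collapse)
  have \<xi>'\<kappa>: "\<xi>' (\<kappa> (b, k), h) = (b, gmul H (\<phi>1 k) h)" if "b \<in> topspace B" "k \<in> ar G" "f b = tgt G k" for b k h
    using \<kappa>D(2)[OF that] \<omega>\<kappa>[of "(b, k)"] that by (simp add: \<xi>'_def datum_bundle_pts)
  have \<theta>E: "(\<kappa> (fst z, gunit G (f (fst z))), snd z) \<in> topspace E" if "z \<in> pts ?D" for z
    using that one(1,3)[of "fst z"] unfolding E ptsD by simp
  have c\<theta>: "continuous_map (total ?D) T \<theta>"
  proof -
    have cfst: "continuous_map (total ?D) B fst" and csnd: "continuous_map (total ?D) (arrs H) snd"
      by (simp_all add: datum_bundle_simps continuous_map_from_subtopology continuous_map_fst continuous_map_snd)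
    have "continuous_map B (total (datum_bundle G B f \<gamma>)) (\<lambda>b. (b, gunit G (f b)))"
      unfolding datum_bundle_simps using D(2) fB
      by (auto simp: continuous_map_in_subtopology continuous_map_pairedI G.continuous_map_gunit G.tgt_gunit)
    from continuous_map_compose[OF continuous_map_compose[OF cfst this] c\<kappa>]
    have "continuous_map (total ?D) (total P) (\<lambda>z. \<kappa> (fst z, gunit G (f (fst z))))" by (simp add: comp_def)
    then have "continuous_map (total ?D) E (\<lambda>z. (\<kappa> (fst z, gunit G (f (fst z))), snd z))"
      unfolding E_def continuous_map_in_subtopology using csnd \<theta>E[unfolded E_def] by (auto simp: continuous_map_pairedI)
    from continuous_map_compose[OF this cq] show ?thesis by (simp add: \<theta>_def[abs_def] comp_def)
  qed
  have c\<xi>': "continuous_map E (total ?D) \<xi>'"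
  proof -
    have cfst: "continuous_map E (total P) fst" and csnd: "continuous_map E (arrs H) snd"
      by (simp_all add: E_def continuous_map_from_subtopology continuous_map_fst continuous_map_snd)
    have 1: "continuous_map E B (\<lambda>z. proj P (fst z))"
      using continuous_map_compose[OF cfst P.proj_continuous] by (simp add: comp_def)
    have "continuous_map (total (datum_bundle G B f \<gamma>)) (arrs G) snd"
      by (simp add: datum_bundle_simps continuous_map_from_subtopology continuous_map_snd)
    from continuous_map_compose[OF continuous_map_compose[OF continuous_map_compose[OF cfst c\<omega>] this] \<phi>1_continuous]
    have 2: "continuous_map E (arrs H) (\<lambda>z. \<phi>1 (snd (\<omega> (fst z))))" by (simp add: comp_def)
    have 3: "src H (\<phi>1 (snd (\<omega> (fst z)))) = tgt H (snd z)" "tgt H (\<phi>1 (snd (\<omega> (fst z)))) = \<phi>0 (f (proj P (fst z)))"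
      "\<phi>1 (snd (\<omega> (fst z))) \<in> ar H" if z: "z \<in> topspace E" for z
    proof -
      have z': "fst z \<in> pts P" "\<phi>0 (anchor P (fst z)) = tgt H (snd z)" using z E[of "fst z" "snd z"] by auto
      obtain b k where b: "fst z = \<kappa> (b, k)" "b \<in> topspace B" "k \<in> ar G" "f b = tgt G k" using \<kappa>P[OF z'(1)] by blast
      then show "src H (\<phi>1 (snd (\<omega> (fst z)))) = tgt H (snd z)" "tgt H (\<phi>1 (snd (\<omega> (fst z)))) = \<phi>0 (f (proj P (fst z)))"
        "\<phi>1 (snd (\<omega> (fst z))) \<in> ar H"
        using \<kappa>D(2,3)[OF b(2-4)] \<omega>\<kappa>[of "(b, k)"] z'(2) by (simp_all add: datum_bundle_pts \<phi>1_src \<phi>1_tgt \<phi>1_closed)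
    qed
    have "continuous_map E (arrs H) (\<lambda>z. gmul H (\<phi>1 (snd (\<omega> (fst z)))) (snd z))"
      by (rule H.continuous_map_gmul[OF 2 csnd 3(1)])
    then show ?thesis
      unfolding datum_bundle_simps continuous_map_in_subtopology \<xi>'_def using 1 3 continuous_map_apply[OF csnd]
      by (auto simp: continuous_map_pairedI H.tgt_gmul)
  qed
  have \<xi>q: "\<xi> (q z) = \<xi>' z" if z: "z \<in> topspace E" for z
  proof -
    obtain p h where zp: "z = (p, h)" by force
    have ph: "p \<in> pts P" "h \<in> ar H" "\<phi>0 (anchor P p) = tgt H h" using z by (simp_all add: zp E)
    obtain b k where b: "p = \<kappa> (b, k)" "b \<in> topspace B" "k \<in> ar G" "f b = tgt G k" using \<kappa>P[OF ph(1)] by blast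
    have "\<xi>' w = \<xi>' z" if w: "w \<in> q z" for w
    proof -
      obtain g where g: "g \<in> ar G" "anchor P p = tgt G g" "w = (act P p g, gmul H (ginv H (\<phi>1 g)) h)" using w unfolding zp q by blast
      have kg: "src G k = tgt G g" using g(2) \<kappa>D(3)[OF b(2-4)] b(1) by simp
      have "\<xi>' w = (b, gmul H (\<phi>1 (gmul G k g)) (gmul H (ginv H (\<phi>1 g)) h))"
        unfolding g(3) b(1) \<kappa>D(4)[OF b(2-4) g(1) kg]
        using b g kg by (intro \<xi>'\<kappa>) (simp_all add: G.gmul_closed G.tgt_gmul)
      also have "gmul H (\<phi>1 (gmul G k g)) (gmul H (ginv H (\<phi>1 g)) h) =
          gmul H (\<phi>1 k) (gmul H (\<phi>1 g) (gmul H (ginv H (\<phi>1 g)) h))"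
        using b g kg ph by (simp add: \<phi>1_gmul) (intro H.gmul_assoc,
          simp_all add: \<phi>1_closed \<phi>1_src \<phi>1_tgt H.gmul_closed H.ginv_closed H.src_ginv H.tgt_gmul H.tgt_ginv)
      also have "gmul H (\<phi>1 g) (gmul H (ginv H (\<phi>1 g)) h) = h"
        using g ph by (intro H.gmul_cancel_left') (simp_all add: \<phi>1_closed \<phi>1_tgt)
      also have "(b, gmul H (\<phi>1 k) h) = \<xi>' z" unfolding zp b(1) by (rule \<xi>'\<kappa>[OF b(2-4), symmetric])
      finally show ?thesis .
    qed
    then have "\<xi>' ` q z = {\<xi>' z}" using q_self[OF z] by blast
    then show ?thesis by (simp add: \<xi>_def)
  qed
  have c\<xi>: "continuous_map T (total ?D) \<xi>"
    unfolding T_def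
  proof (rule continuous_compose_quotient_map[OF quotient_map_quotient_topology])
    show "continuous_map E (total ?D) (\<xi> \<circ> q)" by (rule continuous_map_eq[OF c\<xi>']) (simp add: \<xi>q)
  qed
  have \<xi>\<theta>: "\<xi> (\<theta> z) = z" if z: "z \<in> pts ?D" for z
  proof -
    have b: "fst z \<in> topspace B" "\<phi>0 (f (fst z)) = tgt H (snd z)" "snd z \<in> ar H" using z by (auto simp: ptsD)
    have "\<xi> (\<theta> z) = (fst z, gmul H (\<phi>1 (gunit G (f (fst z)))) (snd z))"
      unfolding \<theta>_def \<xi>q[OF \<theta>E[OF z]] using fB[OF b(1)] b by (intro \<xi>'\<kappa>) (auto simp: G.gunit_closed G.tgt_gunit)
    then show ?thesis using b fB[OF b(1)] H.gmul_gunit_left[of "snd z"] by (simp add: \<phi>1_gunit)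
  qed
  have q\<kappa>: "q (\<kappa> (b, k), h) = q (\<kappa> (b, gunit G (f b)), gmul H (\<phi>1 k) h)"
    if b: "b \<in> topspace B" "k \<in> ar G" "f b = tgt G k" and h: "h \<in> ar H" "\<phi>0 (src G k) = tgt H h" for b k h
  proof -
    have kh: "gmul H (\<phi>1 k) h \<in> ar H" "tgt H (gmul H (\<phi>1 k) h) = \<phi>0 (f b)"
      using b h by (simp_all add: H.gmul_closed H.tgt_gmul \<phi>1_closed \<phi>1_src \<phi>1_tgt)
    have "(\<kappa> (b, gunit G (f b)), gmul H (\<phi>1 k) h) \<in> topspace E" using one(1,3)[OF b(1)] kh by (simp add: E)
    from step(2)[OF this b(2)] show ?thesis
      using one(3,4)[OF b(1)] b h H.gmul_cancel_left[of "\<phi>1 k" h] by (simp add: \<phi>1_closed \<phi>1_src)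
  qed
  have \<theta>\<xi>: "\<theta> (\<xi> c) = c" if c: "c \<in> topspace T" for c
  proof -
    obtain p h where ph: "(p, h) \<in> topspace E" "c = q (p, h)" using c by (auto simp: T_def topspace_quotient_topology)
    have p: "p \<in> pts P" "h \<in> ar H" "\<phi>0 (anchor P p) = tgt H h" using ph by (simp_all add: E)
    obtain b k where b: "p = \<kappa> (b, k)" "b \<in> topspace B" "k \<in> ar G" "f b = tgt G k" using \<kappa>P[OF p(1)] by blast
    have "\<phi>0 (src G k) = tgt H h" using p(3) \<kappa>D(3)[OF b(2-4)] b(1) by simp
    from q\<kappa>[OF b(2-4) p(2) this] show ?thesis
      using \<xi>q[OF ph(1)] \<xi>'\<kappa>[OF b(2-4), of h] unfolding ph(2) b(1) by (simp add: \<theta>_def)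
  qed
  have "homeomorphic_maps (total ?D) (total ?X) \<theta> \<xi>"
    unfolding homeomorphic_maps_def totX using c\<theta> c\<xi> \<xi>\<theta> \<theta>\<xi> by blast
  then have "bundle_iso_map H A ?D ?X \<theta>"
    unfolding bundle_iso_map_def
  proof (intro conjI ballI impI)
    fix z assume z: "z \<in> pts ?D"
    define p where "p = \<kappa> (fst z, gunit G (f (fst z)))"
    have b: "fst z \<in> topspace B" "\<phi>0 (f (fst z)) = tgt H (snd z)" "snd z \<in> ar H" using z by (auto simp: ptsD)
    have \<theta>: "\<theta> z = q (p, snd z)" by (simp add: \<theta>_def p_def)
    have p: "p \<in> pts P" "proj P p = fst z" "anchor P p = f (fst z)" using one(1-3)[OF b(1)] by (simp_all add: p_def)
    have pE: "(p, snd z) \<in> topspace E" using p b by (simp add: E)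
    have orb: "fst w \<in> pts P \<and> proj P (fst w) = fst z \<and> src H (snd w) = src H (snd z) \<and> snd w \<in> ar H" if w: "w \<in> \<theta> z" for w
    proof -
      obtain g where g: "g \<in> ar G" "anchor P p = tgt G g" "w = (act P p g, gmul H (ginv H (\<phi>1 g)) (snd z))" using w unfolding \<theta> q by blast
      then show ?thesis using p b by (simp add: P.act_closed P.proj_act H.src_gmul H.gmul_closed H.ginv_closed H.src_ginv \<phi>1_closed \<phi>1_tgt)
    qed
    have ne: "\<theta> z \<noteq> {}" using q_self[OF pE, folded \<theta>] by blast
    have "(\<lambda>(p, h). proj P p) ` \<theta> z = (\<lambda>_. fst z) ` \<theta> z" "(\<lambda>(p, h). src H h) ` \<theta> z = (\<lambda>_. src H (snd z)) ` \<theta> z"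
      using orb by (intro image_cong refl; simp add: case_prod_unfold)+
    then have "(\<lambda>(p, h). proj P p) ` \<theta> z = {fst z}" "(\<lambda>(p, h). src H h) ` \<theta> z = {src H (snd z)}"
      using ne by (simp_all add: image_constant_conv)
    then show "proj ?X (\<theta> z) = proj ?D z" "anchor ?X (\<theta> z) = anchor ?D z"
      by (simp_all add: extension_bundle_def datum_bundle_simps case_prod_unfold)
    fix k assume k: "k \<in> ar H" "anchor ?D z = tgt H k"
    have sk: "src H (snd z) = tgt H k" using k by (simp add: datum_bundle_simps case_prod_unfold)
    have assoc: "gmul H (gmul H (ginv H (\<phi>1 g)) (snd z)) k = gmul H (ginv H (\<phi>1 g)) (gmul H (snd z) k)"
      if "g \<in> ar G" "anchor P p = tgt G g" for g
      using that p b k sk by (intro H.gmul_assoc) (simp_all add: \<phi>1_closed H.ginv_closed H.src_ginv \<phi>1_tgt)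
    have "act ?X (\<theta> z) k = (\<lambda>(p, h). (p, gmul H h k)) ` q (p, snd z)" by (simp add: extension_bundle_def \<theta>)
    also have "\<dots> = q (p, gmul H (snd z) k)"
      using assoc unfolding q_def extension_orbit_def by (auto simp: image_image)
    also have "\<dots> = \<theta> (act ?D z k)" by (simp add: \<theta>_def p_def datum_bundle_simps case_prod_unfold)
    finally show "\<theta> (act ?D z k) = act ?X (\<theta> z) k" by simp
  next
    fix x assume x: "x \<in> A"
    then have xB: "x \<in> topspace B" using D(1) by blast
    have s: "sect P x = \<kappa> (x, \<gamma> x)" using bundle_iso_map_sect[OF \<kappa> x] by (simp add: datum_bundle_simps)
    have \<gamma>: "\<gamma> x \<in> ar G" "f x = tgt G (\<gamma> x)" "src G (\<gamma> x) = a0" using D(4-6)[OF x] by auto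
    have "gmul H (\<phi>1 (\<gamma> x)) (gunit H (\<phi>0 a0)) = \<phi>1 (\<gamma> x)"
      using H.gmul_gunit_right[of "\<phi>1 (\<gamma> x)"] \<gamma> by (simp add: \<phi>1_closed \<phi>1_src)
    moreover have "gunit H (\<phi>0 a0) \<in> ar H" "tgt H (gunit H (\<phi>0 a0)) = \<phi>0 a0"
      using \<phi>0_closed[OF G.base_in] by (simp_all add: H.gunit_closed H.tgt_gunit)
    ultimately have "q (sect P x, gunit H (\<phi>0 a0)) = q (\<kappa> (x, gunit G (f x)), \<phi>1 (\<gamma> x))"
      unfolding s using q\<kappa>[OF xB \<gamma>(1,2), of "gunit H (\<phi>0 a0)"] \<gamma>(3) by simp
    then show "\<theta> (sect ?D x) = sect ?X x"
      using P.anchor_sect[OF x] by (simp add: \<theta>_def extension_bundle_def datum_bundle_simps q_def)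
  qed (auto simp: homeomorphic_map_maps)
  then show ?thesis by (auto simp: bundle_iso_def)
qed

end

section \<open>Group axioms by reparametrisation\<close>

lemma concat_spheroid_compose: "h \<circ> concat_spheroid f g = concat_spheroid (h \<circ> f) (h \<circ> g)"
  by (auto simp: fun_eq_iff concat_spheroid_def)

text \<open>What makes the usual group axioms work, for the spheroids of a space and for the data \<open>(f, \<gamma>)\<close> of bundles alike:
  representatives \<open>d\<close> of classes are functions on \<open>I^n\<close>, which can be concatenated when they are matched, and
  pulled back along maps of the pair \<open>(I^n, \<partial>I^n)\<close>. Homotopic maps of the pair give the same class, and
  maps into the boundary give the neutral element.\<close>

locale cubical_group =
  fixes n :: nat and D :: "((nat \<Rightarrow> real) \<Rightarrow> 'z) set" and cl :: "((nat \<Rightarrow> real) \<Rightarrow> 'z) \<Rightarrow> 'x" and M :: "'x monoid"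
  assumes n_pos: "0 < n"
    and carrier_eq: "carrier M = cl ` D"
    and one_carrier: "\<one>\<^bsub>M\<^esub> \<in> carrier M"
    and match: "\<lbrakk>d \<in> D; d' \<in> D\<rbrakk> \<Longrightarrow> \<exists>d''\<in>D. cl d'' = cl d' \<and> matched n d d''"
    and mult: "\<lbrakk>d \<in> D; d' \<in> D; matched n d d'\<rbrakk> \<Longrightarrow> concat_spheroid d d' \<in> D \<and> cl d \<otimes>\<^bsub>M\<^esub> cl d' = cl (concat_spheroid d d')"
    and reparam: "\<lbrakk>d \<in> D; continuous_map (cylinder (cube n)) (cube n) \<kappa>;
        \<And>x t. x \<in> cube_boundary n \<Longrightarrow> t \<in> {0..1} \<Longrightarrow> \<kappa> (x, t) \<in> cube_boundary n\<rbrakk> \<Longrightarrow>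
        (\<lambda>x. d (\<kappa> (x, 0))) \<in> D \<and> cl (\<lambda>x. d (\<kappa> (x, 0))) = cl (\<lambda>x. d (\<kappa> (x, 1)))"
    and degenerate: "\<lbrakk>d \<in> D; continuous_map (cube n) (cube n) \<mu>;
        \<And>x. x \<in> topspace (cube n) \<Longrightarrow> \<mu> x \<in> cube_boundary n\<rbrakk> \<Longrightarrow> cl (\<lambda>x. d (\<mu> x)) = \<one>\<^bsub>M\<^esub>"
begin

text \<open>The convex combinations of \<open>r\<close> and \<open>r'\<close> keep the ends, and so preserve the boundary of the cube.\<close>

lemma stretch:
  assumes d: "d \<in> D" and r: "continuous_on {0..1} r" "continuous_on {0..1} r'"
    "\<And>t. t \<in> {0..1} \<Longrightarrow> r t \<in> {0..1} \<and> r' t \<in> {0..1}"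
    and ends: "r 0 = r' 0" "r 1 = r' 1" "r 0 \<in> {0, 1}" "r 1 \<in> {0, 1}"
  shows "(\<lambda>x. d (x(0 := r (x 0)))) \<in> D" "cl (\<lambda>x. d (x(0 := r (x 0)))) = cl (\<lambda>x. d (x(0 := r' (x 0))))"
proof -
  define \<kappa> where "\<kappa> z = (fst z)(0 := (1 - snd z) * r (fst z 0) + snd z * r' (fst z 0))" for z :: "(nat \<Rightarrow> real) \<times> real"
  have conv: "(1 - t) * r s + t * r' s \<in> {0..1}" if "s \<in> {0..1}" "t \<in> {0..1}" for s t
  proof -
    have "r s \<in> {0..1}" "r' s \<in> {0..1}" using r(3) that by auto
    then have "(1 - t) *\<^sub>R r s + t *\<^sub>R r' s \<in> {0..1}" using that by (intro convexD[OF convex_real_interval(5)]) auto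
    then show ?thesis by simp
  qed
  have c: "continuous_map (cylinder (cube n)) (cube n) \<kappa>"
  proof (rule continuous_map_cylinderI)
    show "continuous_on (topspace (cube n) \<times> {0..1}) \<kappa>"
      unfolding \<kappa>_def using n_pos
      by (auto intro!: continuous_intros continuous_on_compose2[OF r(1)] continuous_on_compose2[OF r(2)] simp: in_cube)
    fix x t assume x: "x \<in> topspace (cube n)" and t: "0 \<le> t" "t \<le> (1::real)"
    have "(1 - t) * r (x 0) + t * r' (x 0) \<in> {0..1}" using x t n_pos by (intro conv) (auto simp: in_cube)
    then show "\<kappa> (x, t) \<in> topspace (cube n)" using x n_pos by (auto simp: \<kappa>_def in_cube)
  qed
  have b: "\<kappa> (x, t) \<in> cube_boundary n" if x: "x \<in> cube_boundary n" and t: "t \<in> {0..1}" for x t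
  proof -
    have "x 0 \<in> {0..1}" using x n_pos by (auto simp: cube_boundary_def in_cube)
    from conv[OF this t] show ?thesis
      unfolding \<kappa>_def using x n_pos ends by (auto intro!: boundary_update simp: algebra_simps)
  qed
  show "(\<lambda>x. d (x(0 := r (x 0)))) \<in> D" "cl (\<lambda>x. d (x(0 := r (x 0)))) = cl (\<lambda>x. d (x(0 := r' (x 0))))"
    using reparam[OF d c b] by (simp_all add: \<kappa>_def fun_upd_def)
qed

lemma collapse:
  assumes d: "d \<in> D" and e: "e \<in> {0, 1}"
  shows "(\<lambda>x. d (x(0 := e))) \<in> D" "cl (\<lambda>x. d (x(0 := e))) = \<one>\<^bsub>M\<^esub>"
proof -
  show "(\<lambda>x. d (x(0 := e))) \<in> D" using stretch(1)[OF d, of "\<lambda>_. e" "\<lambda>_. e"] e by auto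
  show "cl (\<lambda>x. d (x(0 := e))) = \<one>\<^bsub>M\<^esub>"
  proof (rule degenerate[OF d, of "\<lambda>x. x(0 := e)"])
    show "continuous_map (cube n) (cube n) (\<lambda>x. x(0 := e))"
      using e n_pos by (intro continuous_map_cubeI) (auto simp: in_cube intro!: continuous_intros)
  qed (use e n_pos in \<open>auto intro: boundary_face\<close>)
qed

theorem is_group: "group M"
proof (rule groupI)
  show "\<one>\<^bsub>M\<^esub> \<in> carrier M" by (rule one_carrier)
next
  fix X Y assume "X \<in> carrier M" "Y \<in> carrier M"
  then obtain d d' where "d \<in> D" "d' \<in> D" "X = cl d" "Y = cl d'" by (auto simp: carrier_eq)
  moreover then obtain d'' where "d'' \<in> D" "cl d'' = cl d'" "matched n d d''" using match by blast
  ultimately show "X \<otimes>\<^bsub>M\<^esub> Y \<in> carrier M" using mult[of d d''] by (auto simp: carrier_eq)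
next
  fix X Y Z assume "X \<in> carrier M" "Y \<in> carrier M" "Z \<in> carrier M"
  then obtain d1 d2' d3' where d': "d1 \<in> D" "d2' \<in> D" "d3' \<in> D" "X = cl d1" "Y = cl d2'" "Z = cl d3'" by (auto simp: carrier_eq)
  obtain d2 where d2: "d2 \<in> D" "cl d2 = cl d2'" "matched n d1 d2" using match[OF d'(1,2)] by blast
  obtain d3 where d3: "d3 \<in> D" "cl d3 = cl d3'" "matched n d2 d3" using match[OF d2(1) d'(3)] by blast
  let ?c = concat_spheroid
  have m1: "matched n (?c d1 d2) d3" using d3(3) by (auto simp: matched_def concat_spheroid_def)
  have m2: "matched n d1 (?c d2 d3)"
    unfolding matched_def
  proof (intro ballI impI)
    fix x assume x: "x \<in> cube_boundary n" "x 0 = 0"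
    then have "x(0 := 0) = x" by auto
    then show "?c d2 d3 x = d1 (x(0 := 1))" using d2(3) x by (simp add: matched_def concat_spheroid_def)
  qed
  \<comment> \<open>The three pieces of length \<open>1/4\<close>, \<open>1/4\<close>, \<open>1/2\<close> are mapped to those of length \<open>1/2\<close>, \<open>1/4\<close>, \<open>1/4\<close>.\<close>
  define r where "r t = min (2 * t) (min (t + 1/4) ((t + 1) / 2))" for t :: real
  have r: "r t = (if t \<le> 1/4 then 2 * t else if t \<le> 1/2 then t + 1/4 else (t + 1) / 2)" for t
    by (auto simp: r_def min_def)
  have eq: "?c (?c d1 d2) d3 = (\<lambda>x. ?c d1 (?c d2 d3) (x(0 := r (x 0))))"
  proof
    fix x :: "nat \<Rightarrow> real"
    have e: "2 * (x 0 + 1/4) - 1 = 2 * x 0 - 1/2" "2 * (2 * x 0 - 1/2) = 2 * (2 * x 0) - 1" "2 * ((x 0 + 1) / 2) - 1 = x 0"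
      by (simp_all add: field_simps)
    consider "x 0 \<le> 1/4" | "1/4 < x 0" "x 0 \<le> 1/2" | "1/2 < x 0" by linarith
    then show "?c (?c d1 d2) d3 x = ?c d1 (?c d2 d3) (x(0 := r (x 0)))"
    proof cases
      case 1
      then show ?thesis by (simp add: r concat_spheroid_def)
    next
      case 2
      then have "\<not> x 0 + 1/4 \<le> 1/2" "2 * x 0 - 1/2 \<le> 1/2" "\<not> 2 * x 0 \<le> 1/2" "r (x 0) = x 0 + 1/4" by (simp_all add: r)
      then show ?thesis using 2 by (simp only: concat_spheroid_def fun_upd_same fun_upd_upd e if_True if_False not_False_eq_True)
    next
      case 3
      then have "\<not> (x 0 + 1) / 2 \<le> 1/2" "\<not> x 0 \<le> 1/2" "r (x 0) = (x 0 + 1) / 2" by (simp_all add: r)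
      then show ?thesis by (simp only: concat_spheroid_def fun_upd_same fun_upd_upd e if_False)
    qed
  qed
  have "?c d1 (?c d2 d3) \<in> D" using mult[OF d2(1) d3(1,3)] mult[OF d'(1) _ m2] by blast
  then have "cl (\<lambda>x. ?c d1 (?c d2 d3) (x(0 := r (x 0)))) = cl (\<lambda>x. ?c d1 (?c d2 d3) (x(0 := x 0)))"
    by (rule stretch(2)) (auto simp: r_def min_le_iff_disj intro!: continuous_intros)
  then have "cl (?c (?c d1 d2) d3) = cl (?c d1 (?c d2 d3))" unfolding eq by simp
  then show "X \<otimes>\<^bsub>M\<^esub> Y \<otimes>\<^bsub>M\<^esub> Z = X \<otimes>\<^bsub>M\<^esub> (Y \<otimes>\<^bsub>M\<^esub> Z)"
    using d' d2 d3 mult[OF d'(1) d2(1,3)] mult[OF d2(1) d3(1,3)] mult[OF _ d3(1) m1] mult[OF d'(1) _ m2] by metis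
next
  fix X assume "X \<in> carrier M"
  then obtain d where d: "d \<in> D" "X = cl d" by (auto simp: carrier_eq)
  let ?e = "\<lambda>x. d (x(0 := 0))"
  have m: "matched n ?e d" unfolding matched_def by (auto simp: fun_upd_idem)
  have eq: "concat_spheroid ?e d = (\<lambda>x. d (x(0 := max 0 (2 * x 0 - 1))))"
  proof
    fix x :: "nat \<Rightarrow> real"
    have "max 0 (2 * x 0 - 1) = (if x 0 \<le> 1/2 then 0 else 2 * x 0 - 1)" by (simp add: max_def)
    then show "concat_spheroid ?e d x = d (x(0 := max 0 (2 * x 0 - 1)))" by (simp add: concat_spheroid_def)
  qed
  have "cl (\<lambda>x. d (x(0 := max 0 (2 * x 0 - 1)))) = cl (\<lambda>x. d (x(0 := x 0)))"
    by (rule stretch(2)[OF d(1)]) (auto intro!: continuous_intros)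
  then show "\<one>\<^bsub>M\<^esub> \<otimes>\<^bsub>M\<^esub> X = X"
    using mult[OF collapse(1)[OF d(1)] d(1) m] collapse(2)[OF d(1), of 0] d(2) unfolding eq by simp
next
  fix X assume "X \<in> carrier M"
  then obtain d where d: "d \<in> D" "X = cl d" by (auto simp: carrier_eq)
  let ?e = "\<lambda>x. d (x(0 := 1 - x 0))"
  have e: "?e \<in> D"
    by (rule stretch(1)[OF d(1), of "\<lambda>t. 1 - t" "\<lambda>t. 1 - t"]) (auto intro!: continuous_intros)
  have m: "matched n ?e d" unfolding matched_def by (auto simp: fun_upd_idem)
  have eq: "concat_spheroid ?e d = (\<lambda>x. d (x(0 := \<bar>2 * x 0 - 1\<bar>)))"
    by (rule ext) (auto simp: concat_spheroid_def)
  have "cl (\<lambda>x. d (x(0 := \<bar>2 * x 0 - 1\<bar>))) = cl (\<lambda>x. d (x(0 := 1)))"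
    by (rule stretch(2)[OF d(1)]) (auto intro!: continuous_intros)
  then have "cl ?e \<otimes>\<^bsub>M\<^esub> X = \<one>\<^bsub>M\<^esub>"
    using mult[OF e d(1) m] collapse(2)[OF d(1), of 1] d(2) unfolding eq by simp
  then show "\<exists>Y\<in>carrier M. Y \<otimes>\<^bsub>M\<^esub> X = \<one>\<^bsub>M\<^esub>" using e by (auto simp: carrier_eq)
qed

end


section \<open>Homotopy classes of spheroids\<close>

text \<open>The cylinder now has the same order of factors as the base of a homotopy of bundles.\<close>

lemma homotopic_spheroids_cylinder:
  "homotopic_spheroids n X x0 f g \<longleftrightarrow> (\<exists>h. continuous_map (cylinder (cube n)) X h \<and>
     (\<forall>x\<in>topspace (cube n). h (x, 0) = f x) \<and> (\<forall>x\<in>topspace (cube n). h (x, 1) = g x) \<and>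
     (\<forall>x\<in>cube_boundary n. \<forall>t\<in>{0..1}. h (x, t) = x0))"
proof -
  have swap: "continuous_map (cylinder (cube n)) (prod_topology unit_interval (cube n)) (\<lambda>z. (snd z, fst z))"
    "continuous_map (prod_topology unit_interval (cube n)) (cylinder (cube n)) (\<lambda>z. (snd z, fst z))"
    by (simp_all add: continuous_map_pairedI continuous_map_fst continuous_map_snd)
  have "homotopic_spheroids n X x0 f g \<longleftrightarrow> (\<exists>h. continuous_map (prod_topology unit_interval (cube n)) X h \<and>
      (\<forall>x\<in>topspace (cube n). h (0, x) = f x) \<and> (\<forall>x\<in>topspace (cube n). h (1, x) = g x) \<and>
      (\<forall>t\<in>{0..1}. \<forall>x\<in>cube_boundary n. h (t, x) = x0))"
    unfolding homotopic_spheroids_def by (rule homotopic_with) (simp add: cube_boundary_subset[THEN subsetD])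
  also have "\<dots> \<longleftrightarrow> (\<exists>h. continuous_map (cylinder (cube n)) X h \<and>
     (\<forall>x\<in>topspace (cube n). h (x, 0) = f x) \<and> (\<forall>x\<in>topspace (cube n). h (x, 1) = g x) \<and>
     (\<forall>x\<in>cube_boundary n. \<forall>t\<in>{0..1}. h (x, t) = x0))"
  proof (intro iffI; elim exE conjE)
    fix h assume h: "continuous_map (prod_topology unit_interval (cube n)) X h"
      "\<forall>x\<in>topspace (cube n). h (0, x) = f x" "\<forall>x\<in>topspace (cube n). h (1, x) = g x"
      "\<forall>t\<in>{0..1}. \<forall>x\<in>cube_boundary n. h (t, x) = x0"
    then show "\<exists>h. continuous_map (cylinder (cube n)) X h \<and>
     (\<forall>x\<in>topspace (cube n). h (x, 0) = f x) \<and> (\<forall>x\<in>topspace (cube n). h (x, 1) = g x) \<and>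
     (\<forall>x\<in>cube_boundary n. \<forall>t\<in>{0..1}. h (x, t) = x0)"
      using continuous_map_compose[OF swap(1) h(1)] by (intro exI[of _ "\<lambda>z. h (snd z, fst z)"]) (auto simp: comp_def)
  next
    fix h assume h: "continuous_map (cylinder (cube n)) X h"
      "\<forall>x\<in>topspace (cube n). h (x, 0) = f x" "\<forall>x\<in>topspace (cube n). h (x, 1) = g x"
      "\<forall>x\<in>cube_boundary n. \<forall>t\<in>{0..1}. h (x, t) = x0"
    then show "\<exists>h. continuous_map (prod_topology unit_interval (cube n)) X h \<and>
      (\<forall>x\<in>topspace (cube n). h (0, x) = f x) \<and> (\<forall>x\<in>topspace (cube n). h (1, x) = g x) \<and>
      (\<forall>t\<in>{0..1}. \<forall>x\<in>cube_boundary n. h (t, x) = x0)"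
      using continuous_map_compose[OF swap(2) h(1)] by (intro exI[of _ "\<lambda>z. h (snd z, fst z)"]) (auto simp: comp_def)
  qed
  finally show ?thesis .
qed

lemma homotopic_spheroidsI:
  assumes "continuous_map (cylinder (cube n)) X h" "\<And>x t. x \<in> cube_boundary n \<Longrightarrow> t \<in> {0..1} \<Longrightarrow> h (x, t) = x0"
    "\<And>x. x \<in> topspace (cube n) \<Longrightarrow> h (x, 0) = f x" "\<And>x. x \<in> topspace (cube n) \<Longrightarrow> h (x, 1) = g x"
  shows "homotopic_spheroids n X x0 f g"
  unfolding homotopic_spheroids_cylinder using assms by blast

lemma homotopic_spheroids_refl: "f \<in> spheroids n X x0 \<Longrightarrow> homotopic_spheroids n X x0 f f"
  by (simp add: homotopic_spheroids_def spheroids_def)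

lemma homotopic_spheroids_cong:
  "f \<in> spheroids n X x0 \<Longrightarrow> (\<And>x. x \<in> topspace (cube n) \<Longrightarrow> f x = g x) \<Longrightarrow> homotopic_spheroids n X x0 f g"
  unfolding homotopic_spheroids_def spheroids_def
  by (intro homotopic_with_equal) (simp_all, metis cube_boundary_subset subsetD)

lemma homotopic_spheroids_sym: "homotopic_spheroids n X x0 f g \<Longrightarrow> homotopic_spheroids n X x0 g f"
  unfolding homotopic_spheroids_def by (rule homotopic_with_symD)

lemma homotopic_spheroids_trans:
  "homotopic_spheroids n X x0 f g \<Longrightarrow> homotopic_spheroids n X x0 g h \<Longrightarrow> homotopic_spheroids n X x0 f h"
  unfolding homotopic_spheroids_def by (rule homotopic_with_trans)

lemma homotopic_spheroids_imp:
  assumes "homotopic_spheroids n X x0 f g" shows "f \<in> spheroids n X x0" "g \<in> spheroids n X x0"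
  using homotopic_with_imp_continuous_maps[OF assms[unfolded homotopic_spheroids_def]]
    homotopic_with_imp_property[OF assms[unfolded homotopic_spheroids_def]]
  by (simp_all add: spheroids_def)

definition spheroid_class :: "nat \<Rightarrow> 'b topology \<Rightarrow> 'b \<Rightarrow> ((nat \<Rightarrow> real) \<Rightarrow> 'b) \<Rightarrow> ((nat \<Rightarrow> real) \<Rightarrow> 'b) set" where
  "spheroid_class n X x0 f = {h. homotopic_spheroids n X x0 f h}"

lemma spheroid_class_eqI: "homotopic_spheroids n X x0 f g \<Longrightarrow> spheroid_class n X x0 f = spheroid_class n X x0 g"
  unfolding spheroid_class_def by (intro Collect_cong) (metis homotopic_spheroids_sym homotopic_spheroids_trans)

lemma spheroid_class_eqD:
  assumes "g \<in> spheroids n X x0" "spheroid_class n X x0 f = spheroid_class n X x0 g"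
  shows "homotopic_spheroids n X x0 f g"
proof -
  have "g \<in> spheroid_class n X x0 f" unfolding assms(2) using homotopic_spheroids_refl[OF assms(1)] by (simp add: spheroid_class_def)
  then show ?thesis by (simp add: spheroid_class_def)
qed

lemma carrier_homotopy_group: "carrier (homotopy_group n X x0) = spheroid_class n X x0 ` spheroids n X x0"
  by (auto simp: homotopy_group_def quotient_def spheroid_class_def)

lemma one_homotopy_group: "\<one>\<^bsub>homotopy_group n X x0\<^esub> = spheroid_class n X x0 (\<lambda>_. x0)"
  by (simp add: homotopy_group_def spheroid_class_def)

lemma constant_spheroid: "x0 \<in> topspace X \<Longrightarrow> (\<lambda>_. x0) \<in> spheroids n X x0"
  by (simp add: spheroids_def)

lemma spheroid_matched:
  assumes "f \<in> spheroids n X x0" "g \<in> spheroids n X x0" "0 < n" shows "matched n f g"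
  using assms boundary_face[OF _ assms(3), of _ 1] cube_boundary_subset by (fastforce simp: matched_def spheroids_def)

lemma homotopic_concat_spheroid:
  assumes n: "0 < n" and f: "homotopic_spheroids n X x0 f f'" and g: "homotopic_spheroids n X x0 g g'"
  shows "homotopic_spheroids n X x0 (concat_spheroid f g) (concat_spheroid f' g')"
proof -
  obtain F where F: "continuous_map (cylinder (cube n)) X F" "\<forall>x\<in>topspace (cube n). F (x, 0) = f x"
     "\<forall>x\<in>topspace (cube n). F (x, 1) = f' x" "\<forall>x\<in>cube_boundary n. \<forall>t\<in>{0..1}. F (x, t) = x0"
    using f unfolding homotopic_spheroids_cylinder by blast
  obtain K where K: "continuous_map (cylinder (cube n)) X K" "\<forall>x\<in>topspace (cube n). K (x, 0) = g x"
     "\<forall>x\<in>topspace (cube n). K (x, 1) = g' x" "\<forall>x\<in>cube_boundary n. \<forall>t\<in>{0..1}. K (x, t) = x0"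
    using g unfolding homotopic_spheroids_cylinder by blast
  show ?thesis
  proof (rule homotopic_spheroidsI)
    have "K (x, t) = F (x(0 := 1), t)" if "x \<in> topspace (cube n)" "x 0 = 0" "t \<in> {0..1}" for x t
    proof -
      have "x(0 := 0) = x" using that(2) by auto
      then have "x \<in> cube_boundary n" "x(0 := 1) \<in> cube_boundary n"
        using boundary_face[OF that(1) n, of 0] boundary_face[OF that(1) n, of 1] by auto
      then show ?thesis using F(4) K(4) that(3) by simp
    qed
    then show "continuous_map (cylinder (cube n)) X (concat_homotopy F K)"
      using continuous_map_concat_homotopy[of "topspace (cube n)" n X F K] F(1) K(1) cube_halves[OF _ n] by simp
    show "concat_homotopy F K (x, t) = x0" if "x \<in> cube_boundary n" "t \<in> {0..1}" for x t
      using that F(4) K(4) boundary_halves[OF that(1) n] by (auto simp: concat_homotopy_def concat_spheroid_def)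
    show "concat_homotopy F K (x, 0) = concat_spheroid f g x" "concat_homotopy F K (x, 1) = concat_spheroid f' g' x"
      if "x \<in> topspace (cube n)" for x
      using F(2,3) K(2,3) cube_halves[OF that n] by (simp_all add: concat_homotopy_def concat_spheroid_def)
  qed
qed

lemma mult_spheroid_class:
  assumes n: "0 < n" and fg: "f \<in> spheroids n X x0" "g \<in> spheroids n X x0"
  shows "concat_spheroid f g \<in> spheroids n X x0"
    "spheroid_class n X x0 f \<otimes>\<^bsub>homotopy_group n X x0\<^esub> spheroid_class n X x0 g = spheroid_class n X x0 (concat_spheroid f g)"
proof -
  show "concat_spheroid f g \<in> spheroids n X x0"
    using homotopic_concat_spheroid[OF n homotopic_spheroids_refl[OF fg(1)] homotopic_spheroids_refl[OF fg(2)]]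
    by (rule homotopic_spheroids_imp)
  show "spheroid_class n X x0 f \<otimes>\<^bsub>homotopy_group n X x0\<^esub> spheroid_class n X x0 g = spheroid_class n X x0 (concat_spheroid f g)"
  proof (intro subset_antisym subsetI)
    fix h assume "h \<in> spheroid_class n X x0 f \<otimes>\<^bsub>homotopy_group n X x0\<^esub> spheroid_class n X x0 g"
    then obtain f' g' where "homotopic_spheroids n X x0 f f'" "homotopic_spheroids n X x0 g g'"
      "homotopic_spheroids n X x0 (concat_spheroid f' g') h" by (auto simp: homotopy_group_def spheroid_class_def)
    then show "h \<in> spheroid_class n X x0 (concat_spheroid f g)"
      using homotopic_spheroids_trans[OF homotopic_concat_spheroid[OF n]] by (simp add: spheroid_class_def)
  next
    fix h assume "h \<in> spheroid_class n X x0 (concat_spheroid f g)"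
    then show "h \<in> spheroid_class n X x0 f \<otimes>\<^bsub>homotopy_group n X x0\<^esub> spheroid_class n X x0 g"
      using homotopic_spheroids_refl[OF fg(1)] homotopic_spheroids_refl[OF fg(2)]
      by (auto simp: homotopy_group_def spheroid_class_def)
  qed
qed

lemma cubical_group_spheroids:
  assumes n: "0 < n" and x0: "x0 \<in> topspace X"
  shows "cubical_group n (spheroids n X x0) (spheroid_class n X x0) (homotopy_group n X x0)"
proof
  show "\<one>\<^bsub>homotopy_group n X x0\<^esub> \<in> carrier (homotopy_group n X x0)"
    using constant_spheroid[OF x0] by (auto simp: one_homotopy_group carrier_homotopy_group)
  fix d assume d: "d \<in> spheroids n X x0"
  then have dc: "continuous_map (cube n) X d" "\<And>x. x \<in> cube_boundary n \<Longrightarrow> d x = x0" by (auto simp: spheroids_def)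
  show "\<exists>d''\<in>spheroids n X x0. spheroid_class n X x0 d'' = spheroid_class n X x0 d' \<and> matched n d d''"
    if "d' \<in> spheroids n X x0" for d' using that spheroid_matched[OF d that n] by blast
  show "concat_spheroid d d' \<in> spheroids n X x0 \<and>
      spheroid_class n X x0 d \<otimes>\<^bsub>homotopy_group n X x0\<^esub> spheroid_class n X x0 d' = spheroid_class n X x0 (concat_spheroid d d')"
    if "d' \<in> spheroids n X x0" for d' using mult_spheroid_class[OF n d that] by blast
  show "(\<lambda>x. d (\<kappa> (x, 0))) \<in> spheroids n X x0 \<and>
      spheroid_class n X x0 (\<lambda>x. d (\<kappa> (x, 0))) = spheroid_class n X x0 (\<lambda>x. d (\<kappa> (x, 1)))"
    if \<kappa>: "continuous_map (cylinder (cube n)) (cube n) \<kappa>"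
      "\<And>x t. x \<in> cube_boundary n \<Longrightarrow> t \<in> {0..1} \<Longrightarrow> \<kappa> (x, t) \<in> cube_boundary n" for \<kappa>
  proof -
    have "homotopic_spheroids n X x0 (\<lambda>x. d (\<kappa> (x, 0))) (\<lambda>x. d (\<kappa> (x, 1)))"
      by (rule homotopic_spheroidsI[OF continuous_map_compose[OF \<kappa>(1) dc(1)]]) (simp_all add: dc(2) \<kappa>(2))
    from homotopic_spheroids_imp(1)[OF this] spheroid_class_eqI[OF this] show ?thesis by simp
  qed
  show "spheroid_class n X x0 (\<lambda>x. d (\<kappa> x)) = \<one>\<^bsub>homotopy_group n X x0\<^esub>"
    if "continuous_map (cube n) (cube n) \<kappa>" "\<And>x. x \<in> topspace (cube n) \<Longrightarrow> \<kappa> x \<in> cube_boundary n" for \<kappa>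
    unfolding one_homotopy_group
    using that dc(2) by (intro spheroid_class_eqI homotopic_spheroids_sym[OF homotopic_spheroids_cong[OF constant_spheroid[OF x0]]]) simp
qed (use n in \<open>simp_all add: carrier_homotopy_group\<close>)

lemma homotopy_group_map_class:
  assumes \<phi>: "continuous_map X Y \<phi>" "\<phi> x0 = y0" and f: "f \<in> spheroids n X x0"
  shows "\<phi> \<circ> f \<in> spheroids n Y y0"
    "homotopy_group_map n Y y0 \<phi> (spheroid_class n X x0 f) = spheroid_class n Y y0 (\<phi> \<circ> f)"
proof -
  have hom: "homotopic_spheroids n Y y0 (\<phi> \<circ> f) (\<phi> \<circ> g)" if "homotopic_spheroids n X x0 f g" for g
    using that \<phi> unfolding homotopic_spheroids_def
    by (auto intro: homotopic_with_compose_continuous_map_left)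
  show "\<phi> \<circ> f \<in> spheroids n Y y0" using hom[OF homotopic_spheroids_refl[OF f]] by (rule homotopic_spheroids_imp)
  show "homotopy_group_map n Y y0 \<phi> (spheroid_class n X x0 f) = spheroid_class n Y y0 (\<phi> \<circ> f)"
    unfolding homotopy_group_map_def spheroid_class_def
    using homotopic_spheroids_trans[OF hom] homotopic_spheroids_refl[OF f] by (intro Collect_cong) (metis mem_Collect_eq)
qed

lemma homotopy_homI:
  assumes "f \<in> carrier M \<rightarrow> carrier N" "f \<one>\<^bsub>M\<^esub> = \<one>\<^bsub>N\<^esub>" "\<one>\<^bsub>M\<^esub> \<in> carrier M"
    "1 \<le> n \<Longrightarrow> group M" "1 \<le> n \<Longrightarrow> group N"
    "\<And>X Y. \<lbrakk>1 \<le> n; X \<in> carrier M; Y \<in> carrier M\<rbrakk> \<Longrightarrow> f (X \<otimes>\<^bsub>M\<^esub> Y) = f X \<otimes>\<^bsub>N\<^esub> f Y"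
  shows "homotopy_hom n M N f"
  using assms unfolding homotopy_hom_def group_hom_def group_hom_axioms_def hom_def by blast

lemma homotopy_hom_group_map:
  assumes x0: "x0 \<in> topspace X" and \<phi>: "continuous_map X Y \<phi>" "\<phi> x0 = y0"
  shows "homotopy_hom n (homotopy_group n X x0) (homotopy_group n Y y0) (homotopy_group_map n Y y0 \<phi>)"
proof (rule homotopy_homI)
  have y0: "y0 \<in> topspace Y" using continuous_map_apply[OF \<phi>(1) x0] \<phi>(2) by simp
  note map = homotopy_group_map_class[OF \<phi>]
  show "homotopy_group_map n Y y0 \<phi> \<in> carrier (homotopy_group n X x0) \<rightarrow> carrier (homotopy_group n Y y0)"
    using map by (auto simp: carrier_homotopy_group)
  show "homotopy_group_map n Y y0 \<phi> \<one>\<^bsub>homotopy_group n X x0\<^esub> = \<one>\<^bsub>homotopy_group n Y y0\<^esub>"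
    using map(2)[OF constant_spheroid[OF x0]] \<phi>(2) by (simp add: one_homotopy_group comp_def)
  show "\<one>\<^bsub>homotopy_group n X x0\<^esub> \<in> carrier (homotopy_group n X x0)"
    using constant_spheroid[OF x0] by (auto simp: one_homotopy_group carrier_homotopy_group)
  assume n: "1 \<le> n"
  have n': "0 < n" using n by simp
  show "group (homotopy_group n X x0)" "group (homotopy_group n Y y0)"
    by (rule cubical_group.is_group[OF cubical_group_spheroids[OF n' x0]])
      (rule cubical_group.is_group[OF cubical_group_spheroids[OF n' y0]])
  fix A B assume "A \<in> carrier (homotopy_group n X x0)" "B \<in> carrier (homotopy_group n X x0)"
  then obtain f g where fg: "f \<in> spheroids n X x0" "g \<in> spheroids n X x0"
    "A = spheroid_class n X x0 f" "B = spheroid_class n X x0 g" by (auto simp: carrier_homotopy_group)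
  show "homotopy_group_map n Y y0 \<phi> (A \<otimes>\<^bsub>homotopy_group n X x0\<^esub> B) =
      homotopy_group_map n Y y0 \<phi> A \<otimes>\<^bsub>homotopy_group n Y y0\<^esub> homotopy_group_map n Y y0 \<phi> B"
    using map fg mult_spheroid_class[OF n' fg(1,2)] mult_spheroid_class[OF n' map(1)[OF fg(1)] map(1)[OF fg(2)]]
    by (simp add: concat_spheroid_compose)
qed

section \<open>Homotopy classes of bundles\<close>

definition bundle_class ::
    "nat \<Rightarrow> ('o, 'a) groupoid \<Rightarrow> 'o \<Rightarrow> ((nat \<Rightarrow> real) \<Rightarrow> 'o) \<Rightarrow> ((nat \<Rightarrow> real) \<Rightarrow> 'a) \<Rightarrow> ('o, 'a) cube_bundle set" where
  "bundle_class n G a0 f \<gamma> = {R. homotopic_cube_bundles n G a0 (cube_bundle_of n G f \<gamma>) R}"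

abbreviation (input) "bundle_group n G a0 \<equiv> groupoid_homotopy_group n G a0"

context pointed_serre_groupoid
begin

lemma homotopic_of_iso:
  assumes "cube_datum n G a0 f \<gamma>" "cube_bundle_iso n G (cube_bundle_of n G f \<gamma>) P"
  shows "homotopic_cube_bundles n G a0 (cube_bundle_of n G f \<gamma>) P"
  using homotopic_bundles_iso[OF homotopic_cube_bundles_refl[OF cube_bundle_of_principal[OF assms(1)]] bundle_iso_refl assms(2)] .

lemma homotopic_class:
  "homotopic_cube_bundles n G a0 P Q \<Longrightarrow> {R. homotopic_cube_bundles n G a0 P R} = {R. homotopic_cube_bundles n G a0 Q R}"
  by (intro Collect_cong) (metis homotopic_cube_bundles_sym homotopic_cube_bundles_trans)

lemma bundle_class_eqI:
  "homotopic_cube_bundles n G a0 (cube_bundle_of n G f \<gamma>) (cube_bundle_of n G f' \<gamma>') \<Longrightarrow>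
   bundle_class n G a0 f \<gamma> = bundle_class n G a0 f' \<gamma>'"
  unfolding bundle_class_def by (rule homotopic_class)

lemma bundle_class_self: "cube_datum n G a0 f \<gamma> \<Longrightarrow> cube_bundle_of n G f \<gamma> \<in> bundle_class n G a0 f \<gamma>"
  unfolding bundle_class_def by (simp add: homotopic_cube_bundles_refl cube_bundle_of_principal)

lemma bundle_class_eqD:
  assumes "cube_datum n G a0 f' \<gamma>'" "bundle_class n G a0 f \<gamma> = bundle_class n G a0 f' \<gamma>'"
  shows "homotopic_cube_bundles n G a0 (cube_bundle_of n G f \<gamma>) (cube_bundle_of n G f' \<gamma>')"
  using bundle_class_self[OF assms(1)] unfolding assms(2)[symmetric] by (simp add: bundle_class_def)

lemma bundle_class_member:
  assumes "P \<in> bundle_class n G a0 f \<gamma>" "cube_datum n G a0 f' \<gamma>'" "cube_bundle_iso n G (cube_bundle_of n G f' \<gamma>') P"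
  shows "bundle_class n G a0 f' \<gamma>' = bundle_class n G a0 f \<gamma>"
proof -
  have "homotopic_cube_bundles n G a0 (cube_bundle_of n G f \<gamma>) P" using assms(1) by (simp add: bundle_class_def)
  then show ?thesis
    using homotopic_cube_bundles_trans homotopic_cube_bundles_sym homotopic_of_iso[OF assms(2,3)]
    by (intro bundle_class_eqI) blast
qed

lemma bundle_class_of:
  assumes "cube_datum n G a0 f \<gamma>" "cube_bundle_iso n G (cube_bundle_of n G f \<gamma>) P"
  shows "{R. homotopic_cube_bundles n G a0 P R} = bundle_class n G a0 f \<gamma>"
  unfolding bundle_class_def by (rule homotopic_class[OF homotopic_of_iso[OF assms], symmetric])

lemma carrier_bundle_group:
  "X \<in> carrier (bundle_group n G a0) \<longleftrightarrow> (\<exists>f \<gamma>. cube_datum n G a0 f \<gamma> \<and> X = bundle_class n G a0 f \<gamma>)"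
proof -
  have "X \<in> carrier (bundle_group n G a0) \<longleftrightarrow>
      (\<exists>P :: ('o, 'a) cube_bundle. cube_pair_bundle n G a0 P \<and> X = {R. homotopic_cube_bundles n G a0 P R})"
    by (auto simp: groupoid_homotopy_group_def quotient_def)
  then show ?thesis
    using cube_bundle_of_principal unfolding bundle_class_def
    by (metis cube_bundle_trivial bundle_class_of bundle_class_def)
qed

lemma bundle_class_homotopy:
  "homotopy_datum n G a0 F \<Gamma> \<Longrightarrow>
   bundle_class n G a0 (\<lambda>x. F (x, 0)) (\<lambda>x. \<Gamma> (x, 0)) = bundle_class n G a0 (\<lambda>x. F (x, 1)) (\<lambda>x. \<Gamma> (x, 1))"
  by (rule bundle_class_eqI[OF homotopic_bundles_of_datum])

lemma bundle_class_gauge: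
  assumes "cube_datum n G a0 f \<gamma>" "cube_datum n G a0 f' \<gamma>'"
    "continuous_map (cube n) (arrs G) u" "\<And>b. b \<in> topspace (cube n) \<Longrightarrow> tgt G (u b) = f' b"
    "\<And>b. b \<in> topspace (cube n) \<Longrightarrow> src G (u b) = f b" "\<And>x. x \<in> cube_boundary n \<Longrightarrow> gmul G (u x) (\<gamma> x) = \<gamma>' x"
  shows "bundle_class n G a0 f \<gamma> = bundle_class n G a0 f' \<gamma>'"
  by (rule bundle_class_eqI[OF homotopic_of_iso[OF assms(1) datum_bundle_gauge[OF locally_anodyne_cube assms]]])

lemma bundle_class_cong:
  assumes "cube_datum n G a0 f \<gamma>"
    "\<And>b. b \<in> topspace (cube n) \<Longrightarrow> f b = f' b" "\<And>x. x \<in> cube_boundary n \<Longrightarrow> \<gamma> x = \<gamma>' x"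
  shows "bundle_class n G a0 f \<gamma> = bundle_class n G a0 f' \<gamma>'" "cube_datum n G a0 f' \<gamma>'"
  using bundle_class_eqI[OF homotopic_of_iso[OF assms(1) datum_bundle_cong(2)[OF locally_anodyne_cube assms]]]
    datum_bundle_cong(1)[OF locally_anodyne_cube assms] by auto

lemma gunit_base: "gunit G a0 \<in> ar G" "src G (gunit G a0) = a0" "tgt G (gunit G a0) = a0"
  using base_in by (simp_all add: gunit_closed src_gunit tgt_gunit)

text \<open>Equality of classes amounts to a homotopy of data followed by a gauge transformation. The homotopy can be kept
  constant on the part of the boundary where the first datum is the unit.\<close>

lemma bundle_class_eq_normalised:
  assumes datum: "cube_datum n G a0 f \<gamma>" "cube_datum n G a0 f' \<gamma>'"
    and eq: "bundle_class n G a0 f \<gamma> = bundle_class n G a0 f' \<gamma>'"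
    and A: "A \<subseteq> cube_boundary n" "closedin (cube n) A"
      "anodyne (cylinder (cube n)) (topspace (cube n) \<times> {0} \<union> A \<times> {0..1})" "\<And>x. x \<in> A \<Longrightarrow> \<gamma> x = gunit G a0"
  obtains F \<Gamma> u where "homotopy_datum n G a0 F \<Gamma>" "\<And>x. x \<in> topspace (cube n) \<Longrightarrow> F (x, 0) = f x"
    "\<And>x. x \<in> cube_boundary n \<Longrightarrow> \<Gamma> (x, 0) = \<gamma> x" "\<And>x t. x \<in> A \<Longrightarrow> t \<in> {0..1} \<Longrightarrow> \<Gamma> (x, t) = gunit G a0"
    "continuous_map (cube n) (arrs G) u" "\<And>b. b \<in> topspace (cube n) \<Longrightarrow> tgt G (u b) = f' b"
    "\<And>b. b \<in> topspace (cube n) \<Longrightarrow> src G (u b) = F (b, 1)" "\<And>x. x \<in> cube_boundary n \<Longrightarrow> gmul G (u x) (\<Gamma> (x, 1)) = \<gamma>' x"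
proof (rule trivialise_homotopy[OF bundle_class_eqD[OF datum(2) eq] bundle_iso_refl datum(1) A(1-3), of "\<lambda>_. gunit G a0"])
  fix F \<Gamma>
  assume F: "homotopy_datum n G a0 F \<Gamma>" "\<And>x. x \<in> topspace (cube n) \<Longrightarrow> F (x, 0) = f x"
    "\<And>x. x \<in> cube_boundary n \<Longrightarrow> \<Gamma> (x, 0) = \<gamma> x" "\<And>z. z \<in> A \<times> {0..1} \<Longrightarrow> \<Gamma> z = gunit G a0"
    and iso: "cube_bundle_iso n G (cube_bundle_of n G (\<lambda>x. F (x, 1)) (\<lambda>x. \<Gamma> (x, 1))) (cube_bundle_of n G f' \<gamma>')"
  show thesis
    by (rule datum_bundle_iso_gauge[OF iso cylinder_datum_at[OF F(1)]]) (auto intro: that[OF F(1-3) F(4)])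
qed (use A(4) gunit_base in auto)


subsection \<open>The group structure\<close>

text \<open>Both homotopies are trivialised so that \<open>\<gamma>\<close> is the unit on the faces to be glued, whence their data
  are matched at all times.\<close>

lemma concat_bundle_homotopic:
  assumes n: "0 < n" and P: "homotopic_cube_bundles n G a0 P P'" and Q: "homotopic_cube_bundles n G a0 Q Q'"
  shows "homotopic_cube_bundles n G a0 (concat_bundle G P Q) (concat_bundle G P' Q')"
proof -
  have face: "faces n {(0, e)} \<subseteq> cube_boundary n" "anodyne (cube n) (faces n {(0, e)})" "closedin (cube n) (faces n {(0, e)})"
    "anodyne (cylinder (cube n)) (topspace (cube n) \<times> {0} \<union> faces n {(0, e)} \<times> {0..1})" if e: "e \<in> {0, 1}" for e
  proof -
    show "faces n {(0, e)} \<subseteq> cube_boundary n" unfolding cube_boundary_faces using n e by (intro faces_mono) auto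
    show "anodyne (cube n) (faces n {(0, e)})" using n e by (intro anodyne_faces[of _ _ 0 e]) auto
    show "closedin (cube n) (faces n {(0, e)})" by (simp add: closedin_faces)
    show "anodyne (cylinder (cube n)) (topspace (cube n) \<times> {0} \<union> faces n {(0, e)} \<times> {0..1})"
      using n e by (intro anodyne_cylinder[of _ _ _ n 0]) auto
  qed
  have norm: "\<exists>F \<Gamma>. homotopy_datum n G a0 F \<Gamma> \<and> (\<forall>z\<in>faces n {(0, e)} \<times> {0..1}. \<Gamma> z = gunit G a0) \<and>
      cube_bundle_iso n G (cube_bundle_of n G (\<lambda>x. F (x, 0)) (\<lambda>x. \<Gamma> (x, 0))) S \<and>
      cube_bundle_iso n G (cube_bundle_of n G (\<lambda>x. F (x, 1)) (\<lambda>x. \<Gamma> (x, 1))) S'"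
    if hom: "homotopic_cube_bundles n G a0 S S'" and e: "e \<in> {0, 1}"
    for e and S :: "(nat \<Rightarrow> real, 'o, 'a, 's) gbundle" and S' :: "(nat \<Rightarrow> real, 'o, 'a, 't) gbundle"
  proof -
    have S: "cube_pair_bundle n G a0 S" using hom by (simp add: homotopic_bundles_def)
    obtain f \<gamma> where fg: "cube_datum n G a0 f \<gamma>" "cube_bundle_iso n G (cube_bundle_of n G f \<gamma>) S"
      "\<And>x. x \<in> faces n {(0, e)} \<Longrightarrow> \<gamma> x = gunit G a0"
      by (rule cube_bundle_trivial_prescribed[OF S face(1,2)[OF e], of "\<lambda>_. gunit G a0"]) (use gunit_base in auto)
    obtain F \<Gamma> where F: "homotopy_datum n G a0 F \<Gamma>" "\<And>x. x \<in> topspace (cube n) \<Longrightarrow> F (x, 0) = f x"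
      "\<And>x. x \<in> cube_boundary n \<Longrightarrow> \<Gamma> (x, 0) = \<gamma> x" "\<And>z. z \<in> faces n {(0, e)} \<times> {0..1} \<Longrightarrow> \<Gamma> z = gunit G a0"
      "cube_bundle_iso n G (cube_bundle_of n G (\<lambda>x. F (x, 1)) (\<lambda>x. \<Gamma> (x, 1))) S'"
      by (rule trivialise_homotopy[OF hom fg(2,1) face(1,3,4)[OF e], of "\<lambda>_. gunit G a0"]) (use gunit_base fg(3) in auto)
    have "cube_bundle_iso n G (cube_bundle_of n G (\<lambda>x. F (x, 0)) (\<lambda>x. \<Gamma> (x, 0))) S"
      using datum_bundle_cong(2)[OF locally_anodyne_cube cylinder_datum_at[OF F(1), of 0] F(2,3)] fg(2)
      by (auto intro: bundle_iso_trans)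
    then show ?thesis using F by blast
  qed
  obtain F \<Gamma> where F: "homotopy_datum n G a0 F \<Gamma>" "\<forall>z\<in>faces n {(0, 1)} \<times> {0..1}. \<Gamma> z = gunit G a0"
      "cube_bundle_iso n G (cube_bundle_of n G (\<lambda>x. F (x, 0)) (\<lambda>x. \<Gamma> (x, 0))) P"
      "cube_bundle_iso n G (cube_bundle_of n G (\<lambda>x. F (x, 1)) (\<lambda>x. \<Gamma> (x, 1))) P'"
    using norm[OF P, of 1] by blast
  obtain F' \<Gamma>' where F': "homotopy_datum n G a0 F' \<Gamma>'" "\<forall>z\<in>faces n {(0, 0)} \<times> {0..1}. \<Gamma>' z = gunit G a0"
      "cube_bundle_iso n G (cube_bundle_of n G (\<lambda>x. F' (x, 0)) (\<lambda>x. \<Gamma>' (x, 0))) Q"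
      "cube_bundle_iso n G (cube_bundle_of n G (\<lambda>x. F' (x, 1)) (\<lambda>x. \<Gamma>' (x, 1))) Q'"
    using norm[OF Q, of 0] by blast
  have m: "matched n (\<lambda>x. \<Gamma> (x, t)) (\<lambda>x. \<Gamma>' (x, t))" if t: "t \<in> {0..1}" for t
    unfolding matched_def
  proof (intro ballI impI)
    fix x assume x: "x \<in> cube_boundary n" "x 0 = 0"
    have xc: "x \<in> topspace (cube n)" using x cube_boundary_subset by blast
    then have "x \<in> faces n {(0, 0)}" "x(0 := 1) \<in> faces n {(0, 1)}"
      using x boundary_face[OF xc n, of 1] cube_boundary_subset by (auto simp: faces_def)
    then show "\<Gamma>' (x, t) = \<Gamma> (x(0 := 1), t)" using F(2) F'(2) t by simp
  qed
  have "homotopy_datum n G a0 (concat_homotopy F F') (concat_homotopy \<Gamma> \<Gamma>')"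
    by (rule homotopy_datum_concat[OF n F(1) F'(1) m])
  from homotopic_bundles_of_datum[OF this]
  have "homotopic_cube_bundles n G a0
      (cube_bundle_of n G (concat_spheroid (\<lambda>x. F (x, 0)) (\<lambda>x. F' (x, 0))) (concat_spheroid (\<lambda>x. \<Gamma> (x, 0)) (\<lambda>x. \<Gamma>' (x, 0))))
      (cube_bundle_of n G (concat_spheroid (\<lambda>x. F (x, 1)) (\<lambda>x. F' (x, 1))) (concat_spheroid (\<lambda>x. \<Gamma> (x, 1)) (\<lambda>x. \<Gamma>' (x, 1))))"
    by (simp add: concat_homotopy_def)
  moreover have d: "cube_datum n G a0 (\<lambda>x. F (x, t)) (\<lambda>x. \<Gamma> (x, t))" "cube_datum n G a0 (\<lambda>x. F' (x, t)) (\<lambda>x. \<Gamma>' (x, t))"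
    if "t \<in> {0..1}" for t using that cylinder_datum_at[OF F(1)] cylinder_datum_at[OF F'(1)] by auto
  ultimately show ?thesis
    using concat_bundle_iso[OF n d(1)[of 0] d(2)[of 0] m[of 0] F(3) F'(3)]
      concat_bundle_iso[OF n d(1)[of 1] d(2)[of 1] m[of 1] F(4) F'(4)] by (auto intro: homotopic_bundles_iso)
qed

lemma mult_bundle_class:
  assumes n: "0 < n" and datum: "cube_datum n G a0 f \<gamma>" "cube_datum n G a0 f' \<gamma>'" and m: "matched n \<gamma> \<gamma>'"
  shows "bundle_class n G a0 f \<gamma> \<otimes>\<^bsub>bundle_group n G a0\<^esub> bundle_class n G a0 f' \<gamma>' =
    bundle_class n G a0 (concat_spheroid f f') (concat_spheroid \<gamma> \<gamma>')"
proof -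
  note D = cube_datum_concat[OF n datum m]
  have conc: "homotopic_cube_bundles n G a0 (cube_bundle_of n G (concat_spheroid f f') (concat_spheroid \<gamma> \<gamma>'))
      (concat_bundle G (cube_bundle_of n G f \<gamma>) (cube_bundle_of n G f' \<gamma>'))"
    by (rule homotopic_of_iso[OF D concat_bundle_iso[OF n datum m bundle_iso_refl bundle_iso_refl]])
  show ?thesis
  proof (intro subset_antisym subsetI)
    fix R assume "R \<in> bundle_class n G a0 f \<gamma> \<otimes>\<^bsub>bundle_group n G a0\<^esub> bundle_class n G a0 f' \<gamma>'"
    then obtain P Q :: "('o, 'a) cube_bundle" where P: "homotopic_cube_bundles n G a0 (cube_bundle_of n G f \<gamma>) P"
      and Q: "homotopic_cube_bundles n G a0 (cube_bundle_of n G f' \<gamma>') Q"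
      and R: "homotopic_cube_bundles n G a0 (concat_bundle G P Q) R"
      by (auto simp: groupoid_homotopy_group_def bundle_class_def)
    show "R \<in> bundle_class n G a0 (concat_spheroid f f') (concat_spheroid \<gamma> \<gamma>')"
      using homotopic_cube_bundles_trans[OF homotopic_cube_bundles_trans[OF conc concat_bundle_homotopic[OF n P Q]] R]
      by (simp add: bundle_class_def)
  next
    fix R assume "R \<in> bundle_class n G a0 (concat_spheroid f f') (concat_spheroid \<gamma> \<gamma>')"
    then have "homotopic_cube_bundles n G a0 (concat_bundle G (cube_bundle_of n G f \<gamma>) (cube_bundle_of n G f' \<gamma>')) R"
      using homotopic_cube_bundles_trans[OF homotopic_cube_bundles_sym[OF conc]] by (simp add: bundle_class_def)
    then show "R \<in> bundle_class n G a0 f \<gamma> \<otimes>\<^bsub>bundle_group n G a0\<^esub> bundle_class n G a0 f' \<gamma>'"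
      using bundle_class_self[OF datum(1)] bundle_class_self[OF datum(2)]
      by (auto simp: groupoid_homotopy_group_def)
  qed
qed

lemma trivial_datum:
  "f \<in> spheroids n (objs G) a0 \<Longrightarrow> cube_datum n G a0 f (\<lambda>_. gunit G a0)"
  using gunit_base cube_boundary_subset by (simp add: section_datum_def spheroids_def)

lemma one_bundle_group: "\<one>\<^bsub>bundle_group n G a0\<^esub> = bundle_class n G a0 (\<lambda>_. a0) (\<lambda>_. gunit G a0)"
  by (simp add: groupoid_homotopy_group_def bundle_class_def pullback_unit_bundle_datum)

lemma one_bundle_group_carrier: "\<one>\<^bsub>bundle_group n G a0\<^esub> \<in> carrier (bundle_group n G a0)"
  unfolding one_bundle_group carrier_bundle_group using trivial_datum[OF constant_spheroid[OF base_in]] by blast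

lemma cubical_group_bundles:
  assumes n: "0 < n"
  shows "cubical_group n {d. cube_datum n G a0 (fst \<circ> d) (snd \<circ> d)} (\<lambda>d. bundle_class n G a0 (fst \<circ> d) (snd \<circ> d))
    (bundle_group n G a0)"
proof
  show "carrier (bundle_group n G a0) = (\<lambda>d. bundle_class n G a0 (fst \<circ> d) (snd \<circ> d)) ` {d. cube_datum n G a0 (fst \<circ> d) (snd \<circ> d)}"
  proof (intro subset_antisym subsetI)
    fix X assume "X \<in> carrier (bundle_group n G a0)"
    then obtain f \<gamma> where "cube_datum n G a0 f \<gamma>" "X = bundle_class n G a0 f \<gamma>" by (auto simp: carrier_bundle_group)
    then show "X \<in> (\<lambda>d. bundle_class n G a0 (fst \<circ> d) (snd \<circ> d)) ` {d. cube_datum n G a0 (fst \<circ> d) (snd \<circ> d)}"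
      by (intro image_eqI[of _ _ "\<lambda>x. (f x, \<gamma> x)"]) (simp_all add: comp_def)
  qed (auto simp: carrier_bundle_group)
  fix d assume "d \<in> {d. cube_datum n G a0 (fst \<circ> d) (snd \<circ> d)}"
  then have d: "cube_datum n G a0 (fst \<circ> d) (snd \<circ> d)" by simp
  note D = section_datumD[OF d]
  show "\<exists>d''\<in>{d. cube_datum n G a0 (fst \<circ> d) (snd \<circ> d)}. bundle_class n G a0 (fst \<circ> d'') (snd \<circ> d'') =
      bundle_class n G a0 (fst \<circ> d') (snd \<circ> d') \<and> matched n d d''"
    if "d' \<in> {d. cube_datum n G a0 (fst \<circ> d) (snd \<circ> d)}" for d'
  proof -
    have d': "cube_datum n G a0 (fst \<circ> d') (snd \<circ> d')" using that by simp
    let ?A = "faces n {(0, 0)}"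
    have Ab: "?A \<subseteq> cube_boundary n" unfolding cube_boundary_faces using n by (intro faces_mono) auto
    have up: "x(0 := 1) \<in> cube_boundary n" if "x \<in> ?A" for x using that boundary_face[OF _ n, of x 1] by (auto simp: faces_def)
    have an: "anodyne (cube n) ?A" using n by (intro anodyne_faces[of _ _ 0 0]) auto
    have c: "continuous_map (subtopology (cube n) ?A) (arrs G) (\<lambda>x. (snd \<circ> d) (x(0 := 1)))"
    proof -
      have "continuous_map (cube n) (cube n) (\<lambda>x. x(0 := 1))"
        using n by (intro continuous_map_cubeI) (auto simp: in_cube intro!: continuous_intros)
      then have "continuous_map (subtopology (cube n) ?A) (subtopology (cube n) (cube_boundary n)) (\<lambda>x. x(0 := 1))"
        using up by (auto simp: continuous_map_in_subtopology intro: continuous_map_from_subtopology)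
      from continuous_map_compose[OF this D(3)] show ?thesis by (simp add: comp_def)
    qed
    have s: "src G ((snd \<circ> d) (x(0 := 1))) = a0" if "x \<in> ?A" for x using D(5)[OF up[OF that]] .
    obtain f \<gamma> where fg: "cube_datum n G a0 f \<gamma>"
      "cube_bundle_iso n G (cube_bundle_of n G f \<gamma>) (cube_bundle_of n G (fst \<circ> d') (snd \<circ> d'))"
      "\<And>x. x \<in> ?A \<Longrightarrow> \<gamma> x = (snd \<circ> d) (x(0 := 1))"
      by (rule cube_bundle_trivial_prescribed[OF cube_bundle_of_principal[OF d'] Ab an c s]) (assumption | rule that)+
    have "matched n d (\<lambda>x. (f x, \<gamma> x))"
      unfolding matched_def
    proof (intro ballI impI)
      fix x assume x: "x \<in> cube_boundary n" "x 0 = 0"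
      then have xA: "x \<in> ?A" using cube_boundary_subset by (auto simp: faces_def)
      have "f x = fst (d (x(0 := 1)))"
        using section_datumD(4)[OF fg(1) x(1)] fg(3)[OF xA] D(4)[OF up[OF xA]] by simp
      then show "(f x, \<gamma> x) = d (x(0 := 1))" using fg(3)[OF xA] by (simp add: prod_eq_iff)
    qed
    moreover have "bundle_class n G a0 f \<gamma> = bundle_class n G a0 (fst \<circ> d') (snd \<circ> d')"
      by (rule bundle_class_member[OF bundle_class_self[OF d'] fg(1,2)])
    ultimately show ?thesis using fg(1) by (intro bexI[of _ "\<lambda>x. (f x, \<gamma> x)"]) (simp_all add: comp_def)
  qed
  show "concat_spheroid d d' \<in> {d. cube_datum n G a0 (fst \<circ> d) (snd \<circ> d)} \<and>
      bundle_class n G a0 (fst \<circ> d) (snd \<circ> d) \<otimes>\<^bsub>bundle_group n G a0\<^esub> bundle_class n G a0 (fst \<circ> d') (snd \<circ> d') =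
      bundle_class n G a0 (fst \<circ> concat_spheroid d d') (snd \<circ> concat_spheroid d d')"
    if "d' \<in> {d. cube_datum n G a0 (fst \<circ> d) (snd \<circ> d)}" "matched n d d'" for d'
  proof -
    have "matched n (snd \<circ> d) (snd \<circ> d')" using that(2) by (simp add: matched_def)
    then show ?thesis using cube_datum_concat[OF n d] mult_bundle_class[OF n d] that(1) by (simp add: concat_spheroid_compose)
  qed
  show "(\<lambda>x. d (\<kappa> (x, 0))) \<in> {d. cube_datum n G a0 (fst \<circ> d) (snd \<circ> d)} \<and>
      bundle_class n G a0 (fst \<circ> (\<lambda>x. d (\<kappa> (x, 0)))) (snd \<circ> (\<lambda>x. d (\<kappa> (x, 0)))) =
      bundle_class n G a0 (fst \<circ> (\<lambda>x. d (\<kappa> (x, 1)))) (snd \<circ> (\<lambda>x. d (\<kappa> (x, 1))))"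
    if \<kappa>: "continuous_map (cylinder (cube n)) (cube n) \<kappa>"
      "\<And>x t. x \<in> cube_boundary n \<Longrightarrow> t \<in> {0..1} \<Longrightarrow> \<kappa> (x, t) \<in> cube_boundary n" for \<kappa>
  proof -
    have "continuous_map (cylinder (subtopology (cube n) (cube_boundary n))) (subtopology (cube n) (cube_boundary n)) \<kappa>"
      unfolding subtopology_cylinder[symmetric] using \<kappa>
      by (auto simp: continuous_map_in_subtopology intro: continuous_map_from_subtopology)
    from continuous_map_compose[OF this D(3)] continuous_map_compose[OF \<kappa>(1) D(2)]
    have "homotopy_datum n G a0 ((fst \<circ> d) \<circ> \<kappa>) ((snd \<circ> d) \<circ> \<kappa>)"
      unfolding cylinder_datum_iff using D(1,4,5) \<kappa>(2) by auto
    from cylinder_datum_at[OF this, of 0] bundle_class_homotopy[OF this] show ?thesis by (simp add: comp_def)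
  qed
  show "bundle_class n G a0 (fst \<circ> (\<lambda>x. d (\<mu> x))) (snd \<circ> (\<lambda>x. d (\<mu> x))) = \<one>\<^bsub>bundle_group n G a0\<^esub>"
    if \<mu>: "continuous_map (cube n) (cube n) \<mu>" "\<And>x. x \<in> topspace (cube n) \<Longrightarrow> \<mu> x \<in> cube_boundary n" for \<mu>
  proof -
    \<comment> \<open>Over the boundary the bundle has the section \<open>\<sigma>\<close>, so its pullback along \<open>\<mu>\<close> is trivial.\<close>
    have "continuous_map (cube n) (subtopology (cube n) (cube_boundary n)) \<mu>"
      using \<mu> by (auto simp: continuous_map_in_subtopology)
    from continuous_map_compose[OF this D(3)] have u: "continuous_map (cube n) (arrs G) ((snd \<circ> d) \<circ> \<mu>)" .
    have datum: "cube_datum n G a0 ((fst \<circ> d) \<circ> \<mu>) ((snd \<circ> d) \<circ> \<mu>)"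
      unfolding section_datum_def
      using continuous_map_compose[OF \<mu>(1) D(2)] continuous_map_from_subtopology[OF u] \<mu>(2) D cube_boundary_subset
      by (auto simp: subset_iff)
    have "bundle_class n G a0 (\<lambda>_. a0) (\<lambda>_. gunit G a0) = bundle_class n G a0 ((fst \<circ> d) \<circ> \<mu>) ((snd \<circ> d) \<circ> \<mu>)"
    proof (rule bundle_class_gauge[OF trivial_datum[OF constant_spheroid[OF base_in]] datum u])
      fix x assume "x \<in> cube_boundary n"
      then have "\<mu> x \<in> cube_boundary n" using \<mu>(2) cube_boundary_subset by blast
      then show "gmul G (((snd \<circ> d) \<circ> \<mu>) x) (gunit G a0) = ((snd \<circ> d) \<circ> \<mu>) x"
        using D(5,6)[of "\<mu> x"] gmul_gunit_right[of "snd (d (\<mu> x))"] by simp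
    qed (use D \<mu>(2) in auto)
    then show ?thesis by (simp add: one_bundle_group comp_def)
  qed
qed (use n one_bundle_group_carrier in simp_all)

lemmas group_bundle_group = cubical_group.is_group[OF cubical_group_bundles]


section \<open>The maps of the sequence on classes\<close>

lemma pullback_unit_class:
  assumes f: "f \<in> spheroids n (objs G) a0"
  shows "pullback_unit_map n G a0 (spheroid_class n (objs G) a0 f) = bundle_class n G a0 f (\<lambda>_. gunit G a0)"
proof -
  have cls: "{R. homotopic_cube_bundles n G a0 (pullback_unit_bundle G (cube n) g) R} = bundle_class n G a0 f (\<lambda>_. gunit G a0)"
    if g: "homotopic_spheroids n (objs G) a0 f g" for g
  proof -
    obtain h where h: "continuous_map (cylinder (cube n)) (objs G) h"
     "\<forall>x\<in>topspace (cube n). h (x, 0) = f x" "\<forall>x\<in>topspace (cube n). h (x, 1) = g x"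
     "\<forall>x\<in>cube_boundary n. \<forall>t\<in>{0..1}. h (x, t) = a0" using g unfolding homotopic_spheroids_cylinder by blast
    have hd: "homotopy_datum n G a0 h (\<lambda>_. gunit G a0)"
      unfolding cylinder_datum_iff using h gunit_base cube_boundary_subset by auto
    have gs: "g \<in> spheroids n (objs G) a0" using g by (rule homotopic_spheroids_imp)
    have "bundle_class n G a0 f (\<lambda>_. gunit G a0) = bundle_class n G a0 (\<lambda>x. h (x, 0)) (\<lambda>_. gunit G a0)"
      using h(2) by (intro bundle_class_cong(1)[OF trivial_datum[OF f]]) auto
    also have "\<dots> = bundle_class n G a0 (\<lambda>x. h (x, 1)) (\<lambda>_. gunit G a0)" using bundle_class_homotopy[OF hd] .
    also have "\<dots> = bundle_class n G a0 g (\<lambda>x. gunit G (g x))"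
      using h(3) gs by (intro bundle_class_cong(1)[OF cylinder_datum_at[OF hd]]) (auto simp: spheroids_def)
    finally show ?thesis by (simp add: bundle_class_def pullback_unit_bundle_datum)
  qed
  show ?thesis
  proof (intro subset_antisym subsetI)
    fix R assume "R \<in> pullback_unit_map n G a0 (spheroid_class n (objs G) a0 f)"
    then show "R \<in> bundle_class n G a0 f (\<lambda>_. gunit G a0)"
      using cls by (auto simp: pullback_unit_map_def spheroid_class_def)
  next
    fix R assume "R \<in> bundle_class n G a0 f (\<lambda>_. gunit G a0)"
    then show "R \<in> pullback_unit_map n G a0 (spheroid_class n (objs G) a0 f)"
      using cls[OF homotopic_spheroids_refl[OF f]] homotopic_spheroids_refl[OF f]
      by (auto simp: pullback_unit_map_def spheroid_class_def)
  qed
qed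

lemma concat_constant: "concat_spheroid (\<lambda>_. c) (\<lambda>_. c) = (\<lambda>_. c)"
  by (simp add: concat_spheroid_def fun_eq_iff)

lemma homotopy_hom_pullback_unit:
  "homotopy_hom n (object_homotopy_group n G a0) (bundle_group n G a0) (pullback_unit_map n G a0)"
proof (rule homotopy_homI)
  show "pullback_unit_map n G a0 \<in> carrier (object_homotopy_group n G a0) \<rightarrow> carrier (bundle_group n G a0)"
    using pullback_unit_class trivial_datum by (fastforce simp: carrier_homotopy_group carrier_bundle_group)
  show "pullback_unit_map n G a0 \<one>\<^bsub>object_homotopy_group n G a0\<^esub> = \<one>\<^bsub>bundle_group n G a0\<^esub>"
    unfolding one_homotopy_group one_bundle_group by (rule pullback_unit_class[OF constant_spheroid[OF base_in]])
  show "\<one>\<^bsub>object_homotopy_group n G a0\<^esub> \<in> carrier (object_homotopy_group n G a0)"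
    using constant_spheroid[OF base_in] by (auto simp: one_homotopy_group carrier_homotopy_group)
  assume "1 \<le> n"
  then have n: "0 < n" by simp
  show "group (object_homotopy_group n G a0)" by (rule cubical_group.is_group[OF cubical_group_spheroids[OF n base_in]])
  show "group (bundle_group n G a0)" by (rule group_bundle_group[OF n])
  fix X Y assume "X \<in> carrier (object_homotopy_group n G a0)" "Y \<in> carrier (object_homotopy_group n G a0)"
  then obtain f g where fg: "f \<in> spheroids n (objs G) a0" "g \<in> spheroids n (objs G) a0"
    "X = spheroid_class n (objs G) a0 f" "Y = spheroid_class n (objs G) a0 g" by (auto simp: carrier_homotopy_group)
  have "matched n (\<lambda>_. gunit G a0) (\<lambda>_. gunit G a0)" by (simp add: matched_def)
  then show "pullback_unit_map n G a0 (X \<otimes>\<^bsub>object_homotopy_group n G a0\<^esub> Y) =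
      pullback_unit_map n G a0 X \<otimes>\<^bsub>bundle_group n G a0\<^esub> pullback_unit_map n G a0 Y"
    using fg mult_spheroid_class[OF n fg(1,2)] mult_bundle_class[OF n trivial_datum[OF fg(1)] trivial_datum[OF fg(2)]]
    by (simp add: pullback_unit_class concat_constant)
qed

end

section \<open>The connecting map\<close>

lemma bottom_face_subset: "topspace (cube n) \<subseteq> topspace (cube (Suc n))"
  by (auto simp: in_cube less_Suc_eq)

lemma bottom_face_iff:
  assumes x: "x \<in> topspace (cube (Suc n))" shows "x \<in> topspace (cube n) \<longleftrightarrow> x n = 0"
proof -
  have "x i = 0" if "n \<le> i" "x n = 0" for i using that x by (cases "i = n") (auto simp: in_cube)
  then show ?thesis using x by (auto simp: in_cube)
qed

lemma bottom_face_subtopology: "subtopology (cube (Suc n)) (topspace (cube n)) = cube n"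
  using bottom_face_subset[of n]
  by (subst (1 3) cube_euclidean) (simp add: subtopology_subtopology Int_absorb1)

lemma bottom_face_faces: "topspace (cube n) = faces (Suc n) {(n, 0)}"
  using bottom_face_subset[of n] bottom_face_iff[of _ n] by (auto simp: faces_def)

lemma cube_boundary_Suc: "cube_boundary (Suc n) = topspace (cube n) \<union> open_box n"
  unfolding bottom_face_faces open_box_faces cube_boundary_faces by (auto simp: faces_def lessThan_Suc)

lemma boundary_in_open_box: "cube_boundary n \<subseteq> open_box n"
  using bottom_face_subset[of n] by (auto simp: cube_boundary_def open_box_def)

lemma bottom_open_box: "x \<in> topspace (cube n) \<Longrightarrow> x \<in> open_box n \<Longrightarrow> x \<in> cube_boundary n"
  by (auto simp: open_box_def cube_boundary_def in_cube)

lemma open_box_properties: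
  "open_box n \<subseteq> cube_boundary (Suc n)" "closedin (cube (Suc n)) (open_box n)"
  "anodyne (cylinder (cube (Suc n))) (topspace (cube (Suc n)) \<times> {0} \<union> open_box n \<times> {0..1})"
  "anodyne (cylinder (cube (Suc n))) (topspace (cube (Suc n)) \<times> {0, 1} \<union> open_box n \<times> {0..1})"
proof -
  show "open_box n \<subseteq> cube_boundary (Suc n)" unfolding cube_boundary_Suc by blast
  show "closedin (cube (Suc n)) (open_box n)" unfolding open_box_faces by (intro closedin_faces) auto
  show "anodyne (cylinder (cube (Suc n))) (topspace (cube (Suc n)) \<times> {0} \<union> open_box n \<times> {0..1})"
    unfolding open_box_faces by (rule anodyne_cylinder[of _ _ _ n 1]) auto
  show "anodyne (cylinder (cube (Suc n))) (topspace (cube (Suc n)) \<times> {0, 1} \<union> open_box n \<times> {0..1})"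
    unfolding open_box_faces by (rule anodyne_cylinder[of _ _ _ n 1]) auto
qed

lemma open_box_update:
  assumes x: "x \<in> open_box n" and n: "0 < n" and c: "x(0 := c) \<in> topspace (cube (Suc n))" "x 0 = 0 \<or> x 0 = 1 \<Longrightarrow> c = 0 \<or> c = 1"
  shows "x(0 := c) \<in> open_box n"
proof (cases "x n = 1")
  case True
  then show ?thesis using n c(1) by (simp add: open_box_def)
next
  case False
  then obtain i where i: "i < n" "x i = 0 \<or> x i = 1" using x by (auto simp: open_box_def)
  then have "(x(0 := c)) i = 0 \<or> (x(0 := c)) i = 1" using c(2) by auto
  then show ?thesis using i(1) c(1) unfolding open_box_def by blast
qed

lemma closedin_cylinder_Times:
  assumes "closedin X A" "closed E" shows "closedin (cylinder X) (A \<times> (E \<inter> {0..1}))"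
proof -
  have "closedin unit_interval (E \<inter> {0..1})" using assms(2) by (metis closedin_closed inf_commute)
  then show ?thesis using assms(1) by (simp add: closedin_prod_Times_iff)
qed

text \<open>The boundary of \<open>I^(n+1)\<close> consists of \<open>I^n\<close> and the open box, which meet in the boundary of \<open>I^n\<close>.\<close>

lemma continuous_map_extend_by_constant:
  assumes g: "continuous_map (cylinder (cube n)) Y g" and c: "c \<in> topspace Y"
    and gc: "\<And>x t. x \<in> cube_boundary n \<Longrightarrow> t \<in> {0..1} \<Longrightarrow> g (x, t) = c"
  shows "continuous_map (cylinder (subtopology (cube (Suc n)) (cube_boundary (Suc n)))) Y
    (\<lambda>z. if fst z n = 0 then g z else c)"
proof (rule continuous_map_eq)
  let ?X = "cylinder (cube (Suc n))"
  have union: "topspace (cube n) \<times> {0..1} \<union> open_box n \<times> {0..1} = cube_boundary (Suc n) \<times> {0..1::real}"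
    unfolding cube_boundary_Suc by blast
  have "continuous_map (subtopology ?X (topspace (cube n) \<times> {0..1} \<union> open_box n \<times> {0..1})) Y
      (\<lambda>z. if z \<in> topspace (cube n) \<times> {0..1} then g z else c)"
  proof (rule continuous_map_union_closed)
    show "closedin ?X (topspace (cube n) \<times> {0..1})" "closedin ?X (open_box n \<times> {0..1})"
      using closedin_cylinder_Times[of "cube (Suc n)" _ UNIV] open_box_properties(2)[of n]
      by (auto simp: bottom_face_faces closedin_faces)
    show "continuous_map (subtopology ?X (topspace (cube n) \<times> {0..1})) Y g"
      unfolding subtopology_cylinder bottom_face_subtopology by (rule g)
    show "g z = c" if "z \<in> topspace (cube n) \<times> {0..1}" "z \<in> open_box n \<times> {0..1}" for z
      using that gc bottom_open_box by (metis mem_Times_iff prod.collapse)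
  qed (use c in simp)
  then show "continuous_map (cylinder (subtopology (cube (Suc n)) (cube_boundary (Suc n)))) Y
      (\<lambda>z. if z \<in> topspace (cube n) \<times> {0..1} then g z else c)"
    unfolding union subtopology_cylinder .
  fix z assume "z \<in> topspace (cylinder (subtopology (cube (Suc n)) (cube_boundary (Suc n))))"
  then show "(if z \<in> topspace (cube n) \<times> {0..1} then g z else c) = (if fst z n = 0 then g z else c)"
    using bottom_face_iff[of "fst z" n] by auto
qed

context pointed_serre_groupoid
begin

abbreviation "fiber \<equiv> source_fiber G a0"
abbreviation "fiber_one \<equiv> gunit G a0"

lemma topspace_fiber: "g \<in> topspace fiber \<longleftrightarrow> g \<in> ar G \<and> src G g = a0"
  by (auto simp: source_fiber_def)

lemma fiber_one: "fiber_one \<in> topspace fiber"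
  using gunit_base by (simp add: topspace_fiber)

lemma continuous_map_fiber: "continuous_map X fiber g \<longleftrightarrow> continuous_map X (arrs G) g \<and> (\<forall>x\<in>topspace X. src G (g x) = a0)"
  by (auto simp: source_fiber_def continuous_map_in_subtopology)

lemma tgt_fiber: "continuous_map fiber (objs G) (tgt G)" "tgt G fiber_one = a0"
  using tgt_continuous gunit_base by (simp_all add: source_fiber_def continuous_map_from_subtopology)

text \<open>By \<open>anodyne_open_box\<close> every bundle has such a datum. It consists of a map \<open>I^n \<rightarrow> s\<inverse>(a0)\<close>, the restriction of
  \<open>\<gamma>\<close> to the last face, and a null homotopy \<open>f\<close> of its composite with \<open>t\<close>.\<close>

definition box_datum :: "nat \<Rightarrow> ((nat \<Rightarrow> real) \<Rightarrow> 'o) \<Rightarrow> ((nat \<Rightarrow> real) \<Rightarrow> 'a) \<Rightarrow> bool" where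
  "box_datum n f \<gamma> \<longleftrightarrow> cube_datum (Suc n) G a0 f \<gamma> \<and> (\<forall>x\<in>open_box n. \<gamma> x = fiber_one)"

lemma box_datum_on_box: "box_datum n f \<gamma> \<Longrightarrow> x \<in> open_box n \<Longrightarrow> \<gamma> x = fiber_one \<and> f x = a0"
  using section_datumD(4)[of G a0 "cube (Suc n)" "cube_boundary (Suc n)" f \<gamma> x] gunit_base open_box_properties(1)[of n]
  by (auto simp: box_datum_def)

lemma continuous_map_bottom:
  assumes "continuous_map (cylinder (subtopology (cube (Suc n)) (cube_boundary (Suc n)))) Y h"
  shows "continuous_map (cylinder (cube n)) Y h"
proof -
  have "continuous_map (subtopology (cylinder (subtopology (cube (Suc n)) (cube_boundary (Suc n)))) (topspace (cube n) \<times> {0..1})) Y h"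
    using assms by (rule continuous_map_from_subtopology)
  then show ?thesis
    unfolding subtopology_cylinder subtopology_subtopology
    using bottom_face_subtopology[of n] by (simp add: cube_boundary_Suc Int_absorb1 Int_absorb2)
qed

lemma box_datum_spheroid:
  assumes "box_datum n f \<gamma>" shows "\<gamma> \<in> spheroids n fiber fiber_one"
proof -
  have d: "cube_datum (Suc n) G a0 f \<gamma>" using assms by (simp add: box_datum_def)
  note D = section_datumD[OF d]
  have "continuous_map (cylinder (cube n)) (arrs G) (\<lambda>z. \<gamma> (fst z))"
    by (rule continuous_map_bottom[OF continuous_map_comp_fst[OF D(3)]])
  from continuous_map_at_time[OF this, of 0] have "continuous_map (cube n) (arrs G) \<gamma>" by simp
  moreover have "src G (\<gamma> x) = a0" if "x \<in> topspace (cube n)" for x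
    using D(5)[of x] that by (simp add: cube_boundary_Suc)
  ultimately show ?thesis
    using assms boundary_in_open_box[of n] unfolding spheroids_def continuous_map_fiber box_datum_def by auto
qed

lemma box_datum_exists:
  assumes "X \<in> carrier (bundle_group (Suc n) G a0)"
  obtains f \<gamma> where "box_datum n f \<gamma>" "X = bundle_class (Suc n) G a0 f \<gamma>"
proof -
  obtain f0 \<gamma>0 where X: "cube_datum (Suc n) G a0 f0 \<gamma>0" "X = bundle_class (Suc n) G a0 f0 \<gamma>0"
    using assms by (auto simp: carrier_bundle_group)
  obtain f \<gamma> where fg: "cube_datum (Suc n) G a0 f \<gamma>"
      "cube_bundle_iso (Suc n) G (cube_bundle_of (Suc n) G f \<gamma>) (cube_bundle_of (Suc n) G f0 \<gamma>0)"
      "\<And>x. x \<in> open_box n \<Longrightarrow> \<gamma> x = fiber_one"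
    by (rule cube_bundle_trivial_prescribed[OF cube_bundle_of_principal[OF X(1)] open_box_properties(1) anodyne_open_box,
        of "\<lambda>_. fiber_one"]) (use gunit_base in auto)
  then show ?thesis
    using that[of f \<gamma>] bundle_class_member[OF bundle_class_self[OF X(1)] fg(1,2), symmetric] X(2) by (simp add: box_datum_def)
qed

text \<open>The two data are connected by a homotopy that is constant on the box and a gauge transformation \<open>u\<close>, which
  is then the unit on the box. The homotopy restricts to one of spheroids. To deform \<open>u\<close> to the unit as well, keeping its
  source and its values on the box, one has to lift along the source map a function on \<open>I^(n+1) \<times> I\<close> with the lift
  prescribed on all faces but \<open>I^n \<times> I\<close>, which is possible because these form an anodyne pair.\<close>

theorem box_datum_homotopic:
  assumes box: "box_datum n f \<gamma>" "box_datum n f' \<gamma>'"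
    and eq: "bundle_class (Suc n) G a0 f \<gamma> = bundle_class (Suc n) G a0 f' \<gamma>'"
  shows "homotopic_spheroids n fiber fiber_one \<gamma> \<gamma>'"
proof -
  let ?C = "topspace (cube (Suc n))"
  have d: "cube_datum (Suc n) G a0 f \<gamma>" "cube_datum (Suc n) G a0 f' \<gamma>'" using box by (simp_all add: box_datum_def)
  have b1: "\<And>x. x \<in> open_box n \<Longrightarrow> \<gamma> x = fiber_one" "\<And>x. x \<in> open_box n \<Longrightarrow> \<gamma>' x = fiber_one"
    using box by (simp_all add: box_datum_def)
  obtain F \<Gamma> u where F: "homotopy_datum (Suc n) G a0 F \<Gamma>" "\<And>x. x \<in> ?C \<Longrightarrow> F (x, 0) = f x"
    "\<And>x. x \<in> cube_boundary (Suc n) \<Longrightarrow> \<Gamma> (x, 0) = \<gamma> x" "\<And>x t. x \<in> open_box n \<Longrightarrow> t \<in> {0..1} \<Longrightarrow> \<Gamma> (x, t) = fiber_one"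
    and u: "continuous_map (cube (Suc n)) (arrs G) u" "\<And>b. b \<in> ?C \<Longrightarrow> tgt G (u b) = f' b"
    "\<And>b. b \<in> ?C \<Longrightarrow> src G (u b) = F (b, 1)" "\<And>x. x \<in> cube_boundary (Suc n) \<Longrightarrow> gmul G (u x) (\<Gamma> (x, 1)) = \<gamma>' x"
    by (rule bundle_class_eq_normalised[OF d eq open_box_properties(1-3) b1(1)]) (assumption | rule that)+
  note FD = F(1)[unfolded cylinder_datum_iff]
  have bd: "x \<in> cube_boundary (Suc n)" if "x \<in> topspace (cube n)" for x using that by (simp add: cube_boundary_Suc)
  have cb: "continuous_map (cylinder (cube n)) (arrs G) \<Gamma>" using FD by (intro continuous_map_bottom) blast
  have 1: "homotopic_spheroids n fiber fiber_one \<gamma> (\<lambda>x. \<Gamma> (x, 1))"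
  proof (rule homotopic_spheroidsI)
    show "continuous_map (cylinder (cube n)) fiber \<Gamma>"
      unfolding continuous_map_fiber using cb FD bd by auto
  qed (use F(3,4) bd boundary_in_open_box[THEN subsetD] in auto)
  have f1: "continuous_map (cube (Suc n)) (objs G) (\<lambda>x. F (x, 1))"
    using FD by (auto intro: continuous_map_at_time)
  have box_F: "F (x, t) = a0" if "x \<in> open_box n" "t \<in> {0..1}" for x t
    using FD F(4)[OF that] that open_box_properties(1)[of n] gunit_base by (metis mem_Sigma_iff subsetD)
  have u_box: "u x = fiber_one" if x: "x \<in> open_box n" for x
  proof -
    have xC: "x \<in> ?C" and xb: "x \<in> cube_boundary (Suc n)" using x open_box_properties(1)[of n] cube_boundary_subset by auto
    have "src G (u x) = a0" using u(3)[OF xC] box_F[OF x, of 1] by simp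
    then have "gmul G (u x) fiber_one = u x" using gmul_gunit_right[of "u x"] continuous_map_apply[OF u(1) xC] by simp
    then show ?thesis using u(4)[OF xb] F(4)[OF x, of 1] b1(2)[OF x] by simp
  qed
  define w where "w z = (if z \<in> ?C \<times> {0} then u (fst z) else if z \<in> ?C \<times> {1} then gunit G (F (fst z, 1)) else fiber_one)" for z :: "(nat \<Rightarrow> real) \<times> real"
  have cl: "closedin (cylinder (cube (Suc n))) (?C \<times> {0})" "closedin (cylinder (cube (Suc n))) (?C \<times> {1})"
    "closedin (cylinder (cube (Suc n))) (open_box n \<times> {0..1})"
    using closedin_cylinder_Times[OF closedin_topspace, of "{0}" "cube (Suc n)"]
      closedin_cylinder_Times[OF closedin_topspace, of "{1}" "cube (Suc n)"]
      closedin_cylinder_Times[OF open_box_properties(2), of UNIV] by auto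
  have gF: "gunit G (F (x, 1)) = fiber_one" if "x \<in> open_box n" for x using box_F[OF that, of 1] by simp
  have cw: "continuous_map (subtopology (cylinder (cube (Suc n))) (?C \<times> {0} \<union> (?C \<times> {1} \<union> open_box n \<times> {0..1}))) (arrs G) w"
    unfolding w_def
  proof (rule continuous_map_union_closed)
    show "continuous_map (subtopology (cylinder (cube (Suc n))) (?C \<times> {1} \<union> open_box n \<times> {0..1})) (arrs G)
        (\<lambda>z. if z \<in> ?C \<times> {1} then gunit G (F (fst z, 1)) else fiber_one)"
    proof (rule continuous_map_union_closed[OF cl(2,3)])
      show "continuous_map (subtopology (cylinder (cube (Suc n))) (?C \<times> {1})) (arrs G) (\<lambda>z. gunit G (F (fst z, 1)))"
        by (intro continuous_map_from_subtopology continuous_map_gunit continuous_map_comp_fst[OF f1])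
    qed (use gunit_base gF in auto)
    show "continuous_map (subtopology (cylinder (cube (Suc n))) (?C \<times> {0})) (arrs G) (\<lambda>z. u (fst z))"
      by (intro continuous_map_from_subtopology continuous_map_comp_fst[OF u(1)])
    show "closedin (cylinder (cube (Suc n))) (?C \<times> {1} \<union> open_box n \<times> {0..1})" using cl by blast
    fix z :: "(nat \<Rightarrow> real) \<times> real"
    assume "z \<in> ?C \<times> {0}" "z \<in> ?C \<times> {1} \<union> open_box n \<times> {0..1}"
    then show "u (fst z) = (if z \<in> ?C \<times> {1} then gunit G (F (fst z, 1)) else fiber_one)" using u_box by auto
  qed (rule cl)
  have sets: "?C \<times> {0} \<union> (?C \<times> {1} \<union> open_box n \<times> {0..1}) = ?C \<times> {0, 1} \<union> open_box n \<times> {0..1::real}" by auto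
  have w01: "w (x, 0) = u x" "w (x, 1) = gunit G (F (x, 1))" if "x \<in> ?C" for x using that by (simp_all add: w_def)
  have w_box: "w (x, t) = fiber_one" if "x \<in> open_box n" for x t
    using that u_box gF by (simp add: w_def)
  have FC: "F (x, 1) \<in> ob G" if "x \<in> ?C" for x using continuous_map_apply[OF f1 that] .
  have sw: "src G (w z) = F (fst z, 1)" if z: "z \<in> ?C \<times> {0, 1} \<union> open_box n \<times> {0..1}" for z
  proof -
    obtain x t where xt: "z = (x, t)" by force
    show ?thesis
    proof (cases "x \<in> open_box n")
      case True
      then show ?thesis using w_box[OF True, of t] box_F[OF True, of 1] gunit_base by (simp add: xt)
    next
      case False
      then have "x \<in> ?C" "t = 0 \<or> t = 1" using z by (auto simp: xt)
      then show ?thesis using w01[of x] u(3)[of x] FC[of x] by (auto simp: xt src_gunit)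
    qed
  qed
  obtain V where V: "continuous_map (cylinder (cube (Suc n))) (arrs G) V"
    "\<And>z. z \<in> topspace (cylinder (cube (Suc n))) \<Longrightarrow> src G (V z) = F (fst z, 1)"
    "\<And>z. z \<in> ?C \<times> {0, 1} \<union> open_box n \<times> {0..1} \<Longrightarrow> V z = w z"
    by (rule serre_fibration_lift[OF serre open_box_properties(4) cw[unfolded sets] continuous_map_comp_fst[OF f1] sw])
      (assumption | rule that)+
  have cV: "continuous_map (cylinder (cube n)) (arrs G) V"
  proof (rule continuous_map_bottom)
    show "continuous_map (cylinder (subtopology (cube (Suc n)) (cube_boundary (Suc n)))) (arrs G) V"
      unfolding subtopology_cylinder[symmetric] by (rule continuous_map_from_subtopology[OF V(1)])
  qed
  have cG1: "continuous_map (cylinder (cube n)) (arrs G) (\<lambda>z. \<Gamma> (fst z, 1))"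
    using cb by (intro continuous_map_comp_fst continuous_map_at_time) auto
  have comp: "src G (V (x, t)) = tgt G (\<Gamma> (x, 1))" "src G (\<Gamma> (x, 1)) = a0" "\<Gamma> (x, 1) \<in> ar G" "V (x, t) \<in> ar G"
    if "x \<in> topspace (cube n)" "t \<in> {0..1}" for x t
    using V(2)[of "(x, t)"] FD bd[OF that(1)] that bottom_face_subset[of n] continuous_map_apply[OF cb, of "(x, 1)"]
      continuous_map_apply[OF cV, of "(x, t)"] by auto
  have 2: "homotopic_spheroids n fiber fiber_one \<gamma>' (\<lambda>x. \<Gamma> (x, 1))"
  proof (rule homotopic_spheroidsI)
    have "continuous_map (cylinder (cube n)) (arrs G) (\<lambda>z. gmul G (V z) (\<Gamma> (fst z, 1)))"
      using comp(1) by (intro continuous_map_gmul[OF cV cG1]) auto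
    then show "continuous_map (cylinder (cube n)) fiber (\<lambda>z. gmul G (V z) (\<Gamma> (fst z, 1)))"
      unfolding continuous_map_fiber using comp by (auto simp: src_gmul)
    show "gmul G (V (x, t)) (\<Gamma> (fst (x, t), 1)) = fiber_one" if "x \<in> cube_boundary n" "t \<in> {0..1}" for x t
    proof -
      have "x \<in> open_box n" using that boundary_in_open_box by blast
      then show ?thesis
        using V(3)[of "(x, t)"] w_box[of x t] F(4)[of x 1] that gmul_gunit_right[of fiber_one] gunit_base by simp
    qed
    fix x assume x: "x \<in> topspace (cube n)"
    then have xC: "x \<in> ?C" using bottom_face_subset by blast
    show "gmul G (V (x, 0)) (\<Gamma> (fst (x, 0), 1)) = \<gamma>' x" using V(3)[of "(x, 0)"] w01[OF xC] u(4)[OF bd[OF x]] xC by simp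
    show "gmul G (V (x, 1)) (\<Gamma> (fst (x, 1), 1)) = \<Gamma> (x, 1)"
      using V(3)[of "(x, 1)"] w01[OF xC] xC comp[OF x, of 1] FD bd[OF x] gmul_gunit_left[of "\<Gamma> (x, 1)"] by simp
  qed
  show ?thesis by (rule homotopic_spheroids_trans[OF 1 homotopic_spheroids_sym[OF 2]])
qed

text \<open>Every choice of a representative and of a section extending \<open>\<sigma>\<close> from the box yields a box datum of the same class,
  so \<open>box_datum_homotopic\<close> applies.\<close>

lemma connecting_class:
  assumes box: "box_datum n f \<gamma>"
  shows "connecting_map n G a0 (bundle_class (Suc n) G a0 f \<gamma>) = spheroid_class n fiber fiber_one \<gamma>"
proof (intro subset_antisym subsetI)
  have d: "cube_datum (Suc n) G a0 f \<gamma>" using box by (simp add: box_datum_def)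
  note D = section_datumD[OF d]
  {
    fix h assume "h \<in> connecting_map n G a0 (bundle_class (Suc n) G a0 f \<gamma>)"
    then obtain P \<tau> where P: "P \<in> bundle_class (Suc n) G a0 f \<gamma>" and \<tau>: "continuous_map (cube (Suc n)) (total P) \<tau>"
      "\<And>x. x \<in> topspace (cube (Suc n)) \<Longrightarrow> proj P (\<tau> x) = x" "\<forall>x\<in>open_box n. \<tau> x = sect P x"
      and h: "homotopic_spheroids n fiber fiber_one (\<lambda>y. transporter G P (\<tau> y) (sect P y)) h"
      unfolding connecting_map_def by blast
    interpret P: principal_pair_bundle G a0 "cube (Suc n)" "cube_boundary (Suc n)" P
      using P by (simp add: bundle_class_def homotopic_bundles_def)
    define f' where "f' b = anchor P (\<tau> b)" for b
    define \<gamma>' where "\<gamma>' x = transporter G P (\<tau> x) (sect P x)" for x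
    have d': "cube_datum (Suc n) G a0 f' \<gamma>'" and iso: "cube_bundle_iso (Suc n) G (cube_bundle_of (Suc n) G f' \<gamma>') P"
      using P.section_datum_of_section[OF \<tau>(1,2), of f' \<gamma>'] by (auto simp: f'_def \<gamma>'_def bundle_iso_def)
    have "\<gamma>' x = fiber_one" if x: "x \<in> open_box n" for x
    proof -
      have xb: "x \<in> cube_boundary (Suc n)" using x open_box_properties(1) by blast
      have "transporter G P (sect P x) (sect P x) = fiber_one"
        using P.sect_closed[OF xb] P.anchor_sect[OF xb] P.act_gunit[of "sect P x"] gunit_base
        by (intro P.transporter_unique) auto
      then show ?thesis using \<tau>(3) x by (simp add: \<gamma>'_def)
    qed
    then have "box_datum n f' \<gamma>'" using d' by (simp add: box_datum_def)
    from box_datum_homotopic[OF box this bundle_class_member[OF P d' iso, symmetric]]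
    show "h \<in> spheroid_class n fiber fiber_one \<gamma>"
      using homotopic_spheroids_trans[OF _ h[folded \<gamma>'_def]] by (simp add: spheroid_class_def)
  next
    fix h assume h: "h \<in> spheroid_class n fiber fiber_one \<gamma>"
    let ?P = "cube_bundle_of (Suc n) G f \<gamma>"
    interpret P: principal_pair_bundle G a0 "cube (Suc n)" "cube_boundary (Suc n)" ?P
      by (rule cube_bundle_of_principal[OF d])
    have fC: "f x \<in> ob G" if "x \<in> topspace (cube (Suc n))" for x using continuous_map_apply[OF D(2) that] .
    have "transporter G ?P (x, gunit G (f x)) (sect ?P x) = \<gamma> x" if x: "x \<in> topspace (cube n)" for x
    proof -
      have xb: "x \<in> cube_boundary (Suc n)" "x \<in> topspace (cube (Suc n))"
        using x bottom_face_subset by (auto simp: cube_boundary_Suc)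
      show ?thesis
        using D(4,6)[OF xb(1)] fC[OF xb(2)] xb gmul_gunit_left[of "\<gamma> x"]
        by (intro P.transporter_unique) (auto simp: datum_bundle_simps gunit_closed src_gunit tgt_gunit)
    qed
    then have "homotopic_spheroids n fiber fiber_one (\<lambda>y. transporter G ?P (y, gunit G (f y)) (sect ?P y)) h"
      using homotopic_spheroids_trans[OF homotopic_spheroids_sym[OF homotopic_spheroids_cong[OF box_datum_spheroid[OF box]]]] h
      by (simp add: spheroid_class_def)
    moreover have "continuous_map (cube (Suc n)) (total ?P) (\<lambda>x. (x, gunit G (f x)))"
      unfolding datum_bundle_simps using D(2) fC
      by (auto simp: continuous_map_in_subtopology continuous_map_pairedI continuous_map_gunit tgt_gunit)
    moreover have "\<forall>x\<in>open_box n. (x, gunit G (f x)) = sect ?P x"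
      using box_datum_on_box[OF box] by (auto simp: datum_bundle_simps)
    ultimately show "h \<in> connecting_map n G a0 (bundle_class (Suc n) G a0 f \<gamma>)"
      using bundle_class_self[OF d] unfolding connecting_map_def
      by (intro CollectI bexI[of _ ?P] exI[of _ "\<lambda>x. (x, gunit G (f x))"]) (auto simp: datum_bundle_simps(2))
  }
qed

lemma box_datum_trivial: "f \<in> spheroids (Suc n) (objs G) a0 \<Longrightarrow> box_datum n f (\<lambda>_. fiber_one)"
  by (simp add: box_datum_def trivial_datum)

lemma homotopy_hom_connecting:
  "homotopy_hom n (bundle_group (Suc n) G a0) (fiber_homotopy_group n G a0) (connecting_map n G a0)"
proof (rule homotopy_homI)
  show "connecting_map n G a0 \<in> carrier (bundle_group (Suc n) G a0) \<rightarrow> carrier (fiber_homotopy_group n G a0)"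
    using connecting_class box_datum_spheroid by (auto simp: carrier_homotopy_group elim!: box_datum_exists)
  show "connecting_map n G a0 \<one>\<^bsub>bundle_group (Suc n) G a0\<^esub> = \<one>\<^bsub>fiber_homotopy_group n G a0\<^esub>"
    unfolding one_bundle_group one_homotopy_group by (rule connecting_class[OF box_datum_trivial[OF constant_spheroid[OF base_in]]])
  show "\<one>\<^bsub>bundle_group (Suc n) G a0\<^esub> \<in> carrier (bundle_group (Suc n) G a0)" by (rule one_bundle_group_carrier)
  assume "1 \<le> n"
  then have n: "0 < n" by simp
  show "group (bundle_group (Suc n) G a0)" by (rule group_bundle_group) simp
  show "group (fiber_homotopy_group n G a0)" by (rule cubical_group.is_group[OF cubical_group_spheroids[OF n fiber_one]])
  fix X Y assume XY: "X \<in> carrier (bundle_group (Suc n) G a0)" "Y \<in> carrier (bundle_group (Suc n) G a0)"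
  obtain f \<gamma> where X: "box_datum n f \<gamma>" "X = bundle_class (Suc n) G a0 f \<gamma>" by (rule box_datum_exists[OF XY(1)])
  obtain f' \<gamma>' where Y: "box_datum n f' \<gamma>'" "Y = bundle_class (Suc n) G a0 f' \<gamma>'" by (rule box_datum_exists[OF XY(2)])
  have d: "cube_datum (Suc n) G a0 f \<gamma>" "cube_datum (Suc n) G a0 f' \<gamma>'" using X Y by (simp_all add: box_datum_def)
  \<comment> \<open>For \<open>n \<ge> 1\<close> both faces along which bundles are concatenated lie in the box.\<close>
  have m: "matched (Suc n) \<gamma> \<gamma>'"
    unfolding matched_def
  proof (intro ballI impI)
    fix x assume x: "x \<in> cube_boundary (Suc n)" "x 0 = 0"
    then have "x(0 := 1) \<in> cube_boundary (Suc n)" using boundary_face[of x "Suc n" 1] cube_boundary_subset by auto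
    then have "x \<in> open_box n" "x(0 := 1) \<in> open_box n" using x n by (auto simp: open_box_def cube_boundary_def)
    then show "\<gamma>' x = \<gamma> (x(0 := 1))" using X Y by (simp add: box_datum_def)
  qed
  have box: "box_datum n (concat_spheroid f f') (concat_spheroid \<gamma> \<gamma>')"
    unfolding box_datum_def
  proof (intro conjI ballI)
    show "cube_datum (Suc n) G a0 (concat_spheroid f f') (concat_spheroid \<gamma> \<gamma>')" by (rule cube_datum_concat[OF _ d m]) simp
    fix x assume x: "x \<in> open_box n"
    have xc: "x \<in> topspace (cube (Suc n))" using x by (simp add: open_box_def)
    have "x(0 := 2 * x 0) \<in> open_box n" if "x 0 \<le> 1/2"
      using cube_halves(1)[OF xc _ that] that by (intro open_box_update[OF x n]) auto
    moreover have "x(0 := 2 * x 0 - 1) \<in> open_box n" if "1/2 \<le> x 0"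
      using cube_halves(2)[OF xc _ that] that by (intro open_box_update[OF x n]) auto
    ultimately show "concat_spheroid \<gamma> \<gamma>' x = fiber_one" using X Y by (simp add: box_datum_def concat_spheroid_def)
  qed
  show "connecting_map n G a0 (X \<otimes>\<^bsub>bundle_group (Suc n) G a0\<^esub> Y) =
      connecting_map n G a0 X \<otimes>\<^bsub>fiber_homotopy_group n G a0\<^esub> connecting_map n G a0 Y"
    using mult_bundle_class[OF _ d m] connecting_class[OF box] connecting_class[OF X(1)] connecting_class[OF Y(1)]
      mult_spheroid_class[OF n box_datum_spheroid[OF X(1)] box_datum_spheroid[OF Y(1)]] X(2) Y(2) by simp
qed

end

section \<open>Exactness\<close>

context pointed_serre_groupoid
begin

lemma target_class:
  assumes "g \<in> spheroids n fiber fiber_one"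
  shows "tgt G \<circ> g \<in> spheroids n (objs G) a0"
    "target_map n G a0 (spheroid_class n fiber fiber_one g) = spheroid_class n (objs G) a0 (tgt G \<circ> g)"
  using homotopy_group_map_class[OF tgt_fiber assms] by simp_all

lemma spheroid_fiberD:
  assumes "g \<in> spheroids n fiber fiber_one"
  shows "continuous_map (cube n) (arrs G) g" "x \<in> topspace (cube n) \<Longrightarrow> g x \<in> ar G"
    "x \<in> topspace (cube n) \<Longrightarrow> src G (g x) = a0" "x \<in> cube_boundary n \<Longrightarrow> g x = fiber_one"
  using assms continuous_map_apply[of "cube n" fiber g x] by (auto simp: spheroids_def continuous_map_fiber topspace_fiber)

text \<open>A map \<open>g\<close> into the source fiber is a gauge transformation from the trivial datum to that of \<open>t g\<close>. Conversely, if the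
  bundle of \<open>f\<close> is homotopic to the trivial one, the homotopy can be trivialised with the unit on the whole boundary. It
  is then a homotopy of spheroids from \<open>f\<close> to some \<open>f'\<close>, and the gauge transformation from \<open>f'\<close> to the
  trivial datum is the inverse of a map \<open>g\<close> with \<open>f' = t g\<close>.\<close>

theorem exact_at_objects:
  "target_map n G a0 ` carrier (fiber_homotopy_group n G a0) =
   kernel (object_homotopy_group n G a0) (bundle_group n G a0) (pullback_unit_map n G a0)"
proof (intro subset_antisym subsetI)
  fix Y assume "Y \<in> target_map n G a0 ` carrier (fiber_homotopy_group n G a0)"
  then obtain g where g: "g \<in> spheroids n fiber fiber_one" "Y = target_map n G a0 (spheroid_class n fiber fiber_one g)"
    by (auto simp: carrier_homotopy_group)
  note gD = spheroid_fiberD[OF g(1)] and t = target_class[OF g(1)]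
  have "bundle_class n G a0 (\<lambda>_. a0) (\<lambda>_. fiber_one) = bundle_class n G a0 (tgt G \<circ> g) (\<lambda>_. fiber_one)"
  proof (rule bundle_class_gauge[OF trivial_datum[OF constant_spheroid[OF base_in]] trivial_datum[OF t(1)] gD(1)])
    fix x assume "x \<in> cube_boundary n"
    then show "gmul G (g x) fiber_one = fiber_one" using gD(4) gmul_gunit_right[of fiber_one] gunit_base by simp
  qed (use gD(3) in auto)
  then show "Y \<in> kernel (object_homotopy_group n G a0) (bundle_group n G a0) (pullback_unit_map n G a0)"
    using t by (auto simp: kernel_def carrier_homotopy_group g(2) pullback_unit_class one_bundle_group)
next
  fix Y assume "Y \<in> kernel (object_homotopy_group n G a0) (bundle_group n G a0) (pullback_unit_map n G a0)"
  then obtain f where f: "f \<in> spheroids n (objs G) a0" "Y = spheroid_class n (objs G) a0 f"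
    "bundle_class n G a0 f (\<lambda>_. fiber_one) = bundle_class n G a0 (\<lambda>_. a0) (\<lambda>_. fiber_one)"
    by (auto simp: kernel_def carrier_homotopy_group pullback_unit_class one_bundle_group)
  obtain F \<Gamma> u where F: "homotopy_datum n G a0 F \<Gamma>" "\<And>x. x \<in> topspace (cube n) \<Longrightarrow> F (x, 0) = f x"
    "\<And>x. x \<in> cube_boundary n \<Longrightarrow> \<Gamma> (x, 0) = fiber_one" "\<And>x t. x \<in> cube_boundary n \<Longrightarrow> t \<in> {0..1} \<Longrightarrow> \<Gamma> (x, t) = fiber_one"
    and u: "continuous_map (cube n) (arrs G) u" "\<And>b. b \<in> topspace (cube n) \<Longrightarrow> tgt G (u b) = a0"
    "\<And>b. b \<in> topspace (cube n) \<Longrightarrow> src G (u b) = F (b, 1)" "\<And>x. x \<in> cube_boundary n \<Longrightarrow> gmul G (u x) (\<Gamma> (x, 1)) = fiber_one"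
    by (rule bundle_class_eq_normalised[OF trivial_datum[OF f(1)] trivial_datum[OF constant_spheroid[OF base_in]] f(3)
        order_refl closedin_cube_boundary anodyne_bottom_boundary refl]) (assumption | rule that)+
  note FD = F(1)[unfolded cylinder_datum_iff]
  have F_bd: "F (x, t) = a0" if "x \<in> cube_boundary n" "t \<in> {0..1}" for x t
    using FD F(4)[OF that] that gunit_base by (metis mem_Sigma_iff)
  define g where "g x = ginv G (u x)" for x
  have up: "u x \<in> ar G" if "x \<in> topspace (cube n)" for x using continuous_map_apply[OF u(1) that] .
  have u_bd: "u x = fiber_one" if x: "x \<in> cube_boundary n" for x
  proof -
    have xC: "x \<in> topspace (cube n)" using x cube_boundary_subset by blast
    have "gmul G (u x) fiber_one = u x"
      using gmul_gunit_right[OF up[OF xC]] u(3)[OF xC] F_bd[OF x, of 1] by simp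
    then show ?thesis using u(4)[OF x] F(4)[OF x, of 1] by simp
  qed
  have g: "g \<in> spheroids n fiber fiber_one"
    unfolding spheroids_def continuous_map_fiber g_def
    using continuous_map_ginv[OF u(1)] u(2) up u_bd base_in by (auto simp: src_ginv ginv_gunit)
  have "homotopic_spheroids n (objs G) a0 f (tgt G \<circ> g)"
    by (rule homotopic_spheroidsI[of _ _ F]) (use FD F(2) F_bd u(3) up in \<open>auto simp: g_def tgt_ginv\<close>)
  then have "Y = target_map n G a0 (spheroid_class n fiber fiber_one g)"
    unfolding f(2) target_class(2)[OF g] by (rule spheroid_class_eqI)
  then show "Y \<in> target_map n G a0 ` carrier (fiber_homotopy_group n G a0)" using g by (auto simp: carrier_homotopy_group)
qed

text \<open>A null homotopy of the restriction of \<open>\<gamma>\<close> to the last face extends by the unit to a homotopy of \<open>\<gamma>\<close>.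
  By the homotopy extension property \<open>f\<close> can be made to follow it, and it ends as a spheroid of the space of objects.\<close>

theorem exact_at_bundles:
  "pullback_unit_map (Suc n) G a0 ` carrier (object_homotopy_group (Suc n) G a0) =
   kernel (bundle_group (Suc n) G a0) (fiber_homotopy_group n G a0) (connecting_map n G a0)"
proof (intro subset_antisym subsetI)
  fix X assume "X \<in> pullback_unit_map (Suc n) G a0 ` carrier (object_homotopy_group (Suc n) G a0)"
  then obtain f where f: "f \<in> spheroids (Suc n) (objs G) a0" "X = bundle_class (Suc n) G a0 f (\<lambda>_. fiber_one)"
    by (auto simp: carrier_homotopy_group pullback_unit_class)
  then show "X \<in> kernel (bundle_group (Suc n) G a0) (fiber_homotopy_group n G a0) (connecting_map n G a0)"
    using trivial_datum[OF f(1)] connecting_class[OF box_datum_trivial[OF f(1)]]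
    by (auto simp: kernel_def carrier_bundle_group one_homotopy_group)
next
  let ?C = "topspace (cube (Suc n))" and ?D = "cube_boundary (Suc n)"
  fix X assume "X \<in> kernel (bundle_group (Suc n) G a0) (fiber_homotopy_group n G a0) (connecting_map n G a0)"
  then have X: "X \<in> carrier (bundle_group (Suc n) G a0)" "connecting_map n G a0 X = spheroid_class n fiber fiber_one (\<lambda>_. fiber_one)"
    by (auto simp: kernel_def one_homotopy_group)
  obtain f \<gamma> where fg: "box_datum n f \<gamma>" "X = bundle_class (Suc n) G a0 f \<gamma>" by (rule box_datum_exists[OF X(1)])
  have d: "cube_datum (Suc n) G a0 f \<gamma>" using fg by (simp add: box_datum_def)
  note D = section_datumD[OF d]
  have "homotopic_spheroids n fiber fiber_one \<gamma> (\<lambda>_. fiber_one)"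
    using spheroid_class_eqD[OF constant_spheroid[OF fiber_one]] X(2) connecting_class[OF fg(1)] fg(2) by simp
  then obtain g where g: "continuous_map (cylinder (cube n)) fiber g" "\<forall>x\<in>topspace (cube n). g (x, 0) = \<gamma> x"
     "\<forall>x\<in>topspace (cube n). g (x, 1) = fiber_one" "\<forall>x\<in>cube_boundary n. \<forall>t\<in>{0..1}. g (x, t) = fiber_one"
    unfolding homotopic_spheroids_cylinder by blast
  define \<Gamma> where "\<Gamma> z = (if fst z n = 0 then g z else fiber_one)" for z
  have c\<Gamma>': "continuous_map (cylinder (subtopology (cube (Suc n)) ?D)) fiber \<Gamma>"
    unfolding \<Gamma>_def using g by (intro continuous_map_extend_by_constant) (auto simp: fiber_one)
  then have c\<Gamma>: "continuous_map (cylinder (subtopology (cube (Suc n)) ?D)) (arrs G) \<Gamma>" by (simp add: continuous_map_fiber)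
  have src\<Gamma>: "src G (\<Gamma> z) = a0" if "z \<in> ?D \<times> {0..1}" for z
    using c\<Gamma>' that cube_boundary_subset[of "Suc n"] by (auto simp: continuous_map_fiber)
  have \<Gamma>0: "\<Gamma> (x, 0) = \<gamma> x" and \<Gamma>1: "\<Gamma> (x, 1) = fiber_one" if x: "x \<in> ?D" for x
  proof -
    have xC: "x \<in> ?C" using x cube_boundary_subset by blast
    show "\<Gamma> (x, 1) = fiber_one" using g(3) bottom_face_iff[OF xC] by (simp add: \<Gamma>_def)
    show "\<Gamma> (x, 0) = \<gamma> x"
    proof (cases "x n = 0")
      case False
      then have "x \<in> open_box n" using x bottom_face_iff[OF xC] by (auto simp: cube_boundary_Suc)
      then show ?thesis using False fg(1) by (simp add: \<Gamma>_def box_datum_def)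
    qed (use g(2) bottom_face_iff[OF xC] in \<open>simp add: \<Gamma>_def\<close>)
  qed
  define F0 where "F0 z = (if z \<in> ?C \<times> {0} then f (fst z) else tgt G (\<Gamma> z))" for z
  have "continuous_map (subtopology (cylinder (cube (Suc n))) (?C \<times> {0} \<union> ?D \<times> {0..1})) (objs G) F0"
    unfolding F0_def
  proof (rule continuous_map_union_closed)
    show "closedin (cylinder (cube (Suc n))) (?C \<times> {0})" "closedin (cylinder (cube (Suc n))) (?D \<times> {0..1})"
      using closedin_cylinder_Times[OF closedin_topspace, of "{0}" "cube (Suc n)"]
        closedin_cylinder_Times[OF closedin_cube_boundary, of UNIV "Suc n"] by auto
    show "continuous_map (subtopology (cylinder (cube (Suc n))) (?C \<times> {0})) (objs G) (\<lambda>z. f (fst z))"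
      by (intro continuous_map_from_subtopology continuous_map_comp_fst D(2))
    show "continuous_map (subtopology (cylinder (cube (Suc n))) (?D \<times> {0..1})) (objs G) (\<lambda>z. tgt G (\<Gamma> z))"
      unfolding subtopology_cylinder by (rule continuous_map_tgt[OF c\<Gamma>])
  qed (use \<Gamma>0 D(4) in auto)
  from anodyne_extension[OF anodyne_bottom_boundary this]
  obtain F where F: "continuous_map (cylinder (cube (Suc n))) (objs G) F" "\<And>z. z \<in> ?C \<times> {0} \<union> ?D \<times> {0..1} \<Longrightarrow> F z = F0 z"
    by blast
  have F_bd: "F z = tgt G (\<Gamma> z)" if "z \<in> ?D \<times> {0..1}" for z
    using that F(2)[of z] \<Gamma>0 D(4) by (auto simp: F0_def)
  have hd: "homotopy_datum (Suc n) G a0 F \<Gamma>"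
    unfolding cylinder_datum_iff using F(1) c\<Gamma> F_bd src\<Gamma> cube_boundary_subset by auto
  have "X = bundle_class (Suc n) G a0 (\<lambda>x. F (x, 0)) (\<lambda>x. \<Gamma> (x, 0))"
    unfolding fg(2) using F(2) \<Gamma>0 by (intro bundle_class_cong(1)[OF d]) (auto simp: F0_def)
  also have "\<dots> = bundle_class (Suc n) G a0 (\<lambda>x. F (x, 1)) (\<lambda>x. \<Gamma> (x, 1))" by (rule bundle_class_homotopy[OF hd])
  also have "\<dots> = bundle_class (Suc n) G a0 (\<lambda>x. F (x, 1)) (\<lambda>_. fiber_one)"
    using \<Gamma>1 by (intro bundle_class_cong(1)[OF cylinder_datum_at[OF hd]]) auto
  finally have X1: "X = bundle_class (Suc n) G a0 (\<lambda>x. F (x, 1)) (\<lambda>_. fiber_one)" .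
  have F1: "(\<lambda>x. F (x, 1)) \<in> spheroids (Suc n) (objs G) a0"
    unfolding spheroids_def using continuous_map_at_time[OF F(1), of 1] F_bd \<Gamma>1 gunit_base by auto
  then show "X \<in> pullback_unit_map (Suc n) G a0 ` carrier (object_homotopy_group (Suc n) G a0)"
    unfolding X1 pullback_unit_class[OF F1, symmetric] carrier_homotopy_group by (intro imageI)
qed

text \<open>A box datum with restriction \<open>g\<close> to the last face is the same as a null homotopy of \<open>t g\<close>.\<close>

theorem exact_at_fiber:
  "connecting_map n G a0 ` carrier (bundle_group (Suc n) G a0) =
   kernel (fiber_homotopy_group n G a0) (object_homotopy_group n G a0) (target_map n G a0)"
proof (intro subset_antisym subsetI)
  let ?to = "\<lambda>(x, t). x(n := t) :: nat \<Rightarrow> real" and ?from = "\<lambda>x. (x(n := 0) :: nat \<Rightarrow> real, x n)"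
  have hm: "continuous_map (cylinder (cube n)) (cube (Suc n)) ?to" "continuous_map (cube (Suc n)) (cylinder (cube n)) ?from"
    using cylinder_cube_homeomorphism[of n] by (auto simp: homeomorphic_maps_def)
  {
    fix Y assume "Y \<in> connecting_map n G a0 ` carrier (bundle_group (Suc n) G a0)"
    then obtain X where X: "X \<in> carrier (bundle_group (Suc n) G a0)" "Y = connecting_map n G a0 X" by blast
    obtain f \<gamma> where fg: "box_datum n f \<gamma>" "X = bundle_class (Suc n) G a0 f \<gamma>" by (rule box_datum_exists[OF X(1)])
    have d: "cube_datum (Suc n) G a0 f \<gamma>" using fg by (simp add: box_datum_def)
    note D = section_datumD[OF d]
    have Y: "Y = spheroid_class n fiber fiber_one \<gamma>" using X(2) fg connecting_class by simp
    have "homotopic_spheroids n (objs G) a0 (tgt G \<circ> \<gamma>) (\<lambda>_. a0)"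
    proof (rule homotopic_spheroidsI)
      show "continuous_map (cylinder (cube n)) (objs G) (f \<circ> ?to)" by (rule continuous_map_compose[OF hm(1) D(2)])
      show "(f \<circ> ?to) (x, t) = a0" if x: "x \<in> cube_boundary n" and t: "t \<in> {0..1}" for x t
      proof -
        obtain i where i: "i < n" "x i = 0 \<or> x i = 1" using x by (auto simp: cube_boundary_def)
        have "x(n := t) \<in> topspace (cube (Suc n))" using x t by (auto simp: cube_boundary_def in_cube less_Suc_eq)
        then have "x(n := t) \<in> open_box n" using i by (auto simp: open_box_def)
        then show ?thesis using box_datum_on_box[OF fg(1)] by simp
      qed
      fix x assume x: "x \<in> topspace (cube n)"
      then have "x(n := 0) = x" by (auto simp: in_cube)
      then show "(f \<circ> ?to) (x, 0) = (tgt G \<circ> \<gamma>) x" using D(4)[of x] x by (simp add: cube_boundary_Suc)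
      have "x(n := 1) \<in> open_box n" using x by (auto simp: open_box_def in_cube less_Suc_eq)
      then show "(f \<circ> ?to) (x, 1) = a0" using box_datum_on_box[OF fg(1)] by simp
    qed
    from spheroid_class_eqI[OF this]
    show "Y \<in> kernel (fiber_homotopy_group n G a0) (object_homotopy_group n G a0) (target_map n G a0)"
      using box_datum_spheroid[OF fg(1)] target_class(2)[OF box_datum_spheroid[OF fg(1)]]
      by (simp add: kernel_def Y carrier_homotopy_group one_homotopy_group)
  next
    fix Y assume "Y \<in> kernel (fiber_homotopy_group n G a0) (object_homotopy_group n G a0) (target_map n G a0)"
    then obtain g where g: "g \<in> spheroids n fiber fiber_one" "Y = spheroid_class n fiber fiber_one g"
      and t: "target_map n G a0 Y = spheroid_class n (objs G) a0 (\<lambda>_. a0)"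
      by (auto simp: kernel_def carrier_homotopy_group one_homotopy_group)
    note gD = spheroid_fiberD[OF g(1)]
    have "homotopic_spheroids n (objs G) a0 (tgt G \<circ> g) (\<lambda>_. a0)"
      using spheroid_class_eqD[OF constant_spheroid[OF base_in]] t target_class(2)[OF g(1)] g(2) by simp
    then obtain h where h: "continuous_map (cylinder (cube n)) (objs G) h" "\<forall>x\<in>topspace (cube n). h (x, 0) = (tgt G \<circ> g) x"
     "\<forall>x\<in>topspace (cube n). h (x, 1) = a0" "\<forall>x\<in>cube_boundary n. \<forall>t\<in>{0..1}. h (x, t) = a0"
      unfolding homotopic_spheroids_cylinder by blast
    define f where "f = h \<circ> ?from"
    define \<gamma> where "\<gamma> x = (if x n = 0 then g x else fiber_one)" for x
    have cf: "continuous_map (cube (Suc n)) (objs G) f" unfolding f_def by (rule continuous_map_compose[OF hm(2) h(1)])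
    have "continuous_map (cylinder (subtopology (cube (Suc n)) (cube_boundary (Suc n)))) fiber
        (\<lambda>z. if fst z n = 0 then g (fst z) else fiber_one)"
      using g gD(4) by (intro continuous_map_extend_by_constant continuous_map_comp_fst) (auto simp: fiber_one spheroids_def)
    from continuous_map_at_time[OF this, of 0]
    have c\<gamma>: "continuous_map (subtopology (cube (Suc n)) (cube_boundary (Suc n))) fiber \<gamma>" by (simp add: \<gamma>_def[abs_def] cong: if_cong)
    have \<gamma>_box: "\<gamma> x = fiber_one" if x: "x \<in> open_box n" for x
    proof (cases "x n = 0")
      case True
      then have "x \<in> topspace (cube n)" using bottom_face_iff[of x n] x by (auto simp: open_box_def)
      then show ?thesis using gD(4)[OF bottom_open_box[OF _ x]] by (simp add: \<gamma>_def)
    qed (simp add: \<gamma>_def)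
    have tgt: "tgt G (\<gamma> x) = f x" if x: "x \<in> cube_boundary (Suc n)" for x
    proof (cases "x n = 0")
      case True
      then have "x \<in> topspace (cube n)" "x(n := 0) = x" using bottom_face_iff[of x n] x cube_boundary_subset by auto
      then show ?thesis using True h(2) by (simp add: \<gamma>_def f_def)
    next
      case False
      have xC: "x \<in> topspace (cube (Suc n))" using x cube_boundary_subset by blast
      then have box: "x \<in> open_box n" using False x bottom_face_iff[OF xC] by (auto simp: cube_boundary_Suc)
      have xn: "x(n := 0) \<in> topspace (cube n)" "x n \<in> {0..1}"
        using xC by (auto simp: in_cube)
      have "f x = a0"
      proof (cases "x n = 1")
        case True then show ?thesis using h(3) xn by (simp add: f_def)
      next
        case False
        then obtain i where "i < n" "x i = 0 \<or> x i = 1" using box by (auto simp: open_box_def)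
        then have "x(n := 0) \<in> cube_boundary n" using xn(1) by (auto simp: cube_boundary_def)
        then show ?thesis using h(4) xn(2) by (simp add: f_def)
      qed
      then show ?thesis using \<gamma>_box[OF box] gunit_base by simp
    qed
    have box: "box_datum n f \<gamma>"
      unfolding box_datum_def section_datum_def using cf c\<gamma> tgt \<gamma>_box cube_boundary_subset[of "Suc n"]
      by (auto simp: continuous_map_fiber)
    have "spheroid_class n fiber fiber_one g = spheroid_class n fiber fiber_one \<gamma>"
      by (intro spheroid_class_eqI homotopic_spheroids_cong[OF g(1)]) (simp add: \<gamma>_def in_cube)
    then have "Y = connecting_map n G a0 (bundle_class (Suc n) G a0 f \<gamma>)" by (simp add: g(2) connecting_class[OF box])
    moreover have "bundle_class (Suc n) G a0 f \<gamma> \<in> carrier (bundle_group (Suc n) G a0)"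
      using box by (auto simp: carrier_bundle_group box_datum_def)
    ultimately show "Y \<in> connecting_map n G a0 ` carrier (bundle_group (Suc n) G a0)" by blast
  }
qed

end


section \<open>Naturality\<close>

context pointed_serre_morphism
begin

lemma fiber_map: "continuous_map (source_fiber G a0) (source_fiber H b0) \<phi>1" "\<phi>1 (gunit G a0) = gunit H b0"
proof -
  show "continuous_map (source_fiber G a0) (source_fiber H b0) \<phi>1"
    unfolding source_fiber_def continuous_map_in_subtopology
    using continuous_map_from_subtopology[OF \<phi>1_continuous] by (auto simp: \<phi>1_src \<phi>0_base)
  show "\<phi>1 (gunit G a0) = gunit H b0" using \<phi>1_gunit[OF G.base_in] \<phi>0_base by simp
qed

text \<open>A morphism preserves homotopies of data and gauge transformations.\<close>

lemma bundle_class_map: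
  assumes d: "cube_datum n G a0 f \<gamma>" "cube_datum n G a0 f' \<gamma>'" and eq: "bundle_class n G a0 f \<gamma> = bundle_class n G a0 f' \<gamma>'"
  shows "bundle_class n H b0 (\<phi>0 \<circ> f) (\<phi>1 \<circ> \<gamma>) = bundle_class n H b0 (\<phi>0 \<circ> f') (\<phi>1 \<circ> \<gamma>')"
proof -
  obtain F \<Gamma> u where F: "homotopy_datum n G a0 F \<Gamma>" "\<And>x. x \<in> topspace (cube n) \<Longrightarrow> F (x, 0) = f x"
    "\<And>x. x \<in> cube_boundary n \<Longrightarrow> \<Gamma> (x, 0) = \<gamma> x"
    and u: "continuous_map (cube n) (arrs G) u" "\<And>b. b \<in> topspace (cube n) \<Longrightarrow> tgt G (u b) = f' b"
    "\<And>b. b \<in> topspace (cube n) \<Longrightarrow> src G (u b) = F (b, 1)" "\<And>x. x \<in> cube_boundary n \<Longrightarrow> gmul G (u x) (\<Gamma> (x, 1)) = \<gamma>' x"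
    by (rule G.bundle_class_eq_normalised[OF d eq empty_subsetI closedin_empty anodyne_bottom]) (simp, rule that, assumption+)
  have up: "u x \<in> ar G" if "x \<in> topspace (cube n)" for x using continuous_map_apply[OF u(1) that] .
  have hd: "homotopy_datum n H b0 (\<phi>0 \<circ> F) (\<phi>1 \<circ> \<Gamma>)" by (rule section_datum_map[OF F(1)])
  have d1: "cube_datum n G a0 (\<lambda>x. F (x, 1)) (\<lambda>x. \<Gamma> (x, 1))" by (rule cylinder_datum_at[OF F(1)]) auto
  note D1 = section_datumD[OF d1]
  have "bundle_class n H b0 (\<phi>0 \<circ> f) (\<phi>1 \<circ> \<gamma>) = bundle_class n H b0 (\<lambda>x. (\<phi>0 \<circ> F) (x, 0)) (\<lambda>x. (\<phi>1 \<circ> \<Gamma>) (x, 0))"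
    using F(2,3) by (intro H.bundle_class_cong(1)[OF section_datum_map[OF d(1)]]) auto
  also have "\<dots> = bundle_class n H b0 (\<lambda>x. (\<phi>0 \<circ> F) (x, 1)) (\<lambda>x. (\<phi>1 \<circ> \<Gamma>) (x, 1))" by (rule H.bundle_class_homotopy[OF hd])
  also have "\<dots> = bundle_class n H b0 (\<phi>0 \<circ> f') (\<phi>1 \<circ> \<gamma>')"
  proof (rule H.bundle_class_gauge[OF cylinder_datum_at[OF hd] section_datum_map[OF d(2)] continuous_map_compose[OF u(1) \<phi>1_continuous]])
    fix x assume x: "x \<in> cube_boundary n"
    then have xC: "x \<in> topspace (cube n)" using cube_boundary_subset by blast
    show "gmul H ((\<phi>1 \<circ> u) x) ((\<phi>1 \<circ> \<Gamma>) (x, 1)) = (\<phi>1 \<circ> \<gamma>') x"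
      using \<phi>1_gmul[OF up[OF xC] D1(6)[OF x]] u(3)[OF xC] D1(4)[OF x] u(4)[OF x] by simp
  qed (use u up in \<open>auto simp: \<phi>1_src \<phi>1_tgt\<close>)
  finally show ?thesis .
qed

lemma extension_class:
  assumes d: "cube_datum n G a0 f \<gamma>"
  shows "groupoid_homotopy_group_map n G H b0 \<phi>0 \<phi>1 (bundle_class n G a0 f \<gamma>) = bundle_class n H b0 (\<phi>0 \<circ> f) (\<phi>1 \<circ> \<gamma>)"
proof -
  have ext: "{R. homotopic_cube_bundles n H b0 (extension_bundle G H \<phi>0 \<phi>1 P) R} = bundle_class n H b0 (\<phi>0 \<circ> f) (\<phi>1 \<circ> \<gamma>)"
    if P: "P \<in> bundle_class n G a0 f \<gamma>" for P
  proof -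
    have PP: "cube_pair_bundle n G a0 P" using P by (simp add: bundle_class_def homotopic_bundles_def)
    obtain f' \<gamma>' where d': "cube_datum n G a0 f' \<gamma>'" "cube_bundle_iso n G (cube_bundle_of n G f' \<gamma>') P"
      by (rule G.cube_bundle_trivial[OF PP])
    show ?thesis
      using H.bundle_class_of[OF section_datum_map[OF d'(1)] extension_bundle_iso[OF PP d']]
        bundle_class_map[OF d'(1) d G.bundle_class_member[OF P d']] by simp
  qed
  have "groupoid_homotopy_group_map n G H b0 \<phi>0 \<phi>1 (bundle_class n G a0 f \<gamma>) =
      (\<Union>P\<in>bundle_class n G a0 f \<gamma>. {R. homotopic_cube_bundles n H b0 (extension_bundle G H \<phi>0 \<phi>1 P) R})"
    by (auto simp: groupoid_homotopy_group_map_def)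
  also have "\<dots> = (\<Union>P\<in>bundle_class n G a0 f \<gamma>. bundle_class n H b0 (\<phi>0 \<circ> f) (\<phi>1 \<circ> \<gamma>))" using ext by simp
  also have "\<dots> = bundle_class n H b0 (\<phi>0 \<circ> f) (\<phi>1 \<circ> \<gamma>)" using G.bundle_class_self[OF d] by auto
  finally show ?thesis .
qed

lemma \<phi>1_constant: "\<phi>1 \<circ> (\<lambda>_. gunit G a0) = (\<lambda>_. gunit H b0)" and \<phi>0_constant: "\<phi>0 \<circ> (\<lambda>_. a0) = (\<lambda>_. b0)"
  using fiber_map(2) \<phi>0_base by (simp_all add: fun_eq_iff)

lemma homotopy_hom_extension:
  "homotopy_hom n (bundle_group n G a0) (bundle_group n H b0) (groupoid_homotopy_group_map n G H b0 \<phi>0 \<phi>1)"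
proof (rule homotopy_homI)
  show "groupoid_homotopy_group_map n G H b0 \<phi>0 \<phi>1 \<in> carrier (bundle_group n G a0) \<rightarrow> carrier (bundle_group n H b0)"
  proof
    fix X assume "X \<in> carrier (bundle_group n G a0)"
    then obtain f \<gamma> where "cube_datum n G a0 f \<gamma>" "X = bundle_class n G a0 f \<gamma>" by (auto simp: G.carrier_bundle_group)
    then show "groupoid_homotopy_group_map n G H b0 \<phi>0 \<phi>1 X \<in> carrier (bundle_group n H b0)"
      unfolding H.carrier_bundle_group using extension_class[of n f \<gamma>] section_datum_map[of _ _ f \<gamma>] by blast
  qed
  show "groupoid_homotopy_group_map n G H b0 \<phi>0 \<phi>1 \<one>\<^bsub>bundle_group n G a0\<^esub> = \<one>\<^bsub>bundle_group n H b0\<^esub>"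
    unfolding G.one_bundle_group H.one_bundle_group extension_class[OF G.trivial_datum[OF constant_spheroid[OF G.base_in]]]
      \<phi>1_constant \<phi>0_constant ..
  show "\<one>\<^bsub>bundle_group n G a0\<^esub> \<in> carrier (bundle_group n G a0)" by (rule G.one_bundle_group_carrier)
  assume "1 \<le> n"
  then have n: "0 < n" by simp
  show "group (bundle_group n G a0)" "group (bundle_group n H b0)"
    by (rule G.group_bundle_group[OF n] H.group_bundle_group[OF n])+
  interpret cubical_group n "{d. cube_datum n G a0 (fst \<circ> d) (snd \<circ> d)}"
    "\<lambda>d. bundle_class n G a0 (fst \<circ> d) (snd \<circ> d)" "bundle_group n G a0" by (rule G.cubical_group_bundles[OF n])
  fix X Y assume "X \<in> carrier (bundle_group n G a0)" "Y \<in> carrier (bundle_group n G a0)"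
  then obtain d d0 where d: "cube_datum n G a0 (fst \<circ> d) (snd \<circ> d)" "X = bundle_class n G a0 (fst \<circ> d) (snd \<circ> d)"
    and d0: "cube_datum n G a0 (fst \<circ> d0) (snd \<circ> d0)" "Y = bundle_class n G a0 (fst \<circ> d0) (snd \<circ> d0)"
    unfolding carrier_eq by blast
  obtain d' where d': "cube_datum n G a0 (fst \<circ> d') (snd \<circ> d')" "Y = bundle_class n G a0 (fst \<circ> d') (snd \<circ> d')" "matched n d d'"
    using match[of d d0] d d0 by auto
  have m: "matched n (snd \<circ> d) (snd \<circ> d')" "matched n (\<phi>1 \<circ> (snd \<circ> d)) (\<phi>1 \<circ> (snd \<circ> d'))"
    using d'(3) by (simp_all add: matched_def)
  show "groupoid_homotopy_group_map n G H b0 \<phi>0 \<phi>1 (X \<otimes>\<^bsub>bundle_group n G a0\<^esub> Y) =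
      groupoid_homotopy_group_map n G H b0 \<phi>0 \<phi>1 X \<otimes>\<^bsub>bundle_group n H b0\<^esub> groupoid_homotopy_group_map n G H b0 \<phi>0 \<phi>1 Y"
    unfolding d(2) d'(2) G.mult_bundle_class[OF n d(1) d'(1) m(1)] extension_class[OF d(1)] extension_class[OF d'(1)]
      extension_class[OF cube_datum_concat[OF n d(1) d'(1) m(1)]]
      H.mult_bundle_class[OF n section_datum_map[OF d(1)] section_datum_map[OF d'(1)] m(2)] concat_spheroid_compose ..
qed

lemma natural_target:
  assumes "X \<in> carrier (fiber_homotopy_group n G a0)"
  shows "target_map n H b0 (fiber_homotopy_group_map n H b0 \<phi>1 X) = object_homotopy_group_map n H b0 \<phi>0 (target_map n G a0 X)"
proof -
  obtain g where g: "g \<in> spheroids n (source_fiber G a0) (gunit G a0)" "X = spheroid_class n (source_fiber G a0) (gunit G a0) g"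
    using assms by (auto simp: carrier_homotopy_group)
  note g' = homotopy_group_map_class[OF fiber_map g(1)]
  have l: "target_map n H b0 (fiber_homotopy_group_map n H b0 \<phi>1 X) = spheroid_class n (objs H) b0 (tgt H \<circ> (\<phi>1 \<circ> g))"
    unfolding g(2) g'(2) by (rule H.target_class(2)[OF g'(1)])
  have r: "object_homotopy_group_map n H b0 \<phi>0 (target_map n G a0 X) = spheroid_class n (objs H) b0 (\<phi>0 \<circ> (tgt G \<circ> g))"
    unfolding g(2) G.target_class(2)[OF g(1)]
    by (rule homotopy_group_map_class(2)[OF \<phi>0_continuous \<phi>0_base G.target_class(1)[OF g(1)]])
  show ?thesis
    unfolding l r using G.spheroid_fiberD(2)[OF g(1)]
    by (intro spheroid_class_eqI homotopic_spheroids_cong[OF H.target_class(1)[OF g'(1)]]) (simp add: \<phi>1_tgt)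
qed

lemma natural_pullback_unit:
  assumes "X \<in> carrier (object_homotopy_group n G a0)"
  shows "pullback_unit_map n H b0 (object_homotopy_group_map n H b0 \<phi>0 X) =
    groupoid_homotopy_group_map n G H b0 \<phi>0 \<phi>1 (pullback_unit_map n G a0 X)"
proof -
  obtain f where f: "f \<in> spheroids n (objs G) a0" "X = spheroid_class n (objs G) a0 f"
    using assms by (auto simp: carrier_homotopy_group)
  note f' = homotopy_group_map_class[OF \<phi>0_continuous \<phi>0_base f(1)]
  show ?thesis
    unfolding f(2) f'(2) G.pullback_unit_class[OF f(1)] H.pullback_unit_class[OF f'(1)]
      extension_class[OF G.trivial_datum[OF f(1)]] \<phi>1_constant ..
qed

lemma natural_connecting:
  assumes "X \<in> carrier (bundle_group (Suc n) G a0)"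
  shows "connecting_map n H b0 (groupoid_homotopy_group_map (Suc n) G H b0 \<phi>0 \<phi>1 X) =
    fiber_homotopy_group_map n H b0 \<phi>1 (connecting_map n G a0 X)"
proof -
  obtain f \<gamma> where fg: "G.box_datum n f \<gamma>" "X = bundle_class (Suc n) G a0 f \<gamma>" by (rule G.box_datum_exists[OF assms])
  have d: "cube_datum (Suc n) G a0 f \<gamma>" using fg by (simp add: G.box_datum_def)
  have box: "H.box_datum n (\<phi>0 \<circ> f) (\<phi>1 \<circ> \<gamma>)"
    using section_datum_map[OF d] fg(1) fiber_map(2) by (simp add: H.box_datum_def G.box_datum_def)
  show ?thesis
    unfolding fg(2) extension_class[OF d] H.connecting_class[OF box] G.connecting_class[OF fg(1)]
      homotopy_group_map_class(2)[OF fiber_map G.box_datum_spheroid[OF fg(1)]] ..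
qed

end

theorem theorem4p8:
  fixes G :: "('o, 'a) groupoid" and a0 :: 'o
  assumes "pointed_serre_groupoid G a0"
  shows
    "(\<forall>n. homotopy_hom n (fiber_homotopy_group n G a0) (object_homotopy_group n G a0)
            (target_map n G a0) \<and>
          homotopy_hom n (object_homotopy_group n G a0) (groupoid_homotopy_group n G a0)
            (pullback_unit_map n G a0) \<and>
          homotopy_hom n (groupoid_homotopy_group (Suc n) G a0) (fiber_homotopy_group n G a0)
            (connecting_map n G a0))
     \<and>
     (\<forall>n. target_map n G a0 ` carrier (fiber_homotopy_group n G a0) =
            kernel (object_homotopy_group n G a0) (groupoid_homotopy_group n G a0)
              (pullback_unit_map n G a0) \<and>
          pullback_unit_map (Suc n) G a0 ` carrier (object_homotopy_group (Suc n) G a0) =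
            kernel (groupoid_homotopy_group (Suc n) G a0) (fiber_homotopy_group n G a0)
              (connecting_map n G a0) \<and>
          connecting_map n G a0 ` carrier (groupoid_homotopy_group (Suc n) G a0) =
            kernel (fiber_homotopy_group n G a0) (object_homotopy_group n G a0)
              (target_map n G a0))
     \<and>
     (\<forall>(H :: ('o2, 'a2) groupoid) b0 \<phi>0 \<phi>1.
        pointed_serre_groupoid H b0 \<and> pointed_groupoid_morphism G a0 H b0 \<phi>0 \<phi>1 \<longrightarrow>
        (\<forall>n. homotopy_hom n (fiber_homotopy_group n G a0) (fiber_homotopy_group n H b0)
               (fiber_homotopy_group_map n H b0 \<phi>1) \<and>
             homotopy_hom n (object_homotopy_group n G a0) (object_homotopy_group n H b0)
               (object_homotopy_group_map n H b0 \<phi>0) \<and>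
             homotopy_hom n (groupoid_homotopy_group n G a0) (groupoid_homotopy_group n H b0)
               (groupoid_homotopy_group_map n G H b0 \<phi>0 \<phi>1) \<and>
             (\<forall>x\<in>carrier (fiber_homotopy_group n G a0).
                target_map n H b0 (fiber_homotopy_group_map n H b0 \<phi>1 x) =
                object_homotopy_group_map n H b0 \<phi>0 (target_map n G a0 x)) \<and>
             (\<forall>x\<in>carrier (object_homotopy_group n G a0).
                pullback_unit_map n H b0 (object_homotopy_group_map n H b0 \<phi>0 x) =
                groupoid_homotopy_group_map n G H b0 \<phi>0 \<phi>1 (pullback_unit_map n G a0 x)) \<and>
             (\<forall>x\<in>carrier (groupoid_homotopy_group (Suc n) G a0).
                connecting_map n H b0 (groupoid_homotopy_group_map (Suc n) G H b0 \<phi>0 \<phi>1 x) =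
                fiber_homotopy_group_map n H b0 \<phi>1 (connecting_map n G a0 x))))"
proof (intro conjI allI impI ballI; (elim conjE)?)
  interpret G: pointed_serre_groupoid G a0 by fact
  show "homotopy_hom n (fiber_homotopy_group n G a0) (object_homotopy_group n G a0) (target_map n G a0)" for n
    by (rule homotopy_hom_group_map[OF G.fiber_one G.tgt_fiber])
  show "homotopy_hom n (object_homotopy_group n G a0) (groupoid_homotopy_group n G a0) (pullback_unit_map n G a0)" for n
    by (rule G.homotopy_hom_pullback_unit)
  show "homotopy_hom n (groupoid_homotopy_group (Suc n) G a0) (fiber_homotopy_group n G a0) (connecting_map n G a0)" for n
    by (rule G.homotopy_hom_connecting)
  show "target_map n G a0 ` carrier (fiber_homotopy_group n G a0) =
      kernel (object_homotopy_group n G a0) (groupoid_homotopy_group n G a0) (pullback_unit_map n G a0)" for n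
    by (rule G.exact_at_objects)
  show "pullback_unit_map (Suc n) G a0 ` carrier (object_homotopy_group (Suc n) G a0) =
      kernel (groupoid_homotopy_group (Suc n) G a0) (fiber_homotopy_group n G a0) (connecting_map n G a0)" for n
    by (rule G.exact_at_bundles)
  show "connecting_map n G a0 ` carrier (groupoid_homotopy_group (Suc n) G a0) =
      kernel (fiber_homotopy_group n G a0) (object_homotopy_group n G a0) (target_map n G a0)" for n
    by (rule G.exact_at_fiber)
next
  fix H :: "('o2, 'a2) groupoid" and b0 \<phi>0 \<phi>1 n
  assume "pointed_serre_groupoid H b0" and "pointed_groupoid_morphism G a0 H b0 \<phi>0 \<phi>1"
  then interpret pointed_serre_morphism G a0 H b0 \<phi>0 \<phi>1
    using assms by (simp add: pointed_serre_morphism_def pointed_serre_morphism_axioms_def)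
  show "homotopy_hom n (fiber_homotopy_group n G a0) (fiber_homotopy_group n H b0) (fiber_homotopy_group_map n H b0 \<phi>1)"
    by (rule homotopy_hom_group_map[OF G.fiber_one fiber_map])
  show "homotopy_hom n (object_homotopy_group n G a0) (object_homotopy_group n H b0) (object_homotopy_group_map n H b0 \<phi>0)"
    by (rule homotopy_hom_group_map[OF G.base_in \<phi>0_continuous \<phi>0_base])
  show "homotopy_hom n (groupoid_homotopy_group n G a0) (groupoid_homotopy_group n H b0)
      (groupoid_homotopy_group_map n G H b0 \<phi>0 \<phi>1)"
    by (rule homotopy_hom_extension)
  show "target_map n H b0 (fiber_homotopy_group_map n H b0 \<phi>1 x) = object_homotopy_group_map n H b0 \<phi>0 (target_map n G a0 x)"
    if "x \<in> carrier (fiber_homotopy_group n G a0)" for x using that by (rule natural_target)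
  show "pullback_unit_map n H b0 (object_homotopy_group_map n H b0 \<phi>0 x) =
      groupoid_homotopy_group_map n G H b0 \<phi>0 \<phi>1 (pullback_unit_map n G a0 x)"
    if "x \<in> carrier (object_homotopy_group n G a0)" for x using that by (rule natural_pullback_unit)
  show "connecting_map n H b0 (groupoid_homotopy_group_map (Suc n) G H b0 \<phi>0 \<phi>1 x) =
      fiber_homotopy_group_map n H b0 \<phi>1 (connecting_map n G a0 x)"
    if "x \<in> carrier (groupoid_homotopy_group (Suc n) G a0)" for x using that by (rule natural_connecting)
qed

end
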